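(* Let $Y$ be a two-dimensional metric space of non-positive curvature and let $A\subset Y$ be an arbitrary subset. Then for every $n\ge 2$, every Lipschitz map $f:\mathbb S^n\to A$ extends to a Lipschitz map $F:B^{n+1}\to A$, where $B^{n+1}\subset\mathbb R^{n+1}$ is the closed unit ball with boundary $\mathbb S^n$. (That is, all higher Lipschitz homotopy groups of $A$ vanish.)
   Context: A metric space has non-positive curvature if it is locally CAT(0). The dimension of such a space is the supremum of the topological dimensions of its compact subsets. $A$ carries the metric induced from $Y$. *)

theory Defs
  imports "HOL-Analysis.Analysis"
begin

definition geodesic_segment :: "'a::metric_space set \<Rightarrow> (real \<Rightarrow> 'a) \<Rightarrow> 'a \<Rightarrow> 'a \<Rightarrow> bool" where
  "geodesic_segment S g p q \<longleftrightarrow>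
     g 0 = p \<and> g (dist p q) = q \<and>
     (\<forall>s\<in>{0..dist p q}. g s \<in> S) \<and>
     (\<forall>s\<in>{0..dist p q}. \<forall>t\<in>{0..dist p q}. dist (g s) (g t) = \<bar>s - t\<bar>)"

definition geodesic_space :: "'a::metric_space set \<Rightarrow> bool" where
  "geodesic_space S \<longleftrightarrow> (\<forall>p\<in>S. \<forall>q\<in>S. \<exists>g. geodesic_segment S g p q)"

text \<open>Comparison point on the side [u,v] of a Euclidean triangle, at distance s from u
  (where L = dist u v is the side length).\<close>
definition cmp_point :: "real^2 \<Rightarrow> real^2 \<Rightarrow> real \<Rightarrow> real \<Rightarrow> real^2" where
  "cmp_point u v L s = u + (s / L) *\<^sub>R (v - u)"

definition CAT0 :: "'a::metric_space set \<Rightarrow> bool" where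
  "CAT0 S \<longleftrightarrow> geodesic_space S \<and>
    (\<forall>p\<in>S. \<forall>q\<in>S. \<forall>r\<in>S. \<forall>g1 g2 g3.
       geodesic_segment S g1 p q \<and> geodesic_segment S g2 q r \<and> geodesic_segment S g3 r p \<longrightarrow>
       (\<forall>a b c :: real^2.
          dist a b = dist p q \<and> dist b c = dist q r \<and> dist c a = dist r p \<longrightarrow>
          (\<forall>(g, u, v, L) \<in> {(g1, a, b, dist p q), (g2, b, c, dist q r), (g3, c, a, dist r p)}.
           \<forall>(g', u', v', L') \<in> {(g1, a, b, dist p q), (g2, b, c, dist q r), (g3, c, a, dist r p)}.
             \<forall>s\<in>{0..L}. \<forall>t\<in>{0..L'}.
               dist (g s) (g' t) \<le> dist (cmp_point u v L s) (cmp_point u' v' L' t))))"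

definition nonpositively_curved :: "'a::metric_space set \<Rightarrow> bool" where
  "nonpositively_curved Y \<longleftrightarrow> (\<forall>x\<in>Y. \<exists>r>0. CAT0 (ball x r \<inter> Y))"

definition covering_metric_dim_le :: "'a::topological_space set \<Rightarrow> nat \<Rightarrow> bool" where
  "covering_metric_dim_le K n \<longleftrightarrow>
    (\<forall>\<U>. finite \<U> \<and> (\<forall>U\<in>\<U>. openin (top_of_set K) U) \<and> K \<subseteq> \<Union>\<U> \<longrightarrow>
      (\<exists>\<V>. finite \<V> \<and> (\<forall>V\<in>\<V>. openin (top_of_set K) V) \<and> K \<subseteq> \<Union>\<V> \<and>
           (\<forall>V\<in>\<V>. \<exists>U\<in>\<U>. V \<subseteq> U) \<and>
           (\<forall>x\<in>K. card {V\<in>\<V>. x \<in> V} \<le> n + 1)))"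

definition metric_dim_le :: "'a::metric_space set \<Rightarrow> nat \<Rightarrow> bool" where
  "metric_dim_le Y n \<longleftrightarrow> (\<forall>K. K \<subseteq> Y \<and> compact K \<longrightarrow> covering_metric_dim_le K n)"

definition two_dimensional :: "'a::metric_space set \<Rightarrow> bool" where
  "two_dimensional Y \<longleftrightarrow> metric_dim_le Y 2 \<and> \<not> metric_dim_le Y 1"

end

theory Submission
  imports Defs
begin

text \<open>
  Only the compact set \<open>K = f(S\<^sup>n)\<close> matters. Cover \<open>K\<close> by finitely many tiny closed balls of the completion
  of \<open>Y\<close>, with radii chosen so that slightly larger balls have the same nerve, and give their union
  \<open>X\<close> the chain (induced length) metric \<open>D\<close>. Locally \<open>X\<close> is a finite union of convex sets of a
  Hadamard space with a common point. The dimension hypothesis forces \<open>D\<close> to be CAT(0) there: if two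
  geodesics with a common start left a convex set containing their ends, projecting to a level set of
  the distance from that set would produce a loop in the star-shaped \<open>X\<close> that links a level curve, and its cone,
  together with the homotopy to the original loop, would give a map from a three-dimensional cylinder that avoids \<open>0\<close>
  after a small perturbation, since compact sets of dimension at most two map to three-space avoiding \<open>0\<close>
  approximately.

  Therefore \<open>D\<close> has locally convex midpoints, and Birkhoff curve shortening applied to the images of
  meridians from a generic pole \<open>p\<close> to \<open>x\<close> contracts the map \<open>f\<close> to the point \<open>f p\<close> inside \<open>X\<close>,
  with a Lipschitz constant \<open>5 \<pi> C\<close> that does not depend on the size of the balls. Finitely many
  points are treated at a time (then a pole avoiding all relevant planes exists because \<open>n + 1 \<ge> 3\<close>), and compactness of
  the product space \<open>K\<^sup>B\<close> gives the extension with values in \<open>K\<close>.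
\<close>

section \<open>Hadamard spaces\<close>

text \<open>The subset A has no structure of its own, so nothing can be pushed into it directly:
  maps are built in ever thinner neighbourhoods X of K, and only their limit lies in K. This asks
  for a Lipschitz constant independent of X. It is available because \<open>D\<close> dominates the
  ambient distance and agrees with it for points of K that share a ball, and because shortening does
  not increase the largest distance between two nearby polygons. Unshortened meridian images would
  not do: the meridians to two close points may be far apart halfway when these are near the
  antipode of p. Long shortening makes corresponding points spread linearly, from 0 at p to the
  distance of the end points, as rays do in non-positive curvature. The constant has two sources:
  changing the direction costs at most \<open>4 * pi * C\<close> times the distance, changing the
  radius \<open>pi * C\<close>. Star-shapedness lets every loop in X bound a cone inside X, which is
  compared with a second disc; dimension two enters there, as instability of the value 0 for maps to
  three-space.\<close>

locale hadamard =
  fixes H :: "'c::complete_space set"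
  assumes closed_H: "closed H"
    and cn_ex: "\<And>x y t. x \<in> H \<Longrightarrow> y \<in> H \<Longrightarrow> 0 \<le> t \<Longrightarrow> t \<le> 1 \<Longrightarrow>
      \<exists>m\<in>H. \<forall>z\<in>H. (dist z m)\<^sup>2 \<le> (1-t) * (dist z x)\<^sup>2 + t * (dist z y)\<^sup>2 - t*(1-t)*(dist x y)\<^sup>2"
begin

text \<open>The point at parameter t of the geodesic from x to y. The inequality is the CN
  inequality of Bruhat and Tits with weights, and it determines the point (see
  \<open>P_unique\<close>).\<close>

definition P :: "'c \<Rightarrow> 'c \<Rightarrow> real \<Rightarrow> 'c" where
  "P x y t = (SOME m. m \<in> H \<and> (\<forall>z\<in>H. (dist z m)\<^sup>2 \<le> (1-t) * (dist z x)\<^sup>2 + t * (dist z y)\<^sup>2 - t*(1-t)*(dist x y)\<^sup>2))"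

lemma P_spec:
  assumes "x \<in> H" "y \<in> H" "0 \<le> t" "t \<le> 1"
  shows "P x y t \<in> H \<and> (\<forall>z\<in>H. (dist z (P x y t))\<^sup>2 \<le> (1-t) * (dist z x)\<^sup>2 + t * (dist z y)\<^sup>2 - t*(1-t)*(dist x y)\<^sup>2)"
  unfolding P_def by (rule someI_ex) (use cn_ex[OF assms] in blast)

lemma P_in: "x \<in> H \<Longrightarrow> y \<in> H \<Longrightarrow> 0 \<le> t \<Longrightarrow> t \<le> 1 \<Longrightarrow> P x y t \<in> H"
  using P_spec by blast

lemma P_cn:
  "z \<in> H \<Longrightarrow> x \<in> H \<Longrightarrow> y \<in> H \<Longrightarrow> 0 \<le> t \<Longrightarrow> t \<le> 1 \<Longrightarrow>
   (dist z (P x y t))\<^sup>2 \<le> (1-t) * (dist z x)\<^sup>2 + t * (dist z y)\<^sup>2 - t*(1-t)*(dist x y)\<^sup>2"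
  using P_spec by blast

lemma dist_P_left_le:
  assumes "x \<in> H" "y \<in> H" "0 \<le> t" "t \<le> 1"
  shows "dist x (P x y t) \<le> t * dist x y"
proof -
  have "(dist x (P x y t))\<^sup>2 \<le> (t * dist x y)\<^sup>2"
    using P_cn[OF assms(1,1,2,3,4)] by (simp add: power2_eq_square algebra_simps)
  then show ?thesis using assms power2_le_imp_le by fastforce
qed

lemma dist_P_right_le:
  assumes "x \<in> H" "y \<in> H" "0 \<le> t" "t \<le> 1"
  shows "dist y (P x y t) \<le> (1-t) * dist x y"
proof -
  have "(dist y (P x y t))\<^sup>2 \<le> ((1-t) * dist x y)\<^sup>2"
    using P_cn[OF assms(2,1,2,3,4)] by (simp add: power2_eq_square algebra_simps dist_commute)
  then show ?thesis using assms power2_le_imp_le by (metis diff_ge_0_iff_ge mult_nonneg_nonneg zero_le_dist)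
qed

lemma dist_P_left:
  assumes "x \<in> H" "y \<in> H" "0 \<le> t" "t \<le> 1"
  shows "dist x (P x y t) = t * dist x y"
  using dist_P_left_le[OF assms] dist_P_right_le[OF assms] dist_triangle2[of x y "P x y t"]
  by (simp add: algebra_simps)

lemma dist_P_right:
  assumes "x \<in> H" "y \<in> H" "0 \<le> t" "t \<le> 1"
  shows "dist y (P x y t) = (1-t) * dist x y"
  using dist_P_left_le[OF assms] dist_P_right_le[OF assms] dist_triangle2[of x y "P x y t"]
  by (simp add: algebra_simps)

text \<open>Insert m itself as the observer z in the CN inequality: the two distance bounds make the
  right-hand side vanish. Most later identities between points of geodesics are obtained this
  way.\<close>

lemma P_unique:
  assumes "x \<in> H" "y \<in> H" "0 \<le> t" "t \<le> 1" and m: "m \<in> H" "dist x m \<le> t * dist x y" "dist y m \<le> (1-t) * dist x y"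
  shows "m = P x y t"
proof -
  have 1: "(dist x m)\<^sup>2 \<le> (t * dist x y)\<^sup>2" and 2: "(dist y m)\<^sup>2 \<le> ((1-t) * dist x y)\<^sup>2"
    using m by (auto intro!: power_mono)
  have "(dist m (P x y t))\<^sup>2 \<le> (1-t) * (dist x m)\<^sup>2 + t * (dist y m)\<^sup>2 - t*(1-t)*(dist x y)\<^sup>2"
    using P_cn[OF m(1) assms(1-4)] by (simp add: dist_commute)
  also have "\<dots> \<le> (1-t) * (t * dist x y)\<^sup>2 + t * ((1-t) * dist x y)\<^sup>2 - t*(1-t)*(dist x y)\<^sup>2"
    using assms 1 2 by (intro diff_right_mono add_mono mult_left_mono) auto
  also have "\<dots> = 0" by (simp add: power2_eq_square algebra_simps)
  finally show ?thesis by simp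
qed

lemma P_0 [simp]: "x \<in> H \<Longrightarrow> y \<in> H \<Longrightarrow> P x y 0 = x"
  by (rule P_unique[symmetric]) (auto simp: dist_commute)

lemma P_1 [simp]: "x \<in> H \<Longrightarrow> y \<in> H \<Longrightarrow> P x y 1 = y"
  by (rule P_unique[symmetric]) auto

lemma P_same [simp]: "x \<in> H \<Longrightarrow> 0 \<le> t \<Longrightarrow> t \<le> 1 \<Longrightarrow> P x x t = x"
  by (rule P_unique[symmetric]) auto

lemma P_sym: "x \<in> H \<Longrightarrow> y \<in> H \<Longrightarrow> 0 \<le> t \<Longrightarrow> t \<le> 1 \<Longrightarrow> P y x t = P x y (1-t)"
  by (rule P_unique) (auto simp: P_in dist_P_left dist_P_right dist_commute)

lemma P_P:
  assumes "x \<in> H" "y \<in> H" "0 \<le> s" "s \<le> 1" "0 \<le> t" "t \<le> 1"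
  shows "P x (P x y t) s = P x y (s*t)"
proof (rule P_unique)
  let ?m = "P x y t"
  have m: "?m \<in> H" using P_in assms by blast
  show "P x ?m s \<in> H" using P_in assms m by blast
  show "0 \<le> s*t" "s*t \<le> 1" using assms by (auto simp: mult_le_one)
  show "dist x (P x ?m s) \<le> s*t * dist x y"
    using dist_P_left[OF assms(1) m assms(3,4)] dist_P_left[OF assms(1,2,5,6)] by simp
  have "dist y (P x ?m s) \<le> dist y ?m + dist ?m (P x ?m s)" by (rule dist_triangle)
  also have "\<dots> = (1-t) * dist x y + (1-s) * (t * dist x y)"
    using dist_P_right[OF assms(1) m assms(3,4)] dist_P_left[OF assms(1,2,5,6)] dist_P_right[OF assms(1,2,5,6)] by simp
  also have "\<dots> = (1 - s*t) * dist x y" by (simp add: algebra_simps)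
  finally show "dist y (P x ?m s) \<le> (1 - s*t) * dist x y" .
qed (use assms in auto)

lemma dist_P_P_aux:
  assumes "x \<in> H" "y \<in> H" "0 \<le> s" "s \<le> t" "t \<le> 1"
  shows "dist (P x y s) (P x y t) = (t-s) * dist x y"
proof (cases "t = 0")
  case True then show ?thesis using assms by simp
next
  case False
  then have t: "0 < t" "0 \<le> s/t" "s/t \<le> 1" using assms by auto
  have m: "P x y t \<in> H" using P_in assms by auto
  have "P x y s = P x (P x y t) (s/t)" using P_P[of x y "s/t" t] assms t by simp
  then have "dist (P x y t) (P x y s) = (1-s/t) * dist x (P x y t)"
    using dist_P_right[OF assms(1) m t(2,3)] by simp
  also have "\<dots> = (1-s/t) * (t * dist x y)" using dist_P_left[of x y t] assms t by auto
  also have "\<dots> = (t-s) * dist x y" using t by (simp add: field_simps)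
  finally show ?thesis by (simp add: dist_commute)
qed

lemma dist_P_P:
  assumes "x \<in> H" "y \<in> H" "0 \<le> s" "s \<le> 1" "0 \<le> t" "t \<le> 1"
  shows "dist (P x y s) (P x y t) = \<bar>t-s\<bar> * dist x y"
  using dist_P_P_aux[of x y s t] dist_P_P_aux[of x y t s] assms
  by (cases "s \<le> t") (auto simp: dist_commute)

text \<open>The CN inequality is applied twice, first to \<open>?m\<close> seen from y, then to
  \<open>?n\<close> seen from \<open>?m\<close>; the terms with distances from p cancel and exactly
  t^2 times the squared distance of x and y remains.\<close>

lemma P_busemann1:
  assumes "p \<in> H" "x \<in> H" "y \<in> H" "0 \<le> t" "t \<le> 1"
  shows "dist (P p x t) (P p y t) \<le> t * dist x y"
proof -
  let ?m = "P p x t" and ?n = "P p y t"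
  have m: "?m \<in> H" using P_in assms by blast
  have a: "(dist y ?m)\<^sup>2 \<le> (1-t) * (dist y p)\<^sup>2 + t * (dist y x)\<^sup>2 - t*(1-t)*(dist p x)\<^sup>2"
    using P_cn assms by blast
  have "(dist ?m ?n)\<^sup>2 \<le> (1-t) * (dist ?m p)\<^sup>2 + t * (dist ?m y)\<^sup>2 - t*(1-t)*(dist p y)\<^sup>2"
    using P_cn[OF m] assms by blast
  also have "\<dots> = (1-t) * (t * dist p x)\<^sup>2 + t * (dist y ?m)\<^sup>2 - t*(1-t)*(dist p y)\<^sup>2"
    using dist_P_left[of p x t] assms by (simp add: dist_commute)
  also have "\<dots> \<le> (1-t) * (t * dist p x)\<^sup>2 + t * ((1-t) * (dist y p)\<^sup>2 + t * (dist y x)\<^sup>2 - t*(1-t)*(dist p x)\<^sup>2) - t*(1-t)*(dist p y)\<^sup>2"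
    using a assms by (intro diff_right_mono add_left_mono mult_left_mono) auto
  also have "\<dots> = (t * dist x y)\<^sup>2" by (simp add: power2_eq_square algebra_simps dist_commute)
  finally show ?thesis using assms power2_le_imp_le by fastforce
qed

lemma P_busemann:
  assumes "x \<in> H" "y \<in> H" "x' \<in> H" "y' \<in> H" "0 \<le> t" "t \<le> 1"
  shows "dist (P x y t) (P x' y' t) \<le> (1-t) * dist x x' + t * dist y y'"
proof -
  have 1: "dist (P x y t) (P x y' t) \<le> t * dist y y'" using P_busemann1 assms by blast
  have "dist (P y' x (1-t)) (P y' x' (1-t)) \<le> (1-t) * dist x x'" using P_busemann1[of y' x x' "1-t"] assms by auto
  moreover have "P y' x (1-t) = P x y' t" "P y' x' (1-t) = P x' y' t"
    using P_sym[of x y' "1-t"] P_sym[of x' y' "1-t"] assms by auto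
  ultimately show ?thesis using 1 dist_triangle[of "P x y t" "P x' y' t" "P x y' t"] by simp
qed

lemma P_lip:
  assumes "x \<in> H" "y \<in> H" "x' \<in> H" "y' \<in> H" "0 \<le> t" "t \<le> 1" "0 \<le> t'" "t' \<le> 1"
  shows "dist (P x y t) (P x' y' t') \<le> dist x x' + dist y y' + \<bar>t - t'\<bar> * dist x' y'"
proof -
  have "dist (P x y t) (P x' y' t) \<le> (1-t) * dist x x' + t * dist y y'"
    using P_busemann assms by blast
  also have "\<dots> \<le> dist x x' + dist y y'"
    using assms by (intro add_mono mult_left_le_one_le) auto
  finally have "dist (P x y t) (P x' y' t) \<le> dist x x' + dist y y'" .
  moreover have "dist (P x' y' t) (P x' y' t') = \<bar>t - t'\<bar> * dist x' y'"
    using dist_P_P[of x' y' t t'] assms by (simp add: abs_minus_commute)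
  ultimately show ?thesis using dist_triangle[of "P x y t" "P x' y' t'" "P x' y' t"] by simp
qed

lemma P_continuous:
  assumes f: "continuous_on S f" and g: "continuous_on S g" and u: "continuous_on S u"
    and fH: "f ` S \<subseteq> H" and gH: "g ` S \<subseteq> H" and u01: "u ` S \<subseteq> {0..1::real}"
  shows "continuous_on S (\<lambda>s. P (f s) (g s) (u s))"
unfolding continuous_on_def
proof (intro ballI)
  fix s assume s: "s \<in> S"
  have inS: "\<forall>\<^sub>F r in at s within S. r \<in> S" by (simp add: eventually_at_filter)
  have f': "(f \<longlongrightarrow> f s) (at s within S)" and g': "(g \<longlongrightarrow> g s) (at s within S)" and u': "(u \<longlongrightarrow> u s) (at s within S)"
    using f g u s by (auto simp: continuous_on_def)
  have "((\<lambda>r. dist (f r) (f s) + dist (g r) (g s) + \<bar>u r - u s\<bar> * dist (f s) (g s)) \<longlongrightarrow>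
      dist (f s) (f s) + dist (g s) (g s) + \<bar>u s - u s\<bar> * dist (f s) (g s)) (at s within S)"
    by (intro tendsto_intros f' g' u')
  then have lim: "((\<lambda>r. dist (f r) (f s) + dist (g r) (g s) + \<bar>u r - u s\<bar> * dist (f s) (g s)) \<longlongrightarrow> 0) (at s within S)"
    by simp
  have bd: "\<forall>\<^sub>F r in at s within S. dist (P (f r) (g r) (u r)) (P (f s) (g s) (u s)) \<le>
      dist (f r) (f s) + dist (g r) (g s) + \<bar>u r - u s\<bar> * dist (f s) (g s)"
    using inS
  proof eventually_elim
    case (elim r)
    have "f r \<in> H" "g r \<in> H" "f s \<in> H" "g s \<in> H" "0 \<le> u r" "u r \<le> 1" "0 \<le> u s" "u s \<le> 1"
      using elim s fH gH u01 by auto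
    then show ?case by (rule P_lip)
  qed
  show "((\<lambda>s. P (f s) (g s) (u s)) \<longlongrightarrow> P (f s) (g s) (u s)) (at s within S)"
    unfolding tendsto_dist_iff[of _ "P (f s) (g s) (u s)"]
    by (rule tendsto_sandwich[OF _ bd tendsto_const lim]) simp
qed

text \<open>Compare y and w with the midpoint of the diagonal from x to z. This replaces the
  inner-product identity behind the nonexpansiveness of projections in a Hilbert space.\<close>

lemma enflo:
  assumes "x \<in> H" "y \<in> H" "z \<in> H" "w \<in> H"
  shows "(dist x z)\<^sup>2 + (dist y w)\<^sup>2 \<le> (dist x y)\<^sup>2 + (dist y z)\<^sup>2 + (dist z w)\<^sup>2 + (dist w x)\<^sup>2"
proof -
  let ?m = "P x z (1/2)"
  have 1: "(dist y ?m)\<^sup>2 \<le> (dist y x)\<^sup>2/2 + (dist y z)\<^sup>2/2 - (dist x z)\<^sup>2/4"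
    using P_cn[of y x z "1/2"] assms by simp
  have 2: "(dist w ?m)\<^sup>2 \<le> (dist w x)\<^sup>2/2 + (dist w z)\<^sup>2/2 - (dist x z)\<^sup>2/4"
    using P_cn[of w x z "1/2"] assms by simp
  have "(dist y w)\<^sup>2 \<le> (dist y ?m + dist w ?m)\<^sup>2"
    using dist_triangle2[of y w ?m] by (intro power_mono) auto
  also have "\<dots> \<le> 2*(dist y ?m)\<^sup>2 + 2*(dist w ?m)\<^sup>2"
    using sum_squares_bound[of "dist y ?m" "dist w ?m"] by (simp add: power2_sum)
  finally show ?thesis using 1 2 by (simp add: dist_commute)
qed

section \<open>Convex sets and nearest-point projections\<close>

definition cvx :: "'c set \<Rightarrow> bool" where
  "cvx C \<longleftrightarrow> C \<subseteq> H \<and> (\<forall>x\<in>C. \<forall>y\<in>C. \<forall>t\<in>{0..1}. P x y t \<in> C)"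

lemma cvxD: "cvx C \<Longrightarrow> x \<in> C \<Longrightarrow> y \<in> C \<Longrightarrow> 0 \<le> t \<Longrightarrow> t \<le> 1 \<Longrightarrow> P x y t \<in> C"
  by (auto simp: cvx_def)

lemma cvx_sub: "cvx C \<Longrightarrow> x \<in> C \<Longrightarrow> x \<in> H" by (auto simp: cvx_def)

lemma cvx_Int: "cvx A \<Longrightarrow> cvx B \<Longrightarrow> cvx (A \<inter> B)" by (auto simp: cvx_def)

text \<open>\<open>R\<close> is increasing and bounded, so it converges and its increments control
  the squared distances. In the application \<open>R\<close> is the squared distance from a base
  point, and u consists of its nearest points in a decreasing sequence of convex sets.\<close>

lemma cauchy_from_cn:
  fixes u :: "nat \<Rightarrow> 'c"
  assumes C: "closed C" and u: "\<And>n. u n \<in> C" and bd: "\<And>n. R n \<le> (B::real)"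
    and inc: "\<And>m n. n \<le> m \<Longrightarrow> (dist (u n) (u m))\<^sup>2 \<le> R m - R n"
  shows "\<exists>l\<in>C. u \<longlonglongrightarrow> l"
proof -
  have mono: "incseq R"
  proof (rule incseq_SucI)
    fix n have "0 \<le> (dist (u n) (u (Suc n)))\<^sup>2" by simp
    then show "R n \<le> R (Suc n)" using inc[of n "Suc n"] by linarith
  qed
  obtain L where L: "R \<longlonglongrightarrow> L" "\<And>n. R n \<le> L" using incseq_convergent[OF mono] bd by blast
  have "Cauchy u"
  proof (rule metric_CauchyI)
    fix e :: real assume e: "e > 0"
    then have "\<forall>\<^sub>F n in sequentially. R n > L - e\<^sup>2" using order_tendstoD(1)[OF L(1), of "L - e\<^sup>2"] by auto
    then obtain N where N: "R N > L - e\<^sup>2" by (auto simp: eventually_sequentially)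
    have *: "dist (u m) (u n) < e" if "N \<le> m" "m \<le> n" for m n
    proof -
      have "(dist (u m) (u n))\<^sup>2 \<le> R n - R m" using inc that by blast
      also have "\<dots> \<le> L - R N" using L(2)[of n] mono that(1) by (auto simp: incseq_def intro: diff_mono)
      also have "\<dots> < e\<^sup>2" using N by simp
      finally show ?thesis using e power2_less_imp_less by fastforce
    qed
    show "\<exists>M. \<forall>m\<ge>M. \<forall>n\<ge>M. dist (u m) (u n) < e"
    proof (intro exI allI impI)
      fix m n assume "N \<le> m" "N \<le> n"
      then show "dist (u m) (u n) < e" using *[of m n] *[of n m] by (cases "m \<le> n") (auto simp: dist_commute)
    qed
  qed
  then obtain l where l: "u \<longlonglongrightarrow> l" using Cauchy_convergent_iff convergent_def by blast
  then show ?thesis using C u closed_sequentially by blast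
qed

text \<open>The midpoint of two nearly nearest points lies in C, so it is no closer to q than the
  infimum; CN then forces the two points together. Completeness replaces compactness.\<close>

lemma proj_ex:
  assumes C: "closed C" "cvx C" "C \<noteq> {}" and q: "q \<in> H"
  shows "\<exists>u\<in>C. \<forall>c\<in>C. dist q u \<le> dist q c"
proof -
  define d where "d = infdist q C"
  have dle: "d \<le> dist q c" if "c \<in> C" for c using that infdist_le d_def by blast
  have d0: "d \<ge> 0" by (simp add: d_def infdist_nonneg)
  have "\<exists>c\<in>C. (dist q c)\<^sup>2 < d\<^sup>2 + 1 / real (Suc n)" for n
  proof (rule ccontr)
    assume "\<not> ?thesis"
    then have *: "\<And>c. c \<in> C \<Longrightarrow> d\<^sup>2 + 1 / real (Suc n) \<le> (dist q c)\<^sup>2" by force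
    have "sqrt (d\<^sup>2 + 1 / real (Suc n)) \<le> dist q c" if "c \<in> C" for c
      using *[OF that] by (simp add: real_le_lsqrt)
    then have "sqrt (d\<^sup>2 + 1 / real (Suc n)) \<le> d"
      unfolding d_def infdist_notempty[OF C(3)] using C(3) by (intro cINF_greatest) auto
    then have "d\<^sup>2 + 1 / real (Suc n) \<le> d\<^sup>2" using d0 sqrt_le_D by blast
    moreover have "0 < 1 / real (Suc n)" by simp
    ultimately show False by linarith
  qed
  then obtain u where u: "\<And>n. u n \<in> C" "\<And>n. (dist q (u n))\<^sup>2 < d\<^sup>2 + 1 / real (Suc n)" by metis
  have cau: "(dist (u n) (u m))\<^sup>2 \<le> 4 / real (Suc n)" if "n \<le> m" for n m
  proof -
    have H: "u n \<in> H" "u m \<in> H" using u C cvx_sub by auto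
    have "P (u n) (u m) (1/2) \<in> C" using cvxD C u by auto
    then have "d\<^sup>2 \<le> (dist q (P (u n) (u m) (1/2)))\<^sup>2" using dle d0 by (intro power_mono) auto
    also have "\<dots> \<le> (dist q (u n))\<^sup>2/2 + (dist q (u m))\<^sup>2/2 - (dist (u n) (u m))\<^sup>2/4"
      using P_cn[OF q H, of "1/2"] by simp
    finally have fin: "d\<^sup>2 \<le> (dist q (u n))\<^sup>2/2 + (dist q (u m))\<^sup>2/2 - (dist (u n) (u m))\<^sup>2/4" .
    have "(dist (u n) (u m))\<^sup>2/4 \<le> 1 / real (Suc n) / 2 + 1 / real (Suc m) / 2"
    proof -
      have aux: "C / 4 \<le> p / 2 + p' / 2" if "D \<le> A / 2 + B / 2 - C / 4" "A < D + p" "B < D + p'" for A B C D p p' :: real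
        using that by linarith
      from aux[OF fin u(2)[of n] u(2)[of m]] show ?thesis .
    qed
    moreover have "1 / real (Suc m) \<le> 1 / real (Suc n)" using that by (simp add: frac_le)
    moreover have "C \<le> 4 * p" if "C / 4 \<le> p / 2 + p' / 2" "p' \<le> p" for C p p' :: real using that by linarith
    ultimately have "(dist (u n) (u m))\<^sup>2 \<le> 4 * (1 / real (Suc n))" by blast
    then show ?thesis by simp
  qed
  have "Cauchy u"
  proof (rule metric_CauchyI)
    fix e :: real assume e: "e > 0"
    obtain N where N: "4 / e\<^sup>2 < real N" using reals_Archimedean2 by blast
  
    have "4 < real N * e\<^sup>2" using N e by (simp add: pos_divide_less_eq)
    also have "\<dots> \<le> real (Suc N) * e\<^sup>2" by (simp add: mult_right_mono)
    finally have N4: "4 / real (Suc N) < e\<^sup>2" by (simp add: pos_divide_less_eq mult.commute)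
    have *: "dist (u m) (u n) < e" if "N \<le> m" "m \<le> n" for m n
    proof -
      have "(dist (u m) (u n))\<^sup>2 \<le> 4 / real (Suc m)" using cau that by blast
      also have "\<dots> \<le> 4 / real (Suc N)" using that by (simp add: frac_le)
      finally have "(dist (u m) (u n))\<^sup>2 < e\<^sup>2" using N4 by linarith
      then show ?thesis by (rule power2_less_imp_less) (use e in simp)
    qed
    show "\<exists>M. \<forall>m\<ge>M. \<forall>n\<ge>M. dist (u m) (u n) < e"
    proof (intro exI allI impI)
      fix m n assume "N \<le> m" "N \<le> n"
      then show "dist (u m) (u n) < e" using *[of m n] *[of n m] by (cases "m \<le> n") (auto simp: dist_commute)
    qed
  qed
  then obtain l where l: "u \<longlonglongrightarrow> l" using Cauchy_convergent_iff convergent_def by blast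
  then have lC: "l \<in> C" using C(1) u(1) closed_sequentially by blast
  have "(\<lambda>n. d\<^sup>2 + 1 / real (Suc n)) \<longlonglongrightarrow> d\<^sup>2 + 0" by (intro tendsto_intros LIMSEQ_Suc lim_1_over_n)
  moreover have "(\<lambda>n. (dist q (u n))\<^sup>2) \<longlonglongrightarrow> (dist q l)\<^sup>2" by (intro tendsto_intros l)
  ultimately have "(dist q l)\<^sup>2 \<le> d\<^sup>2" using u(2) by (intro LIMSEQ_le[where X="\<lambda>n. (dist q (u n))\<^sup>2"]) (auto intro: less_imp_le)
  then have "dist q l \<le> d" using d0 power2_le_imp_le by blast
  then show ?thesis using lC dle by (meson order_trans)
qed

definition pr :: "'c set \<Rightarrow> 'c \<Rightarrow> 'c" where
  "pr C q = (SOME u. u \<in> C \<and> (\<forall>c\<in>C. dist q u \<le> dist q c))"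

lemma pr_spec:
  assumes "closed C" "cvx C" "C \<noteq> {}" "q \<in> H"
  shows "pr C q \<in> C" "\<And>c. c \<in> C \<Longrightarrow> dist q (pr C q) \<le> dist q c"
proof -
  have "pr C q \<in> C \<and> (\<forall>c\<in>C. dist q (pr C q) \<le> dist q c)"
    unfolding pr_def by (rule someI_ex) (use proj_ex[OF assms] in blast)
  then show "pr C q \<in> C" "\<And>c. c \<in> C \<Longrightarrow> dist q (pr C q) \<le> dist q c" by auto
qed

text \<open>First variation: moving from u towards c by a fraction t does not come closer to q.
  Divide the resulting inequality by t and let t tend to 0; geometrically, the angle at u is at
  least a right angle.\<close>

lemma nearest_obtuse:
  assumes C: "cvx C" and q: "q \<in> H" and u: "u \<in> C" "\<And>c. c \<in> C \<Longrightarrow> dist q u \<le> dist q c" and c: "c \<in> C"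
  shows "(dist q u)\<^sup>2 + (dist u c)\<^sup>2 \<le> (dist q c)\<^sup>2"
proof -
  have H: "u \<in> H" "c \<in> H" using u c C cvx_sub by auto
  have *: "(dist q u)\<^sup>2 + (1-t)*(dist u c)\<^sup>2 \<le> (dist q c)\<^sup>2" if t: "0 < t" "t \<le> 1" for t
  proof -
    have "P u c t \<in> C" using cvxD C u c t by auto
    then have "(dist q u)\<^sup>2 \<le> (dist q (P u c t))\<^sup>2" using u by (intro power_mono) auto
    also have "\<dots> \<le> (1-t) * (dist q u)\<^sup>2 + t * (dist q c)\<^sup>2 - t*(1-t)*(dist u c)\<^sup>2"
      using P_cn[OF q H] t by simp
    finally have "t * ((dist q u)\<^sup>2 + (1-t)*(dist u c)\<^sup>2) \<le> t * (dist q c)\<^sup>2" by (simp add: algebra_simps)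
    then show ?thesis using t by simp
  qed
  show ?thesis
  proof (rule field_le_epsilon)
    fix e :: real assume e: "e > 0"
    \<comment> \<open>Makes the error \<open>t * (dist u c)\<close>, squared in the distance, at
      most e; the summand 1 avoids a zero denominator.\<close>
    define t where "t = min 1 (e / (1 + (dist u c)\<^sup>2))"
    have pos: "0 < 1 + (dist u c)\<^sup>2" using zero_le_power2[of "dist u c"] by linarith
    have t: "0 < t" "t \<le> 1" using e pos by (auto simp: t_def)
    have "t \<le> e / (1 + (dist u c)\<^sup>2)" by (simp add: t_def)
    then have "t * (1 + (dist u c)\<^sup>2) \<le> e" using pos by (simp add: pos_le_divide_eq)
    then have "t * (dist u c)\<^sup>2 \<le> e" using t by (simp add: algebra_simps)
    then show "(dist q u)\<^sup>2 + (dist u c)\<^sup>2 \<le> (dist q c)\<^sup>2 + e" using *[OF t] by (simp add: algebra_simps)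
  qed
qed

lemma pr_eqI:
  assumes C: "closed C" "cvx C" "q \<in> H" and u: "u \<in> C" "\<And>c. c \<in> C \<Longrightarrow> dist q u \<le> dist q c"
  shows "pr C q = u"
proof -
  have ne: "C \<noteq> {}" using u by auto
  note p = pr_spec[OF C(1,2) ne C(3)]
  have "(dist q u)\<^sup>2 + (dist u (pr C q))\<^sup>2 \<le> (dist q (pr C q))\<^sup>2" using nearest_obtuse[OF C(2,3) u] p by auto
  moreover have "(dist q (pr C q))\<^sup>2 \<le> (dist q u)\<^sup>2" using p u by (intro power_mono) auto
  ultimately have "(dist u (pr C q))\<^sup>2 \<le> 0" by linarith
  then show ?thesis by simp
qed

lemma pr_id: "closed C \<Longrightarrow> cvx C \<Longrightarrow> q \<in> C \<Longrightarrow> pr C q = q"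
  by (rule pr_eqI) (auto simp: cvx_sub)

text \<open>Add the obtuse-angle inequalities at both feet to the quadrilateral inequality
  \<open>enflo\<close>; the diagonals and the distances to the feet cancel.\<close>

lemma pr_lip:
  assumes C: "closed C" "cvx C" "C \<noteq> {}" and x: "x \<in> H" and y: "y \<in> H"
  shows "dist (pr C x) (pr C y) \<le> dist x y"
proof -
  let ?u = "pr C x" and ?v = "pr C y"
  note u = pr_spec[OF C x] and v = pr_spec[OF C y]
  have H: "?u \<in> H" "?v \<in> H" using u v C cvx_sub by auto
  have "(dist x ?u)\<^sup>2 + (dist ?u ?v)\<^sup>2 \<le> (dist x ?v)\<^sup>2" using nearest_obtuse[OF C(2) x u] v by auto
  moreover have "(dist y ?v)\<^sup>2 + (dist ?v ?u)\<^sup>2 \<le> (dist y ?u)\<^sup>2" using nearest_obtuse[OF C(2) y v] u by auto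
  moreover have "(dist x ?v)\<^sup>2 + (dist y ?u)\<^sup>2 \<le> (dist x y)\<^sup>2 + (dist y ?v)\<^sup>2 + (dist ?v ?u)\<^sup>2 + (dist x ?u)\<^sup>2"
    using enflo[OF x y H(2,1)] by (simp add: dist_commute)
  ultimately have "(dist ?u ?v)\<^sup>2 \<le> (dist x y)\<^sup>2" unfolding dist_commute[of ?v ?u] by linarith
  then show ?thesis by (rule power2_le_imp_le) simp
qed

lemma infdist_pr:
  assumes "closed C" "cvx C" "C \<noteq> {}" "q \<in> H"
  shows "infdist q C = dist q (pr C q)"
proof (rule antisym)
  show "infdist q C \<le> dist q (pr C q)" using pr_spec[OF assms] infdist_le by blast
  show "dist q (pr C q) \<le> infdist q C" unfolding infdist_notempty[OF assms(3)]
    using pr_spec[OF assms] assms(3) by (intro cINF_greatest) auto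
qed

text \<open>Join the feet of x and y by a geodesic in C and compare with it by
  \<open>P_busemann\<close>.\<close>

lemma infdist_convex:
  assumes C: "closed C" "cvx C" "C \<noteq> {}" and x: "x \<in> H" "y \<in> H" "0 \<le> t" "t \<le> 1"
  shows "infdist (P x y t) C \<le> (1-t) * infdist x C + t * infdist y C"
proof -
  have u: "pr C x \<in> C" "pr C y \<in> C" using pr_spec C x by auto
  then have "P (pr C x) (pr C y) t \<in> C" using cvxD C x by auto
  then have "infdist (P x y t) C \<le> dist (P x y t) (P (pr C x) (pr C y) t)" by (rule infdist_le)
  also have "\<dots> \<le> (1-t) * dist x (pr C x) + t * dist y (pr C y)"
    using u C x cvx_sub by (intro P_busemann) auto
  finally show ?thesis using infdist_pr[OF C] x by simp
qed

section \<open>Sublevel sets of the distance from a convex set\<close>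

definition tube :: "'c set \<Rightarrow> real \<Rightarrow> 'c set" where "tube C c = {q\<in>H. infdist q C \<le> c}"

lemma closed_tube: "closed (tube C c)"
proof -
  have "tube C c = H \<inter> {q. infdist q C \<le> c}" by (auto simp: tube_def)
  moreover have "closed {q. infdist q C \<le> c}" by (intro closed_Collect_le continuous_intros)
  ultimately show ?thesis using closed_H by auto
qed

lemma cvx_tube:
  assumes C: "closed C" "cvx C" "C \<noteq> {}" shows "cvx (tube C c)"
proof -
  have "infdist (P x y t) C \<le> c" if "x \<in> H" "y \<in> H" "infdist x C \<le> c" "infdist y C \<le> c" "0 \<le> t" "t \<le> 1" for x y t
  proof -
    have "infdist (P x y t) C \<le> (1-t) * infdist x C + t * infdist y C" using infdist_convex[OF C] that by auto
    also have "\<dots> \<le> (1-t) * c + t * c" using that by (intro add_mono mult_left_mono) auto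
    finally show ?thesis by (simp add: algebra_simps)
  qed
  then show ?thesis by (auto simp: cvx_def tube_def P_in)
qed

lemma tube_sub: "C \<subseteq> H \<Longrightarrow> 0 \<le> c \<Longrightarrow> C \<subseteq> tube C c" by (auto simp: tube_def)

text \<open>The point at height c on the geodesic to the foot on C belongs to the tube, and the
  triangle inequality for \<open>infdist\<close> shows that no point of the tube is closer to
  q.\<close>

lemma pr_tube:
  assumes C: "closed C" "cvx C" "C \<noteq> {}" and q: "q \<in> H" and c: "0 \<le> c" "c \<le> infdist q C"
  shows "dist q (pr (tube C c) q) = infdist q C - c" "infdist (pr (tube C c) q) C = c"
proof -
  let ?T = "tube C c" and ?h = "infdist q C"
  have CH: "C \<subseteq> H" using C by (auto simp: cvx_def)
  have T: "closed ?T" "cvx ?T" "?T \<noteq> {}" using closed_tube cvx_tube[OF C] tube_sub[OF CH c(1)] C(3) by auto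
  note p = pr_spec[OF T q]
  have uC: "pr C q \<in> C" "pr C q \<in> H" using pr_spec[OF C q] CH by auto
  have lo: "?h - c \<le> dist q r" if "infdist r C \<le> c" for r
    using infdist_triangle[of q C r] that by simp
  have up: "dist q (pr ?T q) \<le> ?h - c"
  proof (cases "?h = 0")
    case True
    then have "q \<in> ?T" using c q by (auto simp: tube_def)
    then show ?thesis using pr_id[OF T(1,2)] True c by auto
  next
    case False
    then have h: "?h > 0" using infdist_nonneg[of q C] by linarith
    let ?r = "P (pr C q) q (c / ?h)"
    have t: "0 \<le> c / ?h" "c / ?h \<le> 1" using c h by auto
    have dh: "dist (pr C q) q = ?h" using infdist_pr[OF C q] by (simp add: dist_commute)
    have "infdist ?r C \<le> dist ?r (pr C q)" using uC by (intro infdist_le)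
    also have "\<dots> = c" using dist_P_left[OF uC(2) q t] dh h by (simp add: dist_commute)
    finally have "?r \<in> ?T" using P_in uC q t by (auto simp: tube_def)
    then have "dist q (pr ?T q) \<le> dist q ?r" using p by blast
    also have "\<dots> = (1 - c / ?h) * ?h" using dist_P_right[OF uC(2) q t] dh by simp
    also have "\<dots> = ?h - c" using h by (simp add: field_simps)
    finally show ?thesis .
  qed
  have inT: "infdist (pr ?T q) C \<le> c" using p by (auto simp: tube_def)
  show d: "dist q (pr ?T q) = ?h - c" using up lo[OF inT] by simp
  show "infdist (pr ?T q) C = c" using inT infdist_triangle[of q C "pr ?T q"] d by simp
qed

text \<open>A point of T closer to an inner point of the geodesic would, by the triangle inequality,
  also be closer to q.\<close>

lemma pr_between:
  assumes T: "closed T" "cvx T" "T \<noteq> {}" and q: "q \<in> H" and s: "0 \<le> s" "s \<le> 1"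
  shows "pr T (P (pr T q) q s) = pr T q"
proof (rule pr_eqI)
  note p = pr_spec[OF T q]
  have pH: "pr T q \<in> H" using p T cvx_sub by auto
  show "P (pr T q) q s \<in> H" using P_in pH q s by auto
  show "dist (P (pr T q) q s) (pr T q) \<le> dist (P (pr T q) q s) c" if "c \<in> T" for c
  proof -
    have "dist q (pr T q) \<le> dist q c" using p that by auto
    also have "\<dots> \<le> dist q (P (pr T q) q s) + dist (P (pr T q) q s) c" by (rule dist_triangle)
    finally show ?thesis using dist_P_left[OF pH q s] dist_P_right[OF pH q s] by (simp add: dist_commute algebra_simps)
  qed
qed (use pr_spec[OF T q] T in auto)

text \<open>Moving the higher of the two points down to the level of the other one first is what
  makes the projection strictly contracting in the direction of the distance function.\<close>
lemma pr_tube_contract: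
  assumes C: "closed C" "cvx C" "C \<noteq> {}" and x: "x \<in> H" and y: "y \<in> H"
    and c: "0 \<le> c" "c \<le> infdist x C" "infdist x C \<le> infdist y C"
  shows "(dist (pr (tube C c) x) (pr (tube C c) y))\<^sup>2 + (infdist y C - infdist x C)\<^sup>2 \<le> (dist x y)\<^sup>2"
proof -
  let ?a = "infdist x C" and ?b = "infdist y C"
  have CH: "C \<subseteq> H" using C by (auto simp: cvx_def)
  have Tn: "closed (tube C r)" "cvx (tube C r)" "r \<ge> 0 \<Longrightarrow> tube C r \<noteq> {}" for r
    using closed_tube cvx_tube[OF C] tube_sub[OF CH, of r] C(3) by auto
  have a0: "?a \<ge> 0" by (rule infdist_nonneg)
  let ?T = "tube C c" and ?S = "tube C ?a"
  let ?v = "pr ?T y"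
  have vH: "?v \<in> H" using pr_spec(1)[OF Tn(1,2,3) y] c by (auto simp: tube_def)
  have dv: "dist y ?v = ?b - c" using pr_tube(1)[OF C y] c by auto
  \<comment> \<open>\<open>?y\<close> is the point of the segment from \<open>?v\<close> to y at the
    height of x. If y is already at height c, then so is x and the segment is degenerate.\<close>
  define s where "s = (if ?b = c then 0 else (?a - c) / (?b - c))"
  have s: "0 \<le> s" "s \<le> 1" using c by (auto simp: s_def field_simps)
  let ?y = "P ?v y s"
  have yH: "?y \<in> H" using P_in vH y s by auto
  have sm: "s * (?b - c) = ?a - c" using c by (auto simp: s_def)
  have dv': "dist ?v y = ?b - c" using dv by (simp add: dist_commute)
  have dy: "dist y ?y = ?b - ?a"
    using dist_P_right[OF vH y s] sm unfolding dv' by (simp add: left_diff_distrib)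
  have dy2: "dist ?v ?y = ?a - c"
    using dist_P_left[OF vH y s] sm unfolding dv' by simp
  have hv: "infdist ?v C = c" using pr_tube(2)[OF C y] c by auto
  have "infdist ?y C \<le> infdist ?v C + dist ?y ?v" by (rule infdist_triangle)
  then have "infdist ?y C \<le> ?a" using dy2 hv by (simp add: dist_commute)
  then have yS: "?y \<in> ?S" using yH by (auto simp: tube_def)
  have near: "dist y ?y \<le> dist y r" if "r \<in> ?S" for r
    using that dy infdist_triangle[of y C r] by (auto simp: tube_def)
  have xS: "x \<in> ?S" using x by (auto simp: tube_def)
  have "(dist y ?y)\<^sup>2 + (dist ?y x)\<^sup>2 \<le> (dist y x)\<^sup>2"
    using nearest_obtuse[OF Tn(2) y yS near xS] by simp
  moreover have "pr ?T ?y = ?v" using pr_between[OF Tn(1,2,3) y s] c by auto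
  then have "dist (pr ?T x) ?v \<le> dist x ?y" using pr_lip[OF Tn(1)[of c] Tn(2)[of c] Tn(3)[OF c(1)] x yH] by simp
  then have "(dist (pr ?T x) ?v)\<^sup>2 \<le> (dist x ?y)\<^sup>2" by (intro power_mono) auto
  ultimately show ?thesis unfolding dy dist_commute[of ?y x] dist_commute[of y x] by linarith
qed

text \<open>Without local compactness a minimising sequence has to be selected: the sublevel sets
  \<open>T n\<close> are closed, convex and nested, and their points nearest to b have increasing
  distance from b, bounded by coercivity, so \<open>cauchy_from_cn\<close> applies.\<close>

lemma convex_min_attained:
  fixes f :: "'c \<Rightarrow> real"
  assumes S: "closed S" "cvx S" "S \<noteq> {}"
    and cont: "continuous_on S f"
    and conv: "\<And>x y t. x \<in> S \<Longrightarrow> y \<in> S \<Longrightarrow> 0 \<le> t \<Longrightarrow> t \<le> 1 \<Longrightarrow> f (P x y t) \<le> (1-t) * f x + t * f y"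
    and b: "b \<in> H" and coer: "\<And>x. x \<in> S \<Longrightarrow> dist b x \<le> f x + k"
  shows "\<exists>u\<in>S. \<forall>x\<in>S. f u \<le> f x"
proof -
  define i where "i = Inf (f ` S)"
  have bb: "bdd_below (f ` S)" 
  proof (intro bdd_belowI2[of _ "-k"])
    fix x assume "x \<in> S" then show "-k \<le> f x" using coer[of x] zero_le_dist[of b x] by linarith
  qed
  have ile: "i \<le> f x" if "x \<in> S" for x using that bb unfolding i_def by (intro cInf_lower) auto
  define T where "T n = {x\<in>S. f x \<le> i + 1 / real (Suc n)}" for n
  have Tcl: "closed (T n)" for n
  proof -
    have "closedin (top_of_set S) (S \<inter> f -` {..i + 1 / real (Suc n)})"
      using cont by (intro continuous_closedin_preimage) auto
    moreover have "S \<inter> f -` {..i + 1 / real (Suc n)} = T n" by (auto simp: T_def)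
    ultimately show ?thesis using S(1) closedin_closed_trans by metis
  qed
  have Tcv: "cvx (T n)" for n
    unfolding cvx_def
  proof (intro conjI ballI)
    show "T n \<subseteq> H" using S(2) by (auto simp: T_def cvx_def)
    fix x y t assume a: "x \<in> T n" "y \<in> T n" "t \<in> {0..1::real}"
    have "f (P x y t) \<le> (1-t) * f x + t * f y" using a conv by (auto simp: T_def)
    also have "\<dots> \<le> (1-t) * (i + 1 / real (Suc n)) + t * (i + 1 / real (Suc n))"
      using a by (intro add_mono mult_left_mono) (auto simp: T_def)
    also have "\<dots> = ((1-t) + t) * (i + 1 / real (Suc n))" by (simp only: distrib_right)
    finally show "P x y t \<in> T n" using a cvxD[OF S(2)] by (auto simp: T_def)
  qed
  have Tne: "T n \<noteq> {}" for n
  proof -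
    have "\<exists>y\<in>f ` S. y < i + 1 / real (Suc n)"
      unfolding i_def using S(3) bb by (intro cInf_lessD) auto
    then show ?thesis by (auto simp: T_def intro: less_imp_le)
  qed
  define u where "u n = pr (T n) b" for n
  have uT: "u n \<in> T n" "\<And>c. c \<in> T n \<Longrightarrow> dist b (u n) \<le> dist b c" for n
    using pr_spec[OF Tcl Tcv Tne b] by (auto simp: u_def)
  have Tm: "T m \<subseteq> T n" if "n \<le> m" for n m
  proof
    fix x assume "x \<in> T m"
    moreover have "1 / real (Suc m) \<le> 1 / real (Suc n)" using that by (simp add: frac_le)
    ultimately show "x \<in> T n" by (auto simp: T_def)
  qed
  have bnd: "(dist b (u n))\<^sup>2 \<le> (i + 1 + \<bar>k\<bar>)\<^sup>2" for n
  proof -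
    have "dist b (u n) \<le> f (u n) + k" using uT(1)[of n] coer by (auto simp: T_def)
    also have "\<dots> \<le> i + 1 / real (Suc n) + \<bar>k\<bar>" using uT(1)[of n] by (auto simp: T_def)
    also have "\<dots> \<le> i + 1 + \<bar>k\<bar>" by simp
    finally show ?thesis by (intro power_mono) auto
  qed
  have "\<exists>l\<in>S. u \<longlonglongrightarrow> l"
  proof (rule cauchy_from_cn[OF S(1) _ bnd])
    show "u n \<in> S" for n using uT(1)[of n] by (auto simp: T_def)
    show "(dist (u n) (u m))\<^sup>2 \<le> (dist b (u m))\<^sup>2 - (dist b (u n))\<^sup>2" if "n \<le> m" for m n
    proof -
      have "u m \<in> T n" using uT(1) Tm that by blast
      then show ?thesis using nearest_obtuse[OF Tcv b uT(1) uT(2), of n "u m"] by simp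
    qed
  qed
  then obtain l where l: "l \<in> S" "u \<longlonglongrightarrow> l" by blast
  have "(\<lambda>n. f (u n)) \<longlonglongrightarrow> f l"
    using cont l uT(1) by (intro continuous_on_tendsto_compose[OF cont]) (auto simp: T_def)
  moreover have "(\<lambda>n. i + 1 / real (Suc n)) \<longlonglongrightarrow> i + 0" by (intro tendsto_intros LIMSEQ_Suc lim_1_over_n)
  ultimately have "f l \<le> i"
    using uT(1) by (intro LIMSEQ_le[where X="\<lambda>n. f (u n)"]) (auto simp: T_def)
  then show ?thesis using l ile by (meson order_trans)
qed

lemma dist_convex:
  assumes "z \<in> H" "x \<in> H" "y \<in> H" "0 \<le> t" "t \<le> 1"
  shows "dist z (P x y t) \<le> (1-t) * dist z x + t * dist z y"
  using P_busemann[of z z x y t] assms by simp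

end

section \<open>Finite unions of convex sets and their chain metric\<close>

text \<open>r is the length of a chain from a to b, each step of which stays in one member of
  \<open>CC\<close>. The members will be convex, so a step can be replaced by a geodesic of the same
  length, and \<open>cd\<close> is the induced length metric of the union.\<close>

inductive reach :: "'c::metric_space set set \<Rightarrow> 'c \<Rightarrow> 'c \<Rightarrow> real \<Rightarrow> bool" for CC where
  reach_refl: "a \<in> \<Union>CC \<Longrightarrow> reach CC a a 0"
| reach_step: "reach CC a b r \<Longrightarrow> C \<in> CC \<Longrightarrow> b \<in> C \<Longrightarrow> c \<in> C \<Longrightarrow> reach CC a c (r + dist b c)"

text \<open>This is \<open>Inf {}\<close>, hence unspecified, when \<open>b\<close> cannot be reached from \<open>a\<close>.\<close>

definition cd :: "'c::metric_space set set \<Rightarrow> 'c \<Rightarrow> 'c \<Rightarrow> real" where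
  "cd CC a b = Inf {r. reach CC a b r}"

lemma reach_in: "reach CC a b r \<Longrightarrow> a \<in> \<Union>CC \<and> b \<in> \<Union>CC"
  by (induction rule: reach.induct) auto

lemma reach_ge: "reach CC a b r \<Longrightarrow> dist a b \<le> r"
proof (induction rule: reach.induct)
  case (reach_step a b r C c)
  then show ?case using dist_triangle[of a c b] by simp
qed simp

lemma reach_trans: "reach CC b c s \<Longrightarrow> reach CC a b r \<Longrightarrow> reach CC a c (r + s)"
proof (induction rule: reach.induct)
  case (reach_step b c s C d)
  then have "reach CC a d ((r + s) + dist c d)" by (intro reach.reach_step) auto
  then show ?case by (simp add: add.assoc)
qed simp

lemma reach_one: assumes "C \<in> CC" "a \<in> C" "b \<in> C" shows "reach CC a b (dist a b)"
  using reach_step[OF reach_refl assms(1), of a b] assms by auto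

lemma reach_sym: "reach CC a b r \<Longrightarrow> reach CC b a r"
proof (induction rule: reach.induct)
  case (reach_step a b r C c)
  have "reach CC c b (dist c b)" using reach_step by (intro reach_one)
  from reach_trans[OF reach_step.IH this] show ?case by (simp add: dist_commute add.commute)
qed (auto intro: reach_refl)

lemma reach_bdd: "bdd_below {r. reach CC a b r}"
  using order_trans[OF zero_le_dist reach_ge] by (intro bdd_belowI[of _ 0]) auto

lemma cd_le: "reach CC a b r \<Longrightarrow> cd CC a b \<le> r"
  unfolding cd_def by (rule cInf_lower[OF _ reach_bdd]) simp

lemma cd_ge: "reach CC a b r \<Longrightarrow> dist a b \<le> cd CC a b"
  unfolding cd_def by (rule cInf_greatest) (auto intro: reach_ge)

lemma cd_approx: assumes "reach CC a b r" "e > 0" shows "\<exists>s. reach CC a b s \<and> s < cd CC a b + e"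
  using cInf_lessD[of "{r. reach CC a b r}" "cd CC a b + e"] assms unfolding cd_def by auto

lemma cd_sym: "cd CC a b = cd CC b a"
proof -
  have "{r. reach CC a b r} = {r. reach CC b a r}" using reach_sym by blast
  then show ?thesis by (simp add: cd_def)
qed

lemma cd_triangle:
  assumes "reach CC a b r" "reach CC b c s" shows "cd CC a c \<le> cd CC a b + cd CC b c"
proof (rule field_le_epsilon)
  fix e :: real assume "e > 0"
  then obtain r' s' where "reach CC a b r'" "r' < cd CC a b + e/2" "reach CC b c s'" "s' < cd CC b c + e/2"
    using cd_approx[OF assms(1), of "e/2"] cd_approx[OF assms(2), of "e/2"] by auto
  then have "cd CC a c \<le> r' + s'" "r' < cd CC a b + e/2" "s' < cd CC b c + e/2" using cd_le[OF reach_trans] by auto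
  then show "cd CC a c \<le> cd CC a b + cd CC b c + e" by linarith
qed

lemma cd_same: "C \<in> CC \<Longrightarrow> a \<in> C \<Longrightarrow> b \<in> C \<Longrightarrow> cd CC a b = dist a b"
  using cd_le[OF reach_one] cd_ge[OF reach_one] by (metis antisym)

lemma cd_self: "a \<in> \<Union>CC \<Longrightarrow> cd CC a a = 0" using cd_same by fastforce

text \<open>In contrast to \<open>reach\<close>, the members visited are recorded in order and r is
  only an upper bound for the length. Recording them allows loops to be cut out, which leaves
  finitely many itineraries if \<open>CC\<close> is finite.\<close>

fun thr :: "'c::metric_space set list \<Rightarrow> 'c \<Rightarrow> 'c \<Rightarrow> real \<Rightarrow> bool" where
  "thr [] a b r = False"
| "thr [c] a b r = (a \<in> c \<and> b \<in> c \<and> dist a b \<le> r)"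
| "thr (c # d # ds) a b r = (a \<in> c \<and> (\<exists>z\<in>c \<inter> d. thr (d # ds) z b (r - dist a z)))"

lemma thr_mono: "thr cs a b r \<Longrightarrow> r \<le> r' \<Longrightarrow> thr cs a b r'"
proof (induction cs a b r arbitrary: r' rule: thr.induct)
  case (3 c d ds a b r)
  then obtain z where z: "z \<in> c \<inter> d" "thr (d # ds) z b (r - dist a z)" by auto
  have "thr (d # ds) z b (r' - dist a z)" by (rule "3.IH"[OF z(1) z(2)]) (use "3.prems" in simp)
  then show ?case using "3.prems"(1) z(1) by auto
qed auto

lemma thr_hd_last: "thr cs a b r \<Longrightarrow> cs \<noteq> [] \<and> a \<in> hd cs \<and> b \<in> last cs"
  by (induction cs a b r rule: thr.induct) auto

lemma thr_snoc: "thr cs a b r \<Longrightarrow> b \<in> C \<Longrightarrow> c \<in> C \<Longrightarrow> thr (cs @ [C]) a c (r + dist b c)"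
proof (induction cs a b r rule: thr.induct)
  case (2 e a b r)
  then have "thr [C] b c (r + dist b c - dist a b)" by auto
  moreover have "b \<in> e \<inter> C" "a \<in> e" using 2 by auto
  ultimately have "a \<in> e \<and> (\<exists>z\<in>e \<inter> C. thr [C] z c (r + dist b c - dist a z))" by blast
  then show ?case by (simp only: append.simps thr.simps)
next
  case (3 e d ds a b r)
  then obtain z where z: "z \<in> e \<inter> d" "thr (d # ds) z b (r - dist a z)" by auto
  have "thr ((d # ds) @ [C]) z c (r - dist a z + dist b c)" by (rule "3.IH"[OF z(1) z(2) "3.prems"(2,3)])
  moreover have "r - dist a z + dist b c = r + dist b c - dist a z" by simp
  ultimately have "thr (d # (ds @ [C])) z c (r + dist b c - dist a z)" by (metis append_Cons)
  then show ?case using "3.prems"(1) z(1) by auto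
qed auto

lemma thr_start: "thr (c # zs) z b s \<Longrightarrow> a \<in> c \<Longrightarrow> thr (c # zs) a b (s + dist a z)"
proof (cases zs)
  case Nil
  assume "thr (c # zs) z b s" "a \<in> c"
  then show ?thesis using Nil dist_triangle[of a b z] by auto
next
  case (Cons d ds)
  assume a: "thr (c # zs) z b s" "a \<in> c"
  then obtain z' where z: "z' \<in> c \<inter> d" "thr (d # ds) z' b (s - dist z z')" using Cons by auto
  have "thr (d # ds) z' b (s + dist a z - dist a z')"
    by (rule thr_mono[OF z(2)]) (use dist_triangle[of a z' z] in simp)
  then show ?thesis using a z Cons by auto
qed

lemma thr_drop: "thr (us @ c # zs) a b r \<Longrightarrow> us \<noteq> [] \<Longrightarrow> \<exists>z\<in>c. thr (c # zs) z b (r - dist a z)"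
proof (induction us arbitrary: a r)
  case (Cons u us)
  show ?case
  proof (cases us)
    case Nil then show ?thesis using Cons by auto
  next
    case (Cons u' us')
    then obtain z where z: "z \<in> u" "thr (us @ c # zs) z b (r - dist a z)" using Cons.prems by auto
    then obtain z' where z': "z' \<in> c" "thr (c # zs) z' b (r - dist a z - dist z z')" using Cons.IH[OF z(2)] Cons by auto
    have "thr (c # zs) z' b (r - dist a z')"
      by (rule thr_mono[OF z'(2)]) (use dist_triangle[of a z' z] in simp)
    then show ?thesis using z' by auto
  qed
qed simp

text \<open>Between two visits to c the chain may go straight inside c, which is no longer by the
  triangle inequality.\<close>

lemma thr_cut1: assumes "thr (c # ys @ c # zs) a b r" shows "thr (c # zs) a b r"
proof -
  obtain z where "z \<in> c" "thr (c # zs) z b (r - dist a z)" using thr_drop[of "c # ys" c zs a b r] assms by auto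
  moreover have "a \<in> c" using thr_hd_last[OF assms] by simp
  ultimately show ?thesis using thr_start[of c zs z b "r - dist a z" a] by simp
qed

lemma thr_cut: "thr (xs @ c # ys @ c # zs) a b r \<Longrightarrow> thr (xs @ c # zs) a b r"
proof (induction xs arbitrary: a r)
  case Nil then show ?case using thr_cut1 by auto
next
  case (Cons x xs)
  have ne: "thr (x # l) a b r \<longleftrightarrow> a \<in> x \<and> (\<exists>z\<in>x \<inter> hd l. thr l z b (r - dist a z))" if "l \<noteq> []" for l a r
    using that by (cases l) auto
  have "thr (x # (xs @ c # ys @ c # zs)) a b r" using Cons.prems by simp
  then obtain z where z: "a \<in> x" "z \<in> x" "z \<in> hd (xs @ c # ys @ c # zs)" "thr (xs @ c # ys @ c # zs) z b (r - dist a z)"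
    using ne[of "xs @ c # ys @ c # zs"] by auto
  have "hd (xs @ c # ys @ c # zs) = hd (xs @ c # zs)" by (cases xs) auto
  then show ?case using ne[of "xs @ c # zs" a r] z Cons.IH by auto
qed

lemma thr_distinct:
  assumes "thr cs a b r" shows "\<exists>ds. distinct ds \<and> set ds \<subseteq> set cs \<and> thr ds a b r"
  using assms
proof (induction "length cs" arbitrary: cs rule: less_induct)
  case less
  show ?case
  proof (cases "distinct cs")
    case False
    then obtain xs ys zs c where cs: "cs = xs @ [c] @ ys @ [c] @ zs" using not_distinct_decomp by blast
    have "thr (xs @ c # zs) a b r" using less.prems cs thr_cut[of xs c ys zs] by simp
    then obtain ds where "distinct ds \<and> set ds \<subseteq> set (xs @ c # zs) \<and> thr ds a b r"
      using less.hyps[of "xs @ c # zs"] cs by auto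
    then show ?thesis using cs by auto
  qed (use less in auto)
qed

lemma reach_thr: "reach CC a b r \<Longrightarrow> \<exists>cs. set cs \<subseteq> CC \<and> thr cs a b r"
proof (induction rule: reach.induct)
  case (reach_refl a)
  then obtain C where "C \<in> CC" "a \<in> C" by auto
  then show ?case by (intro exI[of _ "[C]"]) auto
next
  case (reach_step a b r C c)
  then obtain cs where cs: "set cs \<subseteq> CC" "thr cs a b r" by auto
  have "thr (cs @ [C]) a c (r + dist b c)" using reach_step cs by (intro thr_snoc) auto
  moreover have "set (cs @ [C]) \<subseteq> CC" using cs reach_step by auto
  ultimately show ?case by blast
qed

lemma thr_reach: "thr cs a b r \<Longrightarrow> set cs \<subseteq> CC \<Longrightarrow> \<exists>s\<le>r. reach CC a b s"
proof (induction cs a b r rule: thr.induct)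
  case (2 c a b r) then show ?case using reach_one[of c CC a b] by auto
next
  case (3 c d ds a b r)
  then obtain z where z: "z \<in> c \<inter> d" "thr (d # ds) z b (r - dist a z)" by auto
  then obtain s where s: "s \<le> r - dist a z" "reach CC z b s" using "3.IH"[OF z(1) z(2)] "3.prems"(2) by auto
  have "reach CC a z (dist a z)" using "3.prems" z(1) by (intro reach_one[of c]) auto
  from reach_trans[OF s(2) this] show ?case using s by (intro exI[of _ "dist a z + s"]) auto
qed simp

text \<open>Along a sequence of times decreasing to s some member is visited infinitely often, since
  there are finitely many; being closed it also contains \<open>g s\<close>. For geodesics of the
  chain metric this yields straight initial pieces.\<close>

lemma right_hit:
  fixes g :: "real \<Rightarrow> 'c::metric_space"
  assumes CC: "finite CC" "\<And>C. C \<in> CC \<Longrightarrow> closed C" and g: "continuous_on {s..e} g" "g ` {s..e} \<subseteq> \<Union>CC" and se: "s < e"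
  shows "\<exists>C\<in>CC. \<exists>t\<in>{s<..e}. g s \<in> C \<and> g t \<in> C"
proof -
  define t where "t n = s + (e-s) / real (Suc n)" for n
  have t: "t n \<in> {s<..e}" for n
  proof -
    have "(e - s) / real (Suc n) \<le> (e - s) / 1" using se by (intro divide_left_mono) auto
    then show ?thesis using se by (auto simp: t_def)
  qed
  have "(\<lambda>n. s + (e-s) * (1 / real (Suc n))) \<longlonglongrightarrow> s + (e-s) * 0" by (intro tendsto_intros LIMSEQ_Suc lim_1_over_n)
  then have lim: "t \<longlonglongrightarrow> s" unfolding t_def[abs_def] by simp
  have gl: "(\<lambda>n. g (t n)) \<longlonglongrightarrow> g s"
    using lim t se by (intro continuous_on_tendsto_compose[OF g(1)]) (auto simp: less_imp_le)
  have "\<exists>\<^sub>F n in sequentially. \<exists>C\<in>CC. g (t n) \<in> C"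
  proof (intro eventually_frequently sequentially_bot always_eventually allI)
    fix n have "g (t n) \<in> \<Union>CC" 
    proof -
      have "t n \<in> {s..e}" using t[of n] by auto
      then show ?thesis using g(2) by blast
    qed
    then show "\<exists>C\<in>CC. g (t n) \<in> C" by auto
  qed
  from frequently_bex_finite[OF CC(1) this]
  obtain C where C: "C \<in> CC" "\<exists>\<^sub>F n in sequentially. g (t n) \<in> C" by blast
  have "g s \<in> C"
  proof (rule ccontr)
    assume "g s \<notin> C"
    then have "\<forall>\<^sub>F n in sequentially. g (t n) \<in> - C"
      using topological_tendstoD[OF gl, of "-C"] CC(2)[OF C(1)] by auto
    then show False using C(2) by (auto simp: frequently_def elim: eventually_mono)
  qed
  then show ?thesis using C t frequently_ex[OF C(2)] by blast
qed

lemma left_hit: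
  fixes g :: "real \<Rightarrow> 'c::metric_space"
  assumes CC: "finite CC" "\<And>C. C \<in> CC \<Longrightarrow> closed C" and g: "continuous_on {s..e} g" "g ` {s..e} \<subseteq> \<Union>CC" and se: "s < e"
  shows "\<exists>C\<in>CC. \<exists>t\<in>{s..<e}. g e \<in> C \<and> g t \<in> C"
proof -
  have "continuous_on {-e..-s} (\<lambda>t. g (-t))"
    by (intro continuous_on_compose2[OF g(1)] continuous_intros) auto
  moreover have "(\<lambda>t. g (-t)) ` {-e..-s} \<subseteq> \<Union>CC"
  proof
    fix y assume "y \<in> (\<lambda>t. g (-t)) ` {-e..-s}"
    then obtain t where "t \<in> {-e..-s}" "y = g (-t)" by blast
    then have "-t \<in> {s..e}" "y = g (-t)" by auto
    then show "y \<in> \<Union>CC" using g(2) by blast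
  qed
  moreover have "-e < -s" using se by simp
  ultimately obtain C t where *: "C \<in> CC" "t \<in> {-e<..-s}" "g (- (- e)) \<in> C" "g (-t) \<in> C"
    using right_hit[OF CC] by blast
  have "-t \<in> {s..<e}" using *(2) by auto
  then show ?thesis using * by (intro bexI[of _ C] bexI[of _ "-t"]) simp_all
qed

section \<open>Shortest chains and geodesics in unions with a common point\<close>

locale star = hadamard +
  fixes CC :: "'a set set" and w :: 'a
  assumes fin: "finite CC" and ne: "CC \<noteq> {}"
    and cl: "\<And>C. C \<in> CC \<Longrightarrow> closed C" and cv: "\<And>C. C \<in> CC \<Longrightarrow> cvx C" and wC: "\<And>C. C \<in> CC \<Longrightarrow> w \<in> C"
begin

abbreviation "X \<equiv> \<Union>CC"
abbreviation "D \<equiv> cd CC"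

lemma X_H: "X \<subseteq> H" using cv cvx_sub by blast
lemma X_Hin: "x \<in> X \<Longrightarrow> x \<in> H" using X_H by blast
lemma wX: "w \<in> X" using wC ne by auto
lemma wH: "w \<in> H" using wX X_H by auto
lemma closed_X: "closed X" using fin cl by auto

lemma X_star: "x \<in> X \<Longrightarrow> 0 \<le> t \<Longrightarrow> t \<le> 1 \<Longrightarrow> P w x t \<in> X"
  using cv wC cvxD by (meson UnionE UnionI)

lemma reach_all: assumes "a \<in> X" "b \<in> X" shows "\<exists>r. reach CC a b r"
proof -
  obtain A B where "A \<in> CC" "a \<in> A" "B \<in> CC" "b \<in> B" using assms by auto
  then show ?thesis using reach_trans[OF reach_one[of B CC w b] reach_one[of A CC a w]] wC by blast
qed

lemma D_ge: "a \<in> X \<Longrightarrow> b \<in> X \<Longrightarrow> dist a b \<le> D a b" using reach_all cd_ge by blast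
lemma D_nonneg: "a \<in> X \<Longrightarrow> b \<in> X \<Longrightarrow> 0 \<le> D a b" using D_ge zero_le_dist order_trans by blast
lemma D_tri: "a \<in> X \<Longrightarrow> b \<in> X \<Longrightarrow> c \<in> X \<Longrightarrow> D a c \<le> D a b + D b c" using reach_all cd_triangle by blast
lemma D_eq0: "a \<in> X \<Longrightarrow> b \<in> X \<Longrightarrow> D a b = 0 \<longleftrightarrow> a = b"
  using D_ge[of a b] cd_self[of a CC] by auto
lemma D_lip: "p \<in> X \<Longrightarrow> a \<in> X \<Longrightarrow> b \<in> X \<Longrightarrow> \<bar>D p a - D p b\<bar> \<le> D a b"
  using D_tri[of p a b] D_tri[of p b a] cd_sym[of CC a b] by auto

text \<open>Continuity for the ambient topology does not follow from \<open>D_lip\<close>, since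
  \<open>D\<close> dominates the ambient distance. On each member, however, the two agree, and
  finitely many closed members can be glued.\<close>

lemma D_cont: assumes "p \<in> X" shows "continuous_on X (D p)"
proof (rule continuous_on_closed_Union[of CC "\<lambda>C. C", simplified])
  fix C assume C: "C \<in> CC"
  have "1-lipschitz_on C (D p)"
  proof (rule lipschitz_onI)
    fix x y assume "x \<in> C" "y \<in> C"
    then have "\<bar>D p x - D p y\<bar> \<le> dist x y" using D_lip[OF assms, of x y] cd_same[OF C] C by auto
    then show "dist (D p x) (D p y) \<le> 1 * dist x y" by (simp add: dist_real_def)
  qed simp
  then show "continuous_on C (D p)" by (rule lipschitz_on_continuous_on)
qed (use fin cl in auto)

text \<open>The length of a shortest broken geodesic from y to b that passes through the sets in the
  given order. The sets will be the intersections of consecutive members of an itinerary.\<close>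

fun L :: "'a set list \<Rightarrow> 'a \<Rightarrow> 'a \<Rightarrow> real" where
  "L [] b y = dist y b"
| "L (S # Ss) b y = Inf ((\<lambda>z. dist y z + L Ss b z) ` S)"

definition gate :: "'a set \<Rightarrow> bool" where "gate S \<longleftrightarrow> closed S \<and> cvx S \<and> w \<in> S"

text \<open>Proved together because each property feeds the next stage: the Lipschitz bound and the
  convexity for the tail give an attained minimum over S by \<open>convex_min_attained\<close>, and
  attained minima give both properties for the longer list.\<close>

lemma L_props:
  assumes b: "b \<in> H" and "\<forall>S\<in>set Ss. gate S"
  shows "(\<forall>x\<in>H. \<forall>y\<in>H. L Ss b x \<le> L Ss b y + dist x y) \<and>
    (\<forall>x\<in>H. \<forall>y\<in>H. \<forall>t\<in>{0..1}. L Ss b (P x y t) \<le> (1-t) * L Ss b x + t * L Ss b y) \<and>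
    (\<forall>y\<in>H. 0 \<le> L Ss b y) \<and>
    (\<forall>S Ts. Ss = S # Ts \<longrightarrow> (\<forall>y\<in>H. \<exists>z\<in>S. L Ss b y = dist y z + L Ts b z \<and> (\<forall>z'\<in>S. L Ss b y \<le> dist y z' + L Ts b z')))"
  using assms(2)
proof (induction Ss)
  case Nil
  have "dist (P x y t) b \<le> (1-t) * dist x b + t * dist y b" if "x \<in> H" "y \<in> H" "t \<in> {0..1}" for x y t
    using dist_convex[OF b that(1,2)] that(3) by (simp add: dist_commute)
  then show ?case by (auto simp: dist_triangle add.commute)
next
  case (Cons S Ss)
  then have IH1: "\<And>x y. x \<in> H \<Longrightarrow> y \<in> H \<Longrightarrow> L Ss b x \<le> L Ss b y + dist x y"
    and IH2: "\<And>x y t. x \<in> H \<Longrightarrow> y \<in> H \<Longrightarrow> t \<in> {0..1} \<Longrightarrow> L Ss b (P x y t) \<le> (1-t) * L Ss b x + t * L Ss b y"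
    and IH3: "\<And>y. y \<in> H \<Longrightarrow> 0 \<le> L Ss b y" by auto
  have S: "closed S" "cvx S" "S \<noteq> {}" "S \<subseteq> H" using Cons.prems by (auto simp: gate_def cvx_def)
  have SH: "z \<in> S \<Longrightarrow> z \<in> H" for z using S by auto
  have att: "\<exists>z\<in>S. L (S # Ss) b y = dist y z + L Ss b z \<and> (\<forall>z'\<in>S. L (S # Ss) b y \<le> dist y z' + L Ss b z')" if y: "y \<in> H" for y
  proof -
    have lip: "2-lipschitz_on S (\<lambda>z. dist y z + L Ss b z)"
    proof (rule lipschitz_onI)
      fix u v assume "u \<in> S" "v \<in> S"
      then have "\<bar>L Ss b u - L Ss b v\<bar> \<le> dist u v" using IH1[of u v] IH1[of v u] SH by (simp add: dist_commute abs_le_iff)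
      moreover have "\<bar>dist y u - dist y v\<bar> \<le> dist u v" using dist_triangle[of y u v] dist_triangle[of y v u] by (simp add: dist_commute abs_le_iff)
      ultimately show "dist (dist y u + L Ss b u) (dist y v + L Ss b v) \<le> 2 * dist u v" by (simp add: dist_real_def)
    qed simp
    have "\<exists>u\<in>S. \<forall>x\<in>S. dist y u + L Ss b u \<le> dist y x + L Ss b x"
    proof (rule convex_min_attained[OF S(1,2,3) lipschitz_on_continuous_on[OF lip] _ y, of 0])
      fix u v t assume a: "u \<in> S" "v \<in> S" "0 \<le> t" "t \<le> (1::real)"
      have "dist y (P u v t) \<le> (1-t) * dist y u + t * dist y v" using dist_convex[OF y] a SH by auto
      moreover have "L Ss b (P u v t) \<le> (1-t) * L Ss b u + t * L Ss b v" using IH2 a SH by auto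
      ultimately show "dist y (P u v t) + L Ss b (P u v t) \<le> (1-t) * (dist y u + L Ss b u) + t * (dist y v + L Ss b v)"
        by (simp add: algebra_simps)
    qed (use IH3 SH in auto)
    then obtain u where u: "u \<in> S" "\<forall>x\<in>S. dist y u + L Ss b u \<le> dist y x + L Ss b x" by blast
    then have "L (S # Ss) b y = dist y u + L Ss b u" by (auto intro!: cInf_eq_minimum)
    then show ?thesis using u by (intro bexI[of _ u]) auto
  qed
  have lip: "L (S # Ss) b x \<le> L (S # Ss) b y + dist x y" if xy: "x \<in> H" "y \<in> H" for x y
  proof -
    obtain z where "z \<in> S" "L (S # Ss) b y = dist y z + L Ss b z" using att[OF xy(2)] by blast
    moreover from this have "L (S # Ss) b x \<le> dist x z + L Ss b z" using att[OF xy(1)] by blast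
    ultimately show ?thesis using dist_triangle[of x z y] by simp
  qed
  have conv: "L (S # Ss) b (P x y t) \<le> (1-t) * L (S # Ss) b x + t * L (S # Ss) b y" if xy: "x \<in> H" "y \<in> H" "t \<in> {0..1}" for x y t
  proof -
    obtain u where u: "u \<in> S" "L (S # Ss) b x = dist x u + L Ss b u" using att[OF xy(1)] by blast
    obtain v where v: "v \<in> S" "L (S # Ss) b y = dist y v + L Ss b v" using att[OF xy(2)] by blast
    have uv: "P u v t \<in> S" using cvxD[OF S(2)] u v xy by auto
    have "P x y t \<in> H" using P_in xy by auto
    then have "L (S # Ss) b (P x y t) \<le> dist (P x y t) (P u v t) + L Ss b (P u v t)" using att uv by blast
    moreover have "dist (P x y t) (P u v t) \<le> (1-t) * dist x u + t * dist y v" using P_busemann xy u v SH by auto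
    moreover have "L Ss b (P u v t) \<le> (1-t) * L Ss b u + t * L Ss b v" using IH2 u v xy SH by auto
    ultimately show ?thesis using u v by (simp add: algebra_simps)
  qed
  have nn: "0 \<le> L (S # Ss) b y" if y: "y \<in> H" for y
  proof -
    obtain z where "z \<in> S" "L (S # Ss) b y = dist y z + L Ss b z" using att[OF y] by blast
    then show ?thesis using IH3[of z] SH by auto
  qed
  show ?case using att lip conv nn by (auto simp del: L.simps)
qed

fun gates :: "'a set list \<Rightarrow> 'a set list" where
  "gates (c # d # ds) = (c \<inter> d) # gates (d # ds)"
| "gates _ = []"

lemma gates_gate: "set cs \<subseteq> CC \<Longrightarrow> \<forall>S\<in>set (gates cs). gate S"
  by (induction cs rule: gates.induct) (use cl cv wC in \<open>auto simp: gate_def intro!: cvx_Int\<close>)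

lemma thr_L: "thr cs a b r \<Longrightarrow> set cs \<subseteq> CC \<Longrightarrow> L (gates cs) b a \<le> r"
proof (induction cs a b r rule: thr.induct)
  case (3 c d ds a b r)
  then obtain z where z: "z \<in> c \<inter> d" "thr (d # ds) z b (r - dist a z)" by auto
  have "last (d # ds) \<in> CC" using "3.prems"(2) last_in_set[of "d # ds"] by auto
  moreover have "b \<in> last (d # ds)" using thr_hd_last[OF z(2)] by blast
  ultimately have bH: "b \<in> H" using X_H by blast
  have aH: "a \<in> H" using "3.prems" X_H by auto
  have "L (gates (d # ds)) b z \<le> r - dist a z" using "3.IH"[OF z(1) z(2)] "3.prems"(2) by auto
  moreover have "\<forall>S\<in>set ((c \<inter> d) # gates (d # ds)). gate S" using gates_gate[of "c # d # ds"] "3.prems"(2) by simp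
  from L_props[OF bH this] have "L ((c \<inter> d) # gates (d # ds)) b a \<le> dist a z + L (gates (d # ds)) b z"
    using aH z by (auto simp del: L.simps)
  ultimately show ?case by (simp del: L.simps)
qed auto

lemma L_thr: "cs \<noteq> [] \<Longrightarrow> set cs \<subseteq> CC \<Longrightarrow> a \<in> hd cs \<Longrightarrow> b \<in> last cs \<Longrightarrow> thr cs a b (L (gates cs) b a)"
proof (induction cs arbitrary: a rule: gates.induct)
  case (1 c d ds)
  have "last (c # d # ds) \<in> CC" using "1.prems"(2) last_in_set[of "c # d # ds"] by auto
  then have bH: "b \<in> H" using "1.prems"(4) X_H by blast
  have aH: "a \<in> H" using "1.prems" X_H by auto
  have "\<forall>S\<in>set ((c \<inter> d) # gates (d # ds)). gate S" using gates_gate[of "c # d # ds"] "1.prems"(2) by simp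
  from L_props[OF bH this] obtain z where z: "z \<in> c \<inter> d" "L ((c \<inter> d) # gates (d # ds)) b a = dist a z + L (gates (d # ds)) b z"
    using aH by (auto simp del: L.simps)
  have "thr (d # ds) z b (L (gates (d # ds)) b z)" using "1.IH"[of z] "1.prems" z by auto
  then have "thr (d # ds) z b (L (gates (c # d # ds)) b a - dist a z)" using z by (simp del: L.simps)
  then show ?case unfolding thr.simps(3) using z(1) "1.prems"(3) by auto
qed auto

text \<open>Itineraries without repetition suffice, there are finitely many of them, and for each
  one the minimal length is attained by \<open>L_props\<close>. Hence the infimum is the minimum of
  the finite set \<open>M\<close>.\<close>

lemma D_attained: assumes "a \<in> X" "b \<in> X" shows "reach CC a b (D a b)"
proof -
  define M where "M = (\<lambda>cs. L (gates cs) b a) ` {cs. distinct cs \<and> set cs \<subseteq> CC \<and> cs \<noteq> [] \<and> a \<in> hd cs \<and> b \<in> last cs}"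
  have "{cs. distinct cs \<and> set cs \<subseteq> CC \<and> cs \<noteq> [] \<and> a \<in> hd cs \<and> b \<in> last cs} \<subseteq> {cs. set cs \<subseteq> CC \<and> length cs \<le> card CC}"
    using fin by (auto simp: distinct_card[symmetric] intro: card_mono)
  then have finM: "finite M" unfolding M_def using finite_lists_length_le[OF fin] finite_subset by blast
  have Mle: "\<exists>m\<in>M. m \<le> r" if rr: "reach CC a b r" for r
  proof -
    obtain cs where "set cs \<subseteq> CC" "thr cs a b r" using reach_thr[OF rr] by blast
    then obtain ds where ds: "distinct ds" "set ds \<subseteq> CC" "thr ds a b r" using thr_distinct by (metis order_trans)
    then have "L (gates ds) b a \<le> r" "L (gates ds) b a \<in> M" using thr_L[OF ds(3,2)] thr_hd_last[OF ds(3)] by (auto simp: M_def)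
    then show ?thesis by blast
  qed
  have MD: "\<exists>s\<le>m. reach CC a b s" if "m \<in> M" for m
    using that L_thr thr_reach unfolding M_def by blast
  have Mne: "M \<noteq> {}" using reach_all[OF assms] Mle by blast
  then have "Min M \<in> M" using finM by simp
  then obtain s where s: "s \<le> Min M" "reach CC a b s" using MD by blast
  have "Min M \<le> D a b"
  proof (rule field_le_epsilon)
    fix e :: real assume "e > 0"
    then obtain r where r: "reach CC a b r" "r < D a b + e" using cd_approx s by blast
    then obtain m where "m \<in> M" "m \<le> r" using Mle by blast
    then show "Min M \<le> D a b + e" using Min_le[OF finM, of m] r by linarith
  qed
  then have "s = D a b" using s cd_le[OF s(2)] by linarith
  then show ?thesis using s by simp
qed

definition cgeod :: "(real \<Rightarrow> 'a) \<Rightarrow> 'a \<Rightarrow> 'a \<Rightarrow> bool" where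
  "cgeod g a b \<longleftrightarrow> g 0 = a \<and> g (D a b) = b \<and> (\<forall>t\<in>{0..D a b}. g t \<in> X) \<and>
     (\<forall>s\<in>{0..D a b}. \<forall>t\<in>{0..D a b}. D (g s) (g t) = \<bar>s-t\<bar>)"

text \<open>If one piece were shorter than its parameter length, the pieces together would be
  shorter than \<open>D a b\<close>.\<close>

lemma geod_of_lip:
  assumes ab: "a \<in> X" "b \<in> X" "g 0 = a" "g (D a b) = b" and gX: "\<And>t. t \<in> {0..D a b} \<Longrightarrow> g t \<in> X"
    and lip: "\<And>s t. 0 \<le> s \<Longrightarrow> s \<le> t \<Longrightarrow> t \<le> D a b \<Longrightarrow> D (g s) (g t) \<le> t - s"
  shows "cgeod g a b"
proof -
  have "D (g s) (g t) = t - s" if st: "0 \<le> s" "s \<le> t" "t \<le> D a b" for s t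
  proof -
    have X: "g s \<in> X" "g t \<in> X" using gX st by auto
    have "D a b \<le> D a (g s) + D (g s) (g t) + D (g t) b"
      using D_tri[OF ab(1) X(1) ab(2)] D_tri[OF X ab(2)] by simp
    moreover have "D a (g s) \<le> s" using lip[of 0 s] st ab by simp
    moreover have "D (g t) b \<le> D a b - t" using lip[of t "D a b"] st ab by simp
    ultimately show ?thesis using lip[OF st] by simp
  qed
  then have "D (g s) (g t) = \<bar>s - t\<bar>" if "s \<in> {0..D a b}" "t \<in> {0..D a b}" for s t
    using that cd_sym[of CC "g s" "g t"] by (cases "s \<le> t") auto
  then show ?thesis using ab gX by (auto simp: cgeod_def)
qed

text \<open>Every initial part of a shortest chain is itself shortest, so the geodesic grows by one
  straight piece with each step of the chain.\<close>

lemma geod_reach: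
  assumes "reach CC a b r" "r = D a b" shows "\<exists>g. cgeod g a b"
  using assms
proof (induction rule: reach.induct)
  case (reach_refl a)
  then show ?case using cd_self[of a CC] by (intro exI[of _ "\<lambda>_. a"]) (auto simp: cgeod_def)
next
  case (reach_step a b r C c)
  have aX: "a \<in> X" and bX: "b \<in> X" using reach_in[OF reach_step(1)] by auto
  have cX: "c \<in> X" using reach_step by auto
  have bc: "D b c = dist b c" using cd_same reach_step by blast
  have "D a c \<le> D a b + D b c" using D_tri aX bX cX by blast
  moreover have "D a b \<le> r" using reach_step cd_le by blast
  ultimately have r: "r = D a b" using reach_step.prems bc by linarith
  then obtain g where g: "cgeod g a b" using reach_step by blast
  define q where "q = D a b"
  define l where "l = dist b c"
  have q0: "0 \<le> q" "0 \<le> l" using D_nonneg aX bX by (auto simp: q_def l_def)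
  have tot: "D a c = q + l" using reach_step.prems r by (simp add: q_def l_def)
  \<comment> \<open>For l = 0 the quotient is 0 by the convention on division, and
    \<open>P b c 0\<close> is b; so a degenerate last step does no harm.\<close>
  define k where "k t = (if t \<le> q then g t else P b c ((t - q) / l))" for t
  have gq: "g q = b" "g 0 = a" using g by (auto simp: cgeod_def q_def)
  have H: "b \<in> H" "c \<in> H" using bX cX X_H by auto
  have fr: "0 \<le> (t - q) / l" "(t - q)/l \<le> 1" if "q \<le> t" "t \<le> q + l" for t using that q0 by (auto simp: divide_le_eq_1)
  have kq: "k t = P b c ((t-q)/l)" if "q \<le> t" for t using that gq H by (auto simp: k_def)
  have kC: "k t \<in> C" if "q \<le> t" "t \<le> q + l" for t
    using kq[OF that(1)] cvxD[OF cv[OF reach_step(2)] reach_step(3,4)] fr[OF that] by simp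
  have seg: "D (k s) (k t) \<le> t - s" if "q \<le> s" "s \<le> t" "t \<le> q + l" for s t
  proof (cases "l = 0")
    case True then have "s = t" using that by simp
    moreover have "k s \<in> X" using kC[of s] that reach_step(2) by auto
    ultimately show ?thesis using cd_self[of "k s" CC] by simp
  next
    case False
    have "D (k s) (k t) = dist (k s) (k t)" using cd_same[OF reach_step(2)] kC that by auto
    also have "\<dots> = \<bar>(t-q)/l - (s-q)/l\<bar> * l"
      using kq that fr[of s] fr[of t] dist_P_P[OF H, of "(s-q)/l" "(t-q)/l"] by (simp add: l_def)
    also have "\<dots> = \<bar>((t-q)/l - (s-q)/l) * l\<bar>" using q0 by (simp add: abs_mult)
    also have "((t-q)/l - (s-q)/l) * l = t - s" using False by (simp add: field_simps)
    finally show ?thesis using that by simp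
  qed
  have pre: "D (k s) (k t) \<le> t - s" if "0 \<le> s" "s \<le> t" "t \<le> q" for s t
    using g that by (simp add: cgeod_def k_def q_def)
  have kX: "k t \<in> X" if "0 \<le> t" "t \<le> q + l" for t
  proof (cases "t \<le> q")
    case True then show ?thesis using g that by (simp add: cgeod_def k_def q_def)
  next
    case False then have "k t \<in> C" using kC that by simp
    then show ?thesis using reach_step(2) by blast
  qed
  have kb: "k q = b" using gq by (simp add: k_def)
  have "D (k s) (k t) \<le> t - s" if st: "0 \<le> s" "s \<le> t" "t \<le> q + l" for s t
  proof -
    consider "t \<le> q" | "q \<le> s" | "s \<le> q" "q \<le> t" by linarith
    then show ?thesis
    proof cases
      case 3
      have "D (k s) (k t) \<le> D (k s) (k q) + D (k q) (k t)" by (rule D_tri) (use kX st 3 q0 in \<open>simp_all\<close>)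
      then show ?thesis using pre[of s q] seg[of q t] st 3 q0 by simp
    qed (use pre seg st in \<open>simp_all\<close>)
  qed
  moreover have "k (q + l) = c" 
  proof (cases "l = 0")
    case True then show ?thesis using kb by (simp add: l_def)
  next
    case False then show ?thesis using kq[of "q+l"] q0 H by simp
  qed
  moreover have "k 0 = a" using q0 gq by (simp add: k_def)
  ultimately have "cgeod k a c" using kX tot by (intro geod_of_lip aX cX) auto
  then show ?case by blast
qed

lemma geod_ex: "a \<in> X \<Longrightarrow> b \<in> X \<Longrightarrow> \<exists>g. cgeod g a b"
  using geod_reach[OF D_attained] by blast

lemma cgeodD:
  assumes "cgeod g a b"
  shows "g 0 = a" "g (D a b) = b" "\<And>t. 0 \<le> t \<Longrightarrow> t \<le> D a b \<Longrightarrow> g t \<in> X"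
    "\<And>s t. 0 \<le> s \<Longrightarrow> s \<le> D a b \<Longrightarrow> 0 \<le> t \<Longrightarrow> t \<le> D a b \<Longrightarrow> D (g s) (g t) = \<bar>s-t\<bar>"
  using assms by (auto simp: cgeod_def)

lemma geod_dist: "cgeod g a b \<Longrightarrow> s \<in> {0..D a b} \<Longrightarrow> t \<in> {0..D a b} \<Longrightarrow> dist (g s) (g t) \<le> \<bar>s - t\<bar>"
  using D_ge[of "g s" "g t"] by (auto simp: cgeod_def)

lemma geod_cont: "cgeod g a b \<Longrightarrow> continuous_on {0..D a b} g"
  by (rule lipschitz_on_continuous_on[of 1], rule lipschitz_onI) (auto simp: geod_dist dist_real_def)

text \<open>Continuous induction along the segment: beyond the largest t at which the bound holds,
  \<open>right_hit\<close> provides a later point in a common member, where \<open>D\<close> is the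
  ambient distance.\<close>

lemma D_seg:
  assumes u: "u \<in> H" "v \<in> H" and sX: "\<And>t. 0 \<le> t \<Longrightarrow> t \<le> 1 \<Longrightarrow> P u v t \<in> X"
  shows "D u v = dist u v"
proof -
  let ?g = "\<lambda>t. P u v t"
  have gc: "continuous_on {0..1} ?g" by (intro P_continuous continuous_intros) (use u in auto)
  have uX: "u \<in> X" and vX: "v \<in> X" using sX[of 0] sX[of 1] u by auto
  define S where "S = {t\<in>{0..1}. D u (?g t) \<le> t * dist u v}"
  have "continuous_on {0..1} (\<lambda>t. D u (?g t))"
    using sX by (intro continuous_on_compose2[OF D_cont[OF uX] gc]) auto
  then have "closed S" unfolding S_def by (intro continuous_on_closed_Collect_le continuous_intros) auto
  moreover have "bounded S" by (rule bounded_subset[of "{0..1::real}"]) (auto simp: S_def)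
  ultimately have cS: "compact S" by (simp add: compact_eq_bounded_closed)
  have "0 \<in> S" using u uX cd_self[of u CC] by (auto simp: S_def)
  then obtain t where t: "t \<in> S" "\<And>s. s \<in> S \<Longrightarrow> s \<le> t" using compact_attains_sup[OF cS] by blast
  have "t = 1"
  proof (rule ccontr)
    assume "t \<noteq> 1"
    then have t1: "0 \<le> t" "t < 1" using t by (auto simp: S_def)
    have c1: "continuous_on {t..1} ?g" using continuous_on_subset[OF gc] t1 by auto
    have c2: "?g ` {t..1} \<subseteq> X" using sX t1 by auto
    obtain C s where C: "C \<in> CC" "s \<in> {t<..1}" "?g t \<in> C" "?g s \<in> C"
      using right_hit[OF fin cl c1 c2 t1(2)] by blast
    have "D u (?g s) \<le> D u (?g t) + D (?g t) (?g s)" using D_tri uX sX t1 C by auto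
    also have "D (?g t) (?g s) = (s - t) * dist u v"
      using cd_same[OF C(1,3,4)] dist_P_P[OF u, of t s] t1 C by auto
    finally have "D u (?g s) \<le> s * dist u v" using t(1) by (auto simp: S_def algebra_simps)
    then have "s \<in> S" using C t1 by (auto simp: S_def)
    then show False using t(2) C by fastforce
  qed
  then have "D u v \<le> dist u v" using t(1) u by (auto simp: S_def)
  then show ?thesis using D_ge[OF uX vX] by simp
qed

end

section \<open>Linking in dimension two\<close>

text \<open>A positive real part keeps the argument strictly within pi/2 of 0, so a quarter turn in
  either direction stays on the principal branch. This makes the two logarithms of
  \<open>circle_log\<close> agree at 1 and -1.\<close>

lemma Ln_quarter_turns:
  assumes "0 < Re z"
  shows "Ln (\<i> * z) = Ln z + \<i> * (pi/2)" "Ln (- (\<i> * z)) = Ln z - \<i> * (pi/2)"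
proof -
  have z: "z \<noteq> 0" using assms by auto
  then have im: "\<bar>Im (Ln z)\<bar> < pi/2" using Re_Ln_pos_lt assms by blast
  have e: "exp (\<i> * complex_of_real (pi/2)) = \<i>" using cis_pi_half unfolding cis_conv_exp .
  have e': "exp (- (\<i> * complex_of_real (pi/2))) = - \<i>" unfolding exp_minus e by simp
  have "exp (Ln z + \<i> * complex_of_real (pi/2)) = \<i> * z" unfolding exp_add e using z by (simp add: exp_Ln)
  moreover have "Im (Ln z + \<i> * complex_of_real (pi/2)) = Im (Ln z) + pi/2" by simp
  ultimately show "Ln (\<i> * z) = Ln z + \<i> * (pi/2)"
    using im by (intro Ln_unique) (auto simp: abs_less_iff)
  have "exp (Ln z + - (\<i> * complex_of_real (pi/2))) = - (\<i> * z)" unfolding exp_add e' using z by (simp add: exp_Ln)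
  moreover have "Im (Ln z + - (\<i> * complex_of_real (pi/2))) = Im (Ln z) - pi/2" by simp
  ultimately have "Ln (- (\<i> * z)) = Ln z + - (\<i> * complex_of_real (pi/2))"
    using im by (intro Ln_unique) (auto simp: abs_less_iff)
  then show "Ln (- (\<i> * z)) = Ln z - \<i> * (pi/2)" by simp
qed

text \<open>The loop turns once around 0: one half avoids the negative, the other one the positive imaginary axis.\<close>
lemma circle_log:
  fixes \<phi> :: "complex \<Rightarrow> complex"
  assumes cont: "continuous_on (sphere 0 1) \<phi>"
    and up: "\<And>z. z \<in> sphere 0 1 \<Longrightarrow> 0 \<le> Im z \<Longrightarrow> Re (\<phi> z) = 0 \<Longrightarrow> 0 < Im (\<phi> z)"
    and low: "\<And>z. z \<in> sphere 0 1 \<Longrightarrow> Im z \<le> 0 \<Longrightarrow> Re (\<phi> z) = 0 \<Longrightarrow> Im (\<phi> z) < 0"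
    and pos: "0 < Re (\<phi> 1)" and neg: "Re (\<phi> (-1)) < 0"
  obtains k where "continuous_on (sphere 0 1) k" "\<And>z. z \<in> sphere 0 1 \<Longrightarrow> \<phi> z = z * exp (k z)"
proof
  \<comment> \<open>The factors -i and i turn the half axis avoided by \<open>\<phi>\<close> into
    the branch cut of \<open>Ln\<close>. The same turn is applied to z, so the difference is a
    logarithm of \<open>\<phi> z / z\<close> on each half circle.\<close>
  define k where "k z = (if 0 \<le> Im z then Ln (- (\<i> * \<phi> z)) - Ln (- (\<i> * z)) else Ln (\<i> * \<phi> z) - Ln (\<i> * z))" for z
  have nz: "\<phi> z \<noteq> 0" "z \<noteq> 0" if "z \<in> sphere 0 1" for z
    using up[OF that] low[OF that] that by (cases "0 \<le> Im z"; fastforce)+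
  let ?U = "{z \<in> sphere 0 1. 0 \<le> Im z}" and ?L = "{z \<in> sphere 0 1. Im z \<le> 0}"
  have np: "z \<in> \<real>\<^sub>\<le>\<^sub>0 \<longleftrightarrow> Im z = 0 \<and> Re z \<le> 0" for z by (auto simp: complex_nonpos_Reals_iff)
  have one: "Re z = 1 \<or> Re z = -1" if "norm z = 1" "Im z = 0" for z
    using that by (auto simp: cmod_def)
  have zU: "0 < Im z" if "z \<in> ?U" "Re z = 0" for z
  proof -
    have "(Im z)\<^sup>2 = 1" using that by (simp add: cmod_def)
    then show ?thesis using that by (auto simp: power2_eq_1_iff)
  qed
  have zL: "Im z < 0" if "z \<in> ?L" "Re z = 0" for z
  proof -
    have "(Im z)\<^sup>2 = 1" using that by (simp add: cmod_def)
    then show ?thesis using that by (auto simp: power2_eq_1_iff)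
  qed
  have cU: "continuous_on ?U \<phi>" and cL: "continuous_on ?L \<phi>" by (rule continuous_on_subset[OF cont]; auto)+
  have "continuous_on (?U \<union> ?L) (\<lambda>z. if 0 \<le> Im z then Ln (- (\<i> * \<phi> z)) - Ln (- (\<i> * z)) else Ln (\<i> * \<phi> z) - Ln (\<i> * z))"
  proof (rule continuous_on_cases)
    have "closed (sphere 0 1 \<inter> {z::complex. 0 \<le> Im z})" "closed (sphere 0 1 \<inter> {z::complex. Im z \<le> 0})"
      by (auto intro!: closed_Int closed_halfspace_Im_ge closed_halfspace_Im_le)
    then show "closed ?U" "closed ?L" by (auto simp: Int_def)
    show "continuous_on ?U (\<lambda>z. Ln (- (\<i> * \<phi> z)) - Ln (- (\<i> * z)))"
      by (intro continuous_intros cU) (use up zU in \<open>force simp: np\<close>)+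
    show "continuous_on ?L (\<lambda>z. Ln (\<i> * \<phi> z) - Ln (\<i> * z))"
      by (intro continuous_intros cL) (use low zL in \<open>force simp: np\<close>)+
    show "\<forall>z. z \<in> ?U \<and> \<not> 0 \<le> Im z \<or> z \<in> ?L \<and> 0 \<le> Im z \<longrightarrow>
        Ln (- (\<i> * \<phi> z)) - Ln (- (\<i> * z)) = Ln (\<i> * \<phi> z) - Ln (\<i> * z)"
    proof (intro allI impI)
      fix z assume "z \<in> ?U \<and> \<not> 0 \<le> Im z \<or> z \<in> ?L \<and> 0 \<le> Im z"
      then have z: "norm z = 1" "Im z = 0" by auto
      then consider "z = 1" | "z = -1" using one[OF z] by (auto simp: complex_eq_iff)
      then show "Ln (- (\<i> * \<phi> z)) - Ln (- (\<i> * z)) = Ln (\<i> * \<phi> z) - Ln (\<i> * z)"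
      proof cases
        case 1
        then show ?thesis using Ln_quarter_turns[OF pos] Ln_quarter_turns[of 1] by simp
      next
        case 2
        then show ?thesis using Ln_quarter_turns[of "- \<phi> (-1)"] neg Ln_quarter_turns[of 1] by simp
      qed
    qed
  qed
  moreover have "?U \<union> ?L = sphere 0 1" by auto
  ultimately show "continuous_on (sphere 0 1) k" by (simp add: k_def[abs_def])
  show "\<phi> z = z * exp (k z)" if "z \<in> sphere 0 1" for z
    using nz[OF that] by (simp add: k_def exp_diff exp_Ln)
qed

lemma bigon_par: "norm z \<le> 1 \<Longrightarrow> 0 \<le> (1 - Re z)/2" "norm z \<le> 1 \<Longrightarrow> (1 - Re z)/2 \<le> 1"
  using abs_Re_le_cmod[of z] by auto

text \<open>Both paths run from 1 to -1, one on the upper and one on the lower half circle, with the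
  parameter \<open>(1 - Re z)/2\<close>; equal ends make the pieces fit.\<close>

lemma continuous_bigon:
  assumes a: "continuous_on {0..1} \<alpha>" and b: "continuous_on {0..1} \<beta>" and ab: "\<alpha> 0 = \<beta> 0" "\<alpha> 1 = \<beta> 1"
  shows "continuous_on (sphere (0::complex) 1) (\<lambda>z. if 0 \<le> Im z then \<alpha> ((1 - Re z)/2) else \<beta> ((1 - Re z)/2))"
proof -
  let ?U = "{z \<in> sphere 0 1. 0 \<le> Im z}" and ?L = "{z \<in> sphere 0 1. Im z \<le> 0}"
  have "continuous_on (?U \<union> ?L) (\<lambda>z. if 0 \<le> Im z then \<alpha> ((1 - Re z)/2) else \<beta> ((1 - Re z)/2))"
  proof (rule continuous_on_cases)
    have "closed (sphere 0 1 \<inter> {z::complex. 0 \<le> Im z})" "closed (sphere 0 1 \<inter> {z::complex. Im z \<le> 0})"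
      by (auto intro!: closed_Int closed_halfspace_Im_ge closed_halfspace_Im_le)
    then show "closed ?U" "closed ?L" by (auto simp: Int_def)
    show "continuous_on ?U (\<lambda>z. \<alpha> ((1 - Re z)/2))"
      by (rule continuous_on_compose2[OF a(1)]) (use bigon_par in \<open>auto intro!: continuous_intros\<close>)
    show "continuous_on ?L (\<lambda>z. \<beta> ((1 - Re z)/2))"
      by (rule continuous_on_compose2[OF b(1)]) (use bigon_par in \<open>auto intro!: continuous_intros\<close>)
    show "\<forall>z. z \<in> ?U \<and> \<not> 0 \<le> Im z \<or> z \<in> ?L \<and> 0 \<le> Im z \<longrightarrow> \<alpha> ((1 - Re z)/2) = \<beta> ((1 - Re z)/2)"
    proof (intro allI impI)
      fix z assume "z \<in> ?U \<and> \<not> 0 \<le> Im z \<or> z \<in> ?L \<and> 0 \<le> Im z"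
      then have "norm z = 1" "Im z = 0" by auto
      then have "Re z = 1 \<or> Re z = -1" by (auto simp: cmod_def)
      then show "\<alpha> ((1 - Re z)/2) = \<beta> ((1 - Re z)/2)" using ab by auto
    qed
  qed
  moreover have "?U \<union> ?L = sphere 0 1" by auto
  ultimately show ?thesis by simp
qed

lemma sgn_sphere: "z \<noteq> 0 \<Longrightarrow> sgn z \<in> sphere (0::complex) 1" by (simp add: norm_sgn)

text \<open>Away from 0 this is a composition of continuous maps; at 0 the factor z wins because k
  is bounded.\<close>

lemma continuous_cone_mult:
  fixes k :: "'a::topological_space \<Rightarrow> complex \<Rightarrow> complex"
  assumes k: "continuous_on (S \<times> sphere 0 1) (\<lambda>(v, z). k v z)" and bd: "\<And>v z. v \<in> S \<Longrightarrow> z \<in> sphere 0 1 \<Longrightarrow> norm (k v z) \<le> B"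
  shows "continuous_on (S \<times> (UNIV::complex set)) (\<lambda>(v, z). z * k v (sgn z) :: complex)"
  unfolding continuous_on_def
proof (intro ballI)
  fix p assume p: "p \<in> S \<times> (UNIV::complex set)"
  let ?h = "\<lambda>(v, z). z * k v (sgn z)"
  show "(?h \<longlongrightarrow> ?h p) (at p within S \<times> UNIV)"
  proof (cases "snd p = 0")
    case False
    have c: "continuous_on (S \<times> (- {0})) ?h"
    proof -
      have "continuous_on (S \<times> (- {0})) (\<lambda>q. (\<lambda>(v, z). k v z) (fst q, sgn (snd q)))"
        by (rule continuous_on_compose2[OF k]) (auto intro!: continuous_intros simp: norm_sgn)
      then show ?thesis by (auto simp: case_prod_beta intro!: continuous_intros)
    qed
    have "(?h \<longlongrightarrow> ?h p) (at p within S \<times> (- {0}))" using c p False by (auto simp: continuous_on_def)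
    moreover have "open (UNIV \<times> - {0::complex} :: ('a \<times> complex) set)" by (intro open_Times) auto
    then have "at p within S \<times> UNIV = at p within (S \<times> UNIV) \<inter> (UNIV \<times> - {0})"
      by (intro at_within_nhd[of _ "UNIV \<times> - {0}"]) (use False in \<open>auto simp: mem_Times_iff\<close>)
    moreover have "(S \<times> UNIV) \<inter> (UNIV \<times> - {0::complex}) = S \<times> (- {0})" by auto
    ultimately show ?thesis by simp
  next
    case True
    have "((\<lambda>q. norm (snd q) * max B 0) \<longlongrightarrow> norm (snd p) * max B 0) (at p within S \<times> UNIV)"
      by (intro tendsto_intros)
    then have l: "((\<lambda>q. norm (snd q) * max B 0) \<longlongrightarrow> 0) (at p within S \<times> UNIV)" using True by simp
    have "\<forall>\<^sub>F q in at p within S \<times> UNIV. norm (?h q) \<le> norm (snd q) * max B 0"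
      unfolding eventually_at_filter
    proof (intro always_eventually allI impI)
      fix q :: "'a \<times> complex" assume q: "q \<in> S \<times> UNIV"
      show "norm (?h q) \<le> norm (snd q) * max B 0"
      proof (cases "snd q = 0")
        case False
        then have "norm (k (fst q) (sgn (snd q))) \<le> B" using bd[of "fst q" "sgn (snd q)"] q by (auto simp: norm_sgn)
        then show ?thesis by (auto simp: case_prod_beta norm_mult intro!: mult_left_mono)
      qed (auto simp: case_prod_beta)
    qed
    then have "(?h \<longlongrightarrow> 0) (at p within S \<times> UNIV)" by (rule Lim_null_comparison[OF _ l])
    then show ?thesis using True by (simp add: case_prod_beta)
  qed
qed

section \<open>The solid cylinder and essential maps on its boundary\<close>

definition cyl :: "(complex \<times> real) set" where "cyl = cball 0 1 \<times> {0..1}"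
definition bcyl :: "(complex \<times> real) set" where "bcyl = {(z, u) \<in> cyl. norm z = 1 \<or> u = 0 \<or> u = 1}"

lemma compact_cyl: "compact cyl" unfolding cyl_def by (intro compact_Times) auto

lemma bcyl_eq: "bcyl = cyl - ball 0 1 \<times> {0<..<1}" by (auto simp: bcyl_def cyl_def)

lemma compact_bcyl: "compact bcyl"
  unfolding bcyl_eq by (intro compact_diff compact_cyl open_Times) auto

text \<open>With the boundary removed, the component cannot leave the open cylinder. Boundedness is
  what makes the radial map around (0, 1/2) essential on \<open>bcyl\<close>.\<close>

lemma bcyl_component: "bounded (connected_component_set (- bcyl) (0, 1/2))"
proof -
  let ?C = "connected_component_set (- bcyl) (0, 1/2)"
  let ?B = "ball (0::complex) 1 \<times> {0<..<1::real}"
  have "(0, 1/2) \<in> ?B" by auto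
  have sub: "?C \<subseteq> ?B \<union> - cyl" using connected_component_subset[of "- bcyl" "(0,1/2)"] by (auto simp: bcyl_eq)
  have "connected ?C" by simp
  moreover have "open ?B" by (intro open_Times) auto
  moreover have "open (- cyl)" using compact_cyl compact_imp_closed by auto
  moreover have "?B \<inter> - cyl \<inter> ?C = {}" by (auto simp: cyl_def)
  moreover have "(0, 1/2) \<in> ?C" using connected_component_refl[of "(0, 1/2)" "- bcyl"] by (auto simp: bcyl_def)
  then have "?B \<inter> ?C \<noteq> {}" using \<open>(0, 1/2) \<in> ?B\<close> by blast
  ultimately have "- cyl \<inter> ?C = {}" using sub connectedD[of ?C ?B "- cyl"] by auto
  then have "?C \<subseteq> cyl" by auto
  then show ?thesis using compact_imp_bounded[OF compact_cyl] bounded_subset by blast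
qed

lemma not_zero_segment:
  fixes a b :: "'a::euclidean_space"
  shows "dist a b < norm b \<Longrightarrow> closed_segment a b \<subseteq> - {0}"
  using dist_in_closed_segment[of 0 a b] by (auto simp: dist_norm)

lemma zero_segment_pair:
  assumes "(0::complex, 0::real) \<in> closed_segment (a, x) (b, y)"
  shows "0 \<in> closed_segment a b" "0 \<in> closed_segment x y"
  using assms by (auto simp: in_segment zero_prod_def)

lemma zero_segment_real: "(0::real) \<in> closed_segment x y \<longleftrightarrow> (x \<le> 0 \<and> 0 \<le> y) \<or> (y \<le> 0 \<and> 0 \<le> x)"
  by (auto simp: closed_segment_eq_real_ivl)

text \<open>G is defined on a contractible set, so on the boundary it is null-homotopic among maps
  avoiding 0. The boundary conditions deform it, still avoiding 0, into the radial map around the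
  centre of the cylinder, which is essential.\<close>

lemma cylinder_no_extension:
  assumes G: "continuous_on cyl G" "\<And>p. p \<in> cyl \<Longrightarrow> G p \<noteq> (0::complex \<times> real)"
    and T: "continuous_on bcyl T1" "continuous_on bcyl T2"
    and close: "\<And>p. p \<in> bcyl \<Longrightarrow> dist (G p) (T1 p, T2 p) < norm (T1 p, T2 p)"
    and side: "\<And>z u. norm z = 1 \<Longrightarrow> 0 \<le> u \<Longrightarrow> u \<le> 1 \<Longrightarrow> T1 (z, u) = \<phi> z"
    and bot: "\<And>z. norm z \<le> 1 \<Longrightarrow> T2 (z, 0) < 0"
    and top: "\<And>z. norm z \<le> 1 \<Longrightarrow> T1 (z, 1) = 0 \<Longrightarrow> 0 < T2 (z, 1)"
    and k: "continuous_on (sphere 0 1) k" "\<And>z. z \<in> sphere 0 1 \<Longrightarrow> \<phi> z = z * exp (k z)"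
  shows False
proof -
  let ?h = "homotopic_with_canon (\<lambda>x. True) bcyl (- {0 :: complex \<times> real})"
  have sub: "bcyl \<subseteq> cyl" by (auto simp: bcyl_def)
  have Gb: "continuous_on bcyl G" using continuous_on_subset[OF G(1) sub] .
  have "contractible cyl" unfolding cyl_def by (intro convex_imp_contractible convex_Times) auto
  then obtain c where "homotopic_with_canon (\<lambda>x. True) cyl (- {0}) G (\<lambda>x. c)"
    using nullhomotopic_from_contractible[of cyl G "- {0}"] G by auto
  then have 0: "?h G (\<lambda>x. c)" using sub by (rule homotopic_with_subset_left)
  have 1: "?h G (\<lambda>p. (T1 p, T2 p))"
    by (rule homotopic_with_linear) (use Gb T not_zero_segment[OF close] in \<open>auto intro!: continuous_intros\<close>)
  have snz: "\<phi> z \<noteq> 0" if "norm z = 1" for z using k(2)[of z] that by auto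
  \<comment> \<open>Only the second coordinate moves. Where the first one vanishes the point lies on
    a lid, and there \<open>T2\<close> and \<open>2 * u - 1\<close> have the same sign.\<close>
  have 2: "?h (\<lambda>p. (T1 p, T2 p)) (\<lambda>p. (T1 p, 2 * snd p - 1))"
  proof (rule homotopic_with_linear)
    fix p :: "complex \<times> real" assume p: "p \<in> bcyl"
    obtain z u where zu: "p = (z, u)" by fastforce
    have "0 \<notin> closed_segment (T1 p, T2 p) (T1 p, 2 * snd p - 1)"
    proof
      assume a: "0 \<in> closed_segment (T1 p, T2 p) (T1 p, 2 * snd p - 1)"
      then have t1: "T1 p = 0" and t2: "0 \<in> closed_segment (T2 p) (2 * snd p - 1)"
        using zero_segment_pair[of "T1 p" "T2 p" "T1 p" "2 * snd p - 1"] by (auto simp: zero_prod_def)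
      have "norm z \<noteq> 1" using t1 side[of z u] snz[of z] p zu by (auto simp: bcyl_def cyl_def)
      then have "u = 0 \<or> u = 1" "norm z \<le> 1" using p zu by (auto simp: bcyl_def cyl_def)
      then show False using t1 t2 zu bot[of z] top[of z] by (auto simp: zero_segment_real)
    qed
    then show "closed_segment (T1 p, T2 p) (T1 p, 2 * snd p - 1) \<subseteq> - {0}" by auto
  qed (use T in \<open>auto intro!: continuous_intros\<close>)
  have "bounded (k ` sphere 0 1)" by (intro compact_imp_bounded compact_continuous_image k(1)) auto
  then obtain B where "\<forall>x\<in>k ` sphere 0 1. norm x \<le> B" unfolding bounded_iff by blast
  then have B: "\<And>z. z \<in> sphere 0 1 \<Longrightarrow> norm (k z) \<le> B" by auto
  have cH: "continuous_on ({0..1::real} \<times> UNIV) (\<lambda>(v, z). z * exp (complex_of_real (1-v) * k (sgn z)))"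
  proof (rule continuous_cone_mult[where B="exp B"])
    have "continuous_on ({0..1::real} \<times> sphere 0 1) (\<lambda>q. k (snd q))"
      by (rule continuous_on_compose2[OF k(1)]) (auto intro!: continuous_intros)
    then show "continuous_on ({0..1::real} \<times> sphere 0 1) (\<lambda>(v, z). exp (complex_of_real (1 - v) * k z))"
      by (auto simp: case_prod_beta intro!: continuous_intros)
    fix v z assume v: "v \<in> {0..1::real}" "z \<in> sphere (0::complex) 1"
    have "norm (exp (complex_of_real (1 - v) * k z)) \<le> exp (norm (complex_of_real (1 - v) * k z))" by (rule norm_exp)
    also have "norm (complex_of_real (1 - v) * k z) \<le> 1 * norm (k z)"
    proof -
      have "norm (complex_of_real (1 - v)) \<le> 1" using v unfolding norm_of_real by simp
      then show ?thesis unfolding norm_mult by (intro mult_right_mono) auto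
    qed
    then have "exp (norm (complex_of_real (1 - v) * k z)) \<le> exp B" using B[OF v(2)] by simp
    finally show "norm (exp (complex_of_real (1 - v) * k z)) \<le> exp B" .
  qed
  let ?f = "\<lambda>z. z * exp (k (sgn z))"
  have cf: "continuous_on UNIV ?f"
  proof -
    have "continuous_on UNIV (\<lambda>z. (\<lambda>(v, z). z * exp (complex_of_real (1-v) * k (sgn z))) (0::real, z))"
      by (rule continuous_on_compose2[OF cH]) (auto intro!: continuous_intros)
    then show ?thesis by simp
  qed
  have sgn1: "norm z = 1 \<Longrightarrow> sgn z = z" for z :: complex by (simp add: sgn_div_norm)
  \<comment> \<open>The second coordinate vanishes only at half height; boundary points at that
    height lie on the side, where both first coordinates equal \<open>\<phi> z\<close>.\<close>
  have 3: "?h (\<lambda>p. (T1 p, 2 * snd p - 1)) (\<lambda>p. (?f (fst p), 2 * snd p - 1))"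
  proof (rule homotopic_with_linear)
    fix p :: "complex \<times> real" assume p: "p \<in> bcyl"
    obtain z u where zu: "p = (z, u)" by fastforce
    have "0 \<notin> closed_segment (T1 p, 2 * snd p - 1) (?f (fst p), 2 * snd p - 1)"
    proof
      assume a: "0 \<in> closed_segment (T1 p, 2 * snd p - 1) (?f (fst p), 2 * snd p - 1)"
      then have t1: "0 \<in> closed_segment (T1 p) (?f (fst p))" and t2: "2 * snd p - 1 = 0"
        using zero_segment_pair[of "T1 p" "2 * snd p - 1" "?f (fst p)" "2 * snd p - 1"] by (auto simp: zero_prod_def)
      then have z1: "norm z = 1" using p zu by (auto simp: bcyl_def)
      then have "T1 p = \<phi> z" "?f (fst p) = \<phi> z" using zu side[OF z1, of u] k(2)[of z] sgn1[OF z1] p by (auto simp: bcyl_def cyl_def)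
      then show False using t1 snz[OF z1] by simp
    qed
    then show "closed_segment (T1 p, 2 * snd p - 1) (?f (fst p), 2 * snd p - 1) \<subseteq> - {0}" by auto
  qed (use T in \<open>auto intro!: continuous_intros continuous_on_compose2[OF cf]\<close>)
  \<comment> \<open>The exponent is scaled down to 0. As \<open>exp\<close> has no zeros, the first
    coordinate vanishes only on the axis, where on the boundary the second one is 1 or -1.\<close>
  have 4: "?h (\<lambda>p. (?f (fst p), 2 * snd p - 1)) (\<lambda>p. (fst p, 2 * snd p - 1))"
  proof -
    let ?H = "\<lambda>q :: real \<times> complex \<times> real. (fst (snd q) * exp (complex_of_real (1 - fst q) * k (sgn (fst (snd q)))), 2 * snd (snd q) - 1)"
    have "continuous_on ({0..1} \<times> bcyl) (\<lambda>q. (\<lambda>(v, z). z * exp (complex_of_real (1-v) * k (sgn z))) (fst q, fst (snd q)))"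
      by (rule continuous_on_compose2[OF cH]) (auto intro!: continuous_intros)
    then have "continuous_on ({0..1} \<times> bcyl) ?H" by (auto simp: case_prod_beta intro!: continuous_intros)
    moreover have "?H ` ({0..1} \<times> bcyl) \<subseteq> - {0}" by (auto simp: bcyl_def zero_prod_def)
    ultimately show ?thesis unfolding homotopic_with_def by (intro exI[of _ ?H]) (auto simp: bcyl_def zero_prod_def)
  qed
  have 5: "?h (\<lambda>p. (fst p, 2 * snd p - 1)) (\<lambda>p. p - (0, 1/2))"
  proof (rule homotopic_with_linear)
    fix p :: "complex \<times> real" assume p: "p \<in> bcyl"
    obtain z u where zu: "p = (z, u)" by fastforce
    have "0 \<notin> closed_segment (z, 2 * u - 1) (z, u - 1/2)"
    proof
      assume "0 \<in> closed_segment (z, 2 * u - 1) (z, u - 1/2)"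
      then have "z = 0" "0 \<in> closed_segment (2*u-1) (u - 1/2)"
        using zero_segment_pair[of z "2*u-1" z "u-1/2"] by (auto simp: zero_prod_def)
      then show False using p zu by (auto simp: zero_segment_real bcyl_def)
    qed
    then show "closed_segment (fst p, 2 * snd p - 1) (p - (0, 1/2)) \<subseteq> - {0}" using zu by auto
  qed (auto intro!: continuous_intros)
  have "?h (\<lambda>p. p - (0, 1/2)) (\<lambda>x. c)"
    using 0 1 2 3 4 5 by (meson homotopic_with_trans homotopic_with_symD)
  then have "homotopic_with_canon (\<lambda>x. True) bcyl (sphere 0 1)
     ((\<lambda>x. inverse (norm x) *\<^sub>R x) \<circ> (\<lambda>p. p - (0, 1/2))) ((\<lambda>x. inverse (norm x) *\<^sub>R x) \<circ> (\<lambda>x. c))"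
    by (rule homotopic_with_compose_continuous_left) (auto intro!: continuous_intros)
  then have "\<exists>c. homotopic_with_canon (\<lambda>x. True) bcyl (sphere 0 1)
     (\<lambda>x. inverse (norm (x - (0, 1/2))) *\<^sub>R (x - (0, 1/2))) (\<lambda>x. c)" unfolding o_def by (rule exI)
  moreover have "(0, 1/2) \<notin> bcyl" by (auto simp: bcyl_def)
  ultimately show False
    using Borsuk_map_essential_bounded_component[OF compact_bcyl, of "(0, 1/2)"] bcyl_component by blast
qed


context hadamard begin

text \<open>Near the apex the directions vary wildly, but the points are within a bounded multiple
  of \<open>norm z\<close> of w.\<close>

lemma cone_continuous:
  assumes G: "continuous_on (sphere (0::complex) 1) G" "\<And>z. G z \<in> H" and w: "w \<in> H"
  shows "continuous_on (cball (0::complex) 1) (\<lambda>z. P w (G (sgn z)) (norm z))"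
  unfolding continuous_on_def
proof (intro ballI)
  fix z :: complex assume z: "z \<in> cball 0 1"
  let ?h = "\<lambda>z. P w (G (sgn z)) (norm z)"
  show "(?h \<longlongrightarrow> ?h z) (at z within cball 0 1)"
  proof (cases "z = 0")
    case False
    have "continuous_on (cball 0 1 \<inter> - {0}) ?h"
    proof (rule P_continuous)
      show "continuous_on (cball 0 1 \<inter> - {0}) (\<lambda>z. G (sgn z))"
        by (rule continuous_on_compose2[OF G(1)]) (auto intro!: continuous_intros simp: norm_sgn split: if_splits)
    qed (use w G in \<open>auto intro!: continuous_intros\<close>)
    then have "(?h \<longlongrightarrow> ?h z) (at z within cball 0 1 \<inter> - {0})" using z False by (auto simp: continuous_on_def)
    moreover have "at z within cball 0 1 = at z within cball 0 1 \<inter> - {0}"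
      by (rule at_within_nhd[of _ "- {0}"]) (use False in auto)
    ultimately show ?thesis by simp
  next
    case True
    have "bounded (G ` sphere 0 1)" by (intro compact_imp_bounded compact_continuous_image G(1)) auto
    then obtain B where B: "\<forall>y\<in>G ` sphere 0 1. dist w y \<le> B" unfolding bounded_any_center[of _ w] by blast
    have "((\<lambda>q. norm q * max B 0) \<longlongrightarrow> norm z * max B 0) (at z within cball 0 1)" by (intro tendsto_intros)
    then have l: "((\<lambda>q. norm q * max B 0) \<longlongrightarrow> 0) (at z within cball 0 1)" using True by simp
    have b: "\<forall>\<^sub>F q in at z within cball 0 1. dist (?h q) (?h z) \<le> norm q * max B 0"
      unfolding eventually_at_filter
    proof (intro always_eventually allI impI)
      fix q :: complex assume q: "q \<noteq> z" "q \<in> cball 0 1"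
      then have "sgn q \<in> sphere 0 1" using True sgn_sphere by blast
      then have "dist w (G (sgn q)) \<le> B" using B by blast
      then have "dist w (G (sgn q)) \<le> max B 0" by simp
      moreover have "dist w (?h q) = norm q * dist w (G (sgn q))" using dist_P_left w G q by auto
      moreover have "?h z = w" using True w G by simp
      ultimately show "dist (?h q) (?h z) \<le> norm q * max B 0" by (simp add: dist_commute mult_left_mono)
    qed
    show ?thesis unfolding tendsto_dist_iff[of _ "?h z"]
      by (rule tendsto_sandwich[OF _ b tendsto_const l]) simp
  qed
qed

end

text \<open>\<open>D2\<close> says that 0 is an unstable value of every map from a compact subset to
  three-space, a classical form of dimension at most two. It enters the argument in
  \<open>linking\<close>.\<close>

locale hadamard2 = hadamard +
  assumes D2: "\<And>K (\<Theta> :: 'a \<Rightarrow> complex \<times> real) e. compact K \<Longrightarrow> K \<subseteq> H \<Longrightarrow> continuous_on K \<Theta> \<Longrightarrow> 0 < e \<Longrightarrow>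
    \<exists>G. continuous_on K G \<and> (\<forall>x\<in>K. G x \<noteq> 0 \<and> dist (G x) (\<Theta> x) < e)"
begin

text \<open>If there were no such zero, the cone over the loop from w, which lies in X, could be
  joined to the disc E by geodesics. F together with the shifted distance from X would then enclose
  0 on the boundary of this cylinder, and a perturbation without zeros inside contradicts
  \<open>cylinder_no_extension\<close>.\<close>

lemma linking:
  assumes X: "closed X" "X \<subseteq> H" "w \<in> X" "\<And>x t. x \<in> X \<Longrightarrow> 0 \<le> t \<Longrightarrow> t \<le> 1 \<Longrightarrow> P w x t \<in> X"
    and a: "continuous_on {0..1} \<alpha>" "\<And>t. 0 \<le> t \<Longrightarrow> t \<le> 1 \<Longrightarrow> \<alpha> t \<in> X"
    and b: "continuous_on {0..1} \<beta>" "\<And>t. 0 \<le> t \<Longrightarrow> t \<le> 1 \<Longrightarrow> \<beta> t \<in> X"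
    and ab: "\<alpha> 0 = \<beta> 0" "\<alpha> 1 = \<beta> 1"
    and E: "continuous_on (cball (0::complex) 1) E" "\<And>z. norm z \<le> 1 \<Longrightarrow> E z \<in> H"
      "\<And>z. norm z = 1 \<Longrightarrow> E z = (if 0 \<le> Im z then \<alpha> ((1 - Re z)/2) else \<beta> ((1 - Re z)/2))"
    and F: "continuous_on H F"
      "\<And>t. 0 \<le> t \<Longrightarrow> t \<le> 1 \<Longrightarrow> Re (F (\<alpha> t)) = 0 \<Longrightarrow> 0 < Im (F (\<alpha> t))"
      "\<And>t. 0 \<le> t \<Longrightarrow> t \<le> 1 \<Longrightarrow> Re (F (\<beta> t)) = 0 \<Longrightarrow> Im (F (\<beta> t)) < 0"
      "0 < Re (F (\<alpha> 0))" "Re (F (\<alpha> 1)) < 0"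
  shows "\<exists>z. norm z \<le> 1 \<and> F (E z) = 0 \<and> E z \<in> X"
proof (rule ccontr)
  assume no: "\<not> ?thesis"
  define \<Gamma> where "\<Gamma> z = (if 0 \<le> Im z then \<alpha> ((1 - Re z)/2) else \<beta> ((1 - Re z)/2))" for z
  note par = bigon_par
  have \<Gamma>X: "\<Gamma> z \<in> X" if "norm z \<le> 1" for z using a b par[OF that] by (auto simp: \<Gamma>_def)
  have E\<Gamma>: "E z = \<Gamma> z" if "norm z = 1" for z using E(3)[OF that] by (simp add: \<Gamma>_def)
  have c\<Gamma>: "continuous_on (sphere 0 1) \<Gamma>"
    using continuous_bigon[OF a(1) b(1) ab] by (simp add: \<Gamma>_def[abs_def])
  have wH: "w \<in> H" using X by auto
  define Dm where "Dm z = P w (\<Gamma> (sgn z)) (norm z)" for z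
  have ns: "norm (sgn z) \<le> 1" for z :: complex by (simp add: norm_sgn)
  have \<Gamma>H: "\<Gamma> (sgn z) \<in> H" for z using \<Gamma>X[OF ns] X(2) by blast
  have "continuous_on (cball 0 1) (\<lambda>z. P w ((\<Gamma> \<circ> sgn) (sgn z)) (norm z))"
  proof (rule cone_continuous[OF _ _ wH])
    show "continuous_on (sphere 0 1) (\<Gamma> \<circ> sgn)"
      unfolding o_def by (rule continuous_on_compose2[OF c\<Gamma>]) (auto intro!: continuous_intros simp: norm_sgn)
  qed (use \<Gamma>H in auto)
  then have cD: "continuous_on (cball 0 1) Dm" by (simp add: Dm_def[abs_def] sgn_sgn)
  have DX: "Dm z \<in> X" if "norm z \<le> 1" for z using X(4) \<Gamma>X[OF ns] that by (simp add: Dm_def)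
  have Dm1: "Dm z = \<Gamma> z" if "norm z = 1" for z
    using that wH \<Gamma>H[of z] by (simp add: Dm_def sgn_div_norm)
  obtain k where k: "continuous_on (sphere 0 1) k" "\<And>z. z \<in> sphere 0 1 \<Longrightarrow> F (\<Gamma> z) = z * exp (k z)"
  proof (rule circle_log[of "\<lambda>z. F (\<Gamma> z)"])
    show "continuous_on (sphere 0 1) (\<lambda>z. F (\<Gamma> z))"
      by (rule continuous_on_compose2[OF F(1) c\<Gamma>]) (use \<Gamma>X X in auto)
    show "0 < Im (F (\<Gamma> z))" if "z \<in> sphere 0 1" "0 \<le> Im z" "Re (F (\<Gamma> z)) = 0" for z
      using F(2)[OF par] that by (auto simp: \<Gamma>_def)
    show "Im (F (\<Gamma> z)) < 0" if z: "z \<in> sphere 0 1" "Im z \<le> 0" "Re (F (\<Gamma> z)) = 0" for z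
    proof (cases "Im z = 0")
      case True
      then have "Re z = 1 \<or> Re z = -1" using z by (auto simp: cmod_def)
      then have "\<Gamma> z = \<beta> ((1 - Re z)/2)" using ab True by (auto simp: \<Gamma>_def)
      then show ?thesis using F(3)[OF par] z by auto
    next
      case False then show ?thesis using F(3)[OF par] z by (auto simp: \<Gamma>_def)
    qed
    show "0 < Re (F (\<Gamma> 1))" "Re (F (\<Gamma> (-1))) < 0" using F(4,5) by (auto simp: \<Gamma>_def)
  qed blast
  have snz: "F (\<Gamma> z) \<noteq> 0" if "norm z = 1" for z using k(2)[of z] that by auto
  have cE: "continuous_on (cball 0 1) (\<lambda>z. F (E z))"
    by (rule continuous_on_compose2[OF F(1) E(1)]) (use E in auto)
  \<comment> \<open>The zeros of F on the disc form a compact set whose image misses X, so they keep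
    a positive distance from X; half of it gives the strict inequality used on the top lid.\<close>
  obtain \<eta> where \<eta>: "\<eta> > 0" "\<And>z. norm z \<le> 1 \<Longrightarrow> F (E z) = 0 \<Longrightarrow> \<eta> < infdist (E z) X"
  proof -
    let ?Z = "{z \<in> cball 0 1. F (E z) = 0}"
    have "?Z = cball 0 1 \<inter> (\<lambda>z. F (E z)) -` {0}" by auto
    moreover have "closed \<dots>" by (rule continuous_closed_preimage[OF cE]) auto
    ultimately have "closed ?Z" by simp
    moreover have "bounded ?Z" by (rule bounded_subset[of "cball 0 1"]) auto
    ultimately have cZ: "compact ?Z" by (simp add: compact_eq_bounded_closed)
    show thesis
    proof (cases "?Z = {}")
      case True then show thesis using that[of 1] by auto
    next
      case False
      have "continuous_on ?Z (\<lambda>z. infdist (E z) X)" by (intro continuous_intros continuous_on_subset[OF E(1)]) auto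
      then obtain z0 where z0: "z0 \<in> ?Z" "\<And>z. z \<in> ?Z \<Longrightarrow> infdist (E z0) X \<le> infdist (E z) X"
        using continuous_attains_inf[OF cZ False] by blast
      have "E z0 \<notin> X" using no z0 by auto
      then have "0 < infdist (E z0) X" using X by (metis empty_iff in_closed_iff_infdist_zero infdist_nonneg order_less_le)
      then show thesis using that[of "infdist (E z0) X / 2"] z0 by force
    qed
  qed
  define \<sigma> where "\<sigma> p = P (Dm (fst p)) (E (fst p)) (snd p)" for p :: "complex \<times> real"
  have c\<sigma>: "continuous_on cyl \<sigma>" unfolding \<sigma>_def[abs_def]
  proof (rule P_continuous)
    show "continuous_on cyl (\<lambda>p. Dm (fst p))" "continuous_on cyl (\<lambda>p. E (fst p))"
      by (rule continuous_on_compose2[OF cD] continuous_on_compose2[OF E(1)]; auto simp: cyl_def intro!: continuous_intros)+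
  qed (use DX E X in \<open>auto simp: cyl_def intro!: continuous_intros\<close>)
  have \<sigma>H: "\<sigma> ` cyl \<subseteq> H" using DX E X by (auto simp: \<sigma>_def cyl_def intro!: P_in)
  define K where "K = \<sigma> ` cyl"
  have K: "compact K" "K \<subseteq> H" unfolding K_def using compact_continuous_image[OF c\<sigma> compact_cyl] \<sigma>H by auto
  \<comment> \<open>On the bottom, which lies in X, the last coordinate is negative; on the top it
    is positive wherever F vanishes; on the side F has no zero.\<close>
  define \<Theta> where "\<Theta> y = (F y, infdist y X - \<eta>)" for y
  have c\<Theta>: "continuous_on K \<Theta>" unfolding \<Theta>_def[abs_def] by (intro continuous_intros continuous_on_subset[OF F(1)] K)
  have subc: "bcyl \<subseteq> cyl" by (auto simp: bcyl_def)
  have cT: "continuous_on bcyl (\<lambda>p. \<Theta> (\<sigma> p))"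
    by (rule continuous_on_compose2[OF c\<Theta>]) (use continuous_on_subset[OF c\<sigma> subc] subc in \<open>auto simp: K_def\<close>)
  have side: "\<sigma> (z, u) = \<Gamma> z" if "norm z = 1" "0 \<le> u" "u \<le> 1" for z u
    using that Dm1[OF that(1)] E\<Gamma>[OF that(1)] \<Gamma>X[of z] X by (auto simp: \<sigma>_def)
  have bot: "\<sigma> (z, 0) = Dm z" if "norm z \<le> 1" for z using P_0[of "Dm z" "E z"] DX[OF that] E(2)[OF that] X(2) by (auto simp: \<sigma>_def)
  have top: "\<sigma> (z, 1) = E z" if "norm z \<le> 1" for z using P_1[of "Dm z" "E z"] DX[OF that] E(2)[OF that] X(2) by (auto simp: \<sigma>_def)
  have Tbot: "snd (\<Theta> (\<sigma> (z, 0))) < 0" if "norm z \<le> 1" for z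
    using bot[OF that] DX[OF that] \<eta> by (simp add: \<Theta>_def)
  have Ttop: "0 < snd (\<Theta> (\<sigma> (z, 1)))" if "norm z \<le> 1" "fst (\<Theta> (\<sigma> (z, 1))) = 0" for z
    using top[OF that(1)] \<eta>(2)[OF that(1)] that(2) by (simp add: \<Theta>_def)
  have Tside: "fst (\<Theta> (\<sigma> (z, u))) = F (\<Gamma> z)" if "norm z = 1" "0 \<le> u" "u \<le> 1" for z u
    using side[OF that] by (simp add: \<Theta>_def)
  have nz: "\<Theta> (\<sigma> p) \<noteq> 0" if p: "p \<in> bcyl" for p
  proof
    assume z: "\<Theta> (\<sigma> p) = 0"
    obtain x u where xu: "p = (x, u)" by fastforce
    then consider "norm x = 1" "0 \<le> u" "u \<le> 1" | "u = 0" "norm x \<le> 1" | "u = 1" "norm x \<le> 1" using p by (auto simp: bcyl_def cyl_def)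
    then show False
    proof cases
      case 1 then show False using Tside[OF 1] snz z xu by simp
    next
      case 2 then show False using Tbot z xu by force
    next
      case 3 then show False using Ttop[of x] z xu by simp
    qed
  qed
  have "(0, 0) \<in> bcyl" by (auto simp: bcyl_def cyl_def)
  \<comment> \<open>The minimal norm on the boundary is the size of perturbation for which the
    linear homotopy on the boundary still avoids 0.\<close>
  then obtain p0 where p0: "p0 \<in> bcyl" "\<And>p. p \<in> bcyl \<Longrightarrow> norm (\<Theta> (\<sigma> p0)) \<le> norm (\<Theta> (\<sigma> p))"
    using continuous_attains_inf[OF compact_bcyl _ continuous_on_norm[OF cT]] by blast
  then have "0 < norm (\<Theta> (\<sigma> p0))" using nz by auto
  from D2[OF K c\<Theta> this] obtain G where G: "continuous_on K G" "\<And>x. x \<in> K \<Longrightarrow> G x \<noteq> 0" "\<And>x. x \<in> K \<Longrightarrow> dist (G x) (\<Theta> x) < norm (\<Theta> (\<sigma> p0))"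
    by blast
  show False
  proof (rule cylinder_no_extension[where G="\<lambda>p. G (\<sigma> p)" and ?T1.0="\<lambda>p. fst (\<Theta> (\<sigma> p))" and ?T2.0="\<lambda>p. snd (\<Theta> (\<sigma> p))" and \<phi>="\<lambda>z. F (\<Gamma> z)" and k=k])
    show "continuous_on cyl (\<lambda>p. G (\<sigma> p))" by (rule continuous_on_compose2[OF G(1) c\<sigma>]) (auto simp: K_def)
    show "G (\<sigma> p) \<noteq> 0" if "p \<in> cyl" for p using G(2) that by (auto simp: K_def)
    show "dist (G (\<sigma> p)) (fst (\<Theta> (\<sigma> p)), snd (\<Theta> (\<sigma> p))) < norm (fst (\<Theta> (\<sigma> p)), snd (\<Theta> (\<sigma> p)))" if "p \<in> bcyl" for p
      using G(3)[of "\<sigma> p"] p0(2)[OF that] that subc by (auto simp: K_def)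
  qed (use cT Tside Tbot Ttop k in \<open>auto intro!: continuous_intros\<close>)
qed

end

section \<open>A measure argument\<close>

text \<open>Cover S by almost disjoint intervals of nearly the same total length; each part of S is
  mapped into an interval c times as long. The conclusion supplies a measurable superset, which
  keeps the measurability of the image out of the argument.\<close>

lemma lipschitz_outer:
  fixes W :: "real \<Rightarrow> real"
  assumes S: "S \<in> lmeasurable" "S \<subseteq> {a..b}" and c: "0 \<le> c"
    and lip: "\<And>s t. s \<in> S \<Longrightarrow> t \<in> S \<Longrightarrow> \<bar>W s - W t\<bar> \<le> c * \<bar>s - t\<bar>" and e: "e > 0"
  shows "\<exists>T\<in>lmeasurable. W ` S \<subseteq> T \<and> measure lebesgue T \<le> c * measure lebesgue S + e"
proof -
  \<comment> \<open>Dividing by c + 1 rather than by c also covers c = 0.\<close>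
  define e' where "e' = e / (c + 1)"
  have e'0: "e' > 0" using e c by (simp add: e'_def)
  have "c * e' \<le> (c + 1) * e'" using e'0 by (intro mult_right_mono) auto
  also have "\<dots> = e" using c by (simp add: e'_def)
  finally have e': "e' > 0" "c * e' \<le> e" using e'0 by auto
  have S': "S \<subseteq> cbox a b" using S(2) by simp
  obtain \<D> where D: "countable \<D>" "\<And>K. K \<in> \<D> \<Longrightarrow> K \<subseteq> cbox a b \<and> K \<noteq> {} \<and> (\<exists>c d. K = cbox c d)"
    "pairwise (\<lambda>A B. interior A \<inter> interior B = {}) \<D>"
    "S \<subseteq> \<Union>\<D>" "\<Union>\<D> \<in> lmeasurable" "measure lebesgue (\<Union>\<D>) \<le> measure lebesgue S + e'"
    by (rule measurable_outer_intervals_bounded[OF S(1) S' e'(1)]) blast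
  have Dm: "K \<in> lmeasurable" if "K \<in> \<D>" for K using D(2)[OF that] by auto
  \<comment> \<open>If S does not meet K, the left end is an unspecified infimum; any interval of
    this length is good enough then.\<close>
  define T where "T K = {Inf (W ` (S \<inter> K)) .. Inf (W ` (S \<inter> K)) + c * measure lebesgue K}" for K
  have Tm: "T K \<in> lmeasurable" "measure lebesgue (T K) = c * measure lebesgue K" for K
    using c by (auto simp: T_def measure_nonneg)
  have TW: "W ` (S \<inter> K) \<subseteq> T K" if K: "K \<in> \<D>" for K
  proof
    fix y assume y: "y \<in> W ` (S \<inter> K)"
    obtain u v where uv: "K = {u..v}" "u \<le> v" using D(2)[OF K] by (auto simp: cbox_interval)
    have mK: "measure lebesgue K = v - u" using uv by simp
    have diam: "\<bar>p - q\<bar> \<le> c * (v - u)" if pq: "p \<in> W ` (S \<inter> K)" "q \<in> W ` (S \<inter> K)" for p q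
    proof -
      obtain s t where st: "s \<in> S \<inter> K" "t \<in> S \<inter> K" "p = W s" "q = W t" using pq by blast
      then have "\<bar>p - q\<bar> \<le> c * \<bar>s - t\<bar>" using lip by auto
      also have "\<dots> \<le> c * (v - u)" using st uv c by (intro mult_left_mono) auto
      finally show ?thesis .
    qed
    have lo: "y - c * (v-u) \<le> x" if "x \<in> W ` (S \<inter> K)" for x using diam[OF y that] by linarith
    have bdd: "bdd_below (W ` (S \<inter> K))" using lo by (rule bdd_belowI)
    have "Inf (W ` (S \<inter> K)) \<le> y" using y bdd by (rule cInf_lower)
    moreover have "y - c * (v - u) \<le> Inf (W ` (S \<inter> K))"
      using y lo by (intro cInf_greatest) blast+
    ultimately show "y \<in> T K" by (simp add: T_def mK)
  qed
  have fin: "measure lebesgue (\<Union>K\<in>F. T K) \<le> c * measure lebesgue S + e" if F: "F \<subseteq> \<D>" "finite F" for F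
  proof -
    have "measure lebesgue (\<Union>K\<in>F. T K) \<le> (\<Sum>K\<in>F. measure lebesgue (T K))"
      using F Tm by (intro measure_UNION_le) auto
    also have "\<dots> = c * (\<Sum>K\<in>F. measure lebesgue K)" by (simp add: Tm sum_distrib_left)
    also have "(\<Sum>K\<in>F. measure lebesgue K) = measure lebesgue (\<Union>F)"
    proof (rule measure_negligible_finite_Union[symmetric, OF F(2)])
      show "K \<in> lmeasurable" if "K \<in> F" for K using Dm F that by auto
      show "pairwise (\<lambda>S T. negligible (S \<inter> T)) F"
      proof (rule pairwiseI)
        fix A B assume AB: "A \<in> F" "B \<in> F" "A \<noteq> B"
        then have AD: "A \<in> \<D>" "B \<in> \<D>" using F by blast+
        have i: "interior A \<inter> interior B = {}" using D(3) AD AB(3) unfolding pairwise_def by blast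
        obtain a1 b1 a2 b2 where "A = cbox a1 b1" "B = cbox a2 b2" using D(2)[OF AD(1)] D(2)[OF AD(2)] by blast
        then have "A \<inter> B = cbox (max a1 a2) (min b1 b2)" by (auto simp: cbox_interval)
        then obtain p q where pq: "A \<inter> B = cbox p q" by blast
        then have "box p q = {}" using i unfolding interior_Int[symmetric] by (simp add: interior_cbox)
        then show "negligible (A \<inter> B)" unfolding pq by (simp only: negligible_interval)
      qed
    qed
    also have "measure lebesgue (\<Union>F) \<le> measure lebesgue (\<Union>\<D>)"
    proof (rule measure_mono_fmeasurable)
      show "\<Union>F \<subseteq> \<Union>\<D>" using F by blast
      show "\<Union>F \<in> sets lebesgue" by (rule sets.finite_Union[OF F(2)]) (use F Dm in blast)
    qed (rule D(5))
    also have "\<dots> \<le> measure lebesgue S + e'" by (rule D(6))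
    finally have "measure lebesgue (\<Union>K\<in>F. T K) \<le> c * (measure lebesgue S + e')" using c by (simp add: mult_left_mono)
    also have "\<dots> \<le> c * measure lebesgue S + e" using e' unfolding distrib_left by linarith
    finally show ?thesis .
  qed
  have 1: "(\<Union>K\<in>\<D>. T K) \<in> lmeasurable"
    by (rule fmeasurable_UN_bound[where I=\<D> and A=T and B="c * measure lebesgue S + e"]) (rule D(1), rule Tm(1), rule fin, assumption+)
  have 2: "measure lebesgue (\<Union>K\<in>\<D>. T K) \<le> c * measure lebesgue S + e"
    by (rule measure_UN_bound[where I=\<D> and A=T and B="c * measure lebesgue S + e"]) (rule D(1), rule Tm(1), rule fin, assumption+)
  have "W ` S \<subseteq> (\<Union>K\<in>\<D>. T K)"
  proof
    fix y assume "y \<in> W ` S"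
    then obtain s where s: "s \<in> S" "y = W s" by blast
    then obtain K where K: "K \<in> \<D>" "s \<in> K" using D(4) by blast
    then have "y \<in> W ` (S \<inter> K)" using s by blast
    then show "y \<in> (\<Union>K\<in>\<D>. T K)" using TW[OF K(1)] K(1) by blast
  qed
  then show ?thesis using 1 2 by (intro bexI[of _ "\<Union>K\<in>\<D>. T K"] conjI)
qed

text \<open>W is Lipschitz on each piece separately, not across pieces. Removing what the other
  pieces cover makes them disjoint, so that measures add up and overlaps are counted once.\<close>

lemma lipschitz_outer_Union:
  fixes W :: "real \<Rightarrow> real"
  assumes "finite J" and Z: "\<And>j. j \<in> J \<Longrightarrow> Z j \<in> lmeasurable \<and> Z j \<subseteq> {a..b}" and c: "0 \<le> c"
    and lip: "\<And>j s t. j \<in> J \<Longrightarrow> s \<in> Z j \<Longrightarrow> t \<in> Z j \<Longrightarrow> \<bar>W s - W t\<bar> \<le> c * \<bar>s - t\<bar>" and e: "e > 0"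
  shows "\<exists>T\<in>lmeasurable. W ` (\<Union>j\<in>J. Z j) \<subseteq> T \<and> measure lebesgue T \<le> c * measure lebesgue (\<Union>j\<in>J. Z j) + e"
  using assms
proof (induction J arbitrary: e rule: finite_induct)
  case (insert j J)
  let ?A = "\<Union>j\<in>J. Z j"
  have A: "?A \<in> lmeasurable" using insert.hyps insert.prems by (intro fmeasurable.finite_UN) auto
  have Zj: "Z j \<in> lmeasurable" "Z j \<subseteq> {a..b}" using insert.prems by auto
  have "\<exists>T\<in>lmeasurable. W ` ?A \<subseteq> T \<and> measure lebesgue T \<le> c * measure lebesgue ?A + e/2"
  proof (rule insert.IH)
    show "\<bar>W s - W t\<bar> \<le> c * \<bar>s - t\<bar>" if "i \<in> J" "s \<in> Z i" "t \<in> Z i" for i s t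
      using insert.prems(3)[of i s t] that by simp
    show "Z i \<in> lmeasurable \<and> Z i \<subseteq> {a..b}" if "i \<in> J" for i using insert.prems(1)[of i] that by simp
    show "0 \<le> c" "0 < e / 2" using insert.prems by auto
  qed
  then obtain T1 where T1: "T1 \<in> lmeasurable" "W ` ?A \<subseteq> T1" "measure lebesgue T1 \<le> c * measure lebesgue ?A + e/2" by blast
  have "Z j - ?A \<in> lmeasurable" using Zj A by (intro fmeasurable.Diff)
  then have "\<exists>T\<in>lmeasurable. W ` (Z j - ?A) \<subseteq> T \<and> measure lebesgue T \<le> c * measure lebesgue (Z j - ?A) + e/2"
  proof (rule lipschitz_outer)
    show "\<bar>W s - W t\<bar> \<le> c * \<bar>s - t\<bar>" if "s \<in> Z j - ?A" "t \<in> Z j - ?A" for s t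
      using insert.prems(3)[of j s t] that by simp
    show "Z j - ?A \<subseteq> {a..b}" "0 \<le> c" "0 < e/2" using Zj insert.prems by auto
  qed
  then obtain T2 where T2: "T2 \<in> lmeasurable" "W ` (Z j - ?A) \<subseteq> T2" "measure lebesgue T2 \<le> c * measure lebesgue (Z j - ?A) + e/2" by blast
  have "measure lebesgue (T1 \<union> T2) \<le> measure lebesgue T1 + measure lebesgue T2"
    using T1 T2 by (intro measure_Un_le) auto
  also have "\<dots> \<le> c * (measure lebesgue ?A + measure lebesgue (Z j - ?A)) + e"
    using T1 T2 by (simp add: algebra_simps)
  also have "measure lebesgue ?A + measure lebesgue (Z j - ?A) = measure lebesgue (?A \<union> (Z j - ?A))"
  proof -
    have "measure lebesgue ((?A \<union> Z j) - ?A) = measure lebesgue (?A \<union> Z j) - measure lebesgue ?A"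
      using A Zj by (intro measurable_measure_Diff) (auto intro: fmeasurable.Un)
    moreover have "(?A \<union> Z j) - ?A = Z j - ?A" "?A \<union> (Z j - ?A) = ?A \<union> Z j" by auto
    ultimately show ?thesis by simp
  qed
  also have "?A \<union> (Z j - ?A) = (\<Union>j\<in>insert j J. Z j)" by auto
  finally have "measure lebesgue (T1 \<union> T2) \<le> c * measure lebesgue (\<Union>j\<in>insert j J. Z j) + e" .
  moreover have "(\<Union>j\<in>insert j J. Z j) = ?A \<union> (Z j - ?A)" by auto
  then have "W ` (\<Union>j\<in>insert j J. Z j) \<subseteq> T1 \<union> T2" using T1(2) T2(2) by (metis Un_mono image_Un)
  moreover have "T1 \<union> T2 \<in> lmeasurable" using T1 T2 by (intro fmeasurable.Un)
  ultimately show ?case by blast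
qed (auto intro!: bexI[of _ "{}"])

text \<open>The image loses length: on \<open>{n1..n2}\<close> the pieces shrink by the factor q,
  elsewhere they do not expand, so the total measure is at most l - (1-q)(n2-n1) up to small
  errors.\<close>

lemma no_cover:
  fixes W :: "real \<Rightarrow> real"
  assumes J: "finite J" and Z: "\<And>j. j \<in> J \<Longrightarrow> compact (Z j) \<and> Z j \<subseteq> {0..l}"
    and lip: "\<And>j s t. j \<in> J \<Longrightarrow> s \<in> Z j \<Longrightarrow> t \<in> Z j \<Longrightarrow> \<bar>W s - W t\<bar> \<le> \<bar>s - t\<bar>"
    and N: "0 \<le> n1" "n1 < n2" "n2 \<le> l" and q: "0 \<le> q" "q < 1"
    and lipq: "\<And>j s t. j \<in> J \<Longrightarrow> s \<in> Z j \<inter> {n1..n2} \<Longrightarrow> t \<in> Z j \<inter> {n1..n2} \<Longrightarrow> \<bar>W s - W t\<bar> \<le> q * \<bar>s - t\<bar>"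
  shows "\<not> {0..l} \<subseteq> (\<Union>j\<in>J. W ` Z j)"
proof
  assume cov: "{0..l} \<subseteq> (\<Union>j\<in>J. W ` Z j)"
  \<comment> \<open>Each of the two covers below may exceed its target by e; together that is half
    of the length lost by the contraction.\<close>
  define e where "e = (1-q) * (n2 - n1) / 4"
  have e: "e > 0" using N q by (simp add: e_def)
  have Zm: "Z j \<in> lmeasurable" if "j \<in> J" for j using Z[OF that] lmeasurable_compact by blast
  have 1: "Z j \<inter> {n1..n2} \<in> lmeasurable" "Z j - {n1..n2} \<in> lmeasurable" if "j \<in> J" for j
    using Zm[OF that] by (auto intro!: fmeasurable.Int fmeasurable.Diff)
  have "\<exists>T\<in>lmeasurable. W ` (\<Union>j\<in>J. Z j \<inter> {n1..n2}) \<subseteq> T \<and> measure lebesgue T \<le> q * measure lebesgue (\<Union>j\<in>J. Z j \<inter> {n1..n2}) + e"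
    by (rule lipschitz_outer_Union[OF J _ q(1) lipq e, where a=0 and b=l]) (use Z 1 in blast)
  then obtain T1 where T1: "T1 \<in> lmeasurable" "W ` (\<Union>j\<in>J. Z j \<inter> {n1..n2}) \<subseteq> T1"
    "measure lebesgue T1 \<le> q * measure lebesgue (\<Union>j\<in>J. Z j \<inter> {n1..n2}) + e" by blast
  have "\<exists>T\<in>lmeasurable. W ` (\<Union>j\<in>J. Z j - {n1..n2}) \<subseteq> T \<and> measure lebesgue T \<le> 1 * measure lebesgue (\<Union>j\<in>J. Z j - {n1..n2}) + e"
  proof (rule lipschitz_outer_Union[OF J _ _ _ e, where a=0 and b=l])
    show "\<bar>W s - W t\<bar> \<le> 1 * \<bar>s - t\<bar>" if "j \<in> J" "s \<in> Z j - {n1..n2}" "t \<in> Z j - {n1..n2}" for j s t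
      using lip that by simp
  qed (use Z 1 in auto)
  then obtain T2 where T2: "T2 \<in> lmeasurable" "W ` (\<Union>j\<in>J. Z j - {n1..n2}) \<subseteq> T2"
    "measure lebesgue T2 \<le> 1 * measure lebesgue (\<Union>j\<in>J. Z j - {n1..n2}) + e" by blast
  have sub: "{0..l} \<subseteq> T1 \<union> T2"
  proof
    fix x assume "x \<in> {0..l}"
    then obtain j t where "j \<in> J" "t \<in> Z j" "x = W t" using cov by blast
    then show "x \<in> T1 \<union> T2" using T1(2) T2(2) by (cases "t \<in> {n1..n2}") blast+
  qed
  have "l = measure lebesgue {0..l}" using N by simp
  also have "\<dots> \<le> measure lebesgue (T1 \<union> T2)" using sub T1 T2 by (intro measure_mono_fmeasurable) (auto intro: fmeasurable.Un)
  also have "\<dots> \<le> measure lebesgue T1 + measure lebesgue T2" using T1 T2 by (intro measure_Un_le) auto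
  finally have a: "l \<le> measure lebesgue T1 + measure lebesgue T2" .
  have s1: "(\<Union>j\<in>J. Z j \<inter> {n1..n2}) \<in> sets lebesgue" by (rule sets.finite_UN[OF J]) (use 1 in auto)
  have s2: "(\<Union>j\<in>J. Z j - {n1..n2}) \<in> sets lebesgue" by (rule sets.finite_UN[OF J]) (use 1 in auto)
  have "measure lebesgue (\<Union>j\<in>J. Z j \<inter> {n1..n2}) \<le> measure lebesgue {n1..n2}"
    by (rule measure_mono_fmeasurable[OF _ s1]) auto
  then have b: "q * measure lebesgue (\<Union>j\<in>J. Z j \<inter> {n1..n2}) \<le> q * (n2 - n1)" using N q by (intro mult_left_mono) auto
  have "measure lebesgue (\<Union>j\<in>J. Z j - {n1..n2}) \<le> measure lebesgue ({0..l} - {n1..n2})"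
    by (rule measure_mono_fmeasurable[OF _ s2]) (use Z in \<open>auto intro!: fmeasurable.Diff\<close>)
  also have "\<dots> = measure lebesgue {0..l} - measure lebesgue {n1..n2}"
    using N by (intro measurable_measure_Diff) auto
  finally have "measure lebesgue (\<Union>j\<in>J. Z j - {n1..n2}) \<le> l - (n2 - n1)" using N by simp
  then have "l \<le> q * (n2 - n1) + e + (l - (n2 - n1) + e)" using a b T1(3) T2(3) by linarith
  then have "(1-q) * (n2 - n1) \<le> 2 * e" by (simp add: algebra_simps)
  then show False using e by (simp add: e_def)
qed

section \<open>Geodesics of the chain metric stay in convex sets\<close>

locale star2 = star H CC w + hadamard2 H for H :: "'a::complete_space set" and CC w
begin

text \<open>Between s and t the ambient distance already equals the parameter length, so the curve
  is a geodesic of H there and the distance from C is convex along it. The slopes are compared in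
  multiplied-out form to avoid divisions.\<close>

lemma cgeod_infdist_convex:
  assumes C: "closed C" "cvx C" "C \<noteq> {}" and g: "cgeod g a b" and st: "0 \<le> s" "s < t" "t \<le> D a b" and d: "dist (g s) (g t) = t - s"
    and pqr: "s \<le> p" "p < q" "q < r" "r \<le> t"
  shows "(infdist (g q) C - infdist (g p) C) * (r - q) \<le> (infdist (g r) C - infdist (g q) C) * (q - p)"
proof -
  have gX: "g u \<in> X" "g u \<in> H" if "s \<le> u" "u \<le> t" for u using cgeodD(3)[OF g, of u] that st X_Hin by auto
  have le: "dist (g u) (g v) \<le> \<bar>u - v\<bar>" if "s \<le> u" "u \<le> t" "s \<le> v" "v \<le> t" for u v
    using geod_dist[OF g, of u v] that st by auto
  have eq: "dist (g p) (g r) = r - p"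
  proof -
    have "t - s \<le> dist (g s) (g p) + dist (g p) (g r) + dist (g r) (g t)"
      using d dist_triangle[of "g s" "g t" "g p"] dist_triangle[of "g p" "g t" "g r"] by simp
    then show ?thesis using le[of s p] le[of p r] le[of r t] pqr st by simp
  qed
  define \<theta> where "\<theta> = (q - p) / (r - p)"
  have th: "0 \<le> \<theta>" "\<theta> \<le> 1" "\<theta> * (r - p) = q - p" "(1-\<theta>) * (r - p) = r - q"
  proof -
    have rp: "r - p \<noteq> 0" using pqr by simp
    show "0 \<le> \<theta>" "\<theta> \<le> 1" using pqr by (auto simp: \<theta>_def divide_le_eq_1)
    show 1: "\<theta> * (r - p) = q - p" unfolding \<theta>_def using rp by simp
    show "(1-\<theta>) * (r - p) = r - q" using 1 by (simp add: left_diff_distrib)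
  qed
  have "g q = P (g p) (g r) \<theta>"
  proof (rule P_unique)
    show "dist (g p) (g q) \<le> \<theta> * dist (g p) (g r)" using le[of p q] pqr st eq th by simp
    show "dist (g r) (g q) \<le> (1-\<theta>) * dist (g p) (g r)" using le[of r q] pqr st eq th by simp
  qed (use gX[of p] gX[of q] gX[of r] pqr th(1,2) in auto)
  then have "infdist (g q) C \<le> (1-\<theta>) * infdist (g p) C + \<theta> * infdist (g r) C"
    using infdist_convex[OF C, of "g p" "g r" \<theta>] gX pqr th(1,2) by auto
  then have "(r - p) * infdist (g q) C \<le> (r - p) * ((1-\<theta>) * infdist (g p) C + \<theta> * infdist (g r) C)"
    using pqr by (intro mult_left_mono) auto
  also have "\<dots> = ((1-\<theta>) * (r - p)) * infdist (g p) C + (\<theta> * (r - p)) * infdist (g r) C" by (simp add: algebra_simps)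
  finally have "(r - p) * infdist (g q) C \<le> (r - q) * infdist (g p) C + (q - p) * infdist (g r) C" unfolding th(3,4) .
  then show ?thesis by (simp add: algebra_simps)
qed

text \<open>Otherwise there are levels tending to m with coinciding projections. The projected
  points are then closer and closer to each other and to height m, and in the limit the curves have
  a common point at height m > 0, outside C.\<close>

lemma excess_level:
  fixes g g' :: "real \<Rightarrow> 'a"
  assumes C: "closed C" "cvx C" "C \<noteq> {}" and g: "continuous_on {0..l} g" "g ` {0..l} \<subseteq> H" and g': "continuous_on {0..l'} g'" "g' ` {0..l'} \<subseteq> H"
    and common: "\<And>b b'. b \<in> {0..l} \<Longrightarrow> b' \<in> {0..l'} \<Longrightarrow> g b = g' b' \<Longrightarrow> g b \<in> C"
    and m: "m > 0" "\<And>t. t \<in> {0..l} \<Longrightarrow> infdist (g t) C \<le> m" "\<And>t. t \<in> {0..l'} \<Longrightarrow> infdist (g' t) C \<le> m"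
  shows "\<exists>c. 0 < c \<and> c < m \<and> (\<forall>t\<in>{0..l}. \<forall>t'\<in>{0..l'}. c \<le> infdist (g t) C \<longrightarrow> c \<le> infdist (g' t') C \<longrightarrow>
    pr (tube C c) (g t) \<noteq> pr (tube C c) (g' t'))"
proof (rule ccontr)
  assume no: "\<not> ?thesis"
  \<comment> \<open>The shift by 2 keeps the level strictly between 0 and m also for n = 0.\<close>
  define cc where "cc n = m - m / real (n + 2)" for n :: nat
  have c: "0 < cc n" "cc n < m" for n
  proof -
    have "m / real (n + 2) < m / 1" using m by (intro divide_strict_left_mono) auto
    then show "0 < cc n" by (simp add: cc_def)
    show "cc n < m" using m by (simp add: cc_def)
  qed
  have "\<exists>t t'. t \<in> {0..l} \<and> t' \<in> {0..l'} \<and> cc n \<le> infdist (g t) C \<and> cc n \<le> infdist (g' t') C \<and>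
      pr (tube C (cc n)) (g t) = pr (tube C (cc n)) (g' t')" for n using no c[of n] by blast
  then obtain t t' where t: "\<And>n. t n \<in> {0..l}" "\<And>n. t' n \<in> {0..l'}" "\<And>n. cc n \<le> infdist (g (t n)) C"
    "\<And>n. cc n \<le> infdist (g' (t' n)) C" "\<And>n. pr (tube C (cc n)) (g (t n)) = pr (tube C (cc n)) (g' (t' n))" by metis
  have dle: "dist (g (t n)) (g' (t' n)) \<le> 2 * (m - cc n)" for n
  proof -
    have H: "g (t n) \<in> H" "g' (t' n) \<in> H" using t g g' by blast+
    have "dist (g (t n)) (g' (t' n)) \<le> dist (g (t n)) (pr (tube C (cc n)) (g (t n))) + dist (g' (t' n)) (pr (tube C (cc n)) (g' (t' n)))"
      using dist_triangle2[of "g (t n)" "g' (t' n)" "pr (tube C (cc n)) (g (t n))"] t(5)[of n] by simp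
    then show ?thesis using pr_tube(1)[OF C H(1) _ t(3)] pr_tube(1)[OF C H(2) _ t(4)] c[of n] m(2)[OF t(1), of n] m(3)[OF t(2), of n] by simp
  qed
  have "compact ({0..l} \<times> {0..l'})" by (intro compact_Times compact_Icc)
  moreover have "\<forall>n. (t n, t' n) \<in> {0..l} \<times> {0..l'}" using t by auto
  ultimately obtain a r where r: "a \<in> {0..l} \<times> {0..l'}" "strict_mono (r :: nat \<Rightarrow> nat)" "((\<lambda>n. (t n, t' n)) \<circ> r) \<longlonglongrightarrow> a"
    unfolding compact_def by meson
  obtain s s' where a: "a = (s, s')" "s \<in> {0..l}" "s' \<in> {0..l'}" using r(1) by auto
  have ts: "(\<lambda>n. t (r n)) \<longlonglongrightarrow> s" and ts': "(\<lambda>n. t' (r n)) \<longlonglongrightarrow> s'"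
    using tendsto_fst[OF r(3)] tendsto_snd[OF r(3)] a by (auto simp: o_def)
  have gs: "(\<lambda>n. g (t (r n))) \<longlonglongrightarrow> g s" using continuous_on_tendsto_compose[OF g(1) ts a(2)] t by auto
  have gs': "(\<lambda>n. g' (t' (r n))) \<longlonglongrightarrow> g' s'" using continuous_on_tendsto_compose[OF g'(1) ts' a(3)] t by auto
  have "(\<lambda>n. m * (1 / real (n + 2))) \<longlonglongrightarrow> m * 0"
    by (intro tendsto_intros LIMSEQ_ignore_initial_segment[OF lim_1_over_n])
  then have "(\<lambda>n. m / real (n + 2)) \<longlonglongrightarrow> 0" by simp
  then have "(\<lambda>n. m - m / real (n + 2)) \<longlonglongrightarrow> m - 0" by (intro tendsto_intros)
  then have cl: "cc \<longlonglongrightarrow> m" by (simp add: cc_def[abs_def])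
  then have clr: "(\<lambda>n. cc (r n)) \<longlonglongrightarrow> m" using LIMSEQ_subseq_LIMSEQ[OF cl r(2)] by (simp add: o_def)
  have "(\<lambda>n. dist (g (t (r n))) (g' (t' (r n)))) \<longlonglongrightarrow> dist (g s) (g' s')" by (intro tendsto_intros gs gs')
  moreover have "(\<lambda>n. 2 * (m - cc (r n))) \<longlonglongrightarrow> 2 * (m - m)" by (intro tendsto_intros clr)
  ultimately have "dist (g s) (g' s') \<le> 2 * (m - m)" using dle by (intro LIMSEQ_le) auto
  then have "g s = g' s'" by simp
  then have "g s \<in> C" using common a by blast
  moreover have "(\<lambda>n. infdist (g (t (r n))) C) \<longlonglongrightarrow> infdist (g s) C" by (intro tendsto_intros gs)
  then have "m \<le> infdist (g s) C" using clr t(3) by (intro LIMSEQ_le[OF clr]) auto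
  ultimately show False using m(1) by simp
qed

text \<open>Here g is the geodesic that rises highest. Its projection to a level c below m contracts
  a piece strictly, so the part of the projected curve inside X misses some value r of
  \<open>D z\<close>. Over this gap a function F for \<open>linking\<close> is built that separates
  g from g', while a disc spanned by both has no zero of F inside X.\<close>

lemma excess_one:
  assumes xyz: "z \<in> X" "x \<in> X" "y \<in> X" and g: "cgeod g z x" and g': "cgeod g' z y" and seg: "\<And>t. 0 \<le> t \<Longrightarrow> t \<le> 1 \<Longrightarrow> P x y t \<in> X"
    and C: "closed C" "cvx C" and inC: "z \<in> C" "x \<in> C" "y \<in> C"
    and common: "\<And>b b'. b \<in> {0..D z x} \<Longrightarrow> b' \<in> {0..D z y} \<Longrightarrow> g b = g' b' \<Longrightarrow> g b \<in> C"
    and m: "tm \<in> {0..D z x}" "m = infdist (g tm) C" "\<And>t. t \<in> {0..D z x} \<Longrightarrow> infdist (g t) C \<le> m"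
      "\<And>t. t \<in> {0..D z y} \<Longrightarrow> infdist (g' t) C \<le> m"
  shows "m = 0"
proof (rule ccontr)
  assume "m \<noteq> 0"
  then have m0: "m > 0" using m(2) infdist_nonneg[of "g tm" C] by linarith
  define l where "l = D z x"
  define l' where "l' = D z y"
  have C0: "C \<noteq> {}" using inC by auto
  note CC3 = C(1,2) C0
  have H: "z \<in> H" "x \<in> H" "y \<in> H" using xyz X_Hin by auto
  have gc: "continuous_on {0..l} g" and gc': "continuous_on {0..l'} g'" using geod_cont g g' by (auto simp: l_def l'_def)
  have gX: "g t \<in> X" if "t \<in> {0..l}" for t using cgeodD(3)[OF g] that by (auto simp: l_def)
  have gX': "g' t \<in> X" if "t \<in> {0..l'}" for t using cgeodD(3)[OF g'] that by (auto simp: l'_def)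
  have gH: "g t \<in> H" if "t \<in> {0..l}" for t using gX[OF that] X_Hin by auto
  have gH': "g' t \<in> H" if "t \<in> {0..l'}" for t using gX'[OF that] X_Hin by auto
  have l0: "0 \<le> l" "0 \<le> l'" using D_nonneg xyz by (auto simp: l_def l'_def)
  have ends: "g 0 = z" "g l = x" "g' 0 = z" "g' l' = y" using cgeodD g g' by (auto simp: l_def l'_def)
  let ?h = "\<lambda>q. infdist q C"
  have hz: "?h z = 0" "?h x = 0" "?h y = 0" using inC by auto
  have hc: "continuous_on {0..l} (\<lambda>t. ?h (g t))" by (intro continuous_intros gc)
  have "\<exists>c. 0 < c \<and> c < m \<and> (\<forall>t\<in>{0..l}. \<forall>t'\<in>{0..l'}. c \<le> ?h (g t) \<longrightarrow> c \<le> ?h (g' t') \<longrightarrow>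
    pr (tube C c) (g t) \<noteq> pr (tube C c) (g' t'))"
  proof (rule excess_level[OF CC3 gc _ gc'])
    show "g ` {0..l} \<subseteq> H" "g' ` {0..l'} \<subseteq> H" using gH gH' by blast+
    show "g b \<in> C" if "b \<in> {0..l}" "b' \<in> {0..l'}" "g b = g' b'" for b b' using common that unfolding l_def l'_def by blast
  qed (use m0 m(3,4) in \<open>auto simp: l_def l'_def\<close>)
  then obtain c where c: "0 < c" "c < m" and cdis: "\<And>t t'. t \<in> {0..l} \<Longrightarrow> t' \<in> {0..l'} \<Longrightarrow> c \<le> ?h (g t) \<Longrightarrow> c \<le> ?h (g' t') \<Longrightarrow>
    pr (tube C c) (g t) \<noteq> pr (tube C c) (g' t')" by blast
  define T where "T = tube C c"
  have CH: "C \<subseteq> H" using C by (auto simp: cvx_def)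
  have CT: "C \<subseteq> T" unfolding T_def by (rule tube_sub[OF CH]) (use c in simp)
  have T: "closed T" "cvx T" "T \<noteq> {}" using closed_tube cvx_tube[OF CC3] CT C0 by (auto simp: T_def)
  have Th: "q \<in> T \<longleftrightarrow> q \<in> H \<and> ?h q \<le> c" for q by (simp add: T_def tube_def)
  note prT = pr_spec[OF T]
  have prH: "pr T q \<in> H" if "q \<in> H" for q using prT(1)[OF that] Th by blast
  have prid: "pr T q = q" if "q \<in> H" "?h q \<le> c" for q using pr_id[OF T(1,2)] that Th by blast
  have prd: "dist q (pr T q) = ?h q - c" "?h (pr T q) = c" if "q \<in> H" "c \<le> ?h q" for q
    using pr_tube[OF CC3 that(1) _ that(2)] c by (auto simp: T_def)
  have prcont: "continuous_on H (pr T)"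
    by (rule lipschitz_on_continuous_on[of 1], rule lipschitz_onI) (use pr_lip[OF T] in auto)
  define \<zeta> where "\<zeta> t = pr T (g t)" for t
  have \<zeta>c: "continuous_on {0..l} \<zeta>" unfolding \<zeta>_def[abs_def]
    by (rule continuous_on_compose2[OF prcont gc]) (use gH in auto)
  have \<zeta>0: "\<zeta> 0 = z" "\<zeta> l = x" using ends prid H hz c by (auto simp: \<zeta>_def)
  have \<zeta>lip: "dist (\<zeta> s) (\<zeta> t) \<le> \<bar>s - t\<bar>" if "s \<in> {0..l}" "t \<in> {0..l}" for s t
  proof -
    have "dist (\<zeta> s) (\<zeta> t) \<le> dist (g s) (g t)" using pr_lip[OF T gH[OF that(1)] gH[OF that(2)]] by (simp add: \<zeta>_def)
    then show ?thesis using geod_dist[OF g, of s t] that by (simp add: l_def)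
  qed
  obtain n1 n2 k where N: "0 \<le> n1" "n1 < n2" "n2 \<le> l" "0 < k" and Nc: "\<And>a. a \<in> {n1..n2} \<Longrightarrow> c \<le> ?h (g a)"
    and Nk: "\<And>a b. a \<in> {n1..n2} \<Longrightarrow> b \<in> {n1..n2} \<Longrightarrow> a \<le> b \<Longrightarrow> k * (b - a) \<le> ?h (g b) - ?h (g a)"
  proof -
    let ?A = "{t \<in> {0..l}. ?h (g t) = m}"
    have "?A = {0..l} \<inter> (\<lambda>t. ?h (g t)) -` {m}" by auto
    then have "closed ?A" using continuous_closed_preimage[OF hc] by simp
    moreover have "bounded ?A" by (rule bounded_subset[of "{0..l}"]) auto
    ultimately have cA: "compact ?A" by (simp add: compact_eq_bounded_closed)
    have "tm \<in> ?A" using m(1,2) by (simp add: l_def)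
    then have nA: "?A \<noteq> {}" by blast
    \<comment> \<open>The first time of maximal height is used, so that the height is smaller at
      every earlier time.\<close>
    obtain tv where tvA: "tv \<in> ?A" "\<forall>s\<in>?A. tv \<le> s" by (rule bexE[OF compact_attains_inf[OF cA nA]])
    have tv: "tv \<in> ?A" "\<And>s. s \<in> ?A \<Longrightarrow> tv \<le> s" by (rule tvA, rule bspec[OF tvA(2)])
    have "tv \<noteq> 0" using tv(1) ends(1) hz(1) m0 by auto
    then have tv0: "0 < tv" "tv \<le> l" using tv(1) by auto
    have "\<exists>C\<in>CC. \<exists>t\<in>{0..<tv}. g tv \<in> C \<and> g t \<in> C"
      by (rule left_hit[OF fin cl]) (use continuous_on_subset[OF gc] gX tv0 in auto)
    then obtain C0 s where s: "C0 \<in> CC" "s \<in> {0..<tv}" "g tv \<in> C0" "g s \<in> C0" by blast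
    have "dist (g s) (g tv) = D (g s) (g tv)" using cd_same[OF s(1,4,3)] by simp
    also have "\<dots> = tv - s" using cgeodD(4)[OF g, of s tv] s tv0 by (auto simp: l_def)
    finally have ds: "dist (g s) (g tv) = tv - s" .
    have conv: "(?h (g q) - ?h (g p)) * (r - q) \<le> (?h (g r) - ?h (g q)) * (q - p)" if "s \<le> p" "p < q" "q < r" "r \<le> tv" for p q r
      by (rule cgeod_infdist_convex[OF CC3 g _ _ _ ds that]) (use s tv0 in \<open>auto simp: l_def\<close>)
    have hs: "?h (g s) < m"
    proof -
      have "?h (g s) \<noteq> m" using tv(2)[of s] s tv0 by auto
      then show ?thesis using m(3)[of s] s tv0 by (auto simp: l_def)
    qed
    \<comment> \<open>Half of the mean slope between s and \<open>tv\<close>; by convexity on this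
      straight piece every chord close to \<open>tv\<close> is at least this steep.\<close>
    define k where "k = (m - ?h (g s)) / (tv - s) / 2"
    have k: "k > 0" using hs s by (simp add: k_def)
    have lim: "((\<lambda>t. ?h (g t)) \<longlongrightarrow> m) (at tv within {0..l})" using hc tv(1) by (auto simp: continuous_on_def)
    have "((\<lambda>t. ?h (g t) - ?h (g s) - k * (t - s)) \<longlongrightarrow> m - ?h (g s) - k * (tv - s)) (at tv within {0..l})"
      by (intro tendsto_intros lim)
    moreover have "k * (tv - s) = (m - ?h (g s)) / 2" using s by (simp add: k_def nonzero_divide_eq_eq)
    then have "m - ?h (g s) - k * (tv - s) > 0" using hs by simp
    ultimately have "\<forall>\<^sub>F t in at tv within {0..l}. 0 < ?h (g t) - ?h (g s) - k * (t - s)" by (rule order_tendstoD(1))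
    moreover have "\<forall>\<^sub>F t in at tv within {0..l}. c < ?h (g t)" using order_tendstoD(1)[OF lim c(2)] .
    ultimately have "\<forall>\<^sub>F t in at tv within {0..l}. 0 < ?h (g t) - ?h (g s) - k * (t - s) \<and> c < ?h (g t)" by eventually_elim auto
    then obtain d where d: "d > 0" "\<And>t. t \<in> {0..l} \<Longrightarrow> t \<noteq> tv \<Longrightarrow> dist t tv < d \<Longrightarrow> 0 < ?h (g t) - ?h (g s) - k * (t - s) \<and> c < ?h (g t)"
      unfolding eventually_at by blast
    define n1 where "n1 = max ((s + tv)/2) (tv - d/2)"
    have n1: "s < n1" "n1 < tv" "tv - d < n1" "0 \<le> n1" using s d by (auto simp: n1_def max_def)
    have near: "0 < ?h (g t) - ?h (g s) - k * (t - s) \<and> c < ?h (g t)" if "n1 \<le> t" "t < tv" for t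
      using d(2)[of t] that n1 tv0 by (auto simp: dist_real_def)
    show thesis
    proof (rule that[OF n1(4,2) tv0(2) k])
      show "c \<le> ?h (g a)" if "a \<in> {n1..tv}" for a using near[of a] that tv(1) c by (cases "a = tv") auto
      show "k * (b - a) \<le> ?h (g b) - ?h (g a)" if "a \<in> {n1..tv}" "b \<in> {n1..tv}" "a \<le> b" for a b
      proof (cases "a = b")
        case False
        then have ab: "n1 \<le> a" "a < b" "b \<le> tv" using that by auto
        have "k * (a - s) \<le> ?h (g a) - ?h (g s)" using near[of a] ab by auto
        then have "k * (a - s) * (b - a) \<le> (?h (g a) - ?h (g s)) * (b - a)" using ab by (intro mult_right_mono) auto
        also have "\<dots> \<le> (?h (g b) - ?h (g a)) * (a - s)" using conv[of s a b] ab n1 by auto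
        finally have "(a - s) * (k * (b - a)) \<le> (a - s) * (?h (g b) - ?h (g a))" by (simp add: mult_ac)
        then show ?thesis using ab n1 by (subst (asm) mult_le_cancel_left) auto
      qed simp
    qed
  qed
  \<comment> \<open>Pythagoras: of a step of length b - a, at least k (b - a) is spent on height and
    gets lost in the projection.\<close>
  define q where "q = sqrt (1 - k\<^sup>2)"
  have k1: "k \<le> 1"
  proof -
    have "k * (n2 - n1) \<le> ?h (g n2) - ?h (g n1)" using Nk[of n1 n2] N by auto
    also have "\<dots> \<le> dist (g n2) (g n1)" using infdist_triangle[of "g n2" C "g n1"] by simp
    also have "\<dots> \<le> n2 - n1" using geod_dist[OF g, of n2 n1] N by (auto simp: l_def)
    finally show ?thesis using N by simp
  qed
  then have k2: "k\<^sup>2 \<le> 1" using N by (simp add: power_le_one)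
  have q: "0 \<le> q" "q < 1" "q\<^sup>2 = 1 - k\<^sup>2" using N k2 by (auto simp: q_def)
  have Nq: "dist (\<zeta> a) (\<zeta> b) \<le> q * \<bar>a - b\<bar>" if ab: "a \<in> {n1..n2}" "b \<in> {n1..n2}" "a \<le> b" for a b
  proof -
    have in0: "a \<in> {0..l}" "b \<in> {0..l}" using ab N by auto
    have kk: "k * (b - a) \<le> ?h (g b) - ?h (g a)" by (rule Nk[OF ab])
    then have k0: "0 \<le> k * (b - a)" using N ab by auto
    have "?h (g a) \<le> ?h (g b)" using kk k0 by linarith
    then have "(dist (\<zeta> a) (\<zeta> b))\<^sup>2 + (?h (g b) - ?h (g a))\<^sup>2 \<le> (dist (g a) (g b))\<^sup>2"
      using pr_tube_contract[OF CC3 gH[OF in0(1)] gH[OF in0(2)], of c] Nc[OF ab(1)] c by (auto simp: \<zeta>_def T_def)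
    moreover have "(k * (b - a))\<^sup>2 \<le> (?h (g b) - ?h (g a))\<^sup>2" using kk k0 by (intro power_mono)
    moreover have "(dist (g a) (g b))\<^sup>2 \<le> (b - a)\<^sup>2" using geod_dist[OF g, of a b] in0 ab by (intro power_mono) (auto simp: l_def)
    ultimately have "(dist (\<zeta> a) (\<zeta> b))\<^sup>2 \<le> (b - a)\<^sup>2 - (k * (b - a))\<^sup>2" by linarith
    also have "\<dots> = (q * (b - a))\<^sup>2" unfolding power_mult_distrib q(3) by (simp only: left_diff_distrib mult_1)
    finally have sq: "(dist (\<zeta> a) (\<zeta> b))\<^sup>2 \<le> (q * (b - a))\<^sup>2" .
    have "0 \<le> q * (b - a)" using q(1) ab(3) by simp
    then have "dist (\<zeta> a) (\<zeta> b) \<le> q * (b - a)" by (rule power2_le_imp_le[OF sq])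
    then show ?thesis using ab by simp
  qed
  have Nq': "dist (\<zeta> a) (\<zeta> b) \<le> q * \<bar>a - b\<bar>" if "a \<in> {n1..n2}" "b \<in> {n1..n2}" for a b
    using Nq[of a b] Nq[of b a] that by (cases "a \<le> b") (auto simp: dist_commute abs_minus_commute)
  \<comment> \<open>If W took all values in \<open>{0..l}\<close> at times when the projected curve
    is in X, this would contradict \<open>no_cover\<close>. Only two times with values in one member
    can be compared directly, hence the pieces \<open>Z S\<close>.\<close>
  define W where "W t = D z (\<zeta> t)" for t
  define Z where "Z S = {t \<in> {0..l}. \<zeta> t \<in> S}" for S
  have Zc: "compact (Z S) \<and> Z S \<subseteq> {0..l}" if "S \<in> CC" for S
  proof -
    have "Z S = {0..l} \<inter> \<zeta> -` S" by (auto simp: Z_def)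
    then have "closed (Z S)" using continuous_closed_preimage[OF \<zeta>c _ cl[OF that]] by simp
    moreover have "bounded (Z S)" by (rule bounded_subset[of "{0..l}"]) (auto simp: Z_def)
    ultimately show ?thesis by (auto simp: compact_eq_bounded_closed Z_def)
  qed
  have WZ: "\<bar>W s - W t\<bar> \<le> dist (\<zeta> s) (\<zeta> t)" if "S \<in> CC" "s \<in> Z S" "t \<in> Z S" for S s t
  proof -
    have S: "\<zeta> s \<in> S" "\<zeta> t \<in> S" using that by (auto simp: Z_def)
    then have "\<bar>W s - W t\<bar> \<le> D (\<zeta> s) (\<zeta> t)" unfolding W_def using D_lip[OF xyz(1)] that by blast
    then show ?thesis using cd_same[OF that(1) S] by simp
  qed
  have "\<not> {0..l} \<subseteq> (\<Union>S\<in>CC. W ` Z S)"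
  proof (rule no_cover[OF fin Zc _ N(1,2,3) q(1,2)])
    show "\<bar>W s - W t\<bar> \<le> \<bar>s - t\<bar>" if "S \<in> CC" "s \<in> Z S" "t \<in> Z S" for S s t
      using WZ[OF that] \<zeta>lip[of s t] that by (auto simp: Z_def)
    show "\<bar>W s - W t\<bar> \<le> q * \<bar>s - t\<bar>" if "S \<in> CC" "s \<in> Z S \<inter> {n1..n2}" "t \<in> Z S \<inter> {n1..n2}" for S s t
      using WZ[of S s t] Nq'[of s t] that by auto
  qed auto
  then obtain r where r: "r \<in> {0..l}" "\<And>S t. S \<in> CC \<Longrightarrow> t \<in> Z S \<Longrightarrow> W t \<noteq> r" by blast
  have rne: "D z (\<zeta> t) \<noteq> r" if "t \<in> {0..l}" "\<zeta> t \<in> X" for t using r(2) that unfolding W_def Z_def by blast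
  have r0: "0 < r" "r < l"
    using rne[of 0] rne[of l] \<zeta>0 xyz l0 r(1) cd_self[of z CC] by (auto simp: l_def order_less_le)
  define G where "G = \<zeta> ` {0..l} \<inter> X"
  have Gc: "compact G" unfolding G_def by (intro compact_Int_closed compact_continuous_image \<zeta>c closed_X) auto
  \<comment> \<open>The missing value r splits the part of the projected curve in X into two
    disjoint closed sets, one containing z and the other x.\<close>
  define K1 where "K1 = {p \<in> G. D z p \<le> r}"
  define K2 where "K2 = {p \<in> G. r \<le> D z p}"
  have Dc: "continuous_on G (D z)" using continuous_on_subset[OF D_cont[OF xyz(1)]] by (auto simp: G_def)
  have Kcl: "closed K1" "closed K2"
  proof -
    have "K1 = G \<inter> D z -` {..r}" "K2 = G \<inter> D z -` {r..}" by (auto simp: K1_def K2_def)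
    then show "closed K1" "closed K2" using continuous_closed_preimage[OF Dc compact_imp_closed[OF Gc]] by auto
  qed
  have GK: "D z p \<noteq> r" if "p \<in> G" for p
  proof -
    from that obtain t where t: "t \<in> {0..l}" "p = \<zeta> t" "p \<in> X" unfolding G_def by blast
    show ?thesis using rne[OF t(1)] t(2,3) by simp
  qed
  have K12: "K1 \<inter> K2 = {}" "K1 \<union> K2 = G" using GK by (auto simp: K1_def K2_def)
  have zK1: "z \<in> K1" using \<zeta>0 xyz l0 r0 cd_self[of z CC] by (auto simp: K1_def G_def image_iff intro!: bexI[of _ 0])
  have xK2: "x \<in> K2" using \<zeta>0 xyz l0 r0 by (auto simp: K2_def G_def image_iff l_def intro!: bexI[of _ l])
  \<comment> \<open>The shadow of the outer part of g' at level c. By the choice of c it misses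
    \<open>K1\<close>.\<close>
  define I' where "I' = pr T ` (g' ` {t \<in> {0..l'}. c \<le> ?h (g' t)})"
  have I'cl: "closed I'"
  proof -
    have "{t \<in> {0..l'}. c \<le> ?h (g' t)} = {0..l'} \<inter> (\<lambda>t. ?h (g' t)) -` {c..}" by auto
    moreover have "closed \<dots>" by (rule continuous_closed_preimage) (auto intro!: continuous_intros gc')
    ultimately have "closed {t \<in> {0..l'}. c \<le> ?h (g' t)}" by simp
    moreover have "bounded {t \<in> {0..l'}. c \<le> ?h (g' t)}" by (rule bounded_subset[of "{0..l'}"]) auto
    ultimately have "compact {t \<in> {0..l'}. c \<le> ?h (g' t)}" by (simp add: compact_eq_bounded_closed)
    then have "compact I'" unfolding I'_def
      by (intro compact_continuous_image) (use gH' in \<open>auto intro!: continuous_on_subset[OF gc'] continuous_on_subset[OF prcont]\<close>)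
    then show ?thesis by (rule compact_imp_closed)
  qed
  have KI: "K1 \<inter> I' = {}"
  proof (rule equals0I)
    fix p assume p: "p \<in> K1 \<inter> I'"
    then obtain t' where t': "t' \<in> {0..l'}" "c \<le> ?h (g' t')" "p = pr T (g' t')" by (auto simp: I'_def)
    obtain t where t: "t \<in> {0..l}" "p = \<zeta> t" using p by (auto simp: K1_def G_def)
    have hp: "?h p = c" using prd(2)[OF gH'[OF t'(1)] t'(2)] t'(3) by simp
    show False
    proof (cases "c \<le> ?h (g t)")
      case True then show False using cdis[OF t(1) t'(1) True t'(2)] t t' by (simp add: \<zeta>_def T_def)
    next
      case False then have "\<zeta> t = g t" using prid gH t by (simp add: \<zeta>_def)
      then show False using False hp t by simp
    qed
  qed
  \<comment> \<open>Positive on \<open>K1\<close>, negative on \<open>K2\<close> and on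
    \<open>I'\<close>. Hence the points of the projected curve at which it vanishes lie off
    X.\<close>
  define f1 where "f1 p = infdist p (K2 \<union> I') - infdist p K1" for p
  have cl2: "closed (K2 \<union> I')" "K2 \<union> I' \<noteq> {}" using Kcl I'cl xK2 by auto
  have cl1: "closed K1" "K1 \<noteq> {}" using Kcl zK1 by auto
  have f1pos: "0 < f1 p" if "p \<in> K1" for p
  proof -
    have "p \<notin> K2 \<union> I'" using K12 KI that by auto
    then have "infdist p (K2 \<union> I') \<noteq> 0" using in_closed_iff_infdist_zero[OF cl2] by blast
    then show ?thesis using that infdist_nonneg[of p "K2 \<union> I'"] by (simp add: f1_def order_less_le)
  qed
  have f1neg: "f1 p < 0" if "p \<in> K2 \<union> I'" for p
  proof -
    have "p \<notin> K1" using K12 KI that by auto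
    then have "infdist p K1 \<noteq> 0" using in_closed_iff_infdist_zero[OF cl1] by blast
    then show ?thesis using that infdist_nonneg[of p K1] infdist_zero[of p "K2 \<union> I'"] by (simp add: f1_def order_less_le)
  qed
  have f1c: "continuous_on A f1" for A unfolding f1_def[abs_def] by (intro continuous_intros)
  have f1G: "\<zeta> t \<notin> X" if "t \<in> {0..l}" "f1 (\<zeta> t) = 0" for t
  proof
    assume "\<zeta> t \<in> X"
    then have "\<zeta> t \<in> G" using that(1) by (simp add: G_def)
    then have "\<zeta> t \<in> K1 \<or> \<zeta> t \<in> K2" using K12(2) by blast
    then show False using f1pos[of "\<zeta> t"] f1neg[of "\<zeta> t"] that(2) by auto
  qed
  obtain \<eta> where \<eta>: "\<eta> > 0" "\<And>t. t \<in> {0..l} \<Longrightarrow> f1 (\<zeta> t) = 0 \<Longrightarrow> \<eta> \<le> infdist (\<zeta> t) X"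
  proof -
    let ?Q = "{t \<in> {0..l}. f1 (\<zeta> t) = 0}"
    have cf: "continuous_on {0..l} (\<lambda>t. f1 (\<zeta> t))" by (rule continuous_on_compose2[OF f1c \<zeta>c]) auto
    have "?Q = {0..l} \<inter> (\<lambda>t. f1 (\<zeta> t)) -` {0}" by auto
    moreover have "closed \<dots>" by (rule continuous_closed_preimage[OF cf]) auto
    ultimately have "closed ?Q" by simp
    moreover have "bounded ?Q" by (rule bounded_subset[of "{0..l}"]) auto
    ultimately have cQ: "compact ?Q" by (simp add: compact_eq_bounded_closed)
    show thesis
    proof (cases "?Q = {}")
      case True then show thesis using that[of 1] by auto
    next
      case False
      have "continuous_on ?Q (\<lambda>t. infdist (\<zeta> t) X)" by (intro continuous_intros continuous_on_subset[OF \<zeta>c]) auto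
      then obtain t0 where t0: "t0 \<in> ?Q" "\<And>t. t \<in> ?Q \<Longrightarrow> infdist (\<zeta> t0) X \<le> infdist (\<zeta> t) X"
        using continuous_attains_inf[OF cQ False] by blast
      have nX: "\<zeta> t0 \<notin> X" using f1G t0 by auto
      have "X \<noteq> {}" using xyz(1) by blast
      then have "infdist (\<zeta> t0) X \<noteq> 0" using in_closed_iff_infdist_zero[OF closed_X] nX by metis
      then have "0 < infdist (\<zeta> t0) X" using infdist_nonneg[of "\<zeta> t0" X] by linarith
      then show thesis using that[of "infdist (\<zeta> t0) X"] t0 by auto
    qed
  qed
  obtain \<mu> where \<mu>: "0 < \<mu>" "\<mu> \<le> \<eta>" "\<mu> \<le> m - c" using that[of "min \<eta> (m - c)"] \<eta>(1) c by auto
  \<comment> \<open>The level is raised by less than \<open>\<eta>\<close>, so a point of X at this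
    height has its foot on the tube closer than \<open>\<eta>\<close> to X.\<close>
  define c' where "c' = c + \<mu> / 2"
  have c': "c < c'" "c' < m" "c' - c < \<eta>" using \<mu> by (auto simp: c'_def)
  \<comment> \<open>Where the real part vanishes, g runs above the level c', and g' with the segment
    in C runs below it. So the loop formed by both goes around 0 once.\<close>
  define F where "F p = Complex (f1 (pr T p)) (?h p - c')" for p
  have Fc: "continuous_on H F"
  proof -
    have "continuous_on H (\<lambda>p. complex_of_real (f1 (pr T p)) + \<i> * complex_of_real (?h p - c'))"
      by (intro continuous_intros continuous_on_compose2[OF f1c prcont]) auto
    then show ?thesis by (simp add: F_def[abs_def] Complex_eq)
  qed
  define \<alpha> where "\<alpha> s = g (l * s)" for s
  \<comment> \<open>The second path runs along g' and then along the segment in C; like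
    \<open>\<alpha>\<close> it leads from z to x.\<close>
  define \<beta> where "\<beta> s = (if s \<le> 1/2 then g' (2 * s * l') else P y x (2 * s - 1))" for s
  have \<alpha>t: "l * s \<in> {0..l}" if "0 \<le> s" "s \<le> 1" for s using that l0 by (auto simp: mult_left_le)
  have \<beta>t: "2 * s * l' \<in> {0..l'}" if "0 \<le> s" "s \<le> 1/2" for s using that l0 by (auto intro: mult_left_le_one_le)
  have Cseg: "P y x u \<in> C" if "0 \<le> u" "u \<le> 1" for u using cvxD[OF C(2) inC(3,2)] that by auto
  have \<alpha>c: "continuous_on {0..1} \<alpha>" unfolding \<alpha>_def[abs_def]
    by (rule continuous_on_compose2[OF gc]) (use \<alpha>t in \<open>auto intro!: continuous_intros\<close>)
  have \<beta>c: "continuous_on {0..1} \<beta>"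
  proof -
    have "continuous_on ({0..1/2} \<union> {1/2..1}) (\<lambda>s. if s \<le> 1/2 then g' (2 * s * l') else P y x (2 * s - 1))"
    proof (rule continuous_on_cases)
      show "continuous_on {0..1/2} (\<lambda>s. g' (2 * s * l'))"
        by (rule continuous_on_compose2[OF gc']) (use \<beta>t in \<open>auto intro!: continuous_intros\<close>)
      show "continuous_on {1/2..1} (\<lambda>s. P y x (2 * s - 1))" using H by (intro P_continuous continuous_intros) auto
      show "\<forall>s. s \<in> {0..1/2} \<and> \<not> s \<le> 1/2 \<or> s \<in> {1/2..1} \<and> s \<le> 1/2 \<longrightarrow> g' (2 * s * l') = P y x (2 * s - 1)"
      proof (intro allI impI)
        fix s :: real assume "s \<in> {0..1/2} \<and> \<not> s \<le> 1/2 \<or> s \<in> {1/2..1} \<and> s \<le> 1/2"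
        then have "2 * s = 1" by auto
        then show "g' (2 * s * l') = P y x (2 * s - 1)" using ends H by (simp only: mult_1 diff_self P_0)
      qed
    qed auto
    moreover have "{0..1/2} \<union> {1/2..1} = {0..1::real}" by auto
    ultimately show ?thesis by (simp add: \<beta>_def[abs_def])
  qed
  have \<alpha>X: "\<alpha> s \<in> X" if "0 \<le> s" "s \<le> 1" for s using gX \<alpha>t[OF that] by (simp add: \<alpha>_def)
  have \<beta>X: "\<beta> s \<in> X" if "0 \<le> s" "s \<le> 1" for s
  proof (cases "s \<le> 1/2")
    case True then show ?thesis using gX' \<beta>t[of s] that by (simp add: \<beta>_def)
  next
    case False
    then have "P y x (2 * s - 1) = P x y (1 - (2 * s - 1))" using H that by (intro P_sym) auto
    then show ?thesis using seg[of "1 - (2 * s - 1)"] False that by (simp add: \<beta>_def)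
  qed
  define \<Gamma> where "\<Gamma> v = (if 0 \<le> Im v then \<alpha> ((1 - Re v)/2) else \<beta> ((1 - Re v)/2))" for v
  have ab: "\<alpha> 0 = \<beta> 0" "\<alpha> 1 = \<beta> 1" using ends H by (auto simp: \<alpha>_def \<beta>_def)
  have \<Gamma>c: "continuous_on (sphere 0 1) \<Gamma>" using continuous_bigon[OF \<alpha>c \<beta>c ab] by (simp add: \<Gamma>_def[abs_def])
  have \<Gamma>X: "\<Gamma> v \<in> X" if "norm v \<le> 1" for v using \<alpha>X \<beta>X bigon_par[OF that] by (auto simp: \<Gamma>_def)
  have ns: "norm (sgn v) \<le> 1" for v :: complex by (simp add: norm_sgn)
  have \<Gamma>H: "\<Gamma> (sgn v) \<in> H" for v using \<Gamma>X[OF ns] X_Hin by blast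
  \<comment> \<open>The outer annulus moves the loop to its projection on the tube, the inner disc
    is a cone from z inside the tube. So the height c' > c is reached only on the annulus, where the
    feet are those of loop points.\<close>
  define E where "E v = (if 1/2 \<le> norm v then P (pr T (\<Gamma> (sgn v))) (\<Gamma> (sgn v)) (2 * norm v - 1)
      else P z (pr T (\<Gamma> (sgn v))) (2 * norm v))" for v
  have Ec: "continuous_on (cball 0 1) E"
  proof -
    let ?A = "cball 0 1 \<inter> {v::complex. 1/2 \<le> norm v}" and ?B = "cball (0::complex) (1/2)"
    have sg: "continuous_on ?A (\<lambda>v. \<Gamma> (sgn v))"
    proof (rule continuous_on_compose2[OF \<Gamma>c])
      show "continuous_on ?A sgn" by (intro continuous_intros) auto
      show "sgn ` ?A \<subseteq> sphere 0 1"
      proof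
        fix q assume "q \<in> sgn ` ?A"
        then obtain v where "v \<in> ?A" "q = sgn v" by blast
        moreover from this have "v \<noteq> 0" by auto
        ultimately show "q \<in> sphere 0 1" using sgn_sphere by blast
      qed
    qed
    have sgp: "continuous_on ?A (\<lambda>v. pr T (\<Gamma> (sgn v)))"
      by (rule continuous_on_compose2[OF prcont sg]) (use \<Gamma>H in blast)
    have u: "continuous_on ?A (\<lambda>v. 2 * norm v - 1)" "(\<lambda>v. 2 * norm v - 1) ` ?A \<subseteq> {0..1}"
      by (intro continuous_intros, auto)
    have "continuous_on (?A \<union> ?B) (\<lambda>v. if 1/2 \<le> norm v then P (pr T (\<Gamma> (sgn v))) (\<Gamma> (sgn v)) (2 * norm v - 1)
      else P z (pr T (\<Gamma> (sgn v))) (2 * norm v))"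
    proof (rule continuous_on_cases)
      show "closed ?A" by (intro closed_Int closed_Collect_le continuous_intros) auto
      show "closed ?B" by simp
      show "continuous_on ?A (\<lambda>v. P (pr T (\<Gamma> (sgn v))) (\<Gamma> (sgn v)) (2 * norm v - 1))"
        by (rule P_continuous[OF sgp sg u(1) _ _ u(2)]) (use \<Gamma>H prH in blast)+
      have cc: "continuous_on (cball 0 1) (\<lambda>v. P z ((\<lambda>u. pr T (\<Gamma> (sgn u))) (sgn v)) (norm v))"
      proof (rule cone_continuous[OF _ _ H(1)])
        have "continuous_on (sphere 0 1) (\<lambda>u. \<Gamma> (sgn u))"
          by (rule continuous_on_subset[OF sg]) auto
        then show "continuous_on (sphere 0 1) (\<lambda>u. pr T (\<Gamma> (sgn u)))"
          by (rule continuous_on_compose2[OF prcont]) (use \<Gamma>H in auto)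
        show "pr T (\<Gamma> (sgn u)) \<in> H" for u by (rule prH[OF \<Gamma>H])
      qed
      have c2: "continuous_on ?B (\<lambda>v. 2 * v)" by (intro continuous_intros)
      have i2: "(\<lambda>v. 2 * v) ` ?B \<subseteq> cball 0 1" by (auto simp: norm_mult)
      have s2: "sgn (2 * v) = sgn v" for v :: complex by (simp add: sgn_mult sgn_eq)
      show "continuous_on ?B (\<lambda>v. P z (pr T (\<Gamma> (sgn v))) (2 * norm v))"
        using continuous_on_compose2[OF cc c2 i2] by (simp only: sgn_sgn s2 norm_mult norm_numeral)
      show "\<forall>v. v \<in> ?A \<and> \<not> 1/2 \<le> norm v \<or> v \<in> ?B \<and> 1/2 \<le> norm v \<longrightarrow>
        P (pr T (\<Gamma> (sgn v))) (\<Gamma> (sgn v)) (2 * norm v - 1) = P z (pr T (\<Gamma> (sgn v))) (2 * norm v)"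
      proof (intro allI impI)
        fix v assume "v \<in> ?A \<and> \<not> 1/2 \<le> norm v \<or> v \<in> ?B \<and> 1/2 \<le> norm v"
        then have n1: "2 * norm v = 1" by auto
        then show "P (pr T (\<Gamma> (sgn v))) (\<Gamma> (sgn v)) (2 * norm v - 1) = P z (pr T (\<Gamma> (sgn v))) (2 * norm v)"
          unfolding n1 using H prH[OF \<Gamma>H[of v]] \<Gamma>H[of v] by simp
      qed
    qed
    moreover have "?A \<union> ?B = cball 0 1" by auto
    ultimately show ?thesis by (simp add: E_def[abs_def])
  qed
  have EH: "E v \<in> H" if "norm v \<le> 1" for v
    using P_in[OF prH[OF \<Gamma>H[of v]] \<Gamma>H[of v]] P_in[OF H(1) prH[OF \<Gamma>H[of v]]] that by (auto simp: E_def)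
  have E1: "E v = (if 0 \<le> Im v then \<alpha> ((1 - Re v)/2) else \<beta> ((1 - Re v)/2))" if "norm v = 1" for v
  proof -
    have "sgn v = v" using that by (simp add: sgn_div_norm)
    then have "E v = \<Gamma> v" using that prH[OF \<Gamma>H[of v]] \<Gamma>H[of v] by (simp add: E_def)
    then show ?thesis by (simp add: \<Gamma>_def)
  qed
  have I'neg: "f1 (pr T (g' t)) < 0" if "t \<in> {0..l'}" "c \<le> ?h (g' t)" for t
    using f1neg that unfolding I'_def by blast
  \<comment> \<open>Where \<open>f1\<close> vanishes the projected point is at least
    \<open>\<eta>\<close> away from X, so g, which stays in X, must be higher than c' there.\<close>
  have FA: "0 < Im (F (\<alpha> s))" if s: "0 \<le> s" "s \<le> 1" "Re (F (\<alpha> s)) = 0" for s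
  proof (rule ccontr)
    assume "\<not> 0 < Im (F (\<alpha> s))"
    then have h: "?h (g (l * s)) \<le> c'" by (simp add: F_def \<alpha>_def)
    have t: "l * s \<in> {0..l}" using \<alpha>t s by blast
    have "f1 (\<zeta> (l * s)) = 0" using s by (simp add: F_def \<alpha>_def \<zeta>_def)
    then have "\<eta> \<le> infdist (\<zeta> (l * s)) X" using \<eta>(2) t by blast
    also have "\<dots> \<le> dist (\<zeta> (l * s)) (g (l * s))" using gX[OF t] by (rule infdist_le)
    also have "\<dots> \<le> c' - c"
    proof (cases "c \<le> ?h (g (l * s))")
      case True then show ?thesis using prd(1)[OF gH[OF t] True] h by (simp add: \<zeta>_def dist_commute)
    next
      case False then show ?thesis using prid[OF gH[OF t]] c' by (simp add: \<zeta>_def)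
    qed
    finally show False using c' by simp
  qed
  have FB: "Im (F (\<beta> s)) < 0" if s: "0 \<le> s" "s \<le> 1" "Re (F (\<beta> s)) = 0" for s
  proof (cases "s \<le> 1/2")
    case True
    then have t: "2 * s * l' \<in> {0..l'}" using \<beta>t s by blast
    show ?thesis using I'neg[OF t] s True c' by (force simp: F_def \<beta>_def)
  next
    case False
    then have "?h (\<beta> s) = 0" using Cseg[of "2 * s - 1"] s by (simp add: \<beta>_def)
    then show ?thesis using c c' by (simp add: F_def)
  qed
  have "\<exists>v. norm v \<le> 1 \<and> F (E v) = 0 \<and> E v \<in> X"
  proof (rule linking[OF closed_X X_H wX X_star \<alpha>c \<alpha>X \<beta>c \<beta>X ab Ec EH E1 Fc FA FB])
    show "0 < Re (F (\<alpha> 0))" using f1pos[OF zK1] \<zeta>0 by (simp add: F_def \<alpha>_def \<zeta>_def)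
    show "Re (F (\<alpha> 1)) < 0" using f1neg[of x] xK2 \<zeta>0 by (simp add: F_def \<alpha>_def \<zeta>_def)
  qed auto
  \<comment> \<open>Inside the cone the height is at most c. On the annulus the foot is that of a
    loop point \<open>\<xi>\<close> and is within \<open>\<eta>\<close> of X: over g this
    contradicts the choice of \<open>\<eta>\<close>, over g' the sign of \<open>f1\<close>, and over
    the segment the height.\<close>
  then obtain v where v: "norm v \<le> 1" "F (E v) = 0" "E v \<in> X" by blast
  have hE: "?h (E v) = c'" "f1 (pr T (E v)) = 0" using v(2) by (auto simp: F_def Complex_eq_0)
  show False
  proof (cases "1/2 \<le> norm v")
    case False
    have "pr T (\<Gamma> (sgn v)) \<in> T" by (rule prT(1)[OF \<Gamma>H])
    then have "E v \<in> T" using cvxD[OF T(2), of z "pr T (\<Gamma> (sgn v))" "2 * norm v"] inC CT False by (auto simp: E_def)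
    then show False using Th hE c' by auto
  next
    case True
    define \<xi> where "\<xi> = sgn v"
    have x1: "norm \<xi> = 1" using True by (auto simp: \<xi>_def norm_sgn)
    have \<Gamma>\<xi>: "\<Gamma> \<xi> \<in> H" using \<Gamma>H by (simp add: \<xi>_def)
    have Ev: "E v = P (pr T (\<Gamma> \<xi>)) (\<Gamma> \<xi>) (2 * norm v - 1)" using True by (simp add: E_def \<xi>_def)
    have prE: "pr T (E v) = pr T (\<Gamma> \<xi>)" unfolding Ev using pr_between[OF T \<Gamma>\<xi>] True v by auto
    have out: "c < ?h (\<Gamma> \<xi>)"
    proof (rule ccontr)
      assume "\<not> c < ?h (\<Gamma> \<xi>)"
      then have "E v = \<Gamma> \<xi>" using Ev prid[OF \<Gamma>\<xi>] \<Gamma>\<xi> True v by auto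
      then show False using hE c' \<open>\<not> c < ?h (\<Gamma> \<xi>)\<close> by simp
    qed
    have f0: "f1 (pr T (\<Gamma> \<xi>)) = 0" using hE prE by simp
    have "infdist (pr T (\<Gamma> \<xi>)) X \<le> dist (pr T (\<Gamma> \<xi>)) (E v)" by (rule infdist_le[OF v(3)])
    also have "\<dots> = c' - c" using prd(1)[OF EH[OF v(1)]] hE prE c' by (simp add: dist_commute)
    finally have near: "infdist (pr T (\<Gamma> \<xi>)) X < \<eta>" using c' by simp
    define s where "s = (1 - Re \<xi>)/2"
    have s: "0 \<le> s" "s \<le> 1" using bigon_par[of \<xi>] x1 by (auto simp: s_def)
    show False
    proof (cases "0 \<le> Im \<xi>")
      case True
      then have "\<Gamma> \<xi> = g (l * s)" by (simp add: \<Gamma>_def \<alpha>_def s_def)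
      then show False using \<eta>(2)[OF \<alpha>t[OF s]] f0 near by (simp add: \<zeta>_def)
    next
      case False
      then have \<Gamma>\<beta>: "\<Gamma> \<xi> = \<beta> s" by (simp add: \<Gamma>_def s_def)
      show False
      proof (cases "s \<le> 1/2")
        case True
        then have "\<Gamma> \<xi> = g' (2 * s * l')" using \<Gamma>\<beta> by (simp add: \<beta>_def)
        then show False using I'neg[OF \<beta>t[OF s(1) True]] f0 out by simp
      next
        case False
        then have "\<Gamma> \<xi> \<in> C" using \<Gamma>\<beta> Cseg[of "2 * s - 1"] s by (simp add: \<beta>_def)
        then show False using out c by simp
      qed
    qed
  qed
qed

text \<open>Apply \<open>excess_one\<close> to whichever geodesic rises higher above C; the
  hypotheses become symmetric once the segment is reversed.\<close>

lemma geodesics_in_convex: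
  assumes xyz: "z \<in> X" "x \<in> X" "y \<in> X" and g: "cgeod g z x" and g': "cgeod g' z y" and seg: "\<And>t. 0 \<le> t \<Longrightarrow> t \<le> 1 \<Longrightarrow> P x y t \<in> X"
    and C: "closed C" "cvx C" and inC: "z \<in> C" "x \<in> C" "y \<in> C"
    and common: "\<And>b b'. b \<in> {0..D z x} \<Longrightarrow> b' \<in> {0..D z y} \<Longrightarrow> g b = g' b' \<Longrightarrow> g b \<in> C"
    and t: "t \<in> {0..D z x}"
  shows "g t \<in> C"
proof -
  have H: "z \<in> H" "x \<in> H" "y \<in> H" using xyz X_Hin by auto
  have C0: "C \<noteq> {}" using inC by auto
  have l0: "0 \<le> D z x" "0 \<le> D z y" using D_nonneg xyz by auto
  have "continuous_on {0..D z x} (\<lambda>t. infdist (g t) C)" by (intro continuous_intros geod_cont[OF g])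
  then have "\<exists>a\<in>{0..D z x}. \<forall>t\<in>{0..D z x}. infdist (g t) C \<le> infdist (g a) C"
    using l0 by (intro continuous_attains_sup) auto
  then obtain a where a: "a \<in> {0..D z x}" "\<And>t. t \<in> {0..D z x} \<Longrightarrow> infdist (g t) C \<le> infdist (g a) C" by metis
  have "continuous_on {0..D z y} (\<lambda>t. infdist (g' t) C)" by (intro continuous_intros geod_cont[OF g'])
  then have "\<exists>b\<in>{0..D z y}. \<forall>t\<in>{0..D z y}. infdist (g' t) C \<le> infdist (g' b) C"
    using l0 by (intro continuous_attains_sup) auto
  then obtain b where b: "b \<in> {0..D z y}" "\<And>t. t \<in> {0..D z y} \<Longrightarrow> infdist (g' t) C \<le> infdist (g' b) C" by metis
  have "infdist (g a) C = 0"
  proof (cases "infdist (g' b) C \<le> infdist (g a) C")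
    case True
    show ?thesis
      by (rule excess_one[OF xyz g g' seg C inC common a(1) refl a(2)]) (use b(2) True in \<open>auto intro: order_trans\<close>)
  next
    case False
    have "infdist (g' b) C = 0"
    proof (rule excess_one[OF xyz(1,3,2) g' g _ C inC(1,3,2) _ b(1) refl b(2)])
      show "P y x t \<in> X" if "0 \<le> t" "t \<le> 1" for t using seg[of "1-t"] P_sym[of x y t] H that by auto
      show "g' b \<in> C" if "b \<in> {0..D z y}" "b' \<in> {0..D z x}" "g' b = g b'" for b b' using common[of b' b] that by auto
      show "infdist (g t) C \<le> infdist (g' b) C" if "t \<in> {0..D z x}" for t using a(2)[OF that] False by linarith
    qed
    then show ?thesis using False infdist_nonneg[of "g a" C] by linarith
  qed
  then have "infdist (g t) C = 0" using a(2)[OF t] infdist_nonneg[of "g t" C] by linarith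
  then show ?thesis using in_closed_iff_infdist_zero[OF C(1) C0] by blast
qed

end

section \<open>Curvature of the chain metric\<close>

text \<open>A positive maximum of the difference to the chord is attained at an interior point; at
  the first such point midpoint convexity forces an earlier one.\<close>

lemma local_midconvex:
  fixes \<psi> :: "real \<Rightarrow> real"
  assumes c: "continuous_on {0..1} \<psi>"
    and loc: "\<And>s. 0 < s \<Longrightarrow> s < 1 \<Longrightarrow> \<exists>e>0. \<forall>h. 0 < h \<longrightarrow> h < e \<longrightarrow> 0 \<le> s - h \<longrightarrow> s + h \<le> 1 \<longrightarrow> 2 * \<psi> s \<le> \<psi> (s + h) + \<psi> (s - h)"
    and t: "0 \<le> t" "t \<le> 1"
  shows "\<psi> t \<le> (1-t) * \<psi> 0 + t * \<psi> 1"
proof (rule ccontr)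
  assume no: "\<not> ?thesis"
  define \<omega> where "\<omega> u = \<psi> u - (1-u) * \<psi> 0 - u * \<psi> 1" for u
  have cc: "continuous_on {0..1} \<omega>" unfolding \<omega>_def[abs_def] by (intro continuous_intros c)
  have ne: "{0..1::real} \<noteq> {}" by simp
  from continuous_attains_sup[OF compact_Icc ne cc] obtain a where a: "a \<in> {0..1}" and amax: "\<forall>u\<in>{0..1}. \<omega> u \<le> \<omega> a" by (rule bexE)
  have tp: "0 < \<omega> t" using no by (simp add: \<omega>_def)
  have "t \<in> {0..1}" using t by simp
  then have ap: "0 < \<omega> a" using bspec[OF amax] tp by (meson less_le_trans)
  let ?A = "{0..1} \<inter> \<omega> -` {\<omega> a}"
  have "closed ?A" using continuous_closed_preimage[OF cc] by simp
  moreover have "bounded ?A" by (rule bounded_subset[of "{0..1}"]) auto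
  ultimately have cA: "compact ?A" by (simp add: compact_eq_bounded_closed)
  have nA: "?A \<noteq> {}" using a by blast
  obtain s where s: "s \<in> ?A" and smin: "\<forall>u\<in>?A. s \<le> u" by (rule bexE[OF compact_attains_inf[OF cA nA]])
  have cs: "\<omega> s = \<omega> a" "0 \<le> s" "s \<le> 1" using s by auto
  have "s \<noteq> 0" "s \<noteq> 1" using cs(1) ap by (auto simp: \<omega>_def)
  then have s01: "0 < s" "s < 1" using cs by auto
  obtain e where e: "e > 0" "\<And>h. 0 < h \<Longrightarrow> h < e \<Longrightarrow> 0 \<le> s - h \<Longrightarrow> s + h \<le> 1 \<Longrightarrow> 2 * \<psi> s \<le> \<psi> (s + h) + \<psi> (s - h)"
    using loc[OF s01] by metis
  obtain h where h: "0 < h" "h < e" "h \<le> s" "h \<le> 1 - s"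
    using that[of "min (e/2) (min s (1-s))"] e(1) s01 by auto
  have "2 * \<psi> s \<le> \<psi> (s + h) + \<psi> (s - h)" using e(2)[OF h(1,2)] h by simp
  then have "2 * \<omega> s \<le> \<omega> (s + h) + \<omega> (s - h)" by (simp add: \<omega>_def algebra_simps)
  moreover have "\<omega> (s + h) \<le> \<omega> a" by (rule bspec[OF amax]) (use h s01 in simp)
  moreover have "\<omega> (s - h) \<le> \<omega> a" by (rule bspec[OF amax]) (use h s01 in simp)
  ultimately have "\<omega> (s - h) = \<omega> a" using cs(1) by linarith
  then have "s - h \<in> ?A" using h s01 by simp
  then have "s \<le> s - h" by (rule bspec[OF smin])
  then show False using h(1) by simp
qed

section \<open>Segments, thin cones, and the last straight piece of a geodesic\<close>

context hadamard
begin

definition seg :: "'c \<Rightarrow> 'c \<Rightarrow> 'c set" where "seg x y = P x y ` {0..1}"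

lemma compact_seg: assumes "x \<in> H" "y \<in> H" shows "compact (seg x y)"
  unfolding seg_def by (intro compact_continuous_image P_continuous continuous_intros compact_Icc) (use assms in auto)

lemma seg_ends: assumes "x \<in> H" "y \<in> H" shows "x \<in> seg x y" "y \<in> seg x y"
  unfolding seg_def using assms by (auto simp: image_iff intro: bexI[of _ 0] bexI[of _ 1])

lemma seg_subD: "seg x y \<subseteq> S \<Longrightarrow> 0 \<le> t \<Longrightarrow> t \<le> 1 \<Longrightarrow> P x y t \<in> S"
  unfolding seg_def by (rule subsetD) auto

lemma P_seg:
  assumes xy: "x \<in> H" "y \<in> H" and s: "0 \<le> s" "s \<le> 1" and t: "0 \<le> t" "t \<le> 1" and r: "0 \<le> r" "r \<le> 1"
  shows "P (P x y s) (P x y t) r = P x y ((1-r) * s + r * t)"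
proof (rule P_unique[symmetric])
  have u: "0 \<le> (1-r) * s + r * t" "(1-r) * s + r * t \<le> 1" using convex_bound_le[of s 1 t "1-r" r] s t r by auto
  show "P x y ((1-r) * s + r * t) \<in> H" using P_in[OF xy u] .
  have d: "dist (P x y s) (P x y t) = \<bar>t - s\<bar> * dist x y" by (rule dist_P_P[OF xy s t])
  have "dist (P x y s) (P x y ((1-r) * s + r * t)) = \<bar>((1-r) * s + r * t) - s\<bar> * dist x y" by (rule dist_P_P[OF xy s u])
  also have "((1-r) * s + r * t) - s = r * (t - s)" by (simp add: algebra_simps)
  finally show "dist (P x y s) (P x y ((1-r) * s + r * t)) \<le> r * dist (P x y s) (P x y t)"
    using r by (simp add: d abs_mult)
  have "dist (P x y t) (P x y ((1-r) * s + r * t)) = \<bar>((1-r) * s + r * t) - t\<bar> * dist x y" by (rule dist_P_P[OF xy t u])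
  also have "((1-r) * s + r * t) - t = (1-r) * (s - t)" by (simp add: algebra_simps)
  finally show "dist (P x y t) (P x y ((1-r) * s + r * t)) \<le> (1-r) * dist (P x y s) (P x y t)"
    using r by (simp add: d abs_mult abs_minus_commute)
qed (use xy s t r in \<open>auto intro: P_in\<close>)

lemma cvx_seg: assumes "x \<in> H" "y \<in> H" shows "cvx (seg x y)"
proof -
  have "P u v r \<in> seg x y" if u: "u \<in> seg x y" "v \<in> seg x y" and r: "0 \<le> r" "r \<le> 1" for u v r
  proof -
    obtain s t where st: "u = P x y s" "v = P x y t" "0 \<le> s" "s \<le> 1" "0 \<le> t" "t \<le> 1" using u by (auto simp: seg_def)
    have "0 \<le> (1-r) * s + r * t" "(1-r) * s + r * t \<le> 1" using convex_bound_le[of s 1 t "1-r" r] st r by auto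
    then show ?thesis using P_seg[OF assms st(3-6) r] unfolding st(1,2) seg_def by auto
  qed
  moreover have "seg x y \<subseteq> H" using P_in assms by (auto simp: seg_def)
  ultimately show ?thesis by (auto simp: cvx_def)
qed

text \<open>The set contains every point of H within \<open>\<delta>\<close> of x, but is pinched to
  a point at z. It is the convex set to which \<open>geodesics_in_convex\<close> will confine
  geodesics from z to x and to a nearby point.\<close>

definition cone :: "'c \<Rightarrow> 'c \<Rightarrow> real \<Rightarrow> 'c set" where
  "cone z x \<delta> = {q \<in> H. \<exists>l\<in>{0..1}. dist q (P z x l) \<le> l * \<delta>}"

lemma closed_cone:
  assumes "z \<in> H" "x \<in> H" shows "closed (cone z x \<delta>)"
proof (unfold closed_sequential_limits, intro allI impI)
  fix q l assume q: "(\<forall>n. q n \<in> cone z x \<delta>) \<and> q \<longlonglongrightarrow> l"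
  have "\<exists>k. k \<in> {0..1} \<and> dist (q n) (P z x k) \<le> k * \<delta>" for n
  proof -
    have "q n \<in> cone z x \<delta>" using q by simp
    then show ?thesis unfolding cone_def by blast
  qed
  then obtain k where k: "\<And>n. k n \<in> {0..1}" "\<And>n. dist (q n) (P z x (k n)) \<le> k n * \<delta>" by metis
  obtain a r where r: "a \<in> {0..1}" "strict_mono (r :: nat \<Rightarrow> nat)" "(k \<circ> r) \<longlonglongrightarrow> a"
    using compact_Icc[of 0 "1::real"] k(1) unfolding compact_def by meson
  have kr: "(\<lambda>n. k (r n)) \<longlonglongrightarrow> a" using r(3) by (simp add: o_def)
  have ql: "(\<lambda>n. q (r n)) \<longlonglongrightarrow> l" using LIMSEQ_subseq_LIMSEQ[of q l r] q r(2) by (simp add: o_def)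
  have Pc: "continuous_on {0..1} (P z x)" by (intro P_continuous continuous_intros) (use assms in auto)
  have "(\<lambda>n. P z x (k (r n))) \<longlonglongrightarrow> P z x a" by (rule continuous_on_tendsto_compose[OF Pc kr r(1)]) (use k(1) in auto)
  then have "(\<lambda>n. dist (q (r n)) (P z x (k (r n)))) \<longlonglongrightarrow> dist l (P z x a)" by (intro tendsto_dist ql)
  moreover have "(\<lambda>n. k (r n) * \<delta>) \<longlonglongrightarrow> a * \<delta>" by (intro tendsto_intros kr)
  ultimately have "dist l (P z x a) \<le> a * \<delta>" by (rule LIMSEQ_le) (use k(2) in auto)
  moreover have "l \<in> H" by (rule closed_sequentially[OF closed_H]) (use q in \<open>auto simp: cone_def\<close>)
  ultimately show "l \<in> cone z x \<delta>" using r(1) by (auto simp: cone_def)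
qed

lemma cvx_cone:
  assumes zx: "z \<in> H" "x \<in> H" shows "cvx (cone z x \<delta>)"
proof -
  have "P u v r \<in> cone z x \<delta>" if u: "u \<in> cone z x \<delta>" "v \<in> cone z x \<delta>" and r: "0 \<le> r" "r \<le> 1" for u v r
  proof -
    obtain s t where st: "0 \<le> s" "s \<le> 1" "dist u (P z x s) \<le> s * \<delta>" "0 \<le> t" "t \<le> 1" "dist v (P z x t) \<le> t * \<delta>"
      using u by (auto simp: cone_def)
    have H: "u \<in> H" "v \<in> H" using u by (auto simp: cone_def)
    have k: "0 \<le> (1-r) * s + r * t" "(1-r) * s + r * t \<le> 1" using convex_bound_le[of s 1 t "1-r" r] st r by auto
    have "dist (P u v r) (P (P z x s) (P z x t) r) \<le> (1-r) * dist u (P z x s) + r * dist v (P z x t)"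
      using P_busemann H P_in[OF zx] st r by auto
    also have "\<dots> \<le> (1-r) * (s * \<delta>) + r * (t * \<delta>)" using st r by (intro add_mono mult_left_mono) auto
    also have "\<dots> = ((1-r) * s + r * t) * \<delta>" by (simp add: algebra_simps)
    finally have "dist (P u v r) (P z x ((1-r) * s + r * t)) \<le> ((1-r) * s + r * t) * \<delta>"
      using P_seg[OF zx st(1,2,4,5) r] by simp
    then show ?thesis using P_in[OF H r] k by (auto simp: cone_def)
  qed
  then show ?thesis by (auto simp: cvx_def cone_def)
qed

end

context star
begin

lemma D_dist_le: "x \<in> X \<Longrightarrow> y \<in> X \<Longrightarrow> seg x y \<subseteq> X \<Longrightarrow> D x y = dist x y"
  by (rule D_seg) (auto simp: seg_def X_Hin subset_iff)

lemma cgeod_sub: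
  assumes g: "cgeod g a b" and st: "0 \<le> s" "s \<le> t" "t \<le> D a b"
  shows "cgeod (\<lambda>u. g (s + u)) (g s) (g t)" "D (g s) (g t) = t - s"
proof -
  show d: "D (g s) (g t) = t - s" using cgeodD(4)[OF g, of s t] st by simp
  show "cgeod (\<lambda>u. g (s + u)) (g s) (g t)" unfolding cgeod_def d
    using cgeodD(3)[OF g] cgeodD(4)[OF g] st by auto
qed

text \<open>By the intermediate value theorem the curve passes through every point of the segment,
  so the segment lies in X and \<open>D_dist_le\<close> applies.\<close>

lemma cgeod_in_seg:
  assumes g: "cgeod g a b" and ab: "a \<in> X" "b \<in> X" and sub: "\<And>t. t \<in> {0..D a b} \<Longrightarrow> g t \<in> seg a b"
  shows "dist a b = D a b"
proof (rule D_dist_le[symmetric, OF ab])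
  have H: "a \<in> H" "b \<in> H" using ab X_Hin by auto
  show "seg a b \<subseteq> X"
  proof
    fix q assume "q \<in> seg a b"
    then obtain s where s: "q = P a b s" "0 \<le> s" "s \<le> 1" by (auto simp: seg_def)
    have "continuous_on {0..D a b} (\<lambda>t. dist a (g t))" by (intro continuous_intros geod_cont[OF g])
    moreover have "dist a (g 0) \<le> s * dist a b" "s * dist a b \<le> dist a (g (D a b))" using cgeodD(1,2)[OF g] s by (auto simp: mult_left_le_one_le)
    ultimately obtain t where t: "0 \<le> t" "t \<le> D a b" "dist a (g t) = s * dist a b"
      using IVT'[of "\<lambda>t. dist a (g t)" 0 "s * dist a b" "D a b"] D_nonneg[OF ab] by auto
    obtain k where k: "g t = P a b k" "0 \<le> k" "k \<le> 1" using sub[of t] t by (auto simp: seg_def)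
    have "k * dist a b = s * dist a b" using t(3) dist_P_left[OF H k(2,3)] k(1) by simp
    then have "P a b k = P a b s" using H k s by (cases "a = b") auto
    then show "q \<in> X" using s k cgeodD(3)[OF g t(1,2)] by simp
  qed
qed

text \<open>The parameter at which the last straight piece of a geodesic ending in \<open>x\<close> begins.\<close>

definition turn :: "(real \<Rightarrow> 'a) \<Rightarrow> 'a \<Rightarrow> real \<Rightarrow> real" where
  "turn g x l = Inf {t \<in> {0..l}. dist (g t) x = l - t}"

text \<open>The infimum is attained because the set of parameters is closed. By
  \<open>left_hit\<close> the end and some earlier point share a member, so the last straight piece
  is not degenerate.\<close>

lemma turn_props:
  assumes g: "cgeod g p x" and px: "p \<in> X" "x \<in> X" and l: "l = D p x" "0 < l"
  shows "0 \<le> turn g x l" "turn g x l < l" "dist (g (turn g x l)) x = l - turn g x l"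
    "\<And>t. 0 \<le> t \<Longrightarrow> t < turn g x l \<Longrightarrow> dist (g t) x < l - t"
proof -
  let ?A = "{t \<in> {0..l}. dist (g t) x = l - t}"
  have gl: "g l = x" using cgeodD(2)[OF g] l by simp
  have c: "continuous_on {0..l} (\<lambda>t. dist (g t) x + t)" by (intro continuous_intros) (use geod_cont[OF g] l in simp)
  have "?A = {0..l} \<inter> (\<lambda>t. dist (g t) x + t) -` {l}" by auto
  then have "closed ?A" using continuous_closed_preimage[OF c] by simp
  moreover have bd: "bdd_below ?A" by (rule bdd_belowI[of _ 0]) auto
  moreover have "l \<in> ?A" using gl l by simp
  ultimately have tA: "turn g x l \<in> ?A" unfolding turn_def using closed_contains_Inf[of ?A] by blast
  then show "0 \<le> turn g x l" "dist (g (turn g x l)) x = l - turn g x l" by auto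
  have "\<exists>C\<in>CC. \<exists>t\<in>{0..<l}. g l \<in> C \<and> g t \<in> C"
    by (rule left_hit[OF fin cl]) (use geod_cont[OF g] cgeodD(3)[OF g] l in auto)
  then obtain C t where t: "C \<in> CC" "t \<in> {0..<l}" "g l \<in> C" "g t \<in> C" by blast
  have "dist (g t) (g l) = D (g t) (g l)" using cd_same[OF t(1,4,3)] by simp
  also have "\<dots> = l - t" using cgeod_sub(2)[OF g, of t l] t(2) l by simp
  finally have "t \<in> ?A" using t(2) gl by simp
  then have "turn g x l \<le> t" unfolding turn_def using bd by (rule cInf_lower)
  then show "turn g x l < l" using t(2) by simp
  show "dist (g t) x < l - t" if "0 \<le> t" "t < turn g x l" for t
  proof -
    have "t \<notin> ?A" using that cInf_lower[of t ?A] bd unfolding turn_def by auto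
    moreover have "t \<in> {0..l}" using that tA by auto
    moreover have "dist (g t) x \<le> l - t" using geod_dist[OF g, of t l] gl \<open>t \<in> {0..l}\<close> l by simp
    ultimately show ?thesis by auto
  qed
qed

end

section \<open>Branching of geodesics with a common start, and the CN inequality for the chain
  metric\<close>

context star2
begin

lemma straight_conv:
  assumes g: "cgeod g a b" and st: "0 \<le> s" "s < t" "t \<le> D a b" and d: "dist (g s) (g t) = t - s" and x: "x \<in> H"
    and pqr: "s \<le> p" "p < q" "q < r" "r \<le> t"
  shows "(dist (g q) x - dist (g p) x) * (r - q) \<le> (dist (g r) x - dist (g q) x) * (q - p)"
proof -
  have "cvx {x}" using x by (auto simp: cvx_def)
  from cgeod_infdist_convex[OF _ this _ g st d pqr] show ?thesis by simp
qed

text \<open>Between a and b the geodesics have only their ends in common, so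
  \<open>geodesics_in_convex\<close> for the segment between these ends makes g straight there. With
  the straight end of g this would move the beginning of the straight part from
  \<open>turn g x l\<close> back to a.\<close>

lemma no_bigon:
  assumes g: "cgeod g p x" and px: "p \<in> X" "x \<in> X" and l: "l = D p x" "0 < l"
    and y: "y \<in> X" and g': "cgeod g' p y"
    and a: "0 \<le> a" "a < turn g x l" "g a = g' a" and b: "turn g x l < b" "b \<le> l" "b \<le> D p y" "g b = g' b"
    and no: "\<And>t. a < t \<Longrightarrow> t < b \<Longrightarrow> g t \<noteq> g' t"
  shows False
proof -
  note tp = turn_props[OF g px l]
  have gX: "g t \<in> X" if "0 \<le> t" "t \<le> l" for t using cgeodD(3)[OF g] that l by simp
  have aX: "g a \<in> X" "g b \<in> X" using gX[of a] gX[of b] a(1,2) b(1,2) by simp_all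
  have aH: "g a \<in> H" "g b \<in> H" using aX X_Hin by auto
  have ab: "a \<le> b" using a b by simp
  note s1 = cgeod_sub[OF g a(1) ab b(2)[unfolded l]] and s2 = cgeod_sub[OF g' a(1) ab b(3)]
  have "g (a + t) \<in> seg (g a) (g b)" if "t \<in> {0..D (g a) (g b)}" for t
  proof (rule geodesics_in_convex[OF aX aX(2) s1(1) _ _ _ cvx_seg[OF aH] _ _ _ _ that])
    show "cgeod (\<lambda>u. g' (a + u)) (g a) (g b)" using s2(1) a(3) b(4) by simp
    show "P (g b) (g b) t \<in> X" if "0 \<le> t" "t \<le> 1" for t using that aX aH by simp
    show "closed (seg (g a) (g b))" using compact_seg[OF aH] compact_imp_closed by blast
    show e: "g a \<in> seg (g a) (g b)" "g b \<in> seg (g a) (g b)" "g b \<in> seg (g a) (g b)"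
      using seg_ends[OF aH] by auto
    show "g (a + u) \<in> seg (g a) (g b)" if u: "u \<in> {0..D (g a) (g b)}" "u' \<in> {0..D (g a) (g b)}" "g (a + u) = g' (a + u')" for u u'
    proof -
      have r: "0 \<le> u" "u \<le> b - a" "0 \<le> u'" "u' \<le> b - a" using u(1,2) s1(2) by auto
      \<comment> \<open>The parameter is the distance from p, so common points have equal parameters
        on both curves.\<close>
      have "D p (g (a + u)) = a + u" using cgeodD(4)[OF g, of 0 "a+u"] cgeodD(1)[OF g] r a b l by simp
      moreover have "D p (g' (a + u')) = a + u'" using cgeodD(4)[OF g', of 0 "a+u'"] cgeodD(1)[OF g'] r a b by simp
      ultimately have "u = u'" using u(3) by simp
      then have "\<not> (a < a + u \<and> a + u < b)" using no[of "a + u"] u(3) by auto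
      then have "u = 0 \<or> a + u = b" using r by linarith
      then show ?thesis using e by auto
    qed
  qed
  then have "dist (g a) (g b) = D (g a) (g b)" by (rule cgeod_in_seg[OF s1(1) aX])
  then have d: "dist (g a) (g b) = b - a" using s1(2) by simp
  have xl: "g l = x" using cgeodD(2)[OF g] l by simp
  have bx: "dist (g b) x = l - b"
  proof -
    have "dist (g (turn g x l)) x \<le> dist (g (turn g x l)) (g b) + dist (g b) x" by (rule dist_triangle)
    moreover have "dist (g (turn g x l)) (g b) \<le> b - turn g x l" using geod_dist[OF g, of "turn g x l" b] tp b l by simp
    moreover have "dist (g b) x \<le> l - b" using geod_dist[OF g, of b l] xl tp b l by simp
    ultimately show ?thesis using tp(3) by simp
  qed
  \<comment> \<open>Beyond the turn the distance to x decreases at unit speed; by convexity it does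
    so already from a on.\<close>
  have "(dist (g (turn g x l)) x - dist (g a) x) * (b - turn g x l) \<le> (dist (g b) x - dist (g (turn g x l)) x) * (turn g x l - a)"
    by (rule straight_conv[OF g a(1) _ _ d X_Hin[OF px(2)]]) (use a b l in auto)
  then have "(l - turn g x l - dist (g a) x) * (b - turn g x l) \<le> (turn g x l - a) * - (b - turn g x l)"
    unfolding tp(3) bx by (simp add: algebra_simps)
  then have "(l - turn g x l - dist (g a) x + (turn g x l - a)) * (b - turn g x l) \<le> 0" by (simp add: algebra_simps)
  then have "l - a \<le> dist (g a) x" using b(1) by (simp add: mult_le_0_iff)
  then show False using tp(4)[OF a(1,2)] by simp
qed

text \<open>\<open>geodesics_in_convex\<close> is used with the cone whose apex is the last common
  point of the two geodesics; that point is in the cone, as the lemma demands of common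
  points.\<close>

lemma geodesic_in_cone:
  assumes g: "cgeod g p x" and px: "p \<in> X" "x \<in> X" and l: "l = D p x" "0 < l"
    and y: "y \<in> X" "seg x y \<subseteq> X" and g': "cgeod g' p y"
    and a: "0 \<le> a" "a \<le> l" "a \<le> D p y" "g a = g' a"
    and no: "\<And>t. a < t \<Longrightarrow> t \<le> l \<Longrightarrow> t \<le> D p y \<Longrightarrow> g t \<noteq> g' t"
    and t: "a \<le> t" "t \<le> l"
  shows "g t \<in> cone (g a) x (dist x y)"
proof -
  have xl: "g l = x" using cgeodD(2)[OF g] l by simp
  have aX: "g a \<in> X" using cgeodD(3)[OF g, of a] a(1,2) l by simp
  have H: "g a \<in> H" "x \<in> H" "y \<in> H" using aX px y X_Hin by auto
  note s1 = cgeod_sub[OF g a(1) a(2)[unfolded l] order_refl] and s2 = cgeod_sub[OF g' a(1) a(3) order_refl]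
  have e: "g (D p x) = x" "g' (D p y) = y" using cgeodD(2) g g' by auto
  have "g (a + (t - a)) \<in> cone (g a) x (dist x y)"
  proof (rule geodesics_in_convex[OF aX px(2) y(1) s1(1)[unfolded e] _ _ closed_cone cvx_cone])
    show "cgeod (\<lambda>u. g' (a + u)) (g a) y" using s2(1) a(4) e by simp
    show "P x y t \<in> X" if "0 \<le> t" "t \<le> 1" for t using seg_subD[OF y(2) that] .
    show "g a \<in> cone (g a) x (dist x y)" using H by (auto simp: cone_def intro!: bexI[of _ 0])
    show "x \<in> cone (g a) x (dist x y)" "y \<in> cone (g a) x (dist x y)"
      using H by (auto simp: cone_def dist_commute intro!: bexI[of _ 1])
    show "t - a \<in> {0..D (g a) x}" using t s1(2) e l by auto
    show "g (a + u) \<in> cone (g a) x (dist x y)" if u: "u \<in> {0..D (g a) x}" "u' \<in> {0..D (g a) y}" "g (a + u) = g' (a + u')" for u u'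
    proof -
      have r: "0 \<le> u" "u \<le> l - a" "0 \<le> u'" "u' \<le> D p y - a" using u(1,2) s1(2) s2(2) e l a(4) by auto
      have "D p (g (a + u)) = a + u" using cgeodD(4)[OF g, of 0 "a+u"] cgeodD(1)[OF g] r a l by simp
      moreover have "D p (g' (a + u')) = a + u'" using cgeodD(4)[OF g', of 0 "a+u'"] cgeodD(1)[OF g'] r a by simp
      ultimately have "u = u'" using u(3) by simp
      have "\<not> a < a + u"
      proof
        assume "a < a + u"
        moreover have "a + u \<le> l" "a + u \<le> D p y" using r \<open>u = u'\<close> by auto
        ultimately show False using no[of "a + u"] u(3) \<open>u = u'\<close> by blast
      qed
      then have "u = 0" using r by linarith
      then show ?thesis using H by (auto simp: cone_def intro!: bexI[of _ 0])
    qed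
  qed (use H in auto)
  then show ?thesis by simp
qed

text \<open>Otherwise thinner and thinner cones, with apex parameters at most c, contain the rest of
  g. In a limit the rest from some a \<le> c on lies in the segment to x, so g would be straight
  before its turn.\<close>

lemma cone_width_pos:
  assumes g: "cgeod g p x" and px: "p \<in> X" "x \<in> X" and l: "l = D p x" "0 < l" and c: "c < turn g x l"
  shows "\<exists>\<delta>>0. \<forall>a. 0 \<le> a \<longrightarrow> a \<le> c \<longrightarrow> \<not> (\<forall>t\<in>{a..l}. g t \<in> cone (g a) x \<delta>)"
proof (rule ccontr)
  assume no: "\<not> ?thesis"
  note tp = turn_props[OF g px l]
  have "\<exists>a. 0 \<le> a \<and> a \<le> c \<and> (\<forall>t\<in>{a..l}. g t \<in> cone (g a) x (1 / real (Suc n)))" for n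
  proof -
    have "0 < 1 / real (Suc n)" by simp
    then show ?thesis using no by blast
  qed
  then obtain u where u: "\<And>n. 0 \<le> u n" "\<And>n. u n \<le> c" "\<And>n. \<forall>t\<in>{u n..l}. g t \<in> cone (g (u n)) x (1 / real (Suc n))" by metis
  have "\<forall>n. u n \<in> {0..c}" using u by auto
  then obtain a r where r: "a \<in> {0..c}" "strict_mono (r :: nat \<Rightarrow> nat)" "(u \<circ> r) \<longlonglongrightarrow> a"
    using compact_Icc[of 0 c] unfolding compact_def by meson
  have ur: "(\<lambda>n. u (r n)) \<longlonglongrightarrow> a" using r(3) by (simp add: o_def)
  have a: "0 \<le> a" "a < turn g x l" "a \<le> l" using r(1) c tp by auto
  have gX: "g t \<in> X" "g t \<in> H" if "0 \<le> t" "t \<le> l" for t using cgeodD(3)[OF g] that l X_Hin by auto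
  have xH: "x \<in> H" using px X_Hin by auto
  have aH: "g a \<in> H" "g a \<in> X" using gX a by auto
  have xl: "g l = x" using cgeodD(2)[OF g] l by simp
  have ing: "g t \<in> seg (g a) x" if t: "a < t" "t \<le> l" for t
  proof -
    have "g t \<in> closure (seg (g a) x)" unfolding closure_approachable
    proof (intro allI impI)
      fix e :: real assume e: "0 < e"
      have "\<forall>\<^sub>F n in sequentially. u (r n) < t" using order_tendstoD(2)[OF ur t(1)] .
      moreover have "\<forall>\<^sub>F n in sequentially. dist (u (r n)) a < e/2" using tendstoD[OF ur, of "e/2"] e by simp
      moreover have "\<forall>\<^sub>F n in sequentially. 1 / real (Suc n) < e/2"
        using order_tendstoD(2)[OF LIMSEQ_inverse_real_of_nat, of "e/2"] e by (simp add: inverse_eq_divide)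
      ultimately have "\<forall>\<^sub>F n in sequentially. u (r n) < t \<and> dist (u (r n)) a < e/2 \<and> 1 / real (Suc n) < e/2" by eventually_elim auto
      then obtain n where n: "u (r n) < t" "dist (u (r n)) a < e/2" "1 / real (Suc n) < e/2" unfolding eventually_sequentially by blast
      have "g t \<in> cone (g (u (r n))) x (1 / real (Suc (r n)))" using u(3)[of "r n"] n(1) t(2) by simp
      then obtain k where k: "0 \<le> k" "k \<le> 1" "dist (g t) (P (g (u (r n))) x k) \<le> k * (1 / real (Suc (r n)))" unfolding cone_def by auto
      have "k * (1 / real (Suc (r n))) \<le> 1 * (1 / real (Suc n))"
        using k seq_suble[OF r(2), of n] by (intro mult_mono divide_left_mono) auto
      then have 1: "dist (g t) (P (g (u (r n))) x k) < e/2" using k(3) n(3) by simp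
      have ul: "u (r n) \<le> l" using u(2)[of "r n"] c tp by simp
      have uH: "g (u (r n)) \<in> H" using gX(2)[OF u(1) ul] .
      have "dist (P (g (u (r n))) x k) (P (g a) x k) \<le> (1-k) * dist (g (u (r n))) (g a) + k * dist x x"
        by (rule P_busemann[OF uH xH aH(1) xH k(1,2)])
      also have "\<dots> \<le> 1 * dist (g (u (r n))) (g a)" unfolding dist_self mult_zero_right add_0_right using k by (intro mult_right_mono) auto
      also have "\<dots> \<le> \<bar>u (r n) - a\<bar>" using geod_dist[OF g, of "u (r n)" a] u(1)[of "r n"] ul a l by simp
      also have "\<dots> < e/2" using n(2) by (simp add: dist_real_def)
      finally have "dist (P (g a) x k) (g t) < e" using 1 dist_triangle2[of "P (g a) x k" "g t" "P (g (u (r n))) x k"] dist_commute[of "P (g a) x k" "P (g (u (r n))) x k"] by linarith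
      then show "\<exists>y\<in>seg (g a) x. dist y (g t) < e" using k unfolding seg_def by auto
    qed
    then show ?thesis using compact_seg[OF aH(1) xH] compact_imp_closed closure_closed by metis
  qed
  note s1 = cgeod_sub[OF g a(1) a(3)[unfolded l(1)] order_refl, folded l(1), unfolded xl]
  have "dist (g a) x = D (g a) x"
  proof (rule cgeod_in_seg[OF s1(1) aH(2) px(2)])
    show "g (a + t) \<in> seg (g a) x" if "t \<in> {0..D (g a) x}" for t
      using ing[of "a + t"] that s1(2) seg_ends[OF aH(1) xH] by (cases "t = 0") auto
  qed
  then show False using tp(4)[OF a(1,2)] s1(2) by simp
qed

text \<open>Suppose the last agreement a up to the turn comes before it. A later meeting is excluded
  by \<open>no_bigon\<close>. Otherwise g stays in the cone with apex \<open>g a\<close>: for a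
  \<le> c this is excluded by \<open>cone_width_pos\<close>, and for a close to the turn by the
  definite angle that g makes there.\<close>

lemma nearby_geodesics_branch_late:
  assumes g: "cgeod g p x" and px: "p \<in> X" "x \<in> X" and l: "l = D p x" "0 < l"
  shows "\<exists>\<delta>>0. \<forall>y g'. y \<in> X \<longrightarrow> dist x y < \<delta> \<longrightarrow> seg x y \<subseteq> X \<longrightarrow> cgeod g' p y \<longrightarrow>
    turn g x l \<le> D p y \<and> g' (turn g x l) = g (turn g x l)"
proof -
  note tp = turn_props[OF g px l]
  define \<beta> where "\<beta> = turn g x l"
  have b: "0 \<le> \<beta>" "\<beta> < l" "dist (g \<beta>) x = l - \<beta>" using tp by (auto simp: \<beta>_def)
  show ?thesis
  proof (cases "\<beta> = 0")
    case True
    have "0 \<le> D p y \<and> g' 0 = g 0" if "y \<in> X" "cgeod g' p y" for y g'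
      using D_nonneg[OF px(1) that(1)] cgeodD(1)[OF that(2)] cgeodD(1)[OF g] by simp
    then show ?thesis using True unfolding \<beta>_def by (intro exI[of _ 1]) simp
  next
    case False
    then have b0: "0 < \<beta>" using b by simp
    have gX: "g t \<in> X" if "0 \<le> t" "t \<le> l" for t using cgeodD(3)[OF g] that l by auto
    have "\<exists>C\<in>CC. \<exists>t\<in>{0..<\<beta>}. g \<beta> \<in> C \<and> g t \<in> C"
    proof (rule left_hit[OF fin cl _ _ b0])
      show "continuous_on {0..\<beta>} g" by (rule continuous_on_subset[OF geod_cont[OF g]]) (use b l in auto)
      show "g ` {0..\<beta>} \<subseteq> X" using gX b by (intro image_subsetI) auto
    qed
    then obtain C c where c: "C \<in> CC" "c \<in> {0..<\<beta>}" "g \<beta> \<in> C" "g c \<in> C" by blast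
    have c0: "0 \<le> c" "c < \<beta>" using c(2) by auto
    have "dist (g c) (g \<beta>) = D (g c) (g \<beta>)" using cd_same[OF c(1,4,3)] by simp
    also have "\<dots> = \<beta> - c" using cgeod_sub(2)[OF g, of c \<beta>] c0 b l by simp
    finally have str: "dist (g c) (g \<beta>) = \<beta> - c" .
    \<comment> \<open>The defect from being straight towards x. It vanishes at
      \<open>\<beta>\<close> and is concave on the straight piece from c to \<open>\<beta>\<close>,
      so it is at least \<open>\<kappa> * (\<beta> - t)\<close> there.\<close>
    define e where "e t = l - t - dist (g t) x" for t
    have ec: "0 < e c" using tp(4)[of c] c0 by (simp add: e_def \<beta>_def)
    define \<kappa> where "\<kappa> = e c / (\<beta> - c)"
    have \<kappa>: "0 < \<kappa>" "e c = \<kappa> * (\<beta> - c)" using ec c0 by (auto simp: \<kappa>_def)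
    have "c < turn g x l" using c0 by (simp add: \<beta>_def)
    from cone_width_pos[OF g px l this] obtain \<delta>1 where d1: "\<delta>1 > 0" "\<And>a. 0 \<le> a \<Longrightarrow> a \<le> c \<Longrightarrow> \<not> (\<forall>t\<in>{a..l}. g t \<in> cone (g a) x \<delta>1)" by metis
    \<comment> \<open>The estimates \<open>e3\<close> to \<open>e5\<close> below yield
      \<open>\<kappa> * (l - \<beta>) \<le> (2 + 3 * \<kappa>) * \<delta>\<close>, which this value
      contradicts.\<close>
    define \<delta>2 where "\<delta>2 = \<kappa> * (l - \<beta>) / (2 + 3 * \<kappa>)"
    have d2: "\<delta>2 > 0" "\<kappa> * (l - \<beta>) = (2 + 3 * \<kappa>) * \<delta>2" using \<kappa> b by (auto simp: \<delta>2_def)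
    obtain \<delta>0 where d0: "\<delta>0 > 0" "\<delta>0 \<le> \<delta>1" "\<delta>0 \<le> l - \<beta>" "\<delta>0 \<le> \<delta>2"
      using that[of "min \<delta>1 (min (l - \<beta>) \<delta>2)"] d1(1) d2(1) b by auto
    have "\<beta> \<le> D p y \<and> g' \<beta> = g \<beta>" if y: "y \<in> X" "dist x y < \<delta>0" "seg x y \<subseteq> X" and g': "cgeod g' p y" for y g'
    proof -
      have "D x y = dist x y" by (rule D_dist_le[OF px(2) y(1,3)])
      then have "l \<le> D p y + dist x y" using D_tri[OF px(1) y(1) px(2)] l(1) cd_sym[of CC x y] by simp
      then have bl': "\<beta> \<le> D p y" using y(2) d0 by linarith
      have "g' \<beta> = g \<beta>"
      proof (rule ccontr)
        assume ne: "g' \<beta> \<noteq> g \<beta>"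
        have gc: "continuous_on S g" if "S \<subseteq> {0..l}" for S by (rule continuous_on_subset[OF geod_cont[OF g]]) (use that l in auto)
        have gc': "continuous_on S g'" if "S \<subseteq> {0..D p y}" for S by (rule continuous_on_subset[OF geod_cont[OF g']]) (use that in auto)
        have comp: "compact {t \<in> {u..v}. g t = g' t}" if "0 \<le> u" "v \<le> l" "v \<le> D p y" for u v
        proof -
          have "continuous_on {u..v} (\<lambda>t. dist (g t) (g' t))" by (intro continuous_intros gc gc') (use that in auto)
          then have "closed ({u..v} \<inter> (\<lambda>t. dist (g t) (g' t)) -` {0})" by (rule continuous_closed_preimage) auto
          moreover have "{u..v} \<inter> (\<lambda>t. dist (g t) (g' t)) -` {0} = {t \<in> {u..v}. g t = g' t}" by auto
          moreover have "bounded {t \<in> {u..v}. g t = g' t}" by (rule bounded_subset[of "{u..v}"]) auto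
          ultimately show ?thesis by (simp add: compact_eq_bounded_closed)
        qed
        have "g 0 = g' 0" using cgeodD(1)[OF g] cgeodD(1)[OF g'] by simp
        then have "0 \<in> {t \<in> {0..\<beta>}. g t = g' t}" using b by simp
        then have "{t \<in> {0..\<beta>}. g t = g' t} \<noteq> {}" by blast
        from bexE[OF compact_attains_sup[OF comp this]] obtain a where a: "a \<in> {t \<in> {0..\<beta>}. g t = g' t}"
          and amax: "\<forall>t\<in>{t \<in> {0..\<beta>}. g t = g' t}. t \<le> a" using b bl' by auto
        have a0: "0 \<le> a" "a < \<beta>" "g a = g' a" using a ne by (auto simp: order_less_le)
        have anot: "g t \<noteq> g' t" if "a < t" "t \<le> \<beta>" for t
        proof
          assume "g t = g' t"
          then have "t \<in> {t \<in> {0..\<beta>}. g t = g' t}" using that a0 by simp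
          then show False using bspec[OF amax] that(1) by fastforce
        qed
        define m where "m = min l (D p y)"
        have m: "m \<le> l" "m \<le> D p y" "\<beta> \<le> m" using b bl' by (auto simp: m_def)
        show False
        proof (cases "\<exists>t\<in>{\<beta>..m}. g t = g' t")
          case True
          then have "{t \<in> {\<beta>..m}. g t = g' t} \<noteq> {}" by blast
          from bexE[OF compact_attains_inf[OF comp this]] obtain b' where b': "b' \<in> {t \<in> {\<beta>..m}. g t = g' t}"
            and bmin: "\<forall>t\<in>{t \<in> {\<beta>..m}. g t = g' t}. b' \<le> t" using b m by auto
          have bb: "\<beta> < b'" "b' \<le> l" "b' \<le> D p y" "g b' = g' b'" using b' ne m by (auto simp: order_less_le)
          have "g t \<noteq> g' t" if "a < t" "t < b'" for t
          proof (cases "t \<le> \<beta>")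
            case True then show ?thesis using anot that by blast
          next
            case False
            show ?thesis
            proof
              assume "g t = g' t"
              then have "t \<in> {t \<in> {\<beta>..m}. g t = g' t}" using that False b' by simp
              then show False using bspec[OF bmin] that(2) by fastforce
            qed
          qed
          from no_bigon[OF g px l y(1) g' a0(1) _ a0(3) _ bb(2-4) this] show False using a0 bb by (simp add: \<beta>_def)
        next
          case False
          have noc: "g t \<noteq> g' t" if "a < t" "t \<le> l" "t \<le> D p y" for t
          proof (cases "t \<le> \<beta>")
            case True then show ?thesis using anot that by blast
          next
            case F: False
            then have "t \<in> {\<beta>..m}" using that by (simp add: m_def)
            then show ?thesis using False by blast
          qed
          have al: "a \<le> l" "a \<le> D p y" using a0 b bl' by auto
          have inC: "g t \<in> cone (g a) x (dist x y)" if "a \<le> t" "t \<le> l" for t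
            by (rule geodesic_in_cone[OF g px l y(1,3) g' a0(1) al a0(3) noc that])
          have ca: "c < a"
          proof (rule ccontr)
            assume "\<not> c < a"
            then obtain t where t: "t \<in> {a..l}" "g t \<notin> cone (g a) x \<delta>1" using d1(2)[of a] a0 by auto
            obtain k where k: "k \<in> {0..1}" "dist (g t) (P (g a) x k) \<le> k * dist x y" and gH: "g t \<in> H" using inC[of t] t(1) by (auto simp: cone_def)
            have "k * dist x y \<le> k * \<delta>1" using k(1) y(2) d0 by (intro mult_left_mono) auto
            then show False using t(2) k gH by (force simp: cone_def)
          qed
          have H: "g a \<in> H" "x \<in> H" "g \<beta> \<in> H" using X_Hin[OF gX[OF a0(1) al(1)]] X_Hin[OF px(2)] X_Hin[OF gX[of \<beta>]] b by auto
          \<comment> \<open>\<open>g \<beta>\<close> is within \<open>k * \<delta>\<close> of the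
            point at parameter k of the segment from \<open>g a\<close> to x; \<open>e1\<close> and
            \<open>e2\<close> read off its distances from x and from \<open>g a\<close>.\<close>
          obtain k where k: "0 \<le> k" "k \<le> 1" "dist (g \<beta>) (P (g a) x k) \<le> k * dist x y" using inC[of \<beta>] a0 b by (auto simp: cone_def)
          define d where "d = dist (g a) x"
          define \<delta> where "\<delta> = dist x y"
          have e1: "l - \<beta> \<le> k * \<delta> + (1-k) * d"
            using dist_triangle[of "g \<beta>" x "P (g a) x k"] dist_P_right[OF H(1,2) k(1,2)] k(3) b(3) by (simp add: d_def \<delta>_def dist_commute)
          have "dist (g c) (g \<beta>) \<le> dist (g c) (g a) + dist (g a) (g \<beta>)" by (rule dist_triangle)
          moreover have "dist (g c) (g a) \<le> a - c" using geod_dist[OF g, of c a] c0 ca al l by simp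
          moreover have "dist (g a) (g \<beta>) \<le> \<beta> - a" using geod_dist[OF g, of a \<beta>] a0 b l by simp
          ultimately have ab: "dist (g a) (g \<beta>) = \<beta> - a" using str by linarith
          have e2: "k * d \<le> \<beta> - a + k * \<delta>" "\<beta> - a \<le> k * d + k * \<delta>"
            using dist_triangle[of "g a" "P (g a) x k" "g \<beta>"] dist_triangle2[of "g a" "g \<beta>" "P (g a) x k"] dist_P_left[OF H(1,2) k(1,2)] k(3) ab
            by (auto simp: d_def \<delta>_def dist_commute)
          have e3: "e a \<le> 2 * (k * \<delta>)" using e1 e2(2) by (simp add: e_def d_def algebra_simps)
          have "(dist (g a) x - dist (g c) x) * (\<beta> - a) \<le> (dist (g \<beta>) x - dist (g a) x) * (a - c)"
            by (rule straight_conv[OF g c0 _ str H(2)]) (use b l a0 ca in auto)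
          then have "e c * (\<beta> - a) \<le> e a * (\<beta> - c)" unfolding b(3) by (simp add: e_def algebra_simps)
          then have "(\<beta> - c) * (\<kappa> * (\<beta> - a)) \<le> (\<beta> - c) * e a" unfolding \<kappa>(2) by (simp add: mult_ac)
          then have e4: "\<kappa> * (\<beta> - a) \<le> e a" using c0 by (simp add: mult_le_cancel_left)
          have \<delta>0: "0 \<le> \<delta>" "\<delta> < \<delta>2" using y(2) d0 by (auto simp: \<delta>_def)
          have k0: "0 < k"
          proof -
            have "0 < \<kappa> * (\<beta> - a)" using \<kappa> a0 by simp
            then have "0 < k * \<delta>" using e3 e4 by linarith
            then show ?thesis using k(1) by (simp add: zero_less_mult_iff)
          qed
          have "k * (\<kappa> * (d - \<delta>)) = \<kappa> * (k * d - k * \<delta>)" by (simp add: algebra_simps)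
          also have "\<dots> \<le> \<kappa> * (\<beta> - a)" using e2(1) \<kappa>(1) by (intro mult_left_mono) auto
          also have "\<dots> \<le> k * (2 * \<delta>)" using e3 e4 by simp
          finally have e5: "\<kappa> * (d - \<delta>) \<le> 2 * \<delta>" using k0 by (simp only: mult_le_cancel_left_pos)
          have "k * \<delta> \<le> \<delta>" using k \<delta>0 by (simp add: mult_left_le_one_le)
          then have "l - \<beta> - 2 * \<delta> \<le> d" using e3 a0 unfolding e_def d_def by linarith
          then have "\<kappa> * (l - \<beta> - 3 * \<delta>) \<le> \<kappa> * (d - \<delta>)" using \<kappa>(1) by (intro mult_left_mono) auto
          then have "\<kappa> * (l - \<beta>) \<le> (2 + 3 * \<kappa>) * \<delta>" using e5 by (simp add: algebra_simps)
          then have "(2 + 3 * \<kappa>) * \<delta>2 \<le> (2 + 3 * \<kappa>) * \<delta>" unfolding d2(2) .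
          then show False using \<delta>0 \<kappa>(1) by (simp add: mult_le_cancel_left)
        qed
      qed
      then show ?thesis using bl' by simp
    qed
    then show ?thesis unfolding \<beta>_def using d0(1) by blast
  qed
qed

text \<open>Near a point x of the segment all geodesics from p pass through the last turn b of one
  to x. So \<open>D p\<close> equals \<open>\<beta>\<close> plus the ambient distance from b at x,
  and is at least that nearby. The CN inequality of H seen from b thus passes to p locally, and
  convexity is a local matter.\<close>

lemma apex_seg:
  assumes p: "p \<in> X" and uv: "u \<in> H" "v \<in> H" and sX: "seg u v \<subseteq> X" and t: "0 \<le> t" "t \<le> 1"
  shows "(D p (P u v t))\<^sup>2 \<le> (1-t) * (D p u)\<^sup>2 + t * (D p v)\<^sup>2 - t * (1-t) * (dist u v)\<^sup>2"
proof -
  define L where "L = dist u v"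
  \<comment> \<open>Subtracting the quadratic term turns the CN inequality into plain
    convexity.\<close>
  define \<psi> where "\<psi> s = (D p (P u v s))\<^sup>2 - (s * L)\<^sup>2" for s
  have PX: "P u v s \<in> X" if "0 \<le> s" "s \<le> 1" for s using seg_subD[OF sX that] .
  have Pc: "continuous_on {0..1} (P u v)" by (intro P_continuous continuous_intros) (use uv in auto)
  have "continuous_on {0..1} (\<lambda>s. D p (P u v s))" by (rule continuous_on_compose2[OF D_cont[OF p] Pc sX[unfolded seg_def]])
  then have \<psi>c: "continuous_on {0..1} \<psi>" unfolding \<psi>_def[abs_def] by (intro continuous_intros)
  have Dseg: "seg (P u v a) (P u v b) \<subseteq> X" "D (P u v a) (P u v b) = \<bar>b - a\<bar> * L" if ab: "0 \<le> a" "a \<le> 1" "0 \<le> b" "b \<le> 1" for a b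
  proof -
    show *: "seg (P u v a) (P u v b) \<subseteq> X"
    proof
      fix q assume "q \<in> seg (P u v a) (P u v b)"
      then obtain r where r: "0 \<le> r" "r \<le> 1" "q = P (P u v a) (P u v b) r" by (auto simp: seg_def)
      have "0 \<le> (1-r) * a + r * b" "(1-r) * a + r * b \<le> 1" using convex_bound_le[of a 1 b "1-r" r] ab r by auto
      then show "q \<in> X" using PX P_seg[OF uv ab r(1,2)] r(3) by simp
    qed
    show "D (P u v a) (P u v b) = \<bar>b - a\<bar> * L"
      using D_dist_le[OF PX[OF ab(1,2)] PX[OF ab(3,4)] *] dist_P_P[OF uv ab] by (simp add: L_def)
  qed
  have "\<psi> t \<le> (1-t) * \<psi> 0 + t * \<psi> 1"
  proof (rule local_midconvex[OF \<psi>c _ t])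
    fix s :: real assume s: "0 < s" "s < 1"
    define x where "x = P u v s"
    have xX: "x \<in> X" using PX s by (simp add: x_def)
    have dxy: "dist x (P u v (s + h)) \<le> \<bar>h\<bar> * L" "D x (P u v (s + h)) = \<bar>h\<bar> * L" "seg x (P u v (s + h)) \<subseteq> X" if "0 \<le> s + h" "s + h \<le> 1" for h
      using dist_P_P[OF uv, of s "s + h"] Dseg[of s "s + h"] s that by (auto simp: x_def L_def)
    show "\<exists>e>0. \<forall>h. 0 < h \<longrightarrow> h < e \<longrightarrow> 0 \<le> s - h \<longrightarrow> s + h \<le> 1 \<longrightarrow> 2 * \<psi> s \<le> \<psi> (s + h) + \<psi> (s - h)"
    proof (cases "D p x = 0")
      case True
      then have px: "p = x" using D_eq0[OF p xX] by simp
      have "2 * \<psi> s \<le> \<psi> (s + h) + \<psi> (s - h)" if h: "0 < h" "0 \<le> s - h" "s + h \<le> 1" for h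
        using dxy(2)[of h] dxy(2)[of "-h"] h True unfolding \<psi>_def px x_def[symmetric]
        by (simp add: power_mult_distrib power2_eq_square algebra_simps)
      then show ?thesis by (intro exI[of _ 1]) auto
    next
      case False
      define l where "l = D p x"
      have l0: "0 < l" using False D_nonneg[OF p xX] by (simp add: l_def)
      obtain g where g: "cgeod g p x" using geod_ex[OF p xX] by blast
      note tp = turn_props[OF g p xX l_def l0]
      define \<beta> where "\<beta> = turn g x l"
      define b where "b = g \<beta>"
      obtain \<delta> where d: "\<delta> > 0" "\<And>y g'. y \<in> X \<Longrightarrow> dist x y < \<delta> \<Longrightarrow> seg x y \<subseteq> X \<Longrightarrow> cgeod g' p y \<Longrightarrow> \<beta> \<le> D p y \<and> g' \<beta> = b"
        using nearby_geodesics_branch_late[OF g p xX l_def l0] unfolding \<beta>_def b_def by metis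
      have bX: "b \<in> X" unfolding b_def \<beta>_def by (rule cgeodD(3)[OF g tp(1)]) (use tp(2) l_def in simp)
      have bH: "b \<in> H" using bX X_Hin by blast
      have b0: "0 \<le> \<beta>" "dist b x = l - \<beta>" using tp by (auto simp: \<beta>_def b_def)
      have far: "\<beta> + dist b y \<le> D p y" if y: "y \<in> X" "dist x y < \<delta>" "seg x y \<subseteq> X" for y
      proof -
        obtain g' where g': "cgeod g' p y" using geod_ex[OF p y(1)] by blast
        have "\<beta> \<le> D p y" "g' \<beta> = b" using d(2)[OF y g'] by auto
        then have "D b y = D p y - \<beta>" using cgeod_sub(2)[OF g' b0(1) _ order_refl] cgeodD(2)[OF g'] by simp
        then show ?thesis using D_ge[OF bX y(1)] by simp
      qed
      have "2 * \<psi> s \<le> \<psi> (s + h) + \<psi> (s - h)" if h: "0 < h" "h * L < \<delta>" "0 \<le> s - h" "s + h \<le> 1" for h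
      proof -
        define y z where "y = P u v (s + h)" and "z = P u v (s - h)"
        have yz: "y \<in> X" "z \<in> X" "y \<in> H" "z \<in> H" using PX[of "s+h"] PX[of "s-h"] h s X_Hin by (auto simp: y_def z_def)
        have fy: "\<beta> + dist b y \<le> D p y" by (rule far) (use dxy[of h] h s yz in \<open>auto simp: y_def\<close>)
        have fz: "\<beta> + dist b z \<le> D p z" by (rule far) (use dxy[of "-h"] h s yz in \<open>auto simp: z_def\<close>)
        have xm: "x = P z y (1/2)" unfolding x_def y_def z_def using P_seg[OF uv, of "s-h" "s+h" "1/2"] h s by (simp add: field_simps)
        have dzy: "dist z y = 2 * h * L" unfolding y_def z_def using dist_P_P[OF uv, of "s-h" "s+h"] h s by (simp add: L_def)
        have cn: "2 * (dist b x)\<^sup>2 + 2 * (h * L)\<^sup>2 \<le> (dist b z)\<^sup>2 + (dist b y)\<^sup>2"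
          using P_cn[OF bH yz(4,3), of "1/2"] unfolding xm[symmetric] dzy by (simp add: power_mult_distrib)
        have cv: "2 * dist b x \<le> dist b z + dist b y" using dist_convex[OF bH yz(4,3), of "1/2"] unfolding xm[symmetric] by simp
        have "2 * l\<^sup>2 + 2 * (h * L)\<^sup>2 = 2 * \<beta>\<^sup>2 + 2 * \<beta> * (2 * dist b x) + (2 * (dist b x)\<^sup>2 + 2 * (h * L)\<^sup>2)"
          unfolding b0(2) by (simp add: power2_eq_square algebra_simps)
        also have "\<dots> \<le> 2 * \<beta>\<^sup>2 + 2 * \<beta> * (dist b z + dist b y) + ((dist b z)\<^sup>2 + (dist b y)\<^sup>2)"
          by (rule add_mono[OF add_left_mono[OF mult_left_mono[OF cv]] cn]) (use b0(1) in simp)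
        also have "\<dots> = (\<beta> + dist b z)\<^sup>2 + (\<beta> + dist b y)\<^sup>2" by (simp add: power2_eq_square algebra_simps)
        also have "\<dots> \<le> (D p z)\<^sup>2 + (D p y)\<^sup>2" using fy fz b0(1) by (intro add_mono power_mono) auto
        finally show ?thesis unfolding \<psi>_def x_def[symmetric] y_def[symmetric] z_def[symmetric] l_def[symmetric]
          by (simp add: power2_eq_square algebra_simps)
      qed
      moreover have "h * L < \<delta>" if "0 < h" "h < \<delta> / (L + 1)" for h
      proof -
        have "0 \<le> L" by (simp add: L_def)
        then have "h * (L + 1) < \<delta>" using that(2) by (simp add: pos_less_divide_eq)
        then show ?thesis using that(1) by (simp add: algebra_simps)
      qed
      moreover have "0 < \<delta> / (L + 1)" using d(1) by (simp add: L_def add_nonneg_pos)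
      ultimately show ?thesis by (intro exI[of _ "\<delta> / (L + 1)"]) auto
    qed
  qed
  then have "(D p (P u v t))\<^sup>2 - (t * L)\<^sup>2 \<le> (1-t) * (D p u)\<^sup>2 + t * ((D p v)\<^sup>2 - L\<^sup>2)" using uv by (simp add: \<psi>_def)
  then show ?thesis unfolding L_def[symmetric] by (simp add: power2_eq_square algebra_simps)
qed

text \<open>Both distances from \<open>P x v t\<close> are bounded above by convexity on the segment, and their sum is at least \<open>2 h\<close>; divide by \<open>t\<close> and let \<open>t\<close> tend to 0.\<close>

lemma two_apex:
  assumes x: "x \<in> X" "v \<in> X" "seg x v \<subseteq> X" and y: "y \<in> X" "z \<in> X" and h: "D y x = h" "D z x = h" "D y z = 2 * h"
  shows "2 * (dist x v)\<^sup>2 + 2 * h\<^sup>2 \<le> (D y v)\<^sup>2 + (D z v)\<^sup>2"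
proof -
  define r where "r = dist x v"
  have H: "x \<in> H" "v \<in> H" using x X_Hin by auto
  have h0: "0 \<le> h" using D_nonneg[OF y(1) x(1)] h by simp
  have *: "2 * h\<^sup>2 + 2 * (1-t) * r\<^sup>2 \<le> (D y v)\<^sup>2 + (D z v)\<^sup>2" if t: "0 < t" "t \<le> 1" for t
  proof -
    let ?u = "P x v t"
    have uX: "?u \<in> X" using seg_subD[OF x(3)] t by simp
    have "D y z \<le> D y ?u + D z ?u" using D_tri[OF y(1) uX y(2)] cd_sym[of CC z ?u] by simp
    then have "(2 * h)\<^sup>2 \<le> (D y ?u + D z ?u)\<^sup>2" using h0 h by (intro power_mono) auto
    also have "\<dots> \<le> 2 * (D y ?u)\<^sup>2 + 2 * (D z ?u)\<^sup>2" using sum_squares_bound[of "D y ?u" "D z ?u"] by (simp add: power2_eq_square algebra_simps)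
    finally have 1: "2 * h\<^sup>2 \<le> (D y ?u)\<^sup>2 + (D z ?u)\<^sup>2" by (simp add: power_mult_distrib)
    have 2: "(D y ?u)\<^sup>2 \<le> (1-t) * h\<^sup>2 + t * (D y v)\<^sup>2 - t * (1-t) * r\<^sup>2" "(D z ?u)\<^sup>2 \<le> (1-t) * h\<^sup>2 + t * (D z v)\<^sup>2 - t * (1-t) * r\<^sup>2"
      using apex_seg[OF y(1) H x(3), of t] apex_seg[OF y(2) H x(3), of t] t h by (auto simp: r_def)
    have "2 * h\<^sup>2 \<le> 2 * ((1-t) * h\<^sup>2) + t * ((D y v)\<^sup>2 + (D z v)\<^sup>2) - 2 * (t * (1-t) * r\<^sup>2)" using 1 2 by (simp add: distrib_left)
    then have "t * (2 * h\<^sup>2 + 2 * (1-t) * r\<^sup>2) \<le> t * ((D y v)\<^sup>2 + (D z v)\<^sup>2)" by (simp add: algebra_simps)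
    then show ?thesis using t(1) by (simp only: mult_le_cancel_left_pos)
  qed
  have "2 * h\<^sup>2 + 2 * r\<^sup>2 \<le> (D y v)\<^sup>2 + (D z v)\<^sup>2"
  proof (rule tendsto_upperbound[where F = "at_right (0::real)"])
    show "((\<lambda>t. 2 * h\<^sup>2 + 2 * (1-t) * r\<^sup>2) \<longlongrightarrow> 2 * h\<^sup>2 + 2 * r\<^sup>2) (at_right 0)" by (auto intro!: tendsto_eq_intros)
    have "\<forall>\<^sub>F t in at_right (0::real). t \<in> {0<..<1}" by (rule eventually_at_right_real) simp
    then show "\<forall>\<^sub>F t in at_right 0. 2 * h\<^sup>2 + 2 * (1-t) * r\<^sup>2 \<le> (D y v)\<^sup>2 + (D z v)\<^sup>2"
      by eventually_elim (use * in auto)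
  qed simp
  then show ?thesis by (simp add: r_def)
qed

lemma apex_cgeod:
  assumes p: "p \<in> X" and ab: "a \<in> X" "b \<in> X" and \<sigma>: "cgeod \<sigma> a b" and t: "0 \<le> t" "t \<le> 1"
  shows "(D p (\<sigma> (t * D a b)))\<^sup>2 \<le> (1-t) * (D p a)\<^sup>2 + t * (D p b)\<^sup>2 - t * (1-t) * (D a b)\<^sup>2"
proof -
  define L where "L = D a b"
  have L0: "0 \<le> L" using D_nonneg[OF ab] by (simp add: L_def)
  define q where "q s = \<sigma> (s * L)" for s
  define \<psi> where "\<psi> s = (D p (q s))\<^sup>2 - (s * L)\<^sup>2" for s
  have sL: "0 \<le> s * L" "s * L \<le> L" if "0 \<le> s" "s \<le> 1" for s using that L0 by (auto simp: mult_left_le_one_le)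
  have qX: "q s \<in> X" if "0 \<le> s" "s \<le> 1" for s using cgeodD(3)[OF \<sigma>] sL[OF that] by (simp add: q_def L_def)
  have Dq: "D (q s) (q s') = \<bar>s - s'\<bar> * L" if "0 \<le> s" "s \<le> 1" "0 \<le> s'" "s' \<le> 1" for s s'
  proof -
    have "D (q s) (q s') = \<bar>s * L - s' * L\<bar>" unfolding q_def
      by (rule cgeodD(4)[OF \<sigma>]) (use sL[OF that(1,2)] sL[OF that(3,4)] L_def in auto)
    also have "\<dots> = \<bar>s - s'\<bar> * L" using L0 by (simp add: left_diff_distrib[symmetric] abs_mult)
    finally show ?thesis .
  qed
  have "L-lipschitz_on {0..1} q"
  proof (rule lipschitz_onI[OF _ L0])
    fix s s' :: real assume "s \<in> {0..1}" "s' \<in> {0..1}"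
    then show "dist (q s) (q s') \<le> L * dist s s'" using D_ge[OF qX qX, of s s'] Dq[of s s'] by (simp add: dist_real_def mult.commute)
  qed
  then have qc: "continuous_on {0..1} q" by (rule lipschitz_on_continuous_on)
  have qI: "q ` S \<subseteq> X" if "S \<subseteq> {0..1}" for S by (rule image_subsetI, rule qX) (use that in auto)
  have "continuous_on {0..1} (\<lambda>s. D p (q s))" by (rule continuous_on_compose2[OF D_cont[OF p] qc qI]) simp
  then have \<psi>c: "continuous_on {0..1} \<psi>" unfolding \<psi>_def[abs_def] by (intro continuous_intros)
  \<comment> \<open>\<open>right_hit\<close> and \<open>left_hit\<close> give on each side a point
    in a common member with \<open>q s\<close>; convexity of the member keeps the whole piece in
    between inside it.\<close>
  have hit: "\<exists>e>0. \<forall>h. \<bar>h\<bar> < e \<longrightarrow> 0 \<le> s + h \<longrightarrow> s + h \<le> 1 \<longrightarrow> seg (q s) (q (s + h)) \<subseteq> X" if s: "0 < s" "s < 1" for s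
  proof -
    have "\<exists>C\<in>CC. \<exists>t\<in>{s<..1}. q s \<in> C \<and> q t \<in> C"
      by (rule right_hit[OF fin cl continuous_on_subset[OF qc] qI s(2)]) (use s in auto)
    then obtain C t where t: "C \<in> CC" "s < t" "t \<le> 1" "q s \<in> C" "q t \<in> C" by auto
    have "\<exists>C\<in>CC. \<exists>t\<in>{0..<s}. q s \<in> C \<and> q t \<in> C"
      by (rule left_hit[OF fin cl continuous_on_subset[OF qc] qI s(1)]) (use s in auto)
    then obtain C' t' where t': "C' \<in> CC" "0 \<le> t'" "t' < s" "q s \<in> C'" "q t' \<in> C'" by auto
    have main: "q r \<in> B" if B: "B \<in> CC" "q s \<in> B" "q t \<in> B" and t01: "0 \<le> t" "t \<le> 1" and u: "0 \<le> u" "u \<le> 1" "r = s + u * (t - s)" for B t u r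
    proof -
      have sH: "q s \<in> H" "q t \<in> H" using B cvx_sub[OF cv[OF B(1)]] by auto
      have r': "r = (1-u) * s + u * t" using u(3) by (simp add: algebra_simps)
      have "0 \<le> (1-u) * s" "0 \<le> u * t" using u s t01 by auto
      then have r01: "0 \<le> r" "r \<le> 1" using convex_bound_le[of s 1 t "1-u" u] t01 s u unfolding r' by linarith+
      have dst: "dist (q s) (q t) = \<bar>s - t\<bar> * L" using cd_same[OF B] Dq[of s t] s t01 by simp
      have "q r = P (q s) (q t) u"
      proof (rule P_unique[OF sH u(1,2)])
        show "q r \<in> H" using qX[OF r01] X_Hin by blast
        have "dist (q s) (q r) \<le> \<bar>s - r\<bar> * L" using D_ge[OF qX qX, of s r] Dq[of s r] s r01 by simp
        also have "s - r = - (u * (t - s))" using u(3) by simp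
        finally show "dist (q s) (q r) \<le> u * dist (q s) (q t)" using u(1) by (simp add: dst abs_mult abs_minus_commute mult.assoc)
        have "dist (q t) (q r) \<le> \<bar>t - r\<bar> * L" using D_ge[OF qX qX, of t r] Dq[of t r] t01 r01 by simp
        also have "t - r = (1-u) * (t - s)" using u(3) by (simp add: algebra_simps)
        finally show "dist (q t) (q r) \<le> (1-u) * dist (q s) (q t)" using u(2) by (simp add: dst abs_mult abs_minus_commute mult.assoc)
      qed
      then show ?thesis using cvxD[OF cv[OF B(1)] B(2,3) u(1,2)] by simp
    qed
    have segB: "seg (q s) (q r) \<subseteq> X" if "B \<in> CC" "q s \<in> B" "q r \<in> B" for B r
      using cvxD[OF cv[OF that(1)] that(2,3)] that(1) by (auto simp: seg_def)
    define e where "e = min (t - s) (s - t')"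
    have e: "0 < e" "e \<le> t - s" "e \<le> s - t'" using t t' by (auto simp: e_def)
    have "seg (q s) (q (s + h)) \<subseteq> X" if h: "\<bar>h\<bar> < e" for h
    proof (cases "0 \<le> h")
      case True
      have "q (s + h) \<in> C"
        by (rule main[OF t(1,4,5), of "h / (t - s)"]) (use t s True h e in \<open>auto simp: divide_le_eq_1\<close>)
      then show ?thesis using segB t by blast
    next
      case False
      have "q (s + h) \<in> C'"
        by (rule main[OF t'(1,4,5), of "(- h) / (s - t')"]) (use t' s False h e in \<open>auto simp: divide_le_eq_1 field_simps\<close>)
      then show ?thesis using segB t' by blast
    qed
    then show ?thesis using e(1) by blast
  qed
  have "\<psi> t \<le> (1-t) * \<psi> 0 + t * \<psi> 1"
  proof (rule local_midconvex[OF \<psi>c _ t])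
    fix s :: real assume s: "0 < s" "s < 1"
    define x where "x = q s"
    have xX: "x \<in> X" using qX s by (simp add: x_def)
    have xH: "x \<in> H" using xX X_Hin by blast
    have Dx: "D x (q (s + h)) = \<bar>h\<bar> * L" if "0 \<le> s + h" "s + h \<le> 1" for h using Dq[of s "s + h"] s that by (simp add: x_def)
    obtain e0 where e0: "0 < e0" "\<And>h. \<bar>h\<bar> < e0 \<Longrightarrow> 0 \<le> s + h \<Longrightarrow> s + h \<le> 1 \<Longrightarrow> seg x (q (s + h)) \<subseteq> X" using hit[OF s] unfolding x_def by metis
    show "\<exists>e>0. \<forall>h. 0 < h \<longrightarrow> h < e \<longrightarrow> 0 \<le> s - h \<longrightarrow> s + h \<le> 1 \<longrightarrow> 2 * \<psi> s \<le> \<psi> (s + h) + \<psi> (s - h)"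
    proof (cases "D p x = 0")
      case True
      then have px: "p = x" using D_eq0[OF p xX] by simp
      have "2 * \<psi> s \<le> \<psi> (s + h) + \<psi> (s - h)" if h: "0 < h" "0 \<le> s - h" "s + h \<le> 1" for h
        using Dx[of h] Dx[of "-h"] h True unfolding \<psi>_def px x_def[symmetric]
        by (simp add: power_mult_distrib power2_eq_square algebra_simps)
      then show ?thesis by (intro exI[of _ 1]) auto
    next
      case False
      define l where "l = D p x"
      have l0: "0 < l" using False D_nonneg[OF p xX] by (simp add: l_def)
      obtain g where g: "cgeod g p x" using geod_ex[OF p xX] by blast
      note tp = turn_props[OF g p xX l_def l0]
      define \<beta> where "\<beta> = turn g x l"
      define b where "b = g \<beta>"
      obtain \<delta> where d: "\<delta> > 0" "\<And>y g'. y \<in> X \<Longrightarrow> dist x y < \<delta> \<Longrightarrow> seg x y \<subseteq> X \<Longrightarrow> cgeod g' p y \<Longrightarrow> \<beta> \<le> D p y \<and> g' \<beta> = b"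
        using nearby_geodesics_branch_late[OF g p xX l_def l0] unfolding \<beta>_def b_def by metis
      have bX: "b \<in> X" unfolding b_def \<beta>_def by (rule cgeodD(3)[OF g tp(1)]) (use tp(2) l_def in simp)
      have bH: "b \<in> H" using bX X_Hin by blast
      have b0: "0 \<le> \<beta>" "\<beta> < l" "dist b x = l - \<beta>" using tp by (auto simp: \<beta>_def b_def)
      have far: "\<beta> + D y b = D p y" if y: "y \<in> X" "dist x y < \<delta>" "seg x y \<subseteq> X" for y
      proof -
        obtain g' where g': "cgeod g' p y" using geod_ex[OF p y(1)] by blast
        have "\<beta> \<le> D p y" "g' \<beta> = b" using d(2)[OF y g'] by auto
        then have "D b y = D p y - \<beta>" using cgeod_sub(2)[OF g' b0(1) _ order_refl] cgeodD(2)[OF g'] by simp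
        then show ?thesis using cd_sym[of CC b y] by simp
      qed
      have xg: "g l = x" using cgeodD(2)[OF g] by (simp add: l_def)
      have sxb: "seg x b \<subseteq> X"
      proof
        fix w assume "w \<in> seg x b"
        then obtain k where k: "0 \<le> k" "k \<le> 1" "w = P x b k" by (auto simp: seg_def)
        define u where "u = l - k * (l - \<beta>)"
        have "k * (l - \<beta>) \<le> l - \<beta>" "0 \<le> k * (l - \<beta>)" using k b0 by (auto simp: mult_left_le_one_le)
        then have u: "\<beta> \<le> u" "u \<le> l" by (auto simp: u_def)
        have gu: "g u \<in> X" using cgeodD(3)[OF g] u b0 l_def by simp
        have "g u = P x b k"
        proof (rule P_unique[OF xH bH k(1,2)])
          show "g u \<in> H" using gu X_Hin by blast
          have "dist x (g u) \<le> l - u" using geod_dist[OF g, of l u] u b0 xg l_def by simp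
          then show "dist x (g u) \<le> k * dist x b" using b0(3) by (simp add: u_def dist_commute)
          have "dist b (g u) \<le> u - \<beta>" using geod_dist[OF g, of \<beta> u] u b0 l_def by (simp add: b_def)
          also have "\<dots> = (1-k) * (l - \<beta>)" by (simp add: u_def algebra_simps)
          finally show "dist b (g u) \<le> (1-k) * dist x b" using b0(3) by (simp only: dist_commute[of x b])
        qed
        then show "w \<in> X" using gu k by simp
      qed
      have "2 * \<psi> s \<le> \<psi> (s + h) + \<psi> (s - h)" if h: "0 < h" "h < e0" "h * L < \<delta>" "0 \<le> s - h" "s + h \<le> 1" for h
      proof -
        define y z where "y = q (s + h)" and "z = q (s - h)"
        have yz: "y \<in> X" "z \<in> X" using qX[of "s+h"] qX[of "s-h"] h s by (auto simp: y_def z_def)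
        have dy: "D x y = h * L" "D x z = h * L" "D y z = 2 * (h * L)"
          using Dx[of h] Dx[of "-h"] Dq[of "s+h" "s-h"] h s by (auto simp: y_def z_def)
        have fy: "\<beta> + D y b = D p y" by (rule far) (use yz D_ge[OF xX yz(1)] dy h s e0(2)[of h] in \<open>auto simp: y_def\<close>)
        have fz: "\<beta> + D z b = D p z" by (rule far) (use yz D_ge[OF xX yz(2)] dy h s e0(2)[of "-h"] in \<open>auto simp: z_def\<close>)
        define r where "r = dist x b"
        have "r = l - \<beta>" using b0(3) dist_commute[of x b] by (simp add: r_def)
        then have r: "0 \<le> r" "l = \<beta> + r" using b0(2) by auto
        have q: "2 * r\<^sup>2 + 2 * (h * L)\<^sup>2 \<le> (D y b)\<^sup>2 + (D z b)\<^sup>2" unfolding r_def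
          by (rule two_apex[OF xX bX sxb yz]) (use dy cd_sym[of CC x] in auto)
        have lip: "\<bar>D y b - D z b\<bar> \<le> 2 * (h * L)" using D_lip[OF bX yz] dy cd_sym[of CC b] by simp
        have dn: "0 \<le> D y b" "0 \<le> D z b" using D_nonneg yz bX by auto
        \<comment> \<open>By the parallelogram identity, the bound q on the sum of squares and this
          bound on the difference give a lower bound for the sum.\<close>
        have "(D y b - D z b)\<^sup>2 \<le> (2 * (h * L))\<^sup>2" using lip by (rule power2_le_iff_abs_le[THEN iffD2, rotated]) (use h L0 in simp)
        then have "(2 * r)\<^sup>2 \<le> (D y b + D z b)\<^sup>2" using q by (simp add: power2_eq_square algebra_simps)
        then have cv: "2 * r \<le> D y b + D z b" by (rule power2_le_imp_le) (use dn in simp)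
        have "2 * l\<^sup>2 + 2 * (h * L)\<^sup>2 = 2 * \<beta>\<^sup>2 + 2 * \<beta> * (2 * r) + (2 * r\<^sup>2 + 2 * (h * L)\<^sup>2)"
          unfolding r(2) by (simp add: power2_eq_square algebra_simps)
        also have "\<dots> \<le> 2 * \<beta>\<^sup>2 + 2 * \<beta> * (D y b + D z b) + ((D y b)\<^sup>2 + (D z b)\<^sup>2)"
          by (rule add_mono[OF add_left_mono[OF mult_left_mono[OF cv]] q]) (use b0(1) in simp)
        also have "\<dots> = (D p y)\<^sup>2 + (D p z)\<^sup>2" unfolding fy[symmetric] fz[symmetric] by (simp add: power2_eq_square algebra_simps)
        finally show ?thesis unfolding \<psi>_def x_def[symmetric] y_def[symmetric] z_def[symmetric] l_def[symmetric]
          by (simp add: power2_eq_square algebra_simps)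
      qed
      moreover have "h * L < \<delta>" if "0 < h" "h < \<delta> / (L + 1)" for h
      proof -
        have "h * (L + 1) < \<delta>" using that(2) L0 by (simp add: pos_less_divide_eq)
        then show ?thesis using that(1) by (simp add: algebra_simps)
      qed
      moreover have "0 < min e0 (\<delta> / (L + 1))" using d(1) e0 L0 by simp
      ultimately show ?thesis by (intro exI[of _ "min e0 (\<delta> / (L + 1))"]) auto
    qed
  qed
  moreover have "q 0 = a" "q 1 = b" using cgeodD(1,2)[OF \<sigma>] by (auto simp: q_def L_def)
  ultimately have "(D p (q t))\<^sup>2 - (t * L)\<^sup>2 \<le> (1-t) * (D p a)\<^sup>2 + t * ((D p b)\<^sup>2 - L\<^sup>2)" by (simp add: \<psi>_def)
  then show ?thesis unfolding L_def[symmetric] q_def by (simp add: power2_eq_square algebra_simps)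
qed

lemma midpoint_ex:
  assumes "a \<in> X" "b \<in> X"
  shows "\<exists>m\<in>X. \<forall>p\<in>X. (D p m)\<^sup>2 \<le> (D p a)\<^sup>2 / 2 + (D p b)\<^sup>2 / 2 - (D a b)\<^sup>2 / 4"
proof -
  obtain g where g: "cgeod g a b" using geod_ex[OF assms] by blast
  show ?thesis
  proof (intro bexI ballI)
    show "g (1/2 * D a b) \<in> X" using cgeodD(3)[OF g, of "1/2 * D a b"] D_nonneg[OF assms] by simp
    show "(D p (g (1/2 * D a b)))\<^sup>2 \<le> (D p a)\<^sup>2 / 2 + (D p b)\<^sup>2 / 2 - (D a b)\<^sup>2 / 4" if "p \<in> X" for p
      using apex_cgeod[OF that assms g, of "1/2"] by simp
  qed
qed

end

section \<open>Dimension\<close>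

text \<open>A partition of unity sends K into finitely many convex hulls of at most three points
  each, a negligible set in dimension three or more. A small translation therefore makes the image
  miss 0.\<close>

lemma small_cover_avoid:
  fixes \<Theta> :: "'c::metric_space \<Rightarrow> 'e::euclidean_space"
  assumes D: "DIM('e) \<ge> 3" and K: "compact K" and \<Theta>: "continuous_on K \<Theta>" and e: "0 < e"
    and cov: "\<And>\<epsilon>. 0 < \<epsilon> \<Longrightarrow> \<exists>\<V>. finite \<V> \<and> (\<forall>V\<in>\<V>. openin (top_of_set K) V \<and> (\<forall>x\<in>V. \<forall>y\<in>V. dist x y < \<epsilon>)) \<and> K \<subseteq> \<Union>\<V> \<and> (\<forall>x\<in>K. card {V\<in>\<V>. x \<in> V} \<le> 3)"
  shows "\<exists>G. continuous_on K G \<and> (\<forall>x\<in>K. G x \<noteq> 0 \<and> dist (G x) (\<Theta> x) < e)"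
proof -
  have "uniformly_continuous_on K \<Theta>" using compact_uniformly_continuous[OF \<Theta> K] .
  then obtain d where d: "0 < d" "\<And>x y. x \<in> K \<Longrightarrow> y \<in> K \<Longrightarrow> dist x y < d \<Longrightarrow> dist (\<Theta> x) (\<Theta> y) < e/2"
    unfolding uniformly_continuous_on_def using half_gt_zero[OF e] by metis
  from cov[OF d(1)] obtain \<V>0 where V0': "finite \<V>0" "\<forall>V\<in>\<V>0. openin (top_of_set K) V \<and> (\<forall>x\<in>V. \<forall>y\<in>V. dist x y < d)"
    "K \<subseteq> \<Union>\<V>0" "\<forall>x\<in>K. card {V\<in>\<V>0. x \<in> V} \<le> 3" by (elim exE conjE) (rule that)
  have V0: "finite \<V>0" "\<And>V. V \<in> \<V>0 \<Longrightarrow> openin (top_of_set K) V"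
      "\<And>V x y. V \<in> \<V>0 \<Longrightarrow> x \<in> V \<Longrightarrow> y \<in> V \<Longrightarrow> dist x y < d" "K \<subseteq> \<Union>\<V>0" "\<And>x. x \<in> K \<Longrightarrow> card {V\<in>\<V>0. x \<in> V} \<le> 3"
    using V0' by blast+
  define \<V> where "\<V> = \<V>0 - {{}}"
  have V: "finite \<V>" "\<And>V. V \<in> \<V> \<Longrightarrow> openin (top_of_set K) V" "\<And>V x y. V \<in> \<V> \<Longrightarrow> x \<in> V \<Longrightarrow> y \<in> V \<Longrightarrow> dist x y < d" "K \<subseteq> \<Union>\<V>"
    using V0(1-4) by (auto simp: \<V>_def)
  have V3: "card {V\<in>\<V>. x \<in> V} \<le> 3" if "x \<in> K" for x
    by (rule order_trans[OF card_mono V0(5)[OF that]]) (use V0(1) in \<open>auto simp: \<V>_def\<close>)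
  have VK: "V \<subseteq> K" if "V \<in> \<V>" for V using openin_imp_subset[OF V(2)[OF that]] .
  have "\<forall>V\<in>\<V>. \<exists>p. p \<in> V" by (auto simp: \<V>_def)
  then obtain p where p: "\<And>V. V \<in> \<V> \<Longrightarrow> p V \<in> V" by metis
  \<comment> \<open>The distance from the empty set is 0 by convention, hence the separate value for
    V = K.\<close>
  define f where "f V x = (if V = K then 1 else infdist x (K - V))" for V x
  have f0: "0 \<le> f V x" for V x by (simp add: f_def infdist_nonneg)
  have fc: "continuous_on K (f V)" for V unfolding f_def[abs_def] by (cases "V = K") (auto intro!: continuous_intros)
  have fpos: "0 < f V x \<longleftrightarrow> x \<in> V" if "V \<in> \<V>" "x \<in> K" for V x
  proof (cases "V = K")
    case False
    then have ne: "K - V \<noteq> {}" using VK[OF that(1)] by blast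
    have "closed (K - V)"
    proof -
      have "closedin (top_of_set K) (K - V)" using V(2)[OF that(1)] by (simp add: closedin_def Diff_Diff_Int VK that inf.absorb2)
      then show ?thesis using closedin_closed_trans compact_imp_closed[OF K] by blast
    qed
    then have "infdist x (K - V) = 0 \<longleftrightarrow> x \<in> K - V" using in_closed_iff_infdist_zero[OF _ ne] by blast
    then show ?thesis using that False infdist_nonneg[of x "K - V"] by (auto simp: f_def order_less_le)
  qed (use that in \<open>simp add: f_def\<close>)
  define S where "S x = (\<Sum>V\<in>\<V>. f V x)" for x
  have S0: "0 < S x" if x: "x \<in> K" for x
  proof -
    obtain V where "V \<in> \<V>" "x \<in> V" using V(4) x by blast
    then show ?thesis unfolding S_def using fpos[of V x] x f0 by (intro sum_pos2[OF V(1), of V]) auto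
  qed
  define \<Theta>' where "\<Theta>' x = (\<Sum>V\<in>\<V>. (f V x / S x) *\<^sub>R \<Theta> (p V))" for x
  have Sc: "continuous_on K S" unfolding S_def[abs_def] by (intro continuous_intros fc)
  have \<Theta>c: "continuous_on K \<Theta>'" unfolding \<Theta>'_def[abs_def]
    by (intro continuous_intros fc Sc) (use S0 in force)
  have restr: "\<Theta>' x = (\<Sum>V\<in>{V\<in>\<V>. x \<in> V}. (f V x / S x) *\<^sub>R \<Theta> (p V)) \<and> (\<Sum>V\<in>{V\<in>\<V>. x \<in> V}. f V x / S x) = 1" if x: "x \<in> K" for x
  proof
    have z: "f V x = 0" if "V \<in> \<V> - {V\<in>\<V>. x \<in> V}" for V using fpos[of V x] that x f0[of V x] by auto
    show "\<Theta>' x = (\<Sum>V\<in>{V\<in>\<V>. x \<in> V}. (f V x / S x) *\<^sub>R \<Theta> (p V))"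
      unfolding \<Theta>'_def by (rule sum.mono_neutral_right) (use V(1) z in auto)
    have "(\<Sum>V\<in>{V\<in>\<V>. x \<in> V}. f V x / S x) = (\<Sum>V\<in>\<V>. f V x / S x)" by (rule sum.mono_neutral_left) (use V(1) z in auto)
    also have "\<dots> = 1" using S0[OF x] by (simp add: S_def sum_divide_distrib[symmetric])
    finally show "(\<Sum>V\<in>{V\<in>\<V>. x \<in> V}. f V x / S x) = 1" .
  qed
  have near: "\<Theta>' x \<in> ball (\<Theta> x) (e/2)" if x: "x \<in> K" for x
  proof -
    have "(\<Sum>V\<in>{V\<in>\<V>. x \<in> V}. (f V x / S x) *\<^sub>R \<Theta> (p V)) \<in> ball (\<Theta> x) (e/2)"
    proof (rule convex_sum[OF _ convex_ball])
      show "\<Theta> (p i) \<in> ball (\<Theta> x) (e/2)" if "i \<in> {V \<in> \<V>. x \<in> V}" for i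
        using d(2)[OF x, of "p i"] V(3)[of i x "p i"] p[of i] VK[of i] that by auto
    qed (use V(1) restr[OF x] f0 S0[OF x] in \<open>auto intro: divide_nonneg_pos\<close>)
    then show ?thesis using restr[OF x] by simp
  qed
  define N where "N = (\<Union>T\<in>{T. T \<subseteq> \<V> \<and> card T \<le> 3}. convex hull ((\<lambda>V. \<Theta> (p V)) ` T))"
  have inN: "\<Theta>' x \<in> N" if x: "x \<in> K" for x
  proof -
    let ?T = "{V\<in>\<V>. x \<in> V}"
    have "(\<Sum>V\<in>?T. (f V x / S x) *\<^sub>R \<Theta> (p V)) \<in> convex hull ((\<lambda>V. \<Theta> (p V)) ` ?T)"
      by (rule convex_sum[OF _ convex_convex_hull]) (use V(1) restr[OF x] f0 S0[OF x] hull_inc in \<open>auto intro: divide_nonneg_pos hull_inc\<close>)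
    then have "\<Theta>' x \<in> convex hull ((\<lambda>V. \<Theta> (p V)) ` ?T)" using restr[OF x] by simp
    moreover have "?T \<in> {T. T \<subseteq> \<V> \<and> card T \<le> 3}" using V3[OF x] by auto
    ultimately show ?thesis unfolding N_def by (rule UN_I[rotated])
  qed
  have "negligible N" unfolding N_def
  proof (rule negligible_Union)
    show "finite ((\<lambda>T. convex hull ((\<lambda>V. \<Theta> (p V)) ` T)) ` {T. T \<subseteq> \<V> \<and> card T \<le> 3})" using V(1) by auto
    fix t assume "t \<in> (\<lambda>T. convex hull ((\<lambda>V. \<Theta> (p V)) ` T)) ` {T. T \<subseteq> \<V> \<and> card T \<le> 3}"
    then obtain T where T: "T \<subseteq> \<V>" "card T \<le> 3" "t = convex hull ((\<lambda>V. \<Theta> (p V)) ` T)" by auto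
    have fT: "finite T" using T(1) V(1) finite_subset by blast
    have "card ((\<lambda>V. \<Theta> (p V)) ` T) \<le> DIM('e)" using card_image_le[OF fT, of "\<lambda>V. \<Theta> (p V)"] T(2) D by linarith
    then have "interior (convex hull ((\<lambda>V. \<Theta> (p V)) ` T)) = {}" using fT by (intro empty_interior_convex_hull) auto
    then show "negligible t" using T(3) negligible_convex_interior by auto
  qed
  then have "\<not> ball 0 (e/2) \<subseteq> N" using open_not_negligible[of "ball (0::'e) (e/2)"] negligible_subset[of N] e by auto
  then obtain v where "v \<in> ball 0 (e/2)" and vN: "v \<notin> N" by blast
  then have v: "norm v < e/2" "v \<notin> N" by auto
  have "\<Theta>' x - v \<noteq> 0 \<and> dist (\<Theta>' x - v) (\<Theta> x) < e" if x: "x \<in> K" for x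
  proof
    show "\<Theta>' x - v \<noteq> 0" using inN[OF x] v(2) by auto
    have "dist (\<Theta>' x - v) (\<Theta> x) \<le> dist (\<Theta>' x - v) (\<Theta>' x) + dist (\<Theta>' x) (\<Theta> x)" by (rule dist_triangle)
    also have "\<dots> < e/2 + e/2" using near[OF x] v(1) by (intro add_strict_mono) (auto simp: dist_norm norm_minus_commute)
    finally show "dist (\<Theta>' x - v) (\<Theta> x) < e" by simp
  qed
  then show ?thesis by (intro exI[of _ "\<lambda>x. \<Theta>' x - v"]) (auto intro!: continuous_intros \<Theta>c)
qed

lemma small_cover:
  assumes K: "compact K" and dim: "covering_metric_dim_le K n" and e: "0 < \<epsilon>"
  shows "\<exists>\<V>. finite \<V> \<and> (\<forall>V\<in>\<V>. openin (top_of_set K) V \<and> (\<forall>x\<in>V. \<forall>y\<in>V. dist x y < \<epsilon>)) \<and> K \<subseteq> \<Union>\<V> \<and> (\<forall>x\<in>K. card {V\<in>\<V>. x \<in> V} \<le> n + 1)"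
proof -
  obtain Z where Z: "finite Z" "Z \<subseteq> K" "K \<subseteq> (\<Union>z\<in>Z. ball z (\<epsilon>/2))"
    using compactE_image[OF K, of K "\<lambda>z. ball z (\<epsilon>/2)"] e by (metis UN_I centre_in_ball half_gt_zero open_ball subsetI)
  let ?U = "(\<lambda>z. K \<inter> ball z (\<epsilon>/2)) ` Z"
  have "finite ?U \<and> (\<forall>U\<in>?U. openin (top_of_set K) U) \<and> K \<subseteq> \<Union>?U" using Z by (auto intro: openin_open_Int)
  from dim[unfolded covering_metric_dim_le_def, THEN spec, THEN mp, OF this]
  obtain \<V> where V: "finite \<V>" "\<forall>V\<in>\<V>. openin (top_of_set K) V" "K \<subseteq> \<Union>\<V>" "\<forall>V\<in>\<V>. \<exists>U\<in>?U. V \<subseteq> U" "\<forall>x\<in>K. card {V\<in>\<V>. x \<in> V} \<le> n + 1"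
    by (elim exE conjE) (rule that)
  have "dist x y < \<epsilon>" if "V \<in> \<V>" "x \<in> V" "y \<in> V" for V x y
  proof -
    from bspec[OF V(4) that(1)] obtain U where U: "U \<in> ?U" "V \<subseteq> U" by (rule bexE)
    from U(1) obtain z where "U = K \<inter> ball z (\<epsilon>/2)" by (rule imageE)
    then have "V \<subseteq> ball z (\<epsilon>/2)" using U(2) by simp
    then have "dist z x < \<epsilon>/2" "dist z y < \<epsilon>/2" using that by auto
    then show ?thesis using dist_triangle_half_r[of z x \<epsilon> y] by simp
  qed
  then have "\<forall>V\<in>\<V>. openin (top_of_set K) V \<and> (\<forall>x\<in>V. \<forall>y\<in>V. dist x y < \<epsilon>)" using V(2) by simp
  then show ?thesis using V(1,3,5) by (intro exI conjI)
qed

text \<open>The dimension is known for compact subsets of Y, while K lies in a completion. Push K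
  into Y by s, almost without moving it, cover the image, and pull the cover back; multiplicities do
  not grow.\<close>

lemma small_cover_pullback:
  fixes K :: "'c::metric_space set" and \<iota> :: "'a::metric_space \<Rightarrow> 'c"
  assumes K: "compact K" and iso: "\<And>x y. dist (\<iota> x) (\<iota> y) = dist x y" and dim: "metric_dim_le Y n"
    and s: "\<And>\<delta>. 0 < \<delta> \<Longrightarrow> \<exists>s. continuous_on K s \<and> s ` K \<subseteq> Y \<and> (\<forall>x\<in>K. dist (\<iota> (s x)) x < \<delta>)" and e: "0 < \<epsilon>"
  shows "\<exists>\<V>. finite \<V> \<and> (\<forall>V\<in>\<V>. openin (top_of_set K) V \<and> (\<forall>x\<in>V. \<forall>y\<in>V. dist x y < \<epsilon>)) \<and> K \<subseteq> \<Union>\<V> \<and> (\<forall>x\<in>K. card {V\<in>\<V>. x \<in> V} \<le> n + 1)"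
proof -
  have e3: "0 < \<epsilon>/3" using e by simp
  from s[OF e3] obtain s where s: "continuous_on K s" "s ` K \<subseteq> Y" "\<And>x. x \<in> K \<Longrightarrow> dist (\<iota> (s x)) x < \<epsilon>/3" by metis
  have cs: "compact (s ` K)" using compact_continuous_image[OF s(1) K] .
  then have "covering_metric_dim_le (s ` K) n" using dim s(2) unfolding metric_dim_le_def by blast
  from small_cover[OF cs this e3] obtain \<V> where V': "finite \<V>" "\<forall>V\<in>\<V>. openin (top_of_set (s ` K)) V \<and> (\<forall>x\<in>V. \<forall>y\<in>V. dist x y < \<epsilon>/3)"
    "s ` K \<subseteq> \<Union>\<V>" "\<forall>x\<in>s ` K. card {V\<in>\<V>. x \<in> V} \<le> n + 1" by (elim exE conjE) (rule that)
  have V: "finite \<V>" "\<And>V. V \<in> \<V> \<Longrightarrow> openin (top_of_set (s ` K)) V"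
    "\<And>V x y. V \<in> \<V> \<Longrightarrow> x \<in> V \<Longrightarrow> y \<in> V \<Longrightarrow> dist x y < \<epsilon>/3" "s ` K \<subseteq> \<Union>\<V>" "\<And>x. x \<in> s ` K \<Longrightarrow> card {V\<in>\<V>. x \<in> V} \<le> n + 1"
    using V' by blast+
  let ?W = "(\<lambda>V. K \<inter> s -` V) ` \<V>"
  have "openin (top_of_set K) (K \<inter> s -` V)" if "V \<in> \<V>" for V
    by (rule continuous_openin_preimage[OF s(1) _ V(2)[OF that]]) auto
  moreover have "dist x y < \<epsilon>" if "V \<in> \<V>" "x \<in> K \<inter> s -` V" "y \<in> K \<inter> s -` V" for V x y
  proof -
    have "dist (\<iota> (s x)) (\<iota> (s y)) < \<epsilon>/3" using V(3)[OF that(1), of "s x" "s y"] that iso by simp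
    moreover have "dist (\<iota> (s x)) x < \<epsilon>/3" "dist (\<iota> (s y)) y < \<epsilon>/3" using s(3) that by auto
    ultimately show ?thesis using dist_triangle[of x y "\<iota> (s x)"] dist_triangle[of "\<iota> (s x)" y "\<iota> (s y)"] dist_commute[of x "\<iota> (s x)"] by linarith
  qed
  moreover have "card {W\<in>?W. x \<in> W} \<le> n + 1" if x: "x \<in> K" for x
  proof -
    have "card {W\<in>?W. x \<in> W} \<le> card ((\<lambda>V. K \<inter> s -` V) ` {V\<in>\<V>. s x \<in> V})"
      by (rule card_mono) (use V(1) in auto)
    also have "\<dots> \<le> card {V\<in>\<V>. s x \<in> V}" by (rule card_image_le) (use V(1) in auto)
    also have "\<dots> \<le> n + 1" using V(5) x by blast
    finally show ?thesis .
  qed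
  moreover have "K \<subseteq> \<Union>?W" using V(4) by blast
  ultimately have "\<forall>W\<in>?W. openin (top_of_set K) W \<and> (\<forall>x\<in>W. \<forall>y\<in>W. dist x y < \<epsilon>)"
    "\<forall>x\<in>K. card {W\<in>?W. x \<in> W} \<le> n + 1" "K \<subseteq> \<Union>?W" by simp_all
  moreover have "finite ?W" using V(1) by simp
  ultimately show ?thesis by (intro exI[of _ ?W] conjI)
qed

section \<open>Barycentric approximation into a dense convex subset\<close>

context hadamard
begin

text \<open>A barycentre formed by successive geodesic steps. It depends on the order of the list,
  but continuity and the Jensen-type bound for distances survive the induction.\<close>

lemma bary_ex:
  assumes B: "B \<subseteq> H" "\<And>x y t. x \<in> B \<Longrightarrow> y \<in> B \<Longrightarrow> 0 \<le> t \<Longrightarrow> t \<le> 1 \<Longrightarrow> P x y t \<in> B"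
    and bs: "bs \<noteq> []" "set bs \<subseteq> B" and l: "\<And>b. b \<in> set bs \<Longrightarrow> continuous_on K (l b)" "\<And>b x. b \<in> set bs \<Longrightarrow> x \<in> K \<Longrightarrow> 0 < l b x"
  shows "\<exists>R. continuous_on K R \<and> (\<forall>x\<in>K. R x \<in> B \<and> (\<forall>z\<in>H. (\<Sum>b\<leftarrow>bs. l b x) * dist z (R x) \<le> (\<Sum>b\<leftarrow>bs. l b x * dist z b)))"
  using bs l
proof (induction bs rule: list_nonempty_induct)
  case (single b)
  then show ?case by (intro exI[of _ "\<lambda>_. b"]) auto
next
  case (cons b bs)
  from cons.IH cons.prems obtain R where R: "continuous_on K R" "\<And>x. x \<in> K \<Longrightarrow> R x \<in> B"
    "\<And>x z. x \<in> K \<Longrightarrow> z \<in> H \<Longrightarrow> (\<Sum>b\<leftarrow>bs. l b x) * dist z (R x) \<le> (\<Sum>b\<leftarrow>bs. l b x * dist z b)" by auto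
  define W where "W x = (\<Sum>b\<leftarrow>bs. l b x)" for x
  have Wc: "continuous_on K W" 
  proof -
    have "continuous_on K (\<lambda>x. \<Sum>b\<leftarrow>cs. l b x)" if "set cs \<subseteq> set bs" for cs using that
      by (induction cs) (use cons.prems(2) in \<open>auto intro!: continuous_intros\<close>)
    then show ?thesis by (simp add: W_def[abs_def])
  qed
  have W0: "0 < W x" if x: "x \<in> K" for x
  proof -
    have "0 \<le> (\<Sum>b\<leftarrow>cs. l b x)" if "set cs \<subseteq> set bs" for cs using that
      by (induction cs) (use cons.prems(3)[OF _ x] in \<open>auto simp: less_imp_le\<close>)
    moreover obtain c cs where "bs = c # cs" using cons.hyps by (cases bs) auto
    ultimately show ?thesis unfolding W_def using cons.prems(3)[OF _ x, of c] by (auto intro: add_pos_nonneg)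
  qed
  have lb: "0 < l b x" if "x \<in> K" for x using cons.prems(3) that by simp
  define u where "u x = l b x / (l b x + W x)" for x
  have u: "0 \<le> u x" "u x \<le> 1" "(l b x + W x) * u x = l b x" "(l b x + W x) * (1 - u x) = W x" if "x \<in> K" for x
    using lb[OF that] W0[OF that] by (auto simp: u_def divide_le_eq_1 right_diff_distrib add_pos_pos less_imp_neq[OF add_pos_pos, symmetric])
  have bB: "b \<in> B" using cons.prems by simp
  have "l b x + W x \<noteq> 0" if "x \<in> K" for x using lb[OF that] W0[OF that] by simp
  then have uc: "continuous_on K u" unfolding u_def[abs_def] using cons.prems(2) by (intro continuous_intros Wc) auto
  have Rc: "continuous_on K (\<lambda>x. P (R x) b (u x))"
    by (rule P_continuous[OF R(1) _ uc]) (use R(2) B(1) bB u in \<open>auto intro: continuous_intros\<close>)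
  have "(\<Sum>b\<leftarrow>b # bs. l b x) * dist z (P (R x) b (u x)) \<le> (\<Sum>b\<leftarrow>b # bs. l b x * dist z b)" if x: "x \<in> K" and z: "z \<in> H" for x z
  proof -
    have "dist z (P (R x) b (u x)) \<le> (1 - u x) * dist z (R x) + u x * dist z b"
      using dist_convex[OF z, of "R x" b "u x"] R(2)[OF x] bB B(1) u[OF x] by auto
    then have "(l b x + W x) * dist z (P (R x) b (u x)) \<le> (l b x + W x) * ((1 - u x) * dist z (R x) + u x * dist z b)"
      using lb[OF x] W0[OF x] by (intro mult_left_mono) auto
    also have "\<dots> = ((l b x + W x) * (1 - u x)) * dist z (R x) + ((l b x + W x) * u x) * dist z b" by (simp add: algebra_simps)
    also have "\<dots> = W x * dist z (R x) + l b x * dist z b" unfolding u(3,4)[OF x] ..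
    also have "\<dots> \<le> (\<Sum>b\<leftarrow>bs. l b x * dist z b) + l b x * dist z b" using R(3)[OF x z] by (simp add: W_def)
    finally show ?thesis by (simp add: W_def)
  qed
  moreover have "P (R x) b (u x) \<in> B" if "x \<in> K" for x using B(2) R(2)[OF that] bB u[OF that] by blast
  ultimately show ?case using Rc by (intro exI[of _ "\<lambda>x. P (R x) b (u x)"]) auto
qed

text \<open>Send x to a barycentre of a finite net in B, with weights concentrated on the net points
  close to x; the Jensen-type bound seen from x itself shows that x hardly moves.\<close>

lemma approx_into_dense:
  assumes B: "B \<subseteq> H" "\<And>x y t. x \<in> B \<Longrightarrow> y \<in> B \<Longrightarrow> 0 \<le> t \<Longrightarrow> t \<le> 1 \<Longrightarrow> P x y t \<in> B" and dense: "H \<subseteq> closure B"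
    and K: "compact K" "K \<subseteq> H" and d: "0 < \<delta>"
  shows "\<exists>R. continuous_on K R \<and> R ` K \<subseteq> B \<and> (\<forall>x\<in>K. dist (R x) x < \<delta>)"
proof (cases "K = {}")
  case False
  have "\<exists>b\<in>B. dist b x < \<delta>/4" if "x \<in> K" for x
    using dense K(2) that d unfolding closure_approachable by (meson subsetD zero_less_divide_iff zero_less_numeral closure_approachable)
  then obtain nb where nb: "\<And>x. x \<in> K \<Longrightarrow> nb x \<in> B" "\<And>x. x \<in> K \<Longrightarrow> dist (nb x) x < \<delta>/4" by metis
  have K': "K \<subseteq> (\<Union>x\<in>K. ball (nb x) (\<delta>/4))" using nb by auto
  obtain Z where Z: "finite Z" "Z \<subseteq> K" "K \<subseteq> (\<Union>x\<in>Z. ball (nb x) (\<delta>/4))"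
    by (rule compactE_image[OF K(1) _ K']) auto
  obtain bs where bs: "set bs = nb ` Z" "distinct bs" using finite_distinct_list[of "nb ` Z"] Z(1) by auto
  have bne: "bs \<noteq> []" using bs Z False by auto
  have bB: "set bs \<subseteq> B" using bs nb Z by auto
  have hit: "\<exists>b\<in>set bs. dist b x < \<delta>/4" if "x \<in> K" for x using subsetD[OF Z(3) that] bs(1) by auto
  obtain M where M: "0 < M" "\<And>b x. b \<in> set bs \<Longrightarrow> x \<in> K \<Longrightarrow> dist x b \<le> M"
  proof -
    have "bounded (set bs \<union> K)" using K(1) compact_imp_bounded by auto
    then obtain a M where M: "\<And>x. x \<in> set bs \<union> K \<Longrightarrow> dist a x \<le> M" unfolding bounded_def by auto
    have "dist x b \<le> 2 * \<bar>M\<bar> + 1" if "b \<in> set bs" "x \<in> K" for b x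
      using M[of b] M[of x] that dist_triangle3[of x b a] by auto
    then show thesis using that[of "2 * \<bar>M\<bar> + 1"] by auto
  qed
  define n where "n = real (length bs)"
  have n: "n > 0" using bne by (simp add: n_def)
  \<comment> \<open>\<open>bary_ex\<close> asks for positive weights. With this floor the far net
    points together contribute at most \<delta>^2/16, little compared with the weight above
    \<delta>/4 of a near one.\<close>
  define \<eta> where "\<eta> = \<delta>\<^sup>2 / (16 * n * M)"
  have \<eta>: "\<eta> > 0" "n * \<eta> * M = \<delta>\<^sup>2 / 16" using n M d by (auto simp: \<eta>_def)
  define l where "l b x = \<eta> + max 0 (\<delta>/2 - dist x b)" for b x :: 'c
  have l0: "0 < l b x" for b x using \<eta> by (simp add: l_def add_pos_nonneg)
  have lc: "continuous_on K (l b)" for b unfolding l_def[abs_def] by (intro continuous_intros)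
  have "\<exists>R. continuous_on K R \<and> (\<forall>x\<in>K. R x \<in> B \<and> (\<forall>z\<in>H. (\<Sum>b\<leftarrow>bs. l b x) * dist z (R x) \<le> (\<Sum>b\<leftarrow>bs. l b x * dist z b)))"
  proof (rule bary_ex[OF B(1) _ bne bB lc l0])
    show "P x y t \<in> B" if "x \<in> B" "y \<in> B" "0 \<le> t" "t \<le> 1" for x y t by (rule B(2)[OF that])
  qed
  then obtain R where R': "continuous_on K R"
    "\<forall>x\<in>K. R x \<in> B \<and> (\<forall>z\<in>H. (\<Sum>b\<leftarrow>bs. l b x) * dist z (R x) \<le> (\<Sum>b\<leftarrow>bs. l b x * dist z b))" by (elim exE conjE) (rule that)
  have R: "continuous_on K R" "\<And>x. x \<in> K \<Longrightarrow> R x \<in> B"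
    "\<And>x z. x \<in> K \<Longrightarrow> z \<in> H \<Longrightarrow> (\<Sum>b\<leftarrow>bs. l b x) * dist z (R x) \<le> (\<Sum>b\<leftarrow>bs. l b x * dist z b)" using R' by blast+
  have "dist (R x) x < \<delta>" if x: "x \<in> K" for x
  proof -
    have conv: "(\<Sum>b\<leftarrow>bs. g b) = (\<Sum>b\<in>set bs. g b)" for g :: "'c \<Rightarrow> real" using bs(2) by (simp add: sum_list_distinct_conv_sum_set)
    define S where "S = (\<Sum>b\<in>set bs. l b x)"
    have cn: "real (card (set bs)) = n" using bs(2) by (simp add: n_def distinct_card)
    obtain c where c: "c \<in> set bs" "dist c x < \<delta>/4" using hit[OF x] by blast
    have "\<delta>/2 - dist x c \<le> max 0 (\<delta>/2 - dist x c)" by simp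
    then have "\<delta>/4 < l c x" using c(2) \<eta>(1) unfolding l_def dist_commute[of c x] by linarith
    also have "l c x \<le> S" unfolding S_def by (rule member_le_sum) (use c l0 in \<open>auto simp: less_imp_le\<close>)
    finally have S: "\<delta>/4 < S" .
    have "S * dist x (R x) \<le> (\<Sum>b\<in>set bs. l b x * dist x b)" using R(3)[OF x, of x] K(2) x by (auto simp: conv S_def)
    also have "\<dots> \<le> (\<Sum>b\<in>set bs. l b x * (\<delta>/2) + \<eta> * M)"
    proof (rule sum_mono)
      fix b assume b: "b \<in> set bs"
      show "l b x * dist x b \<le> l b x * (\<delta>/2) + \<eta> * M"
      proof (cases "dist x b \<le> \<delta>/2")
        case True
        then have "l b x * dist x b \<le> l b x * (\<delta>/2)" using l0 by (intro mult_left_mono) (auto simp: less_imp_le)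
        then show ?thesis using \<eta>(1) M(1) by (simp add: add_increasing2)
      next
        case False
        then have "l b x = \<eta>" by (simp add: l_def)
        then have "l b x * dist x b \<le> \<eta> * M" using \<eta>(1) M(2)[OF b x] by simp
        moreover have "0 \<le> l b x * (\<delta>/2)" using l0[of b x] d by simp
        ultimately show ?thesis by linarith
      qed
    qed
    also have "\<dots> = S * (\<delta>/2) + n * \<eta> * M" by (simp add: sum.distrib S_def sum_distrib_right sum_divide_distrib cn)
    also have "\<dots> < S * (\<delta>/2) + S * (\<delta>/2)" 
    proof -
      have "\<delta>\<^sup>2 / 16 < \<delta>/4 * (\<delta>/2)" using d by (simp add: power2_eq_square)
      also have "\<dots> < S * (\<delta>/2)" using S d by (intro mult_strict_right_mono) auto
      finally show ?thesis using \<eta>(2) by simp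
    qed
    also have "\<dots> = S * \<delta>" by simp
    finally have "S * dist x (R x) < S * \<delta>" .
    then show ?thesis using S d by (simp add: dist_commute mult_less_cancel_left)
  qed
  then show ?thesis using R by (intro exI[of _ R]) auto
qed auto

end

text \<open>A compact subset of H is pushed into the dense geodesically closed image of B by
  \<open>approx_into_dense\<close>; \<open>small_cover_pullback\<close> then supplies fine covers of
  multiplicity three, and \<open>small_cover_avoid\<close> the perturbation.\<close>

lemma hadamard2_closure:
  fixes H :: "'c::complete_space set" and \<iota> :: "'a::metric_space \<Rightarrow> 'c"
  assumes "hadamard H" and iso: "\<And>x y. dist (\<iota> x) (\<iota> y) = dist x y" and dim: "metric_dim_le Y 2"
    and B: "\<iota> ` B \<subseteq> H" "B \<subseteq> Y" "\<And>x y t. x \<in> B \<Longrightarrow> y \<in> B \<Longrightarrow> 0 \<le> t \<Longrightarrow> t \<le> 1 \<Longrightarrow> hadamard.P H (\<iota> x) (\<iota> y) t \<in> \<iota> ` B" and dense: "H \<subseteq> closure (\<iota> ` B)"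
  shows "hadamard2 H"
proof -
  interpret hadamard H by fact
  show ?thesis
  proof unfold_locales
    fix K and \<Theta> :: "'c \<Rightarrow> complex \<times> real" and e :: real
    assume K: "compact K" "K \<subseteq> H" and \<Theta>: "continuous_on K \<Theta>" and e: "0 < e"
    have inj: "inj \<iota>" using iso by (metis dist_eq_0_iff injI)
    show "\<exists>G. continuous_on K G \<and> (\<forall>x\<in>K. G x \<noteq> 0 \<and> dist (G x) (\<Theta> x) < e)"
    proof (rule small_cover_avoid[OF _ K(1) \<Theta> e])
      show "3 \<le> DIM(complex \<times> real)" by simp
      fix \<epsilon> :: real assume \<epsilon>: "0 < \<epsilon>"
      have ss: "\<exists>s. continuous_on K s \<and> s ` K \<subseteq> Y \<and> (\<forall>x\<in>K. dist (\<iota> (s x)) x < \<delta>)" if d: "0 < \<delta>" for \<delta>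
      proof -
        obtain R where R: "continuous_on K R" "R ` K \<subseteq> \<iota> ` B" "\<forall>x\<in>K. dist (R x) x < \<delta>"
        proof -
          have "\<exists>R. continuous_on K R \<and> R ` K \<subseteq> \<iota> ` B \<and> (\<forall>x\<in>K. dist (R x) x < \<delta>)"
          proof (rule approx_into_dense[OF B(1) _ dense K d])
            show "P x y t \<in> \<iota> ` B" if xy: "x \<in> \<iota> ` B" "y \<in> \<iota> ` B" and t: "0 \<le> t" "t \<le> 1" for x y t
            proof -
              obtain a b where "a \<in> B" "b \<in> B" "x = \<iota> a" "y = \<iota> b" using xy by blast
              then show ?thesis using B(3)[of a b t] t by simp
            qed
          qed
          then show thesis by (elim exE conjE) (rule that)
        qed
        define s where "s x = inv \<iota> (R x)" for x
        have si: "\<iota> (s x) = R x" if "x \<in> K" for x unfolding s_def by (rule f_inv_into_f) (use R(2) that in blast)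
        have "continuous_on K s" unfolding continuous_on_iff
        proof (intro ballI allI impI)
          fix x and k :: real assume x: "x \<in> K" and k: "0 < k"
          then obtain d where d: "0 < d" "\<And>y. y \<in> K \<Longrightarrow> dist y x < d \<Longrightarrow> dist (R y) (R x) < k" using R(1) unfolding continuous_on_iff by metis
          have "dist (s y) (s x) < k" if "y \<in> K" "dist y x < d" for y using d(2)[OF that] si[OF that(1)] si[OF x] iso[of "s y" "s x"] by simp
          then show "\<exists>d>0. \<forall>y\<in>K. dist y x < d \<longrightarrow> dist (s y) (s x) < k" using d(1) by blast
        qed
        moreover have "s x \<in> Y" if "x \<in> K" for x
        proof -
          have "R x \<in> \<iota> ` B" using R(2) that by blast
          then show ?thesis unfolding s_def using inj B(2) by (auto simp: inv_f_f)
        qed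
        ultimately show ?thesis using R(3) si by (intro exI[of _ s]) auto
      qed
      show "\<exists>\<V>. finite \<V> \<and> (\<forall>V\<in>\<V>. openin (top_of_set K) V \<and> (\<forall>x\<in>V. \<forall>y\<in>V. dist x y < \<epsilon>)) \<and> K \<subseteq> \<Union>\<V> \<and> (\<forall>x\<in>K. card {V\<in>\<V>. x \<in> V} \<le> 3)"
        using small_cover_pullback[OF K(1) iso dim ss \<epsilon>] by simp
    qed
  qed
qed

section \<open>Charts\<close>

text \<open>An isometric embedding into a Banach space; subtracting \<open>dist c y\<close> is what
  makes the functions bounded. The closure of the image of Y serves as its completion.\<close>

definition kuratowski :: "'a::metric_space \<Rightarrow> 'a \<Rightarrow> ('a \<Rightarrow>\<^sub>C real)" where
  "kuratowski c x = Bcontfun (\<lambda>y. dist x y - dist c y)"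

lemma kuratowski_apply: "apply_bcontfun (kuratowski c x) y = dist x y - dist c y"
proof -
  have "continuous_on UNIV (\<lambda>y. dist x y - dist c y)" by (intro continuous_intros)
  moreover have "norm (dist x y - dist c y) \<le> dist x c" for y
    using dist_triangle[of x y c] dist_triangle[of c y x] dist_commute[of x c] by (simp add: abs_le_iff)
  ultimately have "(\<lambda>y. dist x y - dist c y) \<in> bcontfun" by (rule bcontfun_normI)
  then show ?thesis by (simp add: kuratowski_def Bcontfun_inverse)
qed

lemma dist_kuratowski: "dist (kuratowski c x) (kuratowski c y) = dist x y"
proof (rule antisym)
  show "dist (kuratowski c x) (kuratowski c y) \<le> dist x y"
  proof (rule dist_bound)
    fix z
    have "\<bar>dist x z - dist y z\<bar> \<le> dist x y" using dist_triangle[of x z y] dist_triangle[of y z x] dist_commute[of x y] by (simp add: abs_le_iff)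
    then show "dist (apply_bcontfun (kuratowski c x) z) (apply_bcontfun (kuratowski c y) z) \<le> dist x y" by (simp add: kuratowski_apply dist_real_def)
  qed
  have "dist (apply_bcontfun (kuratowski c x) y) (apply_bcontfun (kuratowski c y) y) \<le> dist (kuratowski c x) (kuratowski c y)" by (rule dist_bounded)
  then show "dist x y \<le> dist (kuratowski c x) (kuratowski c y)" by (simp add: kuratowski_apply dist_real_def)
qed

text \<open>\<open>CAT0\<close> quantifies over all comparison triangles, so it says something only
  once one is constructed. The third vertex comes from the law of cosines; a zero side is placed
  separately because of the division by \<open>\<alpha>\<close>.\<close>

lemma comparison_triangle:
  assumes "0 \<le> \<alpha>" "0 \<le> \<beta>" "0 \<le> \<gamma>" "\<alpha> \<le> \<beta> + \<gamma>" "\<beta> \<le> \<alpha> + \<gamma>" "\<gamma> \<le> \<alpha> + \<beta>"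
  shows "\<exists>a b c :: real^2. dist a b = \<alpha> \<and> dist b c = \<beta> \<and> dist c a = \<gamma>"
proof -
  have d: "dist (vector [x, y] :: real^2) (vector [x', y']) = sqrt ((x - x')\<^sup>2 + (y - y')\<^sup>2)" for x y x' y' :: real
    by (simp add: dist_vec_def L2_set_def UNIV_2 dist_real_def)
  show ?thesis
  proof (cases "\<alpha> = 0")
    case True
    then have "dist (vector [0, 0] :: real^2) (vector [0, 0]) = \<alpha>" "dist (vector [0, 0] :: real^2) (vector [\<beta>, 0]) = \<beta>" "dist (vector [\<beta>, 0] :: real^2) (vector [0, 0]) = \<gamma>"
      using assms by (auto simp: d)
    then show ?thesis by blast
  next
    case False
    define u where "u = (\<gamma>\<^sup>2 + \<alpha>\<^sup>2 - \<beta>\<^sup>2) / (2 * \<alpha>)"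
    have ua: "2 * \<alpha> * u = \<gamma>\<^sup>2 + \<alpha>\<^sup>2 - \<beta>\<^sup>2" using False by (simp add: u_def)
    have "\<beta>\<^sup>2 \<le> (\<alpha> + \<gamma>)\<^sup>2" using assms by (intro power_mono) auto
    moreover have "(\<alpha> - \<gamma>)\<^sup>2 \<le> \<beta>\<^sup>2" using assms by (intro abs_le_square_iff[THEN iffD1]) auto
    ultimately have "\<bar>2 * \<alpha> * u\<bar> \<le> 2 * \<alpha> * \<gamma>" unfolding ua by (simp add: abs_le_iff power2_eq_square algebra_simps)
    then have "\<bar>u\<bar> \<le> \<gamma>" using assms False by (simp add: abs_mult)
    then have u2: "u\<^sup>2 \<le> \<gamma>\<^sup>2" using abs_le_square_iff[of u \<gamma>] assms by simp
    define v where "v = sqrt (\<gamma>\<^sup>2 - u\<^sup>2)"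
    have v: "v\<^sup>2 = \<gamma>\<^sup>2 - u\<^sup>2" using u2 by (simp add: v_def)
    have "(\<alpha> - u)\<^sup>2 + v\<^sup>2 = \<beta>\<^sup>2" using ua unfolding v by (simp add: power2_eq_square algebra_simps)
    then have "dist (vector [0, 0] :: real^2) (vector [\<alpha>, 0]) = \<alpha>" "dist (vector [\<alpha>, 0] :: real^2) (vector [u, v]) = \<beta>" "dist (vector [u, v] :: real^2) (vector [0, 0]) = \<gamma>"
      using assms v unfolding d by auto
    then show ?thesis by blast
  qed
qed

lemma stewart:
  fixes a b c :: "'e::euclidean_space"
  shows "(dist c (a + t *\<^sub>R (b - a)))\<^sup>2 = (1-t) * (dist c a)\<^sup>2 + t * (dist c b)\<^sup>2 - t * (1-t) * (dist a b)\<^sup>2"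
  unfolding dist_norm power2_norm_eq_inner by (simp add: inner_simps inner_commute algebra_simps)

text \<open>Compare a point of one side with the opposite vertex. In the plane
  \<open>stewart\<close> computes this distance: it is the CN inequality with equality.\<close>

lemma CAT0_cn:
  assumes C: "CAT0 S" and xy: "x \<in> S" "y \<in> S" and t: "0 \<le> t" "t \<le> 1"
  shows "\<exists>m\<in>S. \<forall>z\<in>S. (dist z m)\<^sup>2 \<le> (1-t) * (dist z x)\<^sup>2 + t * (dist z y)\<^sup>2 - t * (1-t) * (dist x y)\<^sup>2"
proof -
  have gs: "\<And>p q. p \<in> S \<Longrightarrow> q \<in> S \<Longrightarrow> \<exists>g. geodesic_segment S g p q" using C by (auto simp: CAT0_def geodesic_space_def)
  obtain g where g: "geodesic_segment S g x y" using gs[OF xy] by blast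
  define s where "s = t * dist x y"
  have s: "s \<in> {0..dist x y}" using t by (auto simp: s_def mult_left_le_one_le)
  have "(dist z (g s))\<^sup>2 \<le> (1-t) * (dist z x)\<^sup>2 + t * (dist z y)\<^sup>2 - t * (1-t) * (dist x y)\<^sup>2" if z: "z \<in> S" for z
  proof -
    obtain g2 g3 where g23: "geodesic_segment S g2 y z" "geodesic_segment S g3 z x" using gs[OF xy(2) z] gs[OF z xy(1)] by blast
    obtain a b c :: "real^2" where abc: "dist a b = dist x y" "dist b c = dist y z" "dist c a = dist z x"
      using comparison_triangle[of "dist x y" "dist y z" "dist z x"] dist_triangle[of x y z] dist_triangle[of y z x] dist_triangle[of z x y]
      by (auto simp: dist_commute)
    let ?T = "{(g, a, b, dist x y), (g2, b, c, dist y z), (g3, c, a, dist z x)}"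
    have all: "\<forall>(g, u, v, L) \<in> ?T. \<forall>(g', u', v', L') \<in> ?T. \<forall>s\<in>{0..L}. \<forall>t\<in>{0..L'}. dist (g s) (g' t) \<le> dist (cmp_point u v L s) (cmp_point u' v' L' t)"
      by (rule bspec[OF bspec[OF bspec[OF C[unfolded CAT0_def, THEN conjunct2] xy(1)] xy(2)] z,
            THEN spec[of _ g], THEN spec[of _ g2], THEN spec[of _ g3], THEN mp, OF conjI[OF g conjI[OF g23]],
            THEN spec[of _ a], THEN spec[of _ b], THEN spec[of _ c], THEN mp, OF conjI[OF abc(1) conjI[OF abc(2,3)]]])
    have "dist (g s) (g3 0) \<le> dist (cmp_point a b (dist x y) s) (cmp_point c a (dist z x) 0)"
      using all s by simp
    moreover have "g3 0 = z" using g23(2) by (simp add: geodesic_segment_def)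
    moreover have "cmp_point c a (dist z x) 0 = c" by (simp add: cmp_point_def)
    moreover have "cmp_point a b (dist x y) s = a + t *\<^sub>R (b - a)"
      using abc(1) by (cases "dist x y = 0") (auto simp: cmp_point_def s_def)
    ultimately have "dist z (g s) \<le> dist c (a + t *\<^sub>R (b - a))" by (simp add: dist_commute)
    then have "(dist z (g s))\<^sup>2 \<le> (dist c (a + t *\<^sub>R (b - a)))\<^sup>2" by (intro power_mono) auto
    then show ?thesis unfolding stewart abc(1,3) using abc(2) by (simp add: dist_commute)
  qed
  moreover have "g s \<in> S" using g s by (auto simp: geodesic_segment_def)
  ultimately show ?thesis by blast
qed

text \<open>The computation of \<open>P_busemann1\<close> with squared distances as plain numbers.
  It recurs where no Hadamard space is at hand: on a set that may be incomplete, and for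
  \<open>D\<close>, whose CN inequality is local.\<close>

lemma cn_share:
  fixes t :: real
  assumes t: "0 \<le> t" "t \<le> 1"
    and 1: "mm \<le> (1-t) * mx + t * my - t * (1-t) * xy"
    and 2: "mx \<le> (1-t) * xx + t * xy - t * (1-t) * xy'"
    and 3: "my \<le> (1-t) * xy' - t * (1-t) * xy'"
  shows "mm \<le> (1-t)\<^sup>2 * xx"
proof -
  have "mm \<le> (1-t) * ((1-t) * xx + t * xy - t * (1-t) * xy') + t * ((1-t) * xy' - t * (1-t) * xy') - t * (1-t) * xy"
    using 1 mult_left_mono[OF 2, of "1-t"] mult_left_mono[OF 3, of t] t by linarith
  also have "\<dots> = (1-t)\<^sup>2 * xx" by (simp add: power2_eq_square algebra_simps)
  finally show ?thesis .
qed

definition cn_point :: "'c::metric_space set \<Rightarrow> 'c \<Rightarrow> 'c \<Rightarrow> real \<Rightarrow> 'c \<Rightarrow> bool" where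
  "cn_point S x y t m \<longleftrightarrow> m \<in> S \<and> (\<forall>z\<in>S. (dist z m)\<^sup>2 \<le> (1-t) * (dist z x)\<^sup>2 + t * (dist z y)\<^sup>2 - t * (1-t) * (dist x y)\<^sup>2)"

lemma cn_point_sym: "cn_point S x y t m \<Longrightarrow> cn_point S y x (1-t) m"
  by (auto simp: cn_point_def dist_commute mult.commute add.commute)

lemma cn_point_share:
  assumes m: "cn_point S x y t m" and m': "cn_point S x' y t m'" and S: "x \<in> S" "x' \<in> S" "y \<in> S" and t: "0 \<le> t" "t \<le> 1"
  shows "dist m m' \<le> (1-t) * dist x x'"
proof -
  have "(dist m' m)\<^sup>2 \<le> (1-t)\<^sup>2 * (dist x x')\<^sup>2"
  proof (rule cn_share[OF t])
    show "(dist m' m)\<^sup>2 \<le> (1-t) * (dist x m')\<^sup>2 + t * (dist y m')\<^sup>2 - t * (1-t) * (dist x y)\<^sup>2"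
      using m m' unfolding cn_point_def by (metis dist_commute)
    show "(dist x m')\<^sup>2 \<le> (1-t) * (dist x x')\<^sup>2 + t * (dist x y)\<^sup>2 - t * (1-t) * (dist x' y)\<^sup>2"
      using m' S unfolding cn_point_def by blast
    have "(dist y m')\<^sup>2 \<le> (1-t) * (dist y x')\<^sup>2 + t * (dist y y)\<^sup>2 - t * (1-t) * (dist x' y)\<^sup>2"
      using m' S unfolding cn_point_def by blast
    then show "(dist y m')\<^sup>2 \<le> (1-t) * (dist x' y)\<^sup>2 - t * (1-t) * (dist x' y)\<^sup>2" by (simp add: dist_commute)
  qed
  then have "(dist m m')\<^sup>2 \<le> ((1-t) * dist x x')\<^sup>2" by (simp add: power_mult_distrib dist_commute)
  then show ?thesis by (rule power2_le_imp_le) (use t in simp)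
qed

text \<open>Pass to the limit along sequences in S. The points \<open>m n\<close> form a Cauchy
  sequence: changing one endpoint at a time, via q, moves them by no more than the endpoints
  move.\<close>

lemma hadamard_closure:
  fixes S :: "'c::complete_space set"
  assumes cn: "\<And>x y t. x \<in> S \<Longrightarrow> y \<in> S \<Longrightarrow> 0 \<le> t \<Longrightarrow> t \<le> 1 \<Longrightarrow> \<exists>m. cn_point S x y t m"
  shows "hadamard (closure S)"
proof
  fix x y and t :: real assume xy: "x \<in> closure S" "y \<in> closure S" and t: "0 \<le> t" "t \<le> 1"
  obtain u v where u: "\<And>n. u n \<in> S" "u \<longlonglongrightarrow> x" and v: "\<And>n. v n \<in> S" "v \<longlonglongrightarrow> y"
    using xy unfolding closure_sequential by metis
  have "\<exists>m. cn_point S (u n) (v n) t m" for n by (rule cn[OF u(1) v(1) t])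
  then obtain m where m: "\<And>n. cn_point S (u n) (v n) t (m n)" by metis
  have mS: "m n \<in> S" for n using m by (simp add: cn_point_def)
  have md: "dist (m i) (m j) \<le> dist (u i) (u j) + dist (v i) (v j)" for i j
  proof -
    obtain q where q: "cn_point S (u j) (v i) t q" using cn[OF u(1) v(1) t] by blast
    have "dist (m i) q \<le> (1-t) * dist (u i) (u j)" by (rule cn_point_share[OF m q u(1) u(1) v(1) t])
    moreover have "dist q (m j) \<le> (1-(1-t)) * dist (v i) (v j)"
      by (rule cn_point_share[OF cn_point_sym[OF q] cn_point_sym[OF m] v(1) v(1) u(1)]) (use t in auto)
    moreover have "(1-t) * dist (u i) (u j) \<le> dist (u i) (u j)" "t * dist (v i) (v j) \<le> dist (v i) (v j)" using t by (auto simp: mult_left_le_one_le)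
    ultimately show ?thesis using dist_triangle[of "m i" "m j" q] by simp
  qed
  have "Cauchy m"
  proof (rule metric_CauchyI)
    fix e :: real assume "0 < e"
    then have e2: "0 < e/2" by simp
    obtain M1 where M1: "\<And>i j. i \<ge> M1 \<Longrightarrow> j \<ge> M1 \<Longrightarrow> dist (u i) (u j) < e/2" using metric_CauchyD[OF LIMSEQ_imp_Cauchy[OF u(2)] e2] by blast
    obtain M2 where M2: "\<And>i j. i \<ge> M2 \<Longrightarrow> j \<ge> M2 \<Longrightarrow> dist (v i) (v j) < e/2" using metric_CauchyD[OF LIMSEQ_imp_Cauchy[OF v(2)] e2] by blast
    have "dist (m i) (m j) < e" if "i \<ge> max M1 M2" "j \<ge> max M1 M2" for i j using md[of i j] M1[of i j] M2[of i j] that by simp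
    then show "\<exists>M. \<forall>i\<ge>M. \<forall>j\<ge>M. dist (m i) (m j) < e" by blast
  qed
  then obtain l where l: "m \<longlonglongrightarrow> l" using Cauchy_convergent convergent_def by blast
  have "l \<in> closure S" unfolding closure_sequential using mS l by blast
  moreover have "(dist z l)\<^sup>2 \<le> (1-t) * (dist z x)\<^sup>2 + t * (dist z y)\<^sup>2 - t * (1-t) * (dist x y)\<^sup>2" if z: "z \<in> closure S" for z
  proof -
    obtain q where q: "\<And>n. q n \<in> S" "q \<longlonglongrightarrow> z" using z unfolding closure_sequential by metis
    show ?thesis
    proof (rule LIMSEQ_le)
      show "(\<lambda>n. (dist (q n) (m n))\<^sup>2) \<longlonglongrightarrow> (dist z l)\<^sup>2" by (intro tendsto_intros q l)
      show "(\<lambda>n. (1-t) * (dist (q n) (u n))\<^sup>2 + t * (dist (q n) (v n))\<^sup>2 - t * (1-t) * (dist (u n) (v n))\<^sup>2) \<longlonglongrightarrow>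
         (1-t) * (dist z x)\<^sup>2 + t * (dist z y)\<^sup>2 - t * (1-t) * (dist x y)\<^sup>2" by (intro tendsto_intros q u v)
      show "\<exists>N. \<forall>n\<ge>N. (dist (q n) (m n))\<^sup>2 \<le> (1-t) * (dist (q n) (u n))\<^sup>2 + t * (dist (q n) (v n))\<^sup>2 - t * (1-t) * (dist (u n) (v n))\<^sup>2"
        using m q(1) unfolding cn_point_def by blast
    qed
  qed
  ultimately show "\<exists>m\<in>closure S. \<forall>z\<in>closure S. (dist z m)\<^sup>2 \<le> (1-t) * (dist z x)\<^sup>2 + t * (dist z y)\<^sup>2 - t * (1-t) * (dist x y)\<^sup>2" by blast
qed simp

text \<open>By \<open>P_unique\<close> the geodesics of the closure between image points come from
  B, so the image is dense and geodesically closed, as \<open>hadamard2_closure\<close>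
  demands.\<close>

lemma CAT0_hadamard2:
  fixes \<iota> :: "'a::metric_space \<Rightarrow> 'c::complete_space"
  assumes iso: "\<And>x y. dist (\<iota> x) (\<iota> y) = dist x y" and C: "CAT0 B" and B: "B \<subseteq> Y" and dim: "metric_dim_le Y 2"
  shows "hadamard2 (closure (\<iota> ` B))"
proof -
  have cnB: "\<exists>m\<in>B. cn_point (\<iota> ` B) (\<iota> x) (\<iota> y) t (\<iota> m)" if "x \<in> B" "y \<in> B" "0 \<le> t" "t \<le> 1" for x y t
    using CAT0_cn[OF C that] by (auto simp: cn_point_def iso)
  have had: "hadamard (closure (\<iota> ` B))"
  proof (rule hadamard_closure)
    fix x y and t :: real assume "x \<in> \<iota> ` B" "y \<in> \<iota> ` B" "0 \<le> t" "t \<le> 1"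
    then show "\<exists>m. cn_point (\<iota> ` B) x y t m" using cnB by blast
  qed
  then interpret hadamard "closure (\<iota> ` B)" .
  show ?thesis
  proof (rule hadamard2_closure[OF had iso dim _ B])
    show "\<iota> ` B \<subseteq> closure (\<iota> ` B)" by (rule closure_subset)
    fix x y and t :: real assume xy: "x \<in> B" "y \<in> B" and t: "0 \<le> t" "t \<le> 1"
    obtain m where m: "m \<in> B" "cn_point (\<iota> ` B) (\<iota> x) (\<iota> y) t (\<iota> m)" using cnB[OF xy t] by blast
    have H: "\<iota> x \<in> closure (\<iota> ` B)" "\<iota> y \<in> closure (\<iota> ` B)" "\<iota> m \<in> closure (\<iota> ` B)" using xy m(1) by (auto intro!: closure_subset[THEN subsetD])
    have "\<iota> m = P (\<iota> x) (\<iota> y) t"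
    proof (rule P_unique[OF H(1,2) t H(3)])
      have "(dist (\<iota> x) (\<iota> m))\<^sup>2 \<le> (1-t) * (dist (\<iota> x) (\<iota> x))\<^sup>2 + t * (dist (\<iota> x) (\<iota> y))\<^sup>2 - t * (1-t) * (dist (\<iota> x) (\<iota> y))\<^sup>2"
        using m(2) xy unfolding cn_point_def by blast
      then have "(dist (\<iota> x) (\<iota> m))\<^sup>2 \<le> (t * dist (\<iota> x) (\<iota> y))\<^sup>2" by (simp add: power2_eq_square algebra_simps)
      then show "dist (\<iota> x) (\<iota> m) \<le> t * dist (\<iota> x) (\<iota> y)" by (rule power2_le_imp_le) (use t in simp)
      have "(dist (\<iota> y) (\<iota> m))\<^sup>2 \<le> (1-t) * (dist (\<iota> y) (\<iota> x))\<^sup>2 + t * (dist (\<iota> y) (\<iota> y))\<^sup>2 - t * (1-t) * (dist (\<iota> x) (\<iota> y))\<^sup>2"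
        using m(2) xy unfolding cn_point_def by blast
      then have "(dist (\<iota> y) (\<iota> m))\<^sup>2 \<le> ((1-t) * dist (\<iota> x) (\<iota> y))\<^sup>2" by (simp add: power2_eq_square dist_commute algebra_simps)
      then show "dist (\<iota> y) (\<iota> m) \<le> (1-t) * dist (\<iota> x) (\<iota> y)" by (rule power2_le_imp_le) (use t in simp)
    qed
    then show "P (\<iota> x) (\<iota> y) t \<in> \<iota> ` B" using m(1) by (metis imageI)
  qed simp
qed

section \<open>Covers with stable nerve\<close>

lemma reach_mono: "reach CC' a b r \<Longrightarrow> CC' \<subseteq> CC \<Longrightarrow> reach CC a b r"
proof (induction rule: reach.induct)
  case (reach_refl a) then show ?case by (intro reach.reach_refl) blast
next
  case (reach_step a b r C c) then show ?case by (meson reach.reach_step subsetD)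
qed

lemma reach_nonneg: "reach CC a b r \<Longrightarrow> 0 \<le> r"
  using reach_ge zero_le_dist order_trans by blast

lemma cd_mono:
  assumes r: "reach CC' u v r" and sub: "CC' \<subseteq> CC" shows "cd CC u v \<le> cd CC' u v"
proof (rule field_le_epsilon)
  fix e :: real assume "0 < e"
  from cd_approx[OF r this] obtain s where s: "reach CC' u v s" "s < cd CC' u v + e" by blast
  show "cd CC u v \<le> cd CC' u v + e" using cd_le[OF reach_mono[OF s(1) sub]] s(2) by simp
qed

text \<open>So short a chain never leaves the open ball of radius \<open>\<rho>\<close> around x,
  hence it uses only members that meet this ball.\<close>

lemma reach_local:
  assumes "reach CC a b r" "dist x a + r < \<rho>" and hit: "\<forall>C\<in>CC. \<forall>q\<in>C. dist x q < \<rho> \<longrightarrow> C \<in> CC'"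
  shows "reach CC' a b r"
  using assms(1,2)
proof (induction rule: reach.induct)
  case (reach_refl a)
  then obtain C where "C \<in> CC" "a \<in> C" by blast
  then have "a \<in> \<Union>CC'" using hit reach_refl by auto
  then show ?case by (rule reach.reach_refl)
next
  case (reach_step a b r C c)
  have "dist x b \<le> dist x a + r" using dist_triangle[of x b a] reach_ge[OF reach_step.hyps(1)] by simp
  then have "dist x b < \<rho>" "dist x a + r < \<rho>" using reach_step.prems zero_le_dist[of b c] by linarith+
  then show ?case using bspec[OF bspec[OF hit reach_step.hyps(2)] reach_step.hyps(3)] reach_step.IH reach_step.hyps(3,4) by (intro reach.reach_step) auto
qed

text \<open>Chains longer than r cannot lower the infimum, and the others are chains of both
  families by \<open>reach_local\<close>.\<close>

lemma cd_local:
  assumes r: "reach CC u v r" "dist x u + r < \<rho>" and sub: "CC' \<subseteq> CC" and hit: "\<forall>C\<in>CC. \<forall>q\<in>C. dist x q < \<rho> \<longrightarrow> C \<in> CC'"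
  shows "reach CC' u v r" "cd CC' u v = cd CC u v"
proof -
  show r': "reach CC' u v r" by (rule reach_local[OF r hit])
  show "cd CC' u v = cd CC u v"
  proof (rule antisym)
    show "cd CC' u v \<le> cd CC u v"
    proof (rule field_le_epsilon)
      fix e :: real assume "0 < e"
      from cd_approx[OF r(1) this] obtain s where s: "reach CC u v s" "s < cd CC u v + e" by blast
      show "cd CC' u v \<le> cd CC u v + e"
      proof (cases "s \<le> r")
        case True
        then have "dist x u + s < \<rho>" using r(2) by simp
        from cd_le[OF reach_local[OF s(1) this hit]] show ?thesis using s(2) by simp
      next
        case False
        then show ?thesis using cd_le[OF r'] s(2) by simp
      qed
    qed
  qed (rule cd_mono[OF r' sub])
qed

text \<open>The midpoint is taken in the chart \<open>CC'\<close>. The factor 4 leaves room for the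
  detour from p via a to b, so distances among these three agree in both families; for m the
  inequality \<open>cd_mono\<close> has the right direction.\<close>

lemma local_cn:
  assumes st: "star2 H CC' w" and sub: "CC' \<subseteq> CC" and hit: "\<forall>C\<in>CC. \<forall>q\<in>C. dist a q < \<rho> \<longrightarrow> C \<in> CC'"
    and ab: "reach CC a b r" "4 * r < \<rho>"
  shows "\<exists>m. (\<exists>s. reach CC a m s) \<and> (\<forall>p r'. reach CC a p r' \<longrightarrow> 4 * r' < \<rho> \<longrightarrow>
    (cd CC p m)\<^sup>2 \<le> (cd CC p a)\<^sup>2 / 2 + (cd CC p b)\<^sup>2 / 2 - (cd CC a b)\<^sup>2 / 4)"
proof -
  interpret star2 H CC' w by fact
  have r0: "0 \<le> r" using reach_nonneg[OF ab(1)] .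
  then have rr: "dist a a + r < \<rho>" using ab(2) by simp
  note loc = cd_local[OF _ _ sub hit]
  have X: "a \<in> \<Union>CC'" "b \<in> \<Union>CC'" using reach_in[OF loc(1)[OF ab(1) rr]] by auto
  obtain m where m: "m \<in> \<Union>CC'" "\<And>p. p \<in> \<Union>CC' \<Longrightarrow> (cd CC' p m)\<^sup>2 \<le> (cd CC' p a)\<^sup>2 / 2 + (cd CC' p b)\<^sup>2 / 2 - (cd CC' a b)\<^sup>2 / 4"
    using midpoint_ex[OF X] by metis
  show ?thesis
  proof (intro exI conjI allI impI)
    obtain s where "reach CC' a m s" using reach_all[OF X(1) m(1)] by blast
    then show "reach CC a m (SOME s. reach CC a m s)" using reach_mono[OF _ sub] by (metis someI)
    fix p r' assume p: "reach CC a p r'" "4 * r' < \<rho>"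
    have r'0: "0 \<le> r'" using reach_nonneg[OF p(1)] .
    have pa: "reach CC p a r'" by (rule reach_sym[OF p(1)])
    have pb: "reach CC p b (r' + r)" by (rule reach_trans[OF ab(1) pa])
    have d: "dist a p \<le> r'" using reach_ge[OF p(1)] .
    have "dist a a + r' < \<rho>" using p(2) r'0 by simp
    then have pX: "p \<in> \<Union>CC'" using reach_in[OF loc(1)[OF p(1)]] by blast
    have e: "cd CC' p a = cd CC p a" "cd CC' p b = cd CC p b" "cd CC' a b = cd CC a b"
      using loc(2)[OF pa] loc(2)[OF pb] loc(2)[OF ab(1) rr] d p(2) ab(2) r0 r'0 by auto
    obtain s where s: "reach CC' p m s" using reach_all[OF pX m(1)] by blast
    have "cd CC p m \<le> cd CC' p m" by (rule cd_mono[OF s sub])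
    moreover have "0 \<le> cd CC p m" using cd_ge[OF reach_mono[OF s sub]] zero_le_dist order_trans by blast
    ultimately have "(cd CC p m)\<^sup>2 \<le> (cd CC' p m)\<^sup>2" by (intro power_mono)
    then show "(cd CC p m)\<^sup>2 \<le> (cd CC p a)\<^sup>2 / 2 + (cd CC p b)\<^sup>2 / 2 - (cd CC a b)\<^sup>2 / 4" using m(2)[OF pX] unfolding e by linarith
  qed
qed

lemma finite_centers:
  fixes A :: "'a::metric_space set"
  assumes "compact A" "\<And>a. a \<in> A \<Longrightarrow> 0 < R a"
  shows "\<exists>Z. finite Z \<and> Z \<subseteq> A \<and> (\<forall>a\<in>A. \<exists>z\<in>Z. dist z a < R z)"
proof -
  have "A \<subseteq> (\<Union>a\<in>A. ball a (R a))" using assms(2) by auto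
  from compactE_image[OF assms(1) open_ball this] obtain Z where Z: "Z \<subseteq> A" "finite Z" "A \<subseteq> (\<Union>a\<in>Z. ball a (R a))" by blast
  have "\<exists>z\<in>Z. dist z a < R z" if "a \<in> A" for a using subsetD[OF Z(3) that] by auto
  then show ?thesis using Z by blast
qed

text \<open>The nerve grows with the radius and can change only finitely often, so it is constant on
  some interval of radii. The balls that come close to a point a contain it after enlargement, so
  they form a simplex of the larger nerve, hence of the smaller one; its witness w is the common
  point of a star.\<close>

lemma chart_cover:
  fixes \<iota> :: "'a::metric_space \<Rightarrow> 'c::complete_space"
  assumes iso: "\<And>x y. dist (\<iota> x) (\<iota> y) = dist x y" and npc: "nonpositively_curved Y" and dim: "metric_dim_le Y 2"
    and A: "compact A" "A \<subseteq> Y" "A \<noteq> {}" and e: "0 < \<epsilon>"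
  shows "\<exists>CC \<rho> \<eta>. 0 < \<rho> \<and> 0 < \<eta> \<and> (\<forall>x\<in>\<Union>CC. \<exists>a\<in>A. dist x (\<iota> a) \<le> \<epsilon>) \<and>
    (\<forall>a\<in>A. \<forall>b\<in>A. dist a b < \<eta> \<longrightarrow> (\<exists>C\<in>CC. \<iota> a \<in> C \<and> \<iota> b \<in> C)) \<and>
    (\<forall>a b r. reach CC a b r \<longrightarrow> r < \<rho> \<longrightarrow> (\<exists>m. (\<exists>s. reach CC a m s) \<and> (\<forall>p r'. reach CC a p r' \<longrightarrow> r' < \<rho> \<longrightarrow>
      (cd CC p m)\<^sup>2 \<le> (cd CC p a)\<^sup>2 / 2 + (cd CC p b)\<^sup>2 / 2 - (cd CC a b)\<^sup>2 / 4)))"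
proof -
  have "\<forall>a\<in>A. \<exists>r>0. CAT0 (ball a r \<inter> Y)" using npc A(2) unfolding nonpositively_curved_def by blast
  then obtain R where R: "\<And>a. a \<in> A \<Longrightarrow> 0 < R a" "\<And>a. a \<in> A \<Longrightarrow> CAT0 (ball a (R a) \<inter> Y)" by metis
  obtain Z0 where Z0: "finite Z0" "Z0 \<subseteq> A" "\<And>a. a \<in> A \<Longrightarrow> \<exists>z\<in>Z0. dist z a < R z / 8"
    using finite_centers[OF A(1), of "\<lambda>a. R a / 8"] R(1) by auto
  have Z0ne: "Z0 \<noteq> {}" using Z0(3) A(3) by blast
  \<comment> \<open>The factor 1/8 leaves room for all that a chart has to contain: from c to a ball
    centre z' it is less than R/8, and the remaining distances add up to at most 6 \<sigma>, that is
    3 R/8.\<close>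
  define r0 where "r0 = Min (R ` Z0) / 8"
  have r0: "0 < r0" "\<And>c. c \<in> Z0 \<Longrightarrow> r0 \<le> R c / 8" using Z0 Z0ne R(1) by (auto simp: r0_def)
  obtain \<sigma> where \<sigma>: "0 < \<sigma>" "2 * \<sigma> \<le> \<epsilon>" "2 * \<sigma> \<le> r0" using that[of "min (\<epsilon>/2) (r0/2)"] e r0(1) by auto
  obtain Z where Z: "finite Z" "Z \<subseteq> A" "\<And>a. a \<in> A \<Longrightarrow> \<exists>z\<in>Z. dist z a < \<sigma> / 2"
    using finite_centers[OF A(1), of "\<lambda>_. \<sigma> / 2"] \<sigma>(1) by auto
  define Cb where "Cb z s = cball (\<iota> z) s \<inter> closure (\<iota> ` Y)" for z s
  define nv where "nv s = {T. T \<subseteq> Z \<and> (\<Inter>z\<in>T. Cb z s) \<noteq> {}}" for s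
  have nvfin: "finite (nv s)" for s by (rule finite_subset[of _ "Pow Z"]) (use Z(1) in \<open>auto simp: nv_def\<close>)
  have nvcard: "card (nv s) \<le> card (Pow Z)" for s by (rule card_mono) (use Z(1) in \<open>auto simp: nv_def\<close>)
  have nvmono: "nv s \<subseteq> nv t" if "s \<le> t" for s t
  proof
    fix T assume "T \<in> nv s"
    then obtain q where q: "T \<subseteq> Z" "\<And>z. z \<in> T \<Longrightarrow> q \<in> Cb z s" by (auto simp: nv_def)
    have "q \<in> Cb z t" if "z \<in> T" for z using q(2)[OF that] \<open>s \<le> t\<close> by (auto simp: Cb_def)
    then show "T \<in> nv t" using q(1) by (auto simp: nv_def)
  qed
  \<comment> \<open>A radius whose nerve is largest among those below \<open>2 * \<sigma>\<close>;
    by monotonicity the nerve cannot change between it and \<open>s1\<close>.\<close>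
  have "\<exists>s. (\<sigma> \<le> s \<and> s < 2 * \<sigma>) \<and> (\<forall>t. (\<sigma> \<le> t \<and> t < 2 * \<sigma>) \<longrightarrow> card (nv t) \<le> card (nv s))"
    by (rule ex_has_greatest_nat[of _ \<sigma> _ "Suc (card (Pow Z))"]) (use \<sigma>(1) nvcard in \<open>auto simp: less_Suc_eq_le simp del: card_Pow\<close>)
  then obtain s0 where s0: "\<sigma> \<le> s0" "s0 < 2 * \<sigma>" "\<And>t. \<sigma> \<le> t \<Longrightarrow> t < 2 * \<sigma> \<Longrightarrow> card (nv t) \<le> card (nv s0)" by blast
  define s1 where "s1 = (s0 + 2 * \<sigma>) / 2"
  have s1: "s0 < s1" "s1 < 2 * \<sigma>" using s0 by (auto simp: s1_def)
  have nveq: "nv s0 = nv s1"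
    by (rule card_seteq[OF nvfin nvmono s0(3)]) (use s0 s1 in auto)
  define CC where "CC = (\<lambda>z. Cb z s0) ` Z"
  define \<rho> where "\<rho> = s1 - s0"
  have \<rho>: "0 < \<rho>" using s1 by (simp add: \<rho>_def)
  have chart: "\<exists>m. (\<exists>s. reach CC a m s) \<and> (\<forall>p r'. reach CC a p r' \<longrightarrow> r' < \<rho>/4 \<longrightarrow>
      (cd CC p m)\<^sup>2 \<le> (cd CC p a)\<^sup>2 / 2 + (cd CC p b)\<^sup>2 / 2 - (cd CC a b)\<^sup>2 / 4)" if ab: "reach CC a b r" "r < \<rho>/4" for a b r
  proof -
    have "a \<in> \<Union>CC" using reach_in[OF ab(1)] by blast
    then obtain z' where z': "z' \<in> Z" "a \<in> Cb z' s0" by (auto simp: CC_def)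
    define I where "I = {z \<in> Z. dist (\<iota> z) a \<le> s1}"
    have acl: "a \<in> closure (\<iota> ` Y)" using z' by (simp add: Cb_def)
    have z'I: "z' \<in> I" using z' s1 by (auto simp: I_def Cb_def)
    have "a \<in> (\<Inter>z\<in>I. Cb z s1)" using acl by (auto simp: I_def Cb_def)
    then have "I \<in> nv s1" by (auto simp: nv_def I_def)
    then have "I \<in> nv s0" using nveq by simp
    then obtain w where w: "\<And>z. z \<in> I \<Longrightarrow> w \<in> Cb z s0" by (auto simp: nv_def)
    obtain c where c: "c \<in> Z0" "dist c z' < R c / 8" using Z0(3)[of z'] z'(1) Z(2) by blast
    have cA: "c \<in> A" using c(1) Z0(2) by blast
    define B where "B = ball c (R c) \<inter> Y"
    define H where "H = closure (\<iota> ` B)"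
    have had: "hadamard2 H" unfolding H_def B_def by (rule CAT0_hadamard2[OF iso R(2)[OF cA] _ dim]) simp
    have near: "dist (\<iota> c) q < R c" "dist (\<iota> c) (\<iota> z) < R c" if z: "z \<in> I" and q: "dist (\<iota> z) q \<le> s0" for z q
    proof -
      have 1: "dist (\<iota> z) a \<le> s1" "dist (\<iota> z') a \<le> s1" using z z'I by (auto simp: I_def)
      have 2: "dist (\<iota> c) (\<iota> z') < R c / 8" using c(2) iso by simp
      have 3: "dist (\<iota> c) (\<iota> z) \<le> dist (\<iota> c) (\<iota> z') + dist (\<iota> z') a + dist (\<iota> z) a"
        using dist_triangle[of "\<iota> c" "\<iota> z" a] dist_triangle[of "\<iota> c" a "\<iota> z'"] dist_commute[of a "\<iota> z"] by linarith
      have 4: "dist (\<iota> c) q \<le> dist (\<iota> c) (\<iota> z) + dist (\<iota> z) q" by (rule dist_triangle)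
      have 5: "6 * \<sigma> \<le> 3 * (R c / 8)" using \<sigma>(3) r0(2)[OF c(1)] by linarith
      show "dist (\<iota> c) (\<iota> z) < R c" using 1 2 3 5 s1 s0 \<sigma>(1) by linarith
      show "dist (\<iota> c) q < R c" using 1 2 3 4 5 s1 s0 q \<sigma>(1) R(1)[OF cA] by linarith
    qed
    \<comment> \<open>The balls live in the closure of all of Y. Inside the open chart ball nothing
      is lost by restricting Y before taking the closure.\<close>
    have CbH: "Cb z s0 = cball (\<iota> z) s0 \<inter> H" if z: "z \<in> I" for z
    proof
      show "cball (\<iota> z) s0 \<inter> H \<subseteq> Cb z s0"
        using closure_mono[of "\<iota> ` B" "\<iota> ` Y"] by (auto simp: Cb_def H_def B_def)
      show "Cb z s0 \<subseteq> cball (\<iota> z) s0 \<inter> H"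
      proof
        fix q assume q: "q \<in> Cb z s0"
        then have "q \<in> ball (\<iota> c) (R c) \<inter> closure (\<iota> ` Y)" using near(1)[OF z, of q] by (auto simp: Cb_def)
        then have "q \<in> closure (ball (\<iota> c) (R c) \<inter> \<iota> ` Y)" by (rule subsetD[OF open_Int_closure_subset[OF open_ball]])
        moreover have "ball (\<iota> c) (R c) \<inter> \<iota> ` Y \<subseteq> \<iota> ` B" by (auto simp: B_def iso)
        ultimately have "q \<in> H" unfolding H_def by (meson closure_mono subsetD)
        then show "q \<in> cball (\<iota> z) s0 \<inter> H" using q by (auto simp: Cb_def)
      qed
    qed
    interpret h: hadamard2 H by (rule had)
    have zH: "\<iota> z \<in> H" if z: "z \<in> I" for z
    proof -
      have "dist (\<iota> z) (\<iota> z) \<le> s0" using s0 \<sigma>(1) by simp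
      have "z \<in> Y" using z Z(2) A(2) unfolding I_def by blast
      moreover have "dist c z < R c" using near(2)[OF z \<open>dist (\<iota> z) (\<iota> z) \<le> s0\<close>] by (simp add: iso)
      ultimately have "z \<in> B" by (simp add: B_def)
      then show ?thesis unfolding H_def by (intro subsetD[OF closure_subset] imageI)
    qed
    have cvx: "h.cvx (Cb z s0)" if z: "z \<in> I" for z
    proof -
      have "h.P x y t \<in> cball (\<iota> z) s0 \<inter> H" if xy: "x \<in> cball (\<iota> z) s0 \<inter> H" "y \<in> cball (\<iota> z) s0 \<inter> H" "0 \<le> t" "t \<le> 1" for x y t
      proof -
        have "dist (\<iota> z) (h.P x y t) \<le> (1-t) * dist (\<iota> z) x + t * dist (\<iota> z) y" using h.dist_convex[OF zH[OF z]] xy by auto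
        also have "\<dots> \<le> (1-t) * s0 + t * s0" using xy by (intro add_mono mult_left_mono) auto
        also have "\<dots> = s0" by (simp add: algebra_simps)
        finally show ?thesis using h.P_in[of x y t] xy by auto
      qed
      then show ?thesis unfolding CbH[OF z] h.cvx_def by auto
    qed
    have st: "star2 H ((\<lambda>z. Cb z s0) ` I) w"
    proof (unfold_locales)
      show "finite ((\<lambda>z. Cb z s0) ` I)" using Z(1) by (auto simp: I_def)
      show "(\<lambda>z. Cb z s0) ` I \<noteq> {}" using z'I by blast
      show "closed C" if "C \<in> (\<lambda>z. Cb z s0) ` I" for C using that by (auto simp: Cb_def)
      show "h.cvx C" if "C \<in> (\<lambda>z. Cb z s0) ` I" for C using that cvx by auto
      show "w \<in> C" if "C \<in> (\<lambda>z. Cb z s0) ` I" for C using that w by auto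
    qed
    have hit: "\<forall>C\<in>CC. \<forall>q\<in>C. dist a q < \<rho> \<longrightarrow> C \<in> (\<lambda>z. Cb z s0) ` I"
    proof (intro ballI impI)
      fix C q assume C: "C \<in> CC" "q \<in> C" "dist a q < \<rho>"
      obtain z where z: "z \<in> Z" "C = Cb z s0" using C(1) by (auto simp: CC_def)
      then have "dist (\<iota> z) q \<le> s0" using C(2) by (simp add: Cb_def)
      then have "dist (\<iota> z) a \<le> s1" using dist_triangle2[of "\<iota> z" a q] C(3) by (simp add: \<rho>_def)
      then show "C \<in> (\<lambda>z. Cb z s0) ` I" using z by (auto simp: I_def)
    qed
    have sub: "(\<lambda>z. Cb z s0) ` I \<subseteq> CC" by (auto simp: CC_def I_def)
    have r4: "4 * r < \<rho>" using ab(2) by simp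
    from local_cn[OF st sub hit ab(1) r4] show ?thesis by (simp add: mult.commute)
  qed
  have apx: "\<exists>a\<in>A. dist x (\<iota> a) \<le> \<epsilon>" if x: "x \<in> \<Union>CC" for x
  proof -
    obtain z where "z \<in> Z" "dist (\<iota> z) x \<le> s0" using x by (auto simp: CC_def Cb_def)
    then show ?thesis using Z(2) s0 \<sigma>(2) by (intro bexI[of _ z]) (auto simp: dist_commute)
  qed
  have both: "\<exists>C\<in>CC. \<iota> a \<in> C \<and> \<iota> b \<in> C" if ab: "a \<in> A" "b \<in> A" "dist a b < \<sigma>/2" for a b
  proof -
    obtain z where z: "z \<in> Z" "dist z a < \<sigma>/2" using Z(3)[OF ab(1)] by blast
    have "dist z b < \<sigma>" using z(2) ab(3) dist_triangle[of z b a] by simp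
    then have "\<iota> a \<in> Cb z s0" "\<iota> b \<in> Cb z s0" using z(2) s0 \<sigma>(1) ab A(2) closure_subset[of "\<iota> ` Y"] by (auto simp: Cb_def iso)
    then show ?thesis using z(1) by (auto simp: CC_def)
  qed
  show ?thesis
    by (intro exI[of _ CC] exI[of _ "\<rho>/4"] exI[of _ "\<sigma>/2"] conjI ballI allI impI) (use \<rho> \<sigma>(1) apx both chart in \<open>simp_all\<close>)
qed

section \<open>Curve shortening\<close>

lemma half_le: "s \<le> 2 * a + 2 * b \<Longrightarrow> s / 2 \<le> a + b" for a b s :: real
  by linarith

lemma mean_le: "s \<le> (a + b) / 2 \<Longrightarrow> a \<le> k \<Longrightarrow> b \<le> k \<Longrightarrow> s \<le> k" for a b k s :: real
  by (erule order_trans) (drule (1) add_mono, simp)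

text \<open>Birkhoff curve shortening in discrete form. As all inner vertices move simultaneously,
  the distances between two polygons satisfy a discrete heat inequality.\<close>

definition bstep :: "('c \<Rightarrow> 'c \<Rightarrow> 'c) \<Rightarrow> nat \<Rightarrow> (nat \<Rightarrow> 'c) \<Rightarrow> nat \<Rightarrow> 'c" where
  "bstep M N y i = (if 0 < i \<and> i < N then M (y (i - 1)) (y (Suc i)) else y i)"

text \<open>A metric with CN midpoints for close pairs, where the observer p must be close too. This
  separates curve shortening from the origin of \<open>D\<close>.\<close>

locale locmid =
  fixes X0 :: "'c set" and D :: "'c \<Rightarrow> 'c \<Rightarrow> real" and \<rho> :: real and M :: "'c \<Rightarrow> 'c \<Rightarrow> 'c"
  assumes D_sym: "D x y = D y x" and D_tri: "x \<in> X0 \<Longrightarrow> y \<in> X0 \<Longrightarrow> z \<in> X0 \<Longrightarrow> D x z \<le> D x y + D y z"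
    and D_nonneg: "x \<in> X0 \<Longrightarrow> y \<in> X0 \<Longrightarrow> 0 \<le> D x y" and D_self: "x \<in> X0 \<Longrightarrow> D x x = 0" and \<rho>: "0 < \<rho>"
    and M_in: "a \<in> X0 \<Longrightarrow> b \<in> X0 \<Longrightarrow> D a b < \<rho> \<Longrightarrow> M a b \<in> X0"
    and M_cn: "a \<in> X0 \<Longrightarrow> b \<in> X0 \<Longrightarrow> p \<in> X0 \<Longrightarrow> D a b < \<rho> \<Longrightarrow> D a p < \<rho> \<Longrightarrow>
      (D p (M a b))\<^sup>2 \<le> (D p a)\<^sup>2 / 2 + (D p b)\<^sup>2 / 2 - (D a b)\<^sup>2 / 4"
begin

lemma M_half:
  assumes ab: "a \<in> X0" "b \<in> X0" "D a b < \<rho>"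
  shows "D a (M a b) \<le> D a b / 2" "D b (M a b) \<le> D a b / 2"
proof -
  have d0: "0 \<le> D a b" using D_nonneg ab by blast
  have "(D a (M a b))\<^sup>2 \<le> (D a b / 2)\<^sup>2" using M_cn[OF ab(1,2,1,3)] D_self[OF ab(1)] \<rho> by (simp add: power_divide)
  then show "D a (M a b) \<le> D a b / 2" by (rule power2_le_imp_le) (use d0 in simp)
  have "(D b (M a b))\<^sup>2 \<le> (D a b / 2)\<^sup>2" using M_cn[OF ab(1,2,2,3,3)] D_self[OF ab(2)] D_sym[of b a] by (simp add: power_divide)
  then show "D b (M a b) \<le> D a b / 2" by (rule power2_le_imp_le) (use d0 in simp)
qed

text \<open>The argument of \<open>cn_point_share\<close>; the bounds by \<rho>/4 keep every
  observer within the range of the CN inequality.\<close>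

lemma M_share1:
  assumes X: "a \<in> X0" "a' \<in> X0" "b \<in> X0" and d: "D a a' < \<rho>/4" "D a b < \<rho>/4" "D a' b < \<rho>/4"
  shows "D (M a b) (M a' b) \<le> D a a' / 2"
proof -
  have r: "D a b < \<rho>" "D a' b < \<rho>" "D a' a < \<rho>" using d \<rho> D_sym[of a' a] by auto
  let ?m = "M a b" and ?m' = "M a' b"
  have m': "?m' \<in> X0" using M_in X r by blast
  have "D a ?m' \<le> D a b + D b ?m'" by (rule D_tri[OF X(1,3) m'])
  then have am': "D a ?m' < \<rho>" using M_half(2)[OF X(2,3) r(2)] d \<rho> by linarith
  have "(D ?m' ?m)\<^sup>2 \<le> (1 - 1/2)\<^sup>2 * (D a a')\<^sup>2"
  proof (rule cn_share[where my = "(D ?m' b)\<^sup>2" and mx = "(D ?m' a)\<^sup>2" and xy = "(D a b)\<^sup>2" and xy' = "(D a' b)\<^sup>2"])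
    show "(D ?m' ?m)\<^sup>2 \<le> (1 - 1/2) * (D ?m' a)\<^sup>2 + 1/2 * (D ?m' b)\<^sup>2 - 1/2 * (1 - 1/2) * (D a b)\<^sup>2"
      using M_cn[OF X(1,3) m' r(1) am'] by simp
    show "(D ?m' a)\<^sup>2 \<le> (1 - 1/2) * (D a a')\<^sup>2 + 1/2 * (D a b)\<^sup>2 - 1/2 * (1 - 1/2) * (D a' b)\<^sup>2"
      using M_cn[OF X(2,3,1) r(2,3)] D_sym[of ?m' a] by simp
    show "(D ?m' b)\<^sup>2 \<le> (1 - 1/2) * (D a' b)\<^sup>2 - 1/2 * (1 - 1/2) * (D a' b)\<^sup>2"
      using M_cn[OF X(2,3,3) r(2,2)] D_sym[of ?m' b] D_sym[of b a'] D_self[OF X(3)] by simp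
  qed auto
  then have "(D ?m ?m')\<^sup>2 \<le> (D a a' / 2)\<^sup>2" using D_sym[of ?m ?m'] by (simp add: power2_eq_square)
  then show ?thesis by (rule power2_le_imp_le) (use D_nonneg[OF X(1,2)] in simp)
qed

lemma M_share2:
  assumes X: "a \<in> X0" "b \<in> X0" "b' \<in> X0" and d: "D b b' < \<rho>/4" "D a b < \<rho>/4" "D a b' < \<rho>/4"
  shows "D (M a b) (M a b') \<le> D b b' / 2"
proof -
  have r: "D a b < \<rho>" "D a b' < \<rho>" using d \<rho> by auto
  let ?m = "M a b" and ?m' = "M a b'"
  have m': "?m' \<in> X0" using M_in X r by blast
  have am': "D a ?m' < \<rho>" using M_half(1)[OF X(1,3) r(2)] d \<rho> by linarith
  have "(D ?m' ?m)\<^sup>2 \<le> (1 - 1/2)\<^sup>2 * (D b b')\<^sup>2"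
  proof (rule cn_share[where my = "(D ?m' a)\<^sup>2" and mx = "(D ?m' b)\<^sup>2" and xy = "(D a b)\<^sup>2" and xy' = "(D a b')\<^sup>2"])
    show "(D ?m' ?m)\<^sup>2 \<le> (1 - 1/2) * (D ?m' b)\<^sup>2 + 1/2 * (D ?m' a)\<^sup>2 - 1/2 * (1 - 1/2) * (D a b)\<^sup>2"
      using M_cn[OF X(1,2) m' r(1) am'] by simp
    show "(D ?m' b)\<^sup>2 \<le> (1 - 1/2) * (D b b')\<^sup>2 + 1/2 * (D a b)\<^sup>2 - 1/2 * (1 - 1/2) * (D a b')\<^sup>2"
      using M_cn[OF X(1,3,2) r(2,1)] D_sym[of ?m' b] D_sym[of b a] by simp
    show "(D ?m' a)\<^sup>2 \<le> (1 - 1/2) * (D a b')\<^sup>2 - 1/2 * (1 - 1/2) * (D a b')\<^sup>2"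
      using M_cn[OF X(1,3,1) r(2)] D_sym[of ?m' a] D_self[OF X(1)] \<rho> by simp
  qed auto
  then have "(D ?m ?m')\<^sup>2 \<le> (D b b' / 2)\<^sup>2" using D_sym[of ?m ?m'] by (simp add: power2_eq_square)
  then show ?thesis by (rule power2_le_imp_le) (use D_nonneg[OF X(2,3)] in simp)
qed

lemma M_contr:
  assumes X: "a \<in> X0" "a' \<in> X0" "b \<in> X0" "b' \<in> X0"
    and d: "D a a' < \<rho>/4" "D a b < \<rho>/4" "D a' b < \<rho>/4" "D a' b' < \<rho>/4" "D b b' < \<rho>/4"
  shows "D (M a b) (M a' b') \<le> (D a a' + D b b') / 2"
proof -
  have "M a b \<in> X0" "M a' b \<in> X0" "M a' b' \<in> X0" using M_in X d \<rho> by auto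
  then have "D (M a b) (M a' b') \<le> D (M a b) (M a' b) + D (M a' b) (M a' b')" by (rule D_tri)
  then show ?thesis using M_share1[OF X(1,2,3) d(1,2,3)] M_share2[OF X(2,3,4) d(5,3,4)] by simp
qed

definition good :: "nat \<Rightarrow> real \<Rightarrow> (nat \<Rightarrow> 'c) \<Rightarrow> bool" where
  "good N s y \<longleftrightarrow> (\<forall>i\<le>N. y i \<in> X0) \<and> (\<forall>i<N. D (y i) (y (Suc i)) \<le> s)"

lemma goodD: "good N s y \<Longrightarrow> i \<le> N \<Longrightarrow> y i \<in> X0" "good N s y \<Longrightarrow> i < N \<Longrightarrow> D (y i) (y (Suc i)) \<le> s"
  by (auto simp: good_def)

lemma good_dist:
  assumes g: "good N s y" shows "i \<le> j \<Longrightarrow> j \<le> N \<Longrightarrow> D (y i) (y j) \<le> real (j - i) * s"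
proof (induction j)
  case 0 then show ?case using D_self goodD(1)[OF g] by simp
next
  case (Suc j)
  show ?case
  proof (cases "i = Suc j")
    case True then show ?thesis using D_self goodD(1)[OF g] Suc by simp
  next
    case False
    then have ij: "i \<le> j" using Suc by simp
    have "D (y i) (y (Suc j)) \<le> D (y i) (y j) + D (y j) (y (Suc j))" by (rule D_tri) (use goodD(1)[OF g] Suc ij in auto)
    also have "\<dots> \<le> real (j - i) * s + s" using Suc ij goodD(2)[OF g, of j] by (intro add_mono) auto
    also have "\<dots> = real (Suc j - i) * s" using ij by (simp add: Suc_diff_le algebra_simps)
    finally show ?thesis .
  qed
qed

text \<open>By \<open>M_contr\<close> a new inner edge is at most the mean of two old ones, and a
  new end edge at most half the distance of second neighbours.\<close>

lemma bstep_good: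
  assumes g: "good N s y" and s: "0 \<le> s" "12 * s < \<rho>"
  shows "good N s (bstep M N y)"
  unfolding good_def
proof (intro conjI allI impI)
  have two: "D (y i) (y (Suc (Suc i))) \<le> 2 * s" if "Suc (Suc i) \<le> N" for i using good_dist[OF g, of i "Suc (Suc i)"] that by simp
  have three: "D (y i) (y (Suc (Suc (Suc i)))) \<le> 3 * s" if "Suc (Suc (Suc i)) \<le> N" for i
    using good_dist[OF g, of i "Suc (Suc (Suc i))"] that by simp
  note gX = goodD(1)[OF g] and gs = goodD(2)[OF g]
  show "bstep M N y i \<in> X0" if "i \<le> N" for i
  proof (cases "0 < i \<and> i < N")
    case True
    then obtain j where j: "i = Suc j" by (cases i) auto
    have "M (y j) (y (Suc (Suc j))) \<in> X0" by (rule M_in) (use gX[of j] gX[of "Suc (Suc j)"] two[of j] True j s in auto)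
    then show ?thesis using True j by (simp add: bstep_def)
  next
    case False
    then show ?thesis using gX[OF that] unfolding bstep_def by (simp only: if_False)
  qed
  show "D (bstep M N y i) (bstep M N y (Suc i)) \<le> s" if i: "i < N" for i
  proof (cases "i = 0")
    case True
    show ?thesis
    proof (cases "N = 1")
      case True then show ?thesis using gs[OF i] \<open>i = 0\<close> by (simp add: bstep_def)
    next
      case False
      then have N: "2 \<le> N" using i by simp
      then have "D (y 0) (M (y 0) (y (Suc (Suc 0)))) \<le> D (y 0) (y (Suc (Suc 0))) / 2"
        by (intro M_half(1)) (use gX[of 0] gX[of "Suc (Suc 0)"] two[of 0] s in auto)
      then show ?thesis using two[of 0] N \<open>i = 0\<close> by (simp add: bstep_def)
    qed
  next
    case False
    then obtain j where j: "i = Suc j" by (cases i) auto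
    show ?thesis
    proof (cases "Suc i < N")
      case True
      let ?a = "y j" and ?b = "y (Suc (Suc j))" and ?a' = "y (Suc j)" and ?b' = "y (Suc (Suc (Suc j)))"
      have "D (M ?a ?b) (M ?a' ?b') \<le> (D ?a ?a' + D ?b ?b') / 2"
        by (rule M_contr) (use gX[of j] gX[of "Suc j"] gX[of "Suc (Suc j)"] gX[of "Suc (Suc (Suc j))"] gs[of j] gs[of "Suc j"] gs[of "Suc (Suc j)"]
          two[of j] two[of "Suc j"] True j s in auto)
      also have "\<dots> \<le> s" using gs[of j] gs[of "Suc (Suc j)"] True j by auto
      finally show ?thesis using True j by (simp add: bstep_def)
    next
      case False
      then have N: "N = Suc (Suc j)" using i j by simp
      have "D (y (Suc (Suc j))) (M (y j) (y (Suc (Suc j)))) \<le> D (y j) (y (Suc (Suc j))) / 2"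
        by (rule M_half(2)) (use gX[of j] gX[of "Suc (Suc j)"] two[of j] s N in auto)
      then have "D (M (y j) (y (Suc (Suc j)))) (y (Suc (Suc j))) \<le> s"
        using two[of j] N D_sym[of "y (Suc (Suc j))"] by simp
      then show ?thesis using N j by (simp add: bstep_def)
    qed
  qed
qed

abbreviation "bk N n y \<equiv> (bstep M N ^^ n) y"

lemma bk_good: "good N s y \<Longrightarrow> 0 \<le> s \<Longrightarrow> 12 * s < \<rho> \<Longrightarrow> good N s (bk N n y)"
  by (induction n) (auto intro: bstep_good)

lemma bk_ends: "bk N n y 0 = y 0" "bk N n y N = y N"
  by (induction n) (auto simp: bstep_def)

text \<open>The factor 12 originates here: the mixed distance is at most k + 2 s, and
  \<open>M_contr\<close> wants it below \<rho>/4.\<close>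

lemma bstep_close:
  assumes g: "good N s y" "good N s y'" and s: "0 \<le> s" "12 * s < \<rho>" and k: "\<And>i. i \<le> N \<Longrightarrow> D (y i) (y' i) \<le> k" "12 * k < \<rho>"
    and i: "Suc i < N"
  shows "D (bstep M N y (Suc i)) (bstep M N y' (Suc i)) \<le> (D (y i) (y' i) + D (y (Suc (Suc i))) (y' (Suc (Suc i)))) / 2"
proof -
  have X: "y i \<in> X0" "y' i \<in> X0" "y (Suc (Suc i)) \<in> X0" "y' (Suc (Suc i)) \<in> X0" using goodD(1)[OF g(1)] goodD(1)[OF g(2)] i by auto
  have 1: "D (y i) (y (Suc (Suc i))) \<le> 2 * s" "D (y' i) (y' (Suc (Suc i))) \<le> 2 * s"
    using good_dist[OF g(1), of i "Suc (Suc i)"] good_dist[OF g(2), of i "Suc (Suc i)"] i by auto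
  have 2: "D (y i) (y' i) \<le> k" "D (y (Suc (Suc i))) (y' (Suc (Suc i))) \<le> k" using k(1) i by auto
  have 3: "D (y' i) (y (Suc (Suc i))) \<le> k + 2 * s" using D_tri[OF X(2,1,3)] D_sym[of "y' i" "y i"] 1 2 by linarith
  have "D (M (y i) (y (Suc (Suc i)))) (M (y' i) (y' (Suc (Suc i)))) \<le> (D (y i) (y' i) + D (y (Suc (Suc i))) (y' (Suc (Suc i)))) / 2"
    by (rule M_contr[OF X]) (use 1 2 3 s k(2) \<rho> in linarith)+
  then show ?thesis using i by (simp add: bstep_def)
qed

text \<open>A discrete maximum principle: each new distance is at most the mean of the old distances
  at the neighbours. Linear functions are invariant under averaging, and the concave barrier
  \<open>1 + i * (N - i)\<close> loses 1, so it shrinks by a fixed factor. The bound k is carried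
  along to keep \<open>bstep_close\<close> applicable.\<close>

lemma bk_close:
  assumes g: "good N s y" "good N s y'" and s: "0 \<le> s" "12 * s < \<rho>" and k: "\<And>i. i \<le> N \<Longrightarrow> D (y i) (y' i) \<le> k" "12 * k < \<rho>"
    and N: "2 \<le> N" and y0: "y 0 = y' 0"
  shows "\<forall>i\<le>N. D (bk N n y i) (bk N n y' i) \<le> k \<and>
    D (bk N n y i) (bk N n y' i) \<le> real i / real N * D (y N) (y' N) + k * (1 - 1 / (real N)\<^sup>2) ^ n * (1 + real i * (real N - real i))"
proof (induction n)
  case 0
  have E: "0 \<le> D (y N) (y' N)" using D_nonneg goodD(1)[OF g(1)] goodD(1)[OF g(2)] by simp
  have k0: "0 \<le> k" using k(1)[of N] E by simp
  have "k \<le> real i / real N * D (y N) (y' N) + k * (1 + real i * (real N - real i))" if "i \<le> N" for i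
  proof -
    have "0 \<le> real i / real N * D (y N) (y' N)" using E by simp
    moreover have "k * 1 \<le> k * (1 + real i * (real N - real i))" using k0 that by (intro mult_left_mono) auto
    ultimately show ?thesis by simp
  qed
  then show ?case using k(1) by (auto intro: order_trans)
next
  case (Suc n)
  let ?E = "D (y N) (y' N)" and ?q = "1 - 1 / (real N)\<^sup>2" and ?u = "bk N n y" and ?v = "bk N n y'"
  have E: "0 \<le> ?E" using D_nonneg goodD(1)[OF g(1)] goodD(1)[OF g(2)] by simp
  have k0: "0 \<le> k" using k(1)[of N] E by simp
  note gu = bk_good[OF g(1) s] and gv = bk_good[OF g(2) s]
  have N0: "real N \<ge> 2" using N by simp
  have q0: "0 \<le> ?q" using N0 by (simp add: power2_eq_square divide_le_eq mult_ge1_I)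
  have ku: "D (?u i) (?v i) \<le> k" if "i \<le> N" for i using Suc that by blast
  define h where "h i = 1 + real i * (real N - real i)" for i
  have h0: "0 \<le> h i" if "i \<le> N" for i using that by (simp add: h_def add_nonneg_nonneg)
  have IH: "D (?u i) (?v i) \<le> real i / real N * ?E + k * ?q ^ n * h i" if "i \<le> N" for i using Suc that unfolding h_def by blast
  have qn: "0 \<le> k * ?q ^ m" for m using k0 q0 by simp
  show ?case unfolding h_def[symmetric]
  proof (intro allI impI)
    fix i assume i: "i \<le> N"
    consider "i = 0" | "i = N" | j where "i = Suc j" "Suc j < N" using i by (cases i) force+
    then show "D (bk N (Suc n) y i) (bk N (Suc n) y' i) \<le> k \<and> D (bk N (Suc n) y i) (bk N (Suc n) y' i) \<le> real i / real N * ?E + k * ?q ^ Suc n * h i"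
    proof cases
      case 1
      have "D (y 0) (y' 0) = 0" unfolding y0 by (rule D_self[OF goodD(1)[OF g(2)]]) simp
      then show ?thesis unfolding 1 bk_ends using k0 qn h0[of 0] by (simp del: power_Suc)
    next
      case 2
      have "0 \<le> k * ?q ^ Suc n * h N" by (rule mult_nonneg_nonneg[OF qn]) (rule h0, simp)
      then show ?thesis unfolding 2 bk_ends using k(1)[of N] N by (simp del: power_Suc)
    next
      case 3
      define J where "J = real (Suc j)"
      define T where "T = real N"
      have J: "1 \<le> J" "J \<le> T - 1" "real j = J - 1" "real (Suc (Suc j)) = J + 1" using 3 by (auto simp: J_def T_def)
      have le: "D (bk N (Suc n) y i) (bk N (Suc n) y' i) \<le> (D (?u j) (?v j) + D (?u (Suc (Suc j))) (?v (Suc (Suc j)))) / 2"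
        using bstep_close[OF gu gv s ku k(2) 3(2)] 3(1) by simp
      have in2: "j \<le> N" "Suc (Suc j) \<le> N" using 3 by auto
      have "D (?u j) (?v j) + D (?u (Suc (Suc j))) (?v (Suc (Suc j))) \<le> ((J - 1) / T * ?E + k * ?q ^ n * h j) + ((J + 1) / T * ?E + k * ?q ^ n * h (Suc (Suc j)))"
        using IH[OF in2(1)] IH[OF in2(2)] unfolding J(3,4) T_def[symmetric] by (rule add_mono)
      also have "\<dots> = 2 * (J / T * ?E) + k * ?q ^ n * (h j + h (Suc (Suc j)))" using N0 by (simp add: T_def field_simps)
      also have "h j + h (Suc (Suc j)) = 2 * (h i - 1)" unfolding h_def J(3,4) 3(1) J_def[symmetric] T_def[symmetric] by (simp add: algebra_simps)
      also have "k * ?q ^ n * (2 * (h i - 1)) = 2 * (k * ?q ^ n * (h i - 1))" by simp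
      finally have "D (bk N (Suc n) y i) (bk N (Suc n) y' i) \<le> J / T * ?E + k * ?q ^ n * (h i - 1)" by (intro order_trans[OF le half_le])
      \<comment> \<open>The barrier is at most N^2, so losing 1 means losing at least the fraction 1
        / N^2.\<close>
      also have "k * ?q ^ n * (h i - 1) \<le> k * ?q ^ n * (?q * h i)"
      proof (rule mult_left_mono[OF _ qn])
        have "h i = 1 + J * (T - J)" unfolding h_def 3(1) J_def T_def ..
        moreover have "J * (T - J) \<le> T\<^sup>2 / 4" using zero_le_power2[of "T - 2 * J"] by (simp add: power2_eq_square algebra_simps)
        moreover have "4 \<le> T\<^sup>2" using N0 power_mono[of 2 T 2] by (simp add: T_def)
        ultimately have "h i \<le> T\<^sup>2" by simp
        then have "h i / T\<^sup>2 \<le> 1" using N0 by (simp add: T_def divide_le_eq)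
        then show "h i - 1 \<le> ?q * h i" by (simp add: T_def left_diff_distrib)
      qed
      finally have B: "D (bk N (Suc n) y i) (bk N (Suc n) y' i) \<le> real i / real N * ?E + k * ?q ^ Suc n * h i"
        using 3(1) by (simp add: J_def T_def mult_ac)
      have "D (bk N (Suc n) y i) (bk N (Suc n) y' i) \<le> k" by (rule mean_le[OF le ku[OF in2(1)] ku[OF in2(2)]])
      then show ?thesis using B by blast
    qed
  qed
qed

end

section \<open>Generic poles and meridians on the sphere\<close>

lemma generic_point:
  fixes W :: "'b::euclidean_space set"
  assumes W: "finite W" and D: "DIM('b) \<ge> 3"
  shows "\<exists>p. norm p = 1 \<and> (\<forall>x\<in>W. \<forall>x'\<in>W. p \<notin> span {x, x'})"
proof -
  \<comment> \<open>Each span is at most a plane; in dimension three or more finitely many of them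
    cannot fill the space.\<close>
  let ?N = "\<Union>((\<lambda>(x, x'). span {x, x'}) ` (W \<times> W))"
  have "negligible (span {x, x'})" for x x' :: 'b
  proof (rule negligible_lowdim)
    have "dim (span {x, x'}) \<le> card {x, x'}" unfolding dim_span by (rule dim_le_card') simp
    also have "\<dots> \<le> 2" by (simp add: card_insert_if)
    finally show "dim (span {x, x'}) < DIM('b)" using D by simp
  qed
  then have "negligible ?N" using W by (intro negligible_Union) auto
  then have "negligible (insert 0 ?N)" by (simp only: negligible_insert)
  then have "insert 0 ?N \<noteq> UNIV" using open_not_negligible[of "UNIV :: 'b set"] by (metis UNIV_not_empty open_UNIV)
  then obtain v where v: "v \<noteq> 0" "v \<notin> ?N" by blast
  have "sgn v \<notin> span {x, x'}" if x: "x \<in> W" "x' \<in> W" for x x'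
  proof
    assume "sgn v \<in> span {x, x'}"
    then have "norm v *\<^sub>R sgn v \<in> span {x, x'}" by (rule span_scale)
    then have "v \<in> span {x, x'}" by (simp add: sgn_div_norm v(1))
    then show False using v(2) x by blast
  qed
  then show ?thesis using v(1) by (intro exI[of _ "sgn v"]) (auto simp: norm_sgn)
qed

text \<open>The great circle arc from p at time 0 to x at time 1. For x = p or x = -p there is no
  direction and \<open>sgn 0 = 0\<close> takes its place; the lemmas below exclude these
  points.\<close>

definition meridian :: "'b::euclidean_space \<Rightarrow> 'b \<Rightarrow> real \<Rightarrow> 'b" where
  "meridian p x t = cos (t * arccos (x \<bullet> p)) *\<^sub>R p + sin (t * arccos (x \<bullet> p)) *\<^sub>R sgn (x - (x \<bullet> p) *\<^sub>R p)"

lemma norm2_orthonormal: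
  fixes p w :: "'b::euclidean_space"
  assumes "norm p = 1" "norm w = 1" "w \<bullet> p = 0" shows "(norm (a *\<^sub>R p + b *\<^sub>R w))\<^sup>2 = a\<^sup>2 + b\<^sup>2"
  using assms unfolding power2_norm_eq_inner by (simp add: inner_simps inner_commute norm_eq_1 power2_eq_square)

lemma cos_half_sin: "cos (x::real) = 1 - 2 * (sin (x / 2))\<^sup>2"
  using cos_double_sin[of "x / 2"] by simp

text \<open>The speed of the arc is the angle between p and x, at most pi, and a chord is no longer
  than its arc.\<close>

lemma meridian_props:
  fixes p x :: "'b::euclidean_space"
  assumes p: "norm p = 1" and x: "norm x = 1" and u: "x \<noteq> (x \<bullet> p) *\<^sub>R p"
  shows "norm (meridian p x t) = 1" "meridian p x 0 = p" "meridian p x 1 = x" "dist (meridian p x s) (meridian p x t) \<le> pi * \<bar>s - t\<bar>"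
proof -
  define c where "c = x \<bullet> p"
  define v where "v = x - c *\<^sub>R p"
  define w where "w = sgn v"
  have v0: "v \<noteq> 0" using u by (simp add: v_def c_def)
  have pp: "p \<bullet> p = 1" "x \<bullet> x = 1" using p x by (auto simp: norm_eq_1)
  have vp: "v \<bullet> p = 0" by (simp add: v_def c_def inner_diff_left pp)
  have w: "norm w = 1" "w \<bullet> p = 0" using v0 vp by (auto simp: w_def norm_sgn sgn_div_norm)
  have c1: "-1 \<le> c" "c \<le> 1" using Cauchy_Schwarz_ineq2[of x p] p x by (auto simp: c_def abs_le_iff)
  have nv: "(norm v)\<^sup>2 = 1 - c\<^sup>2" unfolding power2_norm_eq_inner v_def
    by (simp add: inner_simps pp c_def inner_commute power2_eq_square)
  then have nv': "norm v = sqrt (1 - c\<^sup>2)" by (metis norm_ge_zero real_sqrt_unique)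
  have m: "meridian p x t = cos (t * arccos c) *\<^sub>R p + sin (t * arccos c) *\<^sub>R w" for t by (simp add: meridian_def c_def v_def w_def)
  have "(norm (meridian p x t))\<^sup>2 = 1" unfolding m norm2_orthonormal[OF p w] by simp
  then show "norm (meridian p x t) = 1" by (simp add: power2_eq_1_iff) (smt (verit) norm_ge_zero)
  show "meridian p x 0 = p" by (simp add: m)
  have "meridian p x 1 = c *\<^sub>R p + norm v *\<^sub>R w" unfolding m using c1 by (simp add: sin_arccos nv' cos_arccos)
  then show "meridian p x 1 = x" using v0 by (simp add: w_def sgn_div_norm) (simp add: v_def)
  let ?a = "s * arccos c" and ?b = "t * arccos c"
  have "meridian p x s - meridian p x t = (cos ?a - cos ?b) *\<^sub>R p + (sin ?a - sin ?b) *\<^sub>R w" by (simp add: m algebra_simps)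
  then have "(dist (meridian p x s) (meridian p x t))\<^sup>2 = (cos ?a - cos ?b)\<^sup>2 + (sin ?a - sin ?b)\<^sup>2" unfolding dist_norm using norm2_orthonormal[OF p w] by simp
  also have "\<dots> = ((cos ?a)\<^sup>2 + (sin ?a)\<^sup>2) + ((cos ?b)\<^sup>2 + (sin ?b)\<^sup>2) - 2 * (cos ?a * cos ?b + sin ?a * sin ?b)" by (simp add: power2_eq_square algebra_simps)
  also have "\<dots> = 2 - 2 * cos (?a - ?b)" by (simp add: cos_diff)
  also have "\<dots> = (2 * sin ((?a - ?b) / 2))\<^sup>2" unfolding cos_half_sin[of "?a - ?b"] by (simp add: power_mult_distrib)
  also have "\<dots> \<le> \<bar>?a - ?b\<bar>\<^sup>2" using abs_sin_x_le_abs_x[of "(?a - ?b) / 2"] by (intro abs_le_square_iff[THEN iffD1]) (simp add: abs_mult)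
  finally have "dist (meridian p x s) (meridian p x t) \<le> \<bar>?a - ?b\<bar>" by (rule power2_le_imp_le) simp
  also have "\<dots> = arccos c * \<bar>s - t\<bar>" using arccos_lbound[OF c1] by (simp add: left_diff_distrib[symmetric] abs_mult mult.commute)
  also have "\<dots> \<le> pi * \<bar>s - t\<bar>" using arccos_ubound[OF c1] by (intro mult_right_mono) auto
  finally show "dist (meridian p x s) (meridian p x t) \<le> pi * \<bar>s - t\<bar>" .
qed

lemma meridian_continuous:
  fixes p :: "'b::euclidean_space" and g :: "'z::metric_space \<Rightarrow> 'b"
  assumes p: "norm p = 1" and g: "continuous_on T g" and t: "continuous_on T t" and S: "\<And>z. z \<in> T \<Longrightarrow> norm (g z) = 1 \<and> g z \<noteq> (g z \<bullet> p) *\<^sub>R p"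
  shows "continuous_on T (\<lambda>z. meridian p (g z) (t z))"
proof -
  have c: "-1 \<le> g z \<bullet> p \<and> g z \<bullet> p \<le> 1" if "z \<in> T" for z using Cauchy_Schwarz_ineq2[of "g z" p] p S[OF that] by (auto simp: abs_le_iff)
  have ac: "continuous_on T (\<lambda>z. arccos (g z \<bullet> p))" by (rule continuous_on_arccos) (use c in \<open>auto intro!: continuous_intros g\<close>)
  have sc: "continuous_on T (\<lambda>z. sgn (g z - (g z \<bullet> p) *\<^sub>R p))" by (intro continuous_intros g) (use S in auto)
  show ?thesis unfolding meridian_def
    by (intro continuous_on_add continuous_on_scaleR continuous_on_cos continuous_on_sin continuous_on_mult continuous_on_const t ac sc)
qed

text \<open>The change of direction and the change of norm each contribute at most
  \<open>dist u v / norm u\<close>, and \<open>norm u\<close> is at least 1/2.\<close>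

lemma sgn_lip:
  fixes u v :: "'b::euclidean_space"
  assumes "1/2 \<le> norm u" "1/2 \<le> norm v" shows "dist (sgn u) (sgn v) \<le> 4 * dist u v"
proof -
  have n: "0 < norm u" "0 < norm v" using assms by linarith+
  have "sgn u - sgn v = (1 / norm u) *\<^sub>R (u - v) + ((norm v - norm u) / (norm u * norm v)) *\<^sub>R v"
    using n by (simp add: sgn_div_norm scaleR_diff_right scaleR_diff_left[symmetric] field_simps) (simp add: scaleR_add_left[symmetric] field_simps)
  then have "norm (sgn u - sgn v) \<le> norm ((1 / norm u) *\<^sub>R (u - v)) + norm (((norm v - norm u) / (norm u * norm v)) *\<^sub>R v)" by (metis norm_triangle_ineq)
  also have "\<dots> = (norm (u - v) + \<bar>norm v - norm u\<bar>) / norm u" unfolding norm_scaleR using n by (simp add: abs_mult add_divide_distrib)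
  also have "\<dots> \<le> (2 * norm (u - v)) / norm u" using norm_triangle_ineq3[of v u] n by (intro divide_right_mono) (auto simp: norm_minus_commute)
  also have "\<dots> \<le> (2 * norm (u - v)) / (1/2)" using assms n by (intro divide_left_mono) auto
  finally show ?thesis by (simp add: dist_norm)
qed

text \<open>The points are radial projections of equidistant points of the segment from x to x'.
  They stay in the span of x and x', so they differ from p and -p, and meridians depend uniformly
  continuously on them.\<close>

lemma meridian_chain:
  fixes p x x' :: "'b::euclidean_space"
  assumes p: "norm p = 1" "p \<notin> span {x, x'}" and x: "norm x = 1" "norm x' = 1" "dist x x' \<le> 1" and \<kappa>: "0 < \<kappa>"
  shows "\<exists>K xs. 0 < K \<and> xs 0 = x \<and> xs K = x' \<and> (\<forall>k\<le>K. norm (xs k) = 1 \<and> xs k \<noteq> (xs k \<bullet> p) *\<^sub>R p) \<and>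
    (\<forall>k<K. dist (xs k) (xs (Suc k)) \<le> 4 * dist x x' / real K) \<and> (\<forall>k<K. \<forall>t\<in>{0..1}. dist (meridian p (xs k) t) (meridian p (xs (Suc k)) t) < \<kappa>)"
proof -
  define l where "l s = (1 - s) *\<^sub>R x + s *\<^sub>R x'" for s
  define \<sigma> where "\<sigma> s = sgn (l s)" for s
  \<comment> \<open>The segment has length at most 1 and unit ends, so it stays at distance at least
    1/2 from the centre.\<close>
  have ln: "1/2 \<le> norm (l s)" if s: "0 \<le> s" "s \<le> 1" for s
  proof -
    have "l s = x - s *\<^sub>R (x - x')" "l s = x' + (1-s) *\<^sub>R (x - x')" by (auto simp: l_def algebra_simps)
    then have "norm x - norm (s *\<^sub>R (x - x')) \<le> norm (l s)" "norm x' - norm ((1-s) *\<^sub>R (x - x')) \<le> norm (l s)"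
      using norm_triangle_ineq2[of x "s *\<^sub>R (x - x')"] norm_diff_ineq[of x' "(1-s) *\<^sub>R (x - x')"] by auto
    moreover have "norm (s *\<^sub>R (x - x')) \<le> s" "norm ((1-s) *\<^sub>R (x - x')) \<le> 1 - s"
      using s x(3) by (auto simp: dist_norm mult_left_le)
    ultimately show ?thesis using x(1,2) by linarith
  qed
  have \<sigma>1: "norm (\<sigma> s) = 1" "\<sigma> s \<noteq> (\<sigma> s \<bullet> p) *\<^sub>R p" if s: "0 \<le> s" "s \<le> 1" for s
  proof -
    show n: "norm (\<sigma> s) = 1" using ln[OF s] by (auto simp: \<sigma>_def norm_sgn)
    have "l s \<in> span {x, x'}" unfolding l_def by (intro span_add span_scale span_base) auto
    then have sp: "\<sigma> s \<in> span {x, x'}" unfolding \<sigma>_def sgn_div_norm by (intro span_scale)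
    show "\<sigma> s \<noteq> (\<sigma> s \<bullet> p) *\<^sub>R p"
    proof
      assume e: "\<sigma> s = (\<sigma> s \<bullet> p) *\<^sub>R p"
      then have "\<sigma> s \<bullet> p \<noteq> 0" using n by auto
      then have "p = (1 / (\<sigma> s \<bullet> p)) *\<^sub>R \<sigma> s" using arg_cong[OF e, of "\<lambda>v. (1 / (\<sigma> s \<bullet> p)) *\<^sub>R v"] by simp
      then have "p \<in> span {x, x'}" using span_scale[OF sp] by metis
      then show False using p(2) by blast
    qed
  qed
  have lc: "continuous_on T l" for T unfolding l_def[abs_def] by (intro continuous_intros)
  have \<sigma>c: "continuous_on {0..1} \<sigma>" unfolding \<sigma>_def[abs_def]
  proof (intro continuous_intros lc ballI)
    fix s :: real assume "s \<in> {0..1}" then show "l s \<noteq> 0" using ln[of s] by auto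
  qed
  let ?R = "{0..1} \<times> {0..1::real}"
  have "continuous_on ?R (\<lambda>z. meridian p (\<sigma> (fst z)) (snd z))"
    by (rule meridian_continuous[OF p(1)]) (use \<sigma>1 in \<open>auto intro!: continuous_on_compose2[OF \<sigma>c] continuous_intros\<close>)
  then have "uniformly_continuous_on ?R (\<lambda>z. meridian p (\<sigma> (fst z)) (snd z))" by (rule compact_uniformly_continuous) (intro compact_Times compact_Icc)
  then obtain d where d: "0 < d" "\<And>z z'. z \<in> ?R \<Longrightarrow> z' \<in> ?R \<Longrightarrow> dist z' z < d \<Longrightarrow> dist (meridian p (\<sigma> (fst z')) (snd z')) (meridian p (\<sigma> (fst z)) (snd z)) < \<kappa>"
    unfolding uniformly_continuous_on_def using \<kappa> by metis
  obtain K where K: "0 < K" "1 / real K < d" using reals_Archimedean[OF d(1)] by (metis inverse_eq_divide zero_less_Suc)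
  have frac: "real k / real K \<in> {0..1}" if "k \<le> K" for k using that K by simp
  have sd: "real (Suc k) / real K - real k / real K = 1 / real K" for k by (simp add: diff_divide_distrib[symmetric])
  show ?thesis
  proof (intro exI[of _ K] exI[of _ "\<lambda>k. \<sigma> (real k / real K)"] conjI allI impI ballI)
    show "0 < K" by (rule K(1))
    show "\<sigma> (real 0 / real K) = x" "\<sigma> (real K / real K) = x'" using K x by (auto simp: \<sigma>_def l_def sgn_div_norm)
    show "norm (\<sigma> (real k / real K)) = 1" "\<sigma> (real k / real K) \<noteq> (\<sigma> (real k / real K) \<bullet> p) *\<^sub>R p" if "k \<le> K" for k
      using \<sigma>1[of "real k / real K"] frac[OF that] by auto
    fix k assume k: "k < K"
    have f2: "real k / real K \<in> {0..1}" "real (Suc k) / real K \<in> {0..1}" using frac k by auto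
    have "l (real k / real K) - l (real (Suc k) / real K) = (real (Suc k) / real K - real k / real K) *\<^sub>R (x - x')" by (simp add: l_def algebra_simps)
    then have "dist (l (real k / real K)) (l (real (Suc k) / real K)) = dist x x' / real K" unfolding sd by (simp add: dist_norm)
    then show "dist (\<sigma> (real k / real K)) (\<sigma> (real (Suc k) / real K)) \<le> 4 * dist x x' / real K"
      using sgn_lip[OF ln ln, of "real k / real K" "real (Suc k) / real K"] f2 by (simp add: \<sigma>_def)
    show "dist (meridian p (\<sigma> (real k / real K)) t) (meridian p (\<sigma> (real (Suc k) / real K)) t) < \<kappa>" if t: "t \<in> {0..1}" for t
    proof -
      have "real k / real K - real (Suc k) / real K = - (1 / real K)" using sd[of k] by linarith
      then have "dist (real k / real K, t) (real (Suc k) / real K, t) < d" using K(2) by (simp only: dist_Pair_Pair dist_real_def) simp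
      then show ?thesis using d(2)[of "(real (Suc k) / real K, t)" "(real k / real K, t)"] f2 t by simp
    qed
  qed
qed

section \<open>The extension\<close>

text \<open>Each direction gets the polygon of f along its meridian, shortened n times, and F runs
  along it with the radius as parameter. By \<open>bk_close\<close> two such polygons eventually
  spread almost linearly from their common start, which is a Lipschitz estimate in polar
  coordinates.\<close>

lemma finite_extension:
  fixes f :: "'b::euclidean_space \<Rightarrow> 'a::metric_space" and \<iota> :: "'a \<Rightarrow> 'c::complete_space"
  assumes iso: "\<And>x y. dist (\<iota> x) (\<iota> y) = dist x y" and lip: "C-lipschitz_on (sphere 0 1) f" and D3: "DIM('b) \<ge> 3"
    and \<rho>: "0 < \<rho>" and \<eta>: "0 < \<eta>"
    and both: "\<forall>a\<in>f ` sphere 0 1. \<forall>b\<in>f ` sphere 0 1. dist a b < \<eta> \<longrightarrow> (\<exists>V\<in>CC. \<iota> a \<in> V \<and> \<iota> b \<in> V)"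
    and mid: "\<forall>a b r. reach CC a b r \<longrightarrow> r < \<rho> \<longrightarrow> (\<exists>m. (\<exists>s. reach CC a m s) \<and> (\<forall>p r'. reach CC a p r' \<longrightarrow> r' < \<rho> \<longrightarrow>
      (cd CC p m)\<^sup>2 \<le> (cd CC p a)\<^sup>2 / 2 + (cd CC p b)\<^sup>2 / 2 - (cd CC a b)\<^sup>2 / 4))"
    and Z: "finite Z" "Z \<subseteq> cball 0 1" and \<delta>: "0 < \<delta>"
  shows "\<exists>F. \<forall>z\<in>Z. F z \<in> \<Union>CC \<and> (\<forall>z'\<in>Z. dist (F z) (F z') \<le> 5 * pi * C * dist z z' + \<delta>) \<and> (norm z = 1 \<longrightarrow> F z = \<iota> (f z))"
proof -
  have C0: "0 \<le> C" using lipschitz_on_nonneg[OF lip] .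
  have lipD: "dist (f x) (f y) \<le> C * dist x y" if "norm x = 1" "norm y = 1" for x y
    using lipschitz_onD[OF lip, of x y] that by simp
  define W where "W = sgn ` Z - {0}"
  have Wf: "finite W" using Z(1) by (simp add: W_def)
  have W1: "norm x = 1" if "x \<in> W" for x using that by (auto simp: W_def norm_sgn)
  obtain p where p: "norm p = 1" "\<And>x x'. x \<in> W \<Longrightarrow> x' \<in> W \<Longrightarrow> p \<notin> span {x, x'}" using generic_point[OF Wf D3] by metis
  define D where "D = cd CC"
  \<comment> \<open>The part that chains reach from the image of the pole; between points not joined
    by a chain \<open>cd\<close> is unspecified.\<close>
  define X0 where "X0 = {y. \<exists>r. reach CC (\<iota> (f p)) y r}"
  have X0r: "\<exists>r. reach CC a b r" if ab: "a \<in> X0" "b \<in> X0" for a b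
  proof -
    obtain r r' where "reach CC (\<iota> (f p)) a r" "reach CC (\<iota> (f p)) b r'" using ab by (auto simp: X0_def)
    then show ?thesis using reach_trans[OF _ reach_sym] by blast
  qed
  have X0t: "b \<in> X0" if ab: "a \<in> X0" "reach CC a b r" for a b r
  proof -
    obtain r' where "reach CC (\<iota> (f p)) a r'" using ab(1) by (auto simp: X0_def)
    from reach_trans[OF ab(2) this] show ?thesis by (auto simp: X0_def)
  qed
  have near: "reach CC (\<iota> (f a)) (\<iota> (f b)) (dist (f a) (f b))" "D (\<iota> (f a)) (\<iota> (f b)) \<le> C * dist a b"
    if ab: "norm a = 1" "norm b = 1" "C * dist a b < \<eta>" for a b
  proof -
    have d: "dist (f a) (f b) < \<eta>" using lipD[OF ab(1,2)] ab(3) by simp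
    have "f a \<in> f ` sphere 0 1" "f b \<in> f ` sphere 0 1" using ab by auto
    from both[rule_format, OF this d] obtain V where V: "V \<in> CC" "\<iota> (f a) \<in> V" "\<iota> (f b) \<in> V" by blast
    show "reach CC (\<iota> (f a)) (\<iota> (f b)) (dist (f a) (f b))" using reach_one[OF V] by (simp add: iso)
    show "D (\<iota> (f a)) (\<iota> (f b)) \<le> C * dist a b" using cd_same[OF V] lipD[OF ab(1,2)] by (simp add: D_def iso)
  qed
  have pX: "\<iota> (f p) \<in> X0" using near(1)[OF p(1) p(1)] \<eta> by (auto simp: X0_def)
  define M where "M a b = (SOME m. (\<exists>s. reach CC a m s) \<and> (\<forall>p r'. reach CC a p r' \<longrightarrow> r' < \<rho> \<longrightarrow>
      (cd CC p m)\<^sup>2 \<le> (cd CC p a)\<^sup>2 / 2 + (cd CC p b)\<^sup>2 / 2 - (cd CC a b)\<^sup>2 / 4))" for a b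
  have small: "\<exists>r. reach CC a b r \<and> r < \<rho>" if ab: "a \<in> X0" "b \<in> X0" "D a b < \<rho>" for a b
  proof -
    obtain r where "reach CC a b r" using X0r[OF ab(1,2)] by blast
    from cd_approx[OF this, of "\<rho> - D a b"] show ?thesis using ab(3) by (auto simp: D_def)
  qed
  have Mp: "(\<exists>s. reach CC a (M a b) s) \<and> (\<forall>p r'. reach CC a p r' \<longrightarrow> r' < \<rho> \<longrightarrow>
      (cd CC p (M a b))\<^sup>2 \<le> (cd CC p a)\<^sup>2 / 2 + (cd CC p b)\<^sup>2 / 2 - (cd CC a b)\<^sup>2 / 4)" if ab: "a \<in> X0" "b \<in> X0" "D a b < \<rho>" for a b
  proof -
    obtain r where r: "reach CC a b r" "r < \<rho>" using small[OF ab] by blast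
    show ?thesis unfolding M_def by (rule someI_ex) (rule mid[rule_format, OF r])
  qed
  interpret locmid X0 D \<rho> M
  proof
    show "D x y = D y x" for x y unfolding D_def by (rule cd_sym)
    show "D x z \<le> D x y + D y z" if xyz: "x \<in> X0" "y \<in> X0" "z \<in> X0" for x y z
      unfolding D_def using X0r[OF xyz(1,2)] X0r[OF xyz(2,3)] cd_triangle by metis
    show "0 \<le> D x y" if xy: "x \<in> X0" "y \<in> X0" for x y
      unfolding D_def using X0r[OF xy] cd_ge zero_le_dist order_trans by metis
    show "D x x = 0" if x: "x \<in> X0" for x
    proof -
      have "x \<in> \<Union>CC" using X0r[OF x x] reach_in by metis
      then show ?thesis unfolding D_def by (rule cd_self)
    qed
    show "0 < \<rho>" by (rule \<rho>)
    show "M a b \<in> X0" if ab: "a \<in> X0" "b \<in> X0" "D a b < \<rho>" for a b using Mp[OF ab] X0t[OF ab(1)] by blast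
    show "(D q (M a b))\<^sup>2 \<le> (D q a)\<^sup>2 / 2 + (D q b)\<^sup>2 / 2 - (D a b)\<^sup>2 / 4" if ab: "a \<in> X0" "b \<in> X0" "q \<in> X0" "D a b < \<rho>" "D a q < \<rho>" for a b q
    proof -
      obtain r where r: "reach CC a q r" "r < \<rho>" using small[OF ab(1,3,5)] by blast
      show ?thesis unfolding D_def using conjunct2[OF Mp[OF ab(1,2,4)], rule_format, OF r] .
    qed
  qed
  obtain k0 where k0: "0 < k0" "k0 < \<eta>" "12 * k0 < \<rho>" using that[of "min \<eta> (\<rho>/12) / 2"] \<eta> \<rho> by (auto simp: min_def)
  obtain N where N: "2 \<le> N" "C * pi / real N \<le> k0" "C * pi / real N \<le> \<delta> / 2"
  proof -
    define \<mu> where "\<mu> = min k0 (\<delta>/2)"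
    have \<mu>: "0 < \<mu>" "\<mu> \<le> k0" "\<mu> \<le> \<delta>/2" using k0 \<delta> by (auto simp: \<mu>_def)
    obtain n where n: "C * pi / \<mu> < real n" using reals_Archimedean2 by blast
    define N where "N = n + 2"
    have "C * pi < real n * \<mu>" using n \<mu>(1) by (simp add: pos_divide_less_eq)
    also have "\<dots> \<le> real N * \<mu>" using \<mu>(1) by (simp add: N_def)
    finally have "C * pi / real N \<le> \<mu>" by (simp add: N_def pos_divide_le_eq mult.commute)
    then have 1: "C * pi / real N \<le> k0" and 2: "C * pi / real N \<le> \<delta>/2" using \<mu>(2,3) by linarith+
    have "2 \<le> N" by (simp add: N_def)
    then show thesis using 1 2 by (rule that)
  qed
  define s where "s = C * pi / real N"
  have s: "0 \<le> s" "12 * s < \<rho>" "s < \<eta>" "s \<le> \<delta>/2" using C0 N k0 by (auto simp: s_def)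
  define y where "y x i = \<iota> (f (meridian p x (real i / real N)))" for x i
  define ok where "ok x \<longleftrightarrow> norm x = 1 \<and> x \<noteq> (x \<bullet> p) *\<^sub>R p" for x
  note meridian = meridian_props[OF p(1)]
  have y0: "y x 0 = \<iota> (f p)" if "ok x" for x using meridian(2) that by (simp add: y_def ok_def)
  have yN: "y x N = \<iota> (f x)" if "ok x" for x using meridian(3) that N by (simp add: y_def ok_def)
  have g: "good N s (y x)" if x: "ok x" for x
  proof -
    have st: "reach CC (y x i) (y x (Suc i)) (dist (f (meridian p x (real i / real N))) (f (meridian p x (real (Suc i) / real N)))) \<and> D (y x i) (y x (Suc i)) \<le> s" for i
    proof -
      have n1: "norm (meridian p x t) = 1" for t using meridian(1) x by (simp add: ok_def)
      have "dist (meridian p x (real i / real N)) (meridian p x (real (Suc i) / real N)) \<le> pi * \<bar>real i / real N - real (Suc i) / real N\<bar>"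
        using meridian(4) x by (simp add: ok_def)
      also have "real i / real N - real (Suc i) / real N = - (1 / real N)" by (simp add: diff_divide_distrib[symmetric])
      finally have "C * dist (meridian p x (real i / real N)) (meridian p x (real (Suc i) / real N)) \<le> C * (pi * \<bar>- (1 / real N)\<bar>)" by (rule mult_left_mono[OF _ C0])
      then have le: "C * dist (meridian p x (real i / real N)) (meridian p x (real (Suc i) / real N)) \<le> s" by (simp add: s_def)
      then show ?thesis unfolding y_def using near[OF n1 n1, of "real i / real N" "real (Suc i) / real N"] s(3) by auto
    qed
    have "y x i \<in> X0" for i
    proof (induction i)
      case 0 then show ?case using y0[OF x] pX by simp
    next
      case (Suc i) then show ?case using X0t st[of i] by blast
    qed
    then show ?thesis using st by (simp add: good_def)
  qed
  define T where "T n x = bk N n (y x)" for n x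
  have Tg: "good N s (T n x)" if "ok x" for n x unfolding T_def by (rule bk_good[OF g[OF that] s(1,2)])
  have T0: "T n x 0 = \<iota> (f p)" if "ok x" for n x unfolding T_def bk_ends using y0[OF that] .
  have TN: "T n x N = \<iota> (f x)" if "ok x" for n x unfolding T_def bk_ends using yN[OF that] .
  have Wok: "ok x" if x: "x \<in> W" for x
  proof -
    have "x \<noteq> (x \<bullet> p) *\<^sub>R p"
    proof
      assume e: "x = (x \<bullet> p) *\<^sub>R p"
      then have "x \<bullet> p \<noteq> 0" using W1[OF x] by auto
      then have "p = (1 / (x \<bullet> p)) *\<^sub>R x" using arg_cong[OF e, of "\<lambda>v. (1 / (x \<bullet> p)) *\<^sub>R v"] by simp
      moreover have "(1 / (x \<bullet> p)) *\<^sub>R x \<in> span {x, x}" by (intro span_scale span_base) simp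
      ultimately show False using p(2)[OF x x] by simp
    qed
    then show ?thesis using W1[OF x] by (simp add: ok_def)
  qed
  \<comment> \<open>For directions more than 1 apart, going back to the pole is good enough: it
    costs twice \<open>pi * C\<close> over the full length. Closer ones are joined by a chain of
    directions; the factor 4 of \<open>meridian_chain\<close> is at most \<open>2 * pi\<close>, and
    the decaying terms fall below \<open>\<delta>/2\<close>.\<close>
  have pair: "\<forall>\<^sub>F n in sequentially. \<forall>i\<le>N. D (T n x i) (T n x' i) \<le> real i / real N * (2 * pi * C * dist x x') + \<delta>/2" if xx: "x \<in> W" "x' \<in> W" for x x'
  proof (cases "dist x x' \<le> 1")
    case False
    have "D (T n x i) (T n x' i) \<le> real i / real N * (2 * pi * C * dist x x') + \<delta>/2" if i: "i \<le> N" for n i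
    proof -
      have X: "T n x i \<in> X0" "T n x' i \<in> X0" "T n x 0 \<in> X0" using goodD(1)[OF Tg[OF Wok]] xx i by auto
      have "D (T n x 0) (T n x i) \<le> real i * s" "D (T n x' 0) (T n x' i) \<le> real i * s"
        using good_dist[OF Tg[OF Wok], of _ 0 i] xx i by auto
      moreover have "T n x 0 = T n x' 0" using T0 Wok xx by simp
      ultimately have "D (T n x i) (T n x' i) \<le> 2 * (real i * s)" using D_tri[OF X(1,3,2)] D_sym[of "T n x i"] by simp
      also have "\<dots> = real i / real N * (2 * pi * C * 1)" by (simp add: s_def)
      also have "\<dots> \<le> real i / real N * (2 * pi * C * dist x x')" using False C0 by (intro mult_left_mono) auto
      finally show ?thesis using \<delta> by simp
    qed
    then show ?thesis by simp
  next
    case True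
    \<comment> \<open>C + 1 instead of C allows C = 0.\<close>
    have \<kappa>: "0 < k0 / (C + 1)" using k0 C0 by simp
    have \<kappa>C: "C * (k0 / (C + 1)) \<le> k0"
    proof -
      have "C * k0 \<le> (C + 1) * k0" using k0 by simp
      then show ?thesis using C0 by (simp add: pos_divide_le_eq mult.commute)
    qed
    obtain K xs where K: "0 < K" "xs 0 = x" "xs K = x'" and ok': "\<And>k. k \<le> K \<Longrightarrow> ok (xs k)"
      and dK: "\<And>k. k < K \<Longrightarrow> dist (xs k) (xs (Suc k)) \<le> 4 * dist x x' / real K"
      and mK: "\<And>k t. k < K \<Longrightarrow> t \<in> {0..1} \<Longrightarrow> dist (meridian p (xs k) t) (meridian p (xs (Suc k)) t) < k0 / (C + 1)"
      using meridian_chain[OF p(1) p(2)[OF xx] W1[OF xx(1)] W1[OF xx(2)] True \<kappa>] unfolding ok_def by metis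
    define q where "q = 1 - 1 / (real N)\<^sup>2"
    have q: "0 \<le> q" "q < 1" using N(1) by (auto simp: q_def power2_eq_square divide_le_eq mult_ge1_I)
    \<comment> \<open>Bounds the barrier of \<open>bk_close\<close> uniformly in the index.\<close>
    define B where "B = k0 * (1 + (real N)\<^sup>2)"
    have step: "D (T n (xs k) i) (T n (xs (Suc k)) i) \<le> real i / real N * (C * (4 * dist x x' / real K)) + B * q ^ n" if k: "k < K" and i: "i \<le> N" for n k i
    proof -
      have oks: "ok (xs k)" "ok (xs (Suc k))" using ok' k by auto
      have Cm: "C * dist (meridian p (xs k) t) (meridian p (xs (Suc k)) t) \<le> k0" if "t \<in> {0..1}" for t
        using mult_left_mono[OF less_imp_le[OF mK[OF k that]] C0] \<kappa>C by linarith
      have init: "D (y (xs k) j) (y (xs (Suc k)) j) \<le> k0" if j: "j \<le> N" for j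
      proof -
        have "real j / real N \<in> {0..1}" using j N by simp
        note c = Cm[OF this]
        have "norm (meridian p (xs k) (real j / real N)) = 1" "norm (meridian p (xs (Suc k)) (real j / real N)) = 1" using meridian(1) oks by (auto simp: ok_def)
        from near(2)[OF this] show ?thesis unfolding y_def using c k0(2) by simp
      qed
      have "C * dist (xs k) (xs (Suc k)) \<le> k0" using Cm[of 1] meridian(3) oks by (simp add: ok_def)
      then have "D (y (xs k) N) (y (xs (Suc k)) N) \<le> C * dist (xs k) (xs (Suc k))"
        unfolding yN[OF oks(1)] yN[OF oks(2)] using near(2)[of "xs k" "xs (Suc k)"] oks k0(2) by (simp add: ok_def)
      also have "\<dots> \<le> C * (4 * dist x x' / real K)" by (rule mult_left_mono[OF dK[OF k] C0])
      finally have E: "D (y (xs k) N) (y (xs (Suc k)) N) \<le> C * (4 * dist x x' / real K)" .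
      have yy: "y (xs k) 0 = y (xs (Suc k)) 0" using y0 oks by simp
      have "D (T n (xs k) i) (T n (xs (Suc k)) i) \<le> real i / real N * D (y (xs k) N) (y (xs (Suc k)) N) + k0 * q ^ n * (1 + real i * (real N - real i))"
        using bk_close[OF g[OF oks(1)] g[OF oks(2)] s(1,2) init k0(3) N(1) yy, of n] i unfolding T_def q_def by blast
      also have "\<dots> \<le> real i / real N * (C * (4 * dist x x' / real K)) + k0 * q ^ n * (1 + (real N)\<^sup>2)"
      proof (rule add_mono)
        show "real i / real N * D (y (xs k) N) (y (xs (Suc k)) N) \<le> real i / real N * (C * (4 * dist x x' / real K))" by (rule mult_left_mono[OF E]) simp
        have "real i * (real N - real i) \<le> real N * real N" using i by (intro mult_mono) auto
        then show "k0 * q ^ n * (1 + real i * (real N - real i)) \<le> k0 * q ^ n * (1 + (real N)\<^sup>2)"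
          using k0(1) q(1) by (intro mult_left_mono) (auto simp: power2_eq_square)
      qed
      finally show ?thesis by (simp add: B_def mult_ac)
    qed
    have chain: "j \<le> K \<Longrightarrow> D (T n (xs 0) i) (T n (xs j) i) \<le> real j * (real i / real N * (C * (4 * dist x x' / real K)) + B * q ^ n)" if i: "i \<le> N" for n i j
    proof (induction j)
      case 0 then show ?case using D_self[OF goodD(1)[OF Tg[OF ok'] i]] by simp
    next
      case (Suc j)
      have "D (T n (xs 0) i) (T n (xs (Suc j)) i) \<le> D (T n (xs 0) i) (T n (xs j) i) + D (T n (xs j) i) (T n (xs (Suc j)) i)"
        by (rule D_tri) (rule goodD(1)[OF Tg[OF ok'] i], use Suc in simp)+
      also have "\<dots> \<le> real j * (real i / real N * (C * (4 * dist x x' / real K)) + B * q ^ n) + (real i / real N * (C * (4 * dist x x' / real K)) + B * q ^ n)"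
        using Suc.IH Suc.prems by (intro add_mono step[OF _ i]) auto
      also have "\<dots> = real (Suc j) * (real i / real N * (C * (4 * dist x x' / real K)) + B * q ^ n)" unfolding of_nat_Suc distrib_right[of 1] by simp
      finally show ?case .
    qed
    have "(\<lambda>n. real K * B * q ^ n) \<longlonglongrightarrow> real K * B * 0" by (intro tendsto_intros LIMSEQ_realpow_zero q)
    then have "\<forall>\<^sub>F n in sequentially. real K * B * q ^ n < \<delta>/2" using \<delta> by (intro order_tendstoD(2)) auto
    then show ?thesis
    proof eventually_elim
      case (elim n)
      show ?case
      proof (intro allI impI)
        fix i assume i: "i \<le> N"
        have "D (T n x i) (T n x' i) \<le> real K * (real i / real N * (C * (4 * dist x x' / real K)) + B * q ^ n)" using chain[OF i order_refl, of n] K by simp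
        also have "\<dots> = real i / real N * (4 * (C * dist x x')) + real K * B * q ^ n" using K(1) by (simp add: distrib_left)
        also have "\<dots> \<le> real i / real N * (2 * pi * (C * dist x x')) + \<delta>/2"
          using pi_gt3 C0 elim by (intro add_mono mult_left_mono mult_right_mono) auto
        finally show "D (T n x i) (T n x' i) \<le> real i / real N * (2 * pi * C * dist x x') + \<delta>/2" by (simp only: mult.assoc)
      qed
    qed
  qed
  have "\<forall>\<^sub>F n in sequentially. \<forall>x\<in>W. \<forall>x'\<in>W. \<forall>i\<le>N. D (T n x i) (T n x' i) \<le> real i / real N * (2 * pi * C * dist x x') + \<delta>/2"
    using pair by (intro eventually_ball_finite Wf ballI)
  \<comment> \<open>One number of steps serves all pairs because W is finite; like the choice of the
    pole, this relies on the finiteness of Z.\<close>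
  then obtain n where n: "\<And>x x' i. x \<in> W \<Longrightarrow> x' \<in> W \<Longrightarrow> i \<le> N \<Longrightarrow> D (T n x i) (T n x' i) \<le> real i / real N * (2 * pi * C * dist x x') + \<delta>/2"
    unfolding eventually_sequentially by blast
  \<comment> \<open>The radius in units of 1/N, rounded down. Rounding costs at most one edge s,
    which is at most \<open>\<delta>/2\<close>.\<close>
  define I where "I z = nat \<lfloor>norm z * real N\<rfloor>" for z :: 'b
  define F where "F z = (if z = 0 then \<iota> (f p) else T n (sgn z) (I z))" for z
  have I: "real (I z) \<le> norm z * real N" "norm z * real N < real (I z) + 1" for z
    unfolding I_def using zero_le_mult_iff[of "norm z" "real N"] by (auto simp: of_nat_nat floor_less_iff)
  have IN: "I z \<le> N" if "z \<in> Z" for z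
  proof -
    have "norm z * real N \<le> real N" using Z(2) that by (auto simp: mult_left_le_one_le)
    then show ?thesis using I(1)[of z] by linarith
  qed
  have sW: "sgn z \<in> W" if "z \<in> Z" "z \<noteq> 0" for z using that by (auto simp: W_def sgn_zero_iff)
  have FX: "F z \<in> X0" if z: "z \<in> Z" for z
    using pX goodD(1)[OF Tg[OF Wok[OF sW[OF z]]] IN[OF z]] by (auto simp: F_def)
  have sN: "real j * s = real j / real N * (C * pi)" for j by (simp add: s_def)
  have iN: "real (I z) / real N \<le> norm z" "norm z - 1 / real N \<le> real (I z) / real N" for z
  proof -
    show "real (I z) / real N \<le> norm z" using I(1)[of z] N by (simp add: pos_divide_le_eq)
    have "norm z \<le> (real (I z) + 1) / real N" using I(2)[of z] N by (simp add: pos_le_divide_eq)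
    then show "norm z - 1 / real N \<le> real (I z) / real N" by (simp add: add_divide_distrib)
  qed
  have CP: "0 \<le> C * pi" using C0 by simp
  \<comment> \<open>First change the direction at radius \<open>norm z\<close>: since
    \<open>norm z * dist x x'\<close> is at most twice the distance of z and z', this costs four
    times \<open>pi * C\<close>. Then change the radius, which costs \<open>pi * C\<close> once
    more.\<close>
  have est: "D (F z) (F z') \<le> 5 * pi * C * dist z z' + \<delta>" if z: "z \<in> Z" "z' \<in> Z" "norm z \<le> norm z'" for z z'
  proof (cases "z' = 0")
    case True
    then have "z = 0" using z(3) by simp
    then show ?thesis using True D_self[OF pX] \<delta> by (simp add: F_def)
  next
    case z'0: False
    note ok2 = Wok[OF sW[OF z(2) z'0]]
    show ?thesis
    proof (cases "z = 0")
      case True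
      have "D (T n (sgn z') 0) (T n (sgn z') (I z')) \<le> real (I z') / real N * (C * pi)"
        using good_dist[OF Tg[OF ok2], of 0 "I z'"] IN[OF z(2)] sN[of "I z'"] by simp
      also have "\<dots> \<le> norm z' * (C * pi)" by (rule mult_right_mono[OF iN(1) CP])
      also have "\<dots> \<le> 5 * (norm z' * (C * pi)) + \<delta>" using \<delta> mult_nonneg_nonneg[OF norm_ge_zero CP, of z'] by linarith
      finally show ?thesis using True z'0 T0[OF ok2] by (simp add: F_def mult_ac)
    next
      case z0: False
      define x x' where "x = sgn z" and "x' = sgn z'"
      have xW: "x \<in> W" "x' \<in> W" using sW z z0 z'0 by (auto simp: x_def x'_def)
      have zx: "z = norm z *\<^sub>R x" "z' = norm z' *\<^sub>R x'" using z0 z'0 by (auto simp: x_def x'_def sgn_div_norm)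
      have le: "I z \<le> I z'" unfolding I_def by (intro nat_mono floor_mono mult_right_mono z(3)) simp
      have nd: "norm z' - norm z \<le> dist z z'" using norm_triangle_ineq2[of z' z] by (simp add: dist_norm norm_minus_commute)
      have "norm z * dist x x' = dist z (norm z *\<^sub>R x')" by (subst (2) zx(1)) (simp add: dist_norm scaleR_diff_right[symmetric])
      also have "\<dots> \<le> dist z z' + dist z' (norm z *\<^sub>R x')" by (rule dist_triangle)
      also have "dist z' (norm z *\<^sub>R x') = norm z' - norm z"
      proof -
        have "dist z' (norm z *\<^sub>R x') = norm ((norm z' - norm z) *\<^sub>R x')" by (subst zx(2)) (simp add: dist_norm scaleR_diff_left)
        then show ?thesis using z(3) W1[OF xW(2)] by simp
      qed
      finally have dx: "norm z * dist x x' \<le> 2 * dist z z'" using nd by linarith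
      have X: "T n x (I z) \<in> X0" "T n x' (I z) \<in> X0" "T n x' (I z') \<in> X0" using goodD(1)[OF Tg[OF Wok]] xW IN z le by auto
      have 1: "D (T n x (I z)) (T n x' (I z)) \<le> real (I z) / real N * (2 * pi * C * dist x x') + \<delta>/2" by (rule n[OF xW IN[OF z(1)]])
      have "real (I z) / real N * (2 * pi * C * dist x x') \<le> norm z * (2 * pi * C * dist x x')" using C0 by (intro mult_right_mono iN(1)) auto
      also have "\<dots> = (2 * pi * C) * (norm z * dist x x')" by simp
      also have "\<dots> \<le> (2 * pi * C) * (2 * dist z z')" using C0 by (intro mult_left_mono dx) auto
      finally have 2: "real (I z) / real N * (2 * pi * C * dist x x') \<le> 4 * (pi * C * dist z z')" by simp
      have "D (T n x' (I z)) (T n x' (I z')) \<le> real (I z' - I z) / real N * (C * pi)"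
        using good_dist[OF Tg[OF Wok[OF xW(2)]] le IN[OF z(2)]] sN by simp
      also have "\<dots> \<le> (dist z z' + 1 / real N) * (C * pi)"
      proof (rule mult_right_mono[OF _ CP])
        have "real (I z' - I z) / real N = real (I z') / real N - real (I z) / real N" using le by (simp add: of_nat_diff diff_divide_distrib)
        then show "real (I z' - I z) / real N \<le> dist z z' + 1 / real N" using iN(1)[of z'] iN(2)[of z] nd by linarith
      qed
      also have "\<dots> = pi * C * dist z z' + s" by (simp add: s_def distrib_right)
      finally have 3: "D (T n x' (I z)) (T n x' (I z')) \<le> pi * C * dist z z' + s" .
      have "D (F z) (F z') \<le> 5 * (pi * C * dist z z') + \<delta>"
        using D_tri[OF X] 1 2 3 s(4) z0 z'0 by (simp add: F_def x_def x'_def)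
      then show ?thesis by (simp only: mult.assoc)
    qed
  qed
  show ?thesis
  proof (intro exI[of _ F] ballI conjI impI)
    fix z assume z: "z \<in> Z"
    show "F z \<in> \<Union>CC" using X0r[OF FX[OF z] FX[OF z]] reach_in by metis
    show "F z = \<iota> (f z)" if n1: "norm z = 1"
    proof -
      have "z \<noteq> 0" "sgn z = z" "I z = N" using n1 by (auto simp: sgn_div_norm I_def)
      moreover from this have "ok z" using Wok[OF sW[OF z]] by simp
      ultimately show ?thesis using TN by (simp add: F_def)
    qed
    fix z' assume z': "z' \<in> Z"
    obtain r where "reach CC (F z) (F z') r" using X0r[OF FX[OF z] FX[OF z']] by blast
    then have "dist (F z) (F z') \<le> D (F z) (F z')" unfolding D_def by (rule cd_ge)
    also have "\<dots> \<le> 5 * pi * C * dist z z' + \<delta>"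
      using est[OF z z'] est[OF z' z] D_sym[of "F z'" "F z"] dist_commute[of z' z] by (cases "norm z \<le> norm z'") auto
    finally show "dist (F z) (F z') \<le> 5 * pi * C * dist z z' + \<delta>" .
  qed
qed

text \<open>Work in the product of copies of K, which is compact by Tychonoff. Each condition on two
  points and one tolerance e is closed, and finitely many can be met together, so some map meets
  them all.\<close>

lemma lipschitz_extension_limit:
  fixes f :: "'b::metric_space \<Rightarrow> 'a::metric_space"
  assumes K: "compact K" and L: "0 \<le> L"
    and fin: "\<And>Z e. finite Z \<Longrightarrow> Z \<subseteq> B \<Longrightarrow> 0 < e \<Longrightarrow>
      \<exists>G. \<forall>z\<in>Z. G z \<in> K \<and> (\<forall>z'\<in>Z. dist (G z) (G z') \<le> L * dist z z' + e) \<and> (z \<in> S \<longrightarrow> G z = f z)"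
    and ne: "K \<noteq> {}"
  shows "\<exists>F. L-lipschitz_on B F \<and> F ` B \<subseteq> K \<and> (\<forall>z\<in>B \<inter> S. F z = f z)"
proof -
  define T where "T = (\<lambda>(z, z', e). {F :: 'b \<Rightarrow> 'a. dist (F z) (F z') \<le> L * dist z z' + e \<and> (z \<in> S \<longrightarrow> F z = f z)})"
  define I where "I = B \<times> B \<times> {0::real<..}"
  let ?P = "{F :: 'b \<Rightarrow> 'a. \<forall>z. F z \<in> K}"
  have Pc: "compact ?P"
  proof -
    have "compactin (product_topology (\<lambda>_. euclidean) UNIV) (PiE UNIV (\<lambda>_::'b. K))" using K by (simp add: compactin_PiE)
    moreover have "PiE UNIV (\<lambda>_::'b. K) = ?P" by (auto simp: PiE_def Pi_def extensional_def)
    ultimately show ?thesis by (simp add: euclidean_product_topology)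
  qed
  have Tc: "closed (T i)" if "i \<in> I" for i
  proof -
    obtain z z' e where i: "i = (z, z', e)" by (cases i)
    have c: "continuous_on UNIV (\<lambda>F :: 'b \<Rightarrow> 'a. F z)" for z by (rule continuous_on_product_coordinates)
    have "closed {F :: 'b \<Rightarrow> 'a. dist (F z) (F z') \<le> L * dist z z' + e}" by (intro closed_Collect_le continuous_intros c)
    moreover have "closed {F :: 'b \<Rightarrow> 'a. z \<in> S \<longrightarrow> F z = f z}"
    proof (cases "z \<in> S")
      case True
      then show ?thesis using closed_Collect_eq[OF c, of "\<lambda>_. f z" z] by simp
    qed simp
    ultimately have "closed ({F :: 'b \<Rightarrow> 'a. dist (F z) (F z') \<le> L * dist z z' + e} \<inter> {F. z \<in> S \<longrightarrow> F z = f z})" by (rule closed_Int)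
    then show ?thesis by (simp add: T_def i Collect_conj_eq)
  qed
  have "?P \<inter> (\<Inter>i\<in>I. T i) \<noteq> {}"
  proof (rule compact_imp_fip_image[OF Pc Tc])
    fix I' assume I': "finite I'" "I' \<subseteq> I"
    define Z where "Z = fst ` I' \<union> (fst \<circ> snd) ` I'"
    \<comment> \<open>The 1 keeps the set of tolerances nonempty, so that its minimum
      exists.\<close>
    define E where "E = insert 1 ((snd \<circ> snd) ` I')"
    have Z: "finite Z" "Z \<subseteq> B" using I' by (auto simp: Z_def I_def)
    have E: "finite E" "E \<noteq> {}" "\<And>e. e \<in> E \<Longrightarrow> 0 < e" using I' by (auto simp: E_def I_def)
    have "0 < Min E" using E by simp
    from fin[OF Z this] obtain G where G: "\<And>z. z \<in> Z \<Longrightarrow> G z \<in> K" "\<And>z z'. z \<in> Z \<Longrightarrow> z' \<in> Z \<Longrightarrow> dist (G z) (G z') \<le> L * dist z z' + Min E"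
      "\<And>z. z \<in> Z \<Longrightarrow> z \<in> S \<Longrightarrow> G z = f z" by metis
    obtain k where k: "k \<in> K" using ne by blast
    define F where "F z = (if z \<in> Z then G z else k)" for z
    have "F \<in> T i" if i: "i \<in> I'" for i
    proof -
      obtain z z' e where ie: "i = (z, z', e)" by (cases i)
      have zz: "z \<in> Z" "z' \<in> Z" "e \<in> E" using i ie by (force simp: Z_def E_def)+
      have "Min E \<le> e" using E zz by simp
      then show ?thesis using G(2)[OF zz(1,2)] G(3)[OF zz(1)] zz by (simp add: T_def ie F_def)
    qed
    moreover have "F \<in> ?P" using G(1) k by (simp add: F_def)
    ultimately show "?P \<inter> (\<Inter>i\<in>I'. T i) \<noteq> {}" by blast
  qed
  then obtain F where F: "\<And>z. F z \<in> K" "\<And>i. i \<in> I \<Longrightarrow> F \<in> T i" by blast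
  have FT: "dist (F z) (F z') \<le> L * dist z z' + e \<and> (z \<in> S \<longrightarrow> F z = f z)" if "z \<in> B" "z' \<in> B" "0 < e" for z z' e
    using F(2)[of "(z, z', e)"] that by (simp add: I_def T_def)
  have "L-lipschitz_on B F"
    by (rule lipschitz_onI[OF _ L], rule field_le_epsilon) (use FT in blast)
  moreover have "F z = f z" if "z \<in> B \<inter> S" for z using FT[of z z 1] that by simp
  ultimately show ?thesis using F(1) by blast
qed

theorem theorem1p4:
  fixes Y A :: "'a::metric_space set"
    and f :: "'b::euclidean_space \<Rightarrow> 'a"
  assumes "two_dimensional Y"
    and "nonpositively_curved Y"
    and "A \<subseteq> Y"
    and "DIM('b) \<ge> 3"
    and "C-lipschitz_on (sphere 0 1) f"
    and "f ` sphere 0 1 \<subseteq> A"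
  shows "\<exists>F L. L-lipschitz_on (cball 0 1) F \<and> F ` cball 0 1 \<subseteq> A \<and>
           (\<forall>x\<in>sphere 0 1. F x = f x)"
proof -
  define K where "K = f ` sphere 0 1"
  have C0: "0 \<le> C" using lipschitz_on_nonneg[OF assms(5)] .
  have K: "compact K" unfolding K_def by (rule compact_continuous_image[OF lipschitz_on_continuous_on[OF assms(5)] compact_sphere])
  have KY: "K \<subseteq> Y" using assms(3,6) by (auto simp: K_def)
  obtain b :: 'b where "b \<in> Basis" using nonempty_Basis by blast
  then have "b \<in> sphere 0 1" by simp
  then have Kne: "K \<noteq> {}" unfolding K_def by blast
  have dim: "metric_dim_le Y 2" using assms(1) by (simp add: two_dimensional_def)
  let ?i = "kuratowski (f b)"
  have "\<exists>F. (5 * pi * C)-lipschitz_on (cball 0 1) F \<and> F ` cball 0 1 \<subseteq> K \<and> (\<forall>z\<in>cball 0 1 \<inter> sphere 0 1. F z = f z)"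
  proof (rule lipschitz_extension_limit[OF K _ _ Kne])
    show "0 \<le> 5 * pi * C" using C0 by simp
    fix Z :: "'b set" and e :: real assume Z: "finite Z" "Z \<subseteq> cball 0 1" and e: "0 < e"
    have e3: "0 < e/3" using e by simp
    from chart_cover[of ?i, OF dist_kuratowski assms(2) dim K KY Kne e3] obtain CC \<rho> \<eta> where c: "0 < \<rho>" "0 < \<eta>" "\<forall>x\<in>\<Union>CC. \<exists>a\<in>K. dist x (?i a) \<le> e/3"
      "\<forall>a\<in>K. \<forall>b\<in>K. dist a b < \<eta> \<longrightarrow> (\<exists>V\<in>CC. ?i a \<in> V \<and> ?i b \<in> V)"
      "\<forall>a b r. reach CC a b r \<longrightarrow> r < \<rho> \<longrightarrow> (\<exists>m. (\<exists>s. reach CC a m s) \<and> (\<forall>p r'. reach CC a p r' \<longrightarrow> r' < \<rho> \<longrightarrow>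
        (cd CC p m)\<^sup>2 \<le> (cd CC p a)\<^sup>2 / 2 + (cd CC p b)\<^sup>2 / 2 - (cd CC a b)\<^sup>2 / 4))" by (elim exE conjE) (rule that)
    from finite_extension[of ?i, OF dist_kuratowski assms(5,4) c(1,2) c(4)[unfolded K_def] c(5) Z e3]
    obtain F where F: "\<forall>z\<in>Z. F z \<in> \<Union>CC \<and> (\<forall>z'\<in>Z. dist (F z) (F z') \<le> 5 * pi * C * dist z z' + e/3) \<and> (norm z = 1 \<longrightarrow> F z = ?i (f z))" by (rule exE)
    \<comment> \<open>F only has values near K. Replacing each by a close point of K, without change
      on the sphere, adds e/3 at either end of a pair; the remaining e/3 is the error of F
      itself.\<close>
    have "\<exists>a. a \<in> K \<and> dist (F z) (?i a) \<le> e/3 \<and> (norm z = 1 \<longrightarrow> a = f z)" if z: "z \<in> Z" for z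
    proof (cases "norm z = 1")
      case True
      then have "F z = ?i (f z)" "f z \<in> K" using F z by (auto simp: K_def)
      then show ?thesis using e by (intro exI[of _ "f z"]) simp
    next
      case False
      then show ?thesis using c(3) F z by blast
    qed
    then obtain G where G: "\<And>z. z \<in> Z \<Longrightarrow> G z \<in> K \<and> dist (F z) (?i (G z)) \<le> e/3 \<and> (norm z = 1 \<longrightarrow> G z = f z)" by metis
    have "dist (G z) (G z') \<le> 5 * pi * C * dist z z' + e" if z: "z \<in> Z" "z' \<in> Z" for z z'
    proof -
      have "dist (?i (G z)) (?i (G z')) \<le> dist (F z) (?i (G z)) + dist (F z) (F z') + dist (F z') (?i (G z'))"
        using dist_triangle[of "?i (G z)" "?i (G z')" "F z"] dist_triangle[of "F z" "?i (G z')" "F z'"] dist_commute[of "?i (G z)" "F z"] by linarith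
      moreover have "dist (F z) (F z') \<le> 5 * pi * C * dist z z' + e/3" using F z by blast
      moreover have "dist (F z) (?i (G z)) \<le> e/3" "dist (F z') (?i (G z')) \<le> e/3" using G z by auto
      ultimately show ?thesis unfolding dist_kuratowski by linarith
    qed
    then show "\<exists>G. \<forall>z\<in>Z. G z \<in> K \<and> (\<forall>z'\<in>Z. dist (G z) (G z') \<le> 5 * pi * C * dist z z' + e) \<and> (z \<in> sphere 0 1 \<longrightarrow> G z = f z)"
      using G by (intro exI[of _ G]) auto
  qed
  then obtain F where F: "(5 * pi * C)-lipschitz_on (cball 0 1) F" "F ` cball 0 1 \<subseteq> K" "\<forall>z\<in>cball 0 1 \<inter> sphere 0 1. F z = f z" by blast
  have "K \<subseteq> A" using assms(6) by (simp add: K_def)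
  then show ?thesis using F by (intro exI[of _ F] exI[of _ "5 * pi * C"]) auto
qed

end
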